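(* Let $U,V\subset\mathbb{R}^n$ be open, $A\subset U$ a relatively closed semi-analytic subset which is a deformation retract of $U$, $\pi:V\to U$ a proper surjective real-analytic map, and $B=\pi^{-1}(A)$, such that $B$ is locally a union of quadrants, $B$ is a deformation retract of $V$, and $\pi$ restricts to a real-analytic isomorphism $V\setminus B\to U\setminus A$. Then the quotient map $J^\bullet_A:\Omega^\bullet(U)\to\Omega^\bullet_W(A)$ is a quasi-isomorphism of commutative differential graded algebras.
   Context: $\mathcal{J}^\infty(A,U)$ is the ideal of smooth functions on $U$ flat on $A$ (all partial derivatives of all orders vanish on $A$); $\Omega^\bullet(A,U)=\mathcal{J}^\infty(A,U)\Omega^\bullet(U)$; the Whitney–de Rham complex is $\Omega^\bullet_W(A)=\Omega^\bullet(U)/\Omega^\bullet(A,U)$, a CDGA, and $J^\bullet_A$ is the quotient map. Quadrants: for real-analytic coordinates $z$ and a partition $\{1,\dots,n\}=I_0\sqcup I_+\sqcup I_-$, $Q_{I_0,I_+,I_-}=\{z_i=0\ (i\in I_0),\ z_j>0\ (j\in I_+),\ z_k<0\ (k\in I_-)\}$; locally a union of quadrants means around each point, in suitable analytic coordinates centered there, the set is a union of such quadrants. A quasi-isomorphism is a morphism inducing isomorphisms in cohomology. *)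

theory Defs
  imports "HOL-Analysis.Analysis"
begin

definition monomial_at :: "(real^'n::finite) \<Rightarrow> ('n \<Rightarrow> nat) \<Rightarrow> real^'n \<Rightarrow> real" where
  "monomial_at x \<alpha> y = (\<Prod>i\<in>UNIV. (y$i - x$i) ^ \<alpha> i)"

definition real_analytic_at :: "(real^'n::finite \<Rightarrow> real) \<Rightarrow> real^'n \<Rightarrow> bool" where
  "real_analytic_at f x \<longleftrightarrow>
     (\<exists>r>0. \<exists>c :: ('n \<Rightarrow> nat) \<Rightarrow> real.
        \<forall>y\<in>ball x r. ((\<lambda>\<alpha>. c \<alpha> * monomial_at x \<alpha> y) has_sum f y) UNIV)"

definition real_analytic_on :: "(real^'n::finite) set \<Rightarrow> (real^'n \<Rightarrow> real) \<Rightarrow> bool" where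
  "real_analytic_on W f \<longleftrightarrow> (\<forall>x\<in>W. real_analytic_at f x)"

definition real_analytic_map_on :: "(real^'n::finite) set \<Rightarrow> (real^'n \<Rightarrow> real^'m::finite) \<Rightarrow> bool" where
  "real_analytic_map_on W f \<longleftrightarrow> (\<forall>j. real_analytic_on W (\<lambda>x. f x $ j))"

definition semi_analytic_in :: "(real^'n::finite) set \<Rightarrow> (real^'n) set \<Rightarrow> bool" where
  "semi_analytic_in U A \<longleftrightarrow> A \<subseteq> U \<and>
     (\<forall>x\<in>U. \<exists>W. open W \<and> x \<in> W \<and> W \<subseteq> U \<and>
        (\<exists>(p::nat) (q::nat) (F :: nat \<Rightarrow> nat \<Rightarrow> real^'n \<Rightarrow> real) (s :: nat \<Rightarrow> nat \<Rightarrow> bool).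
           (\<forall>i<p. \<forall>j<q. real_analytic_on W (F i j)) \<and>
           A \<inter> W = {y\<in>W. \<exists>i<p. \<forall>j<q. (if s i j then F i j y = 0 else F i j y > 0)}))"

definition real_analytic_iso :: "(real^'n::finite) set \<Rightarrow> (real^'n) set \<Rightarrow> (real^'n \<Rightarrow> real^'n) \<Rightarrow> bool" where
  "real_analytic_iso S T f \<longleftrightarrow> real_analytic_map_on S f \<and> f ` S = T \<and>
     (\<exists>g. real_analytic_map_on T g \<and> g ` T = S \<and> (\<forall>x\<in>S. g (f x) = x) \<and> (\<forall>y\<in>T. f (g y) = y))"

text \<open>Quadrant Q_{I0,I+,I-}, encoded by the sign vector sigma (sigma i = 0, 1, -1 for i in I0, I+, I-).\<close>
definition quadrant :: "('n::finite \<Rightarrow> real) \<Rightarrow> (real^'n) set" where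
  "quadrant \<sigma> = {z. \<forall>i. sgn (z$i) = \<sigma> i}"

definition locally_union_of_quadrants :: "(real^'n::finite) set \<Rightarrow> (real^'n) set \<Rightarrow> bool" where
  "locally_union_of_quadrants V B \<longleftrightarrow>
     (\<forall>p\<in>V. \<exists>W \<phi> \<Sigma>. open W \<and> p \<in> W \<and> W \<subseteq> V \<and> open (\<phi> ` W) \<and>
        real_analytic_iso W (\<phi> ` W) \<phi> \<and> \<phi> p = 0 \<and>
        \<phi> ` (B \<inter> W) = \<phi> ` W \<inter> (\<Union>\<sigma>\<in>\<Sigma>. quadrant \<sigma>))"

definition deformation_retract_of :: "'a::euclidean_space set \<Rightarrow> 'a set \<Rightarrow> bool" where
  "deformation_retract_of T S \<longleftrightarrow>
     (\<exists>r. homotopic_with_canon (\<lambda>x. True) S S id r \<and> retraction S T r)"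

definition partial :: "'n \<Rightarrow> (real^'n::finite \<Rightarrow> real) \<Rightarrow> real^'n \<Rightarrow> real" where
  "partial i f x = frechet_derivative f (at x) (axis i 1)"

fun iter_partial :: "'n list \<Rightarrow> (real^'n::finite \<Rightarrow> real) \<Rightarrow> real^'n \<Rightarrow> real" where
  "iter_partial [] f = f"
| "iter_partial (i # is) f = partial i (iter_partial is f)"

definition smooth_on :: "(real^'n::finite) set \<Rightarrow> (real^'n \<Rightarrow> real) \<Rightarrow> bool" where
  "smooth_on U f \<longleftrightarrow> (\<forall>js. \<forall>x\<in>U. iter_partial js f differentiable (at x))"

definition flat_on :: "(real^'n::finite) set \<Rightarrow> (real^'n) set \<Rightarrow> (real^'n \<Rightarrow> real) \<Rightarrow> bool" where
  "flat_on A U f \<longleftrightarrow> smooth_on U f \<and> (\<forall>js. \<forall>x\<in>A. iter_partial js f x = 0)"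

text \<open>A differential k-form on U is represented by its alternating coefficient function:
  omega x [i1,...,ik] = omega_x(e_i1,...,e_ik); it vanishes outside U and on lists of length ~= k.\<close>
definition alternating :: "('n list \<Rightarrow> real) \<Rightarrow> bool" where
  "alternating c \<longleftrightarrow> (\<forall>is i j. i < length is \<and> j < length is \<and> i \<noteq> j \<longrightarrow>
       c (is[i := is!j, j := is!i]) = - c is)"

definition form_on :: "(real^'n::finite) set \<Rightarrow> nat \<Rightarrow> (real^'n \<Rightarrow> 'n list \<Rightarrow> real) \<Rightarrow> bool" where
  "form_on U k \<omega> \<longleftrightarrow> (\<forall>x is. x \<notin> U \<or> length is \<noteq> k \<longrightarrow> \<omega> x is = 0) \<and>
     (\<forall>x. alternating (\<omega> x)) \<and> (\<forall>is. smooth_on U (\<lambda>x. \<omega> x is))"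

definition ext_d :: "(real^'n::finite) set \<Rightarrow> (real^'n \<Rightarrow> 'n list \<Rightarrow> real) \<Rightarrow> real^'n \<Rightarrow> 'n list \<Rightarrow> real" where
  "ext_d U \<omega> x is = (if x \<in> U then
      (\<Sum>j<length is. (-1)^j * partial (is!j) (\<lambda>y. \<omega> y (take j is @ drop (Suc j) is)) x)
     else 0)"

text \<open>Omega^k(A,U) = J^infinity(A,U) Omega^k(U): forms whose coefficients are flat on A.\<close>
definition flat_form :: "(real^'n::finite) set \<Rightarrow> (real^'n) set \<Rightarrow> nat \<Rightarrow> (real^'n \<Rightarrow> 'n list \<Rightarrow> real) \<Rightarrow> bool" where
  "flat_form A U k \<omega> \<longleftrightarrow> form_on U k \<omega> \<and> (\<forall>is. flat_on A U (\<lambda>x. \<omega> x is))"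

definition prev_form :: "(real^'n::finite) set \<Rightarrow> nat \<Rightarrow> (real^'n \<Rightarrow> 'n list \<Rightarrow> real) \<Rightarrow> bool" where
  "prev_form U k \<eta> \<longleftrightarrow> (if k = 0 then \<eta> = (\<lambda>_ _. 0) else form_on U (k - 1) \<eta>)"

definition cocycles_dR :: "(real^'n::finite) set \<Rightarrow> nat \<Rightarrow> (real^'n \<Rightarrow> 'n list \<Rightarrow> real) set" where
  "cocycles_dR U k = {\<omega>. form_on U k \<omega> \<and> ext_d U \<omega> = (\<lambda>_ _. 0)}"

definition cohom_rel_dR :: "(real^'n::finite) set \<Rightarrow> nat \<Rightarrow> ((real^'n \<Rightarrow> 'n list \<Rightarrow> real) \<times> (real^'n \<Rightarrow> 'n list \<Rightarrow> real)) set" where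
  "cohom_rel_dR U k = {(\<omega>, \<omega>'). \<omega> \<in> cocycles_dR U k \<and> \<omega>' \<in> cocycles_dR U k \<and>
      (\<exists>\<eta>. prev_form U k \<eta> \<and> (\<lambda>x is. \<omega> x is - \<omega>' x is) = ext_d U \<eta>)}"

definition cohom_dR :: "(real^'n::finite) set \<Rightarrow> nat \<Rightarrow> (real^'n \<Rightarrow> 'n list \<Rightarrow> real) set set" where
  "cohom_dR U k = cocycles_dR U k // cohom_rel_dR U k"

text \<open>Cocycles of the Whitney-de Rham complex, via representatives in Omega^k(U):
  the class of omega is closed iff d omega lies in Omega^{k+1}(A,U).\<close>
definition cocycles_W :: "(real^'n::finite) set \<Rightarrow> (real^'n) set \<Rightarrow> nat \<Rightarrow> (real^'n \<Rightarrow> 'n list \<Rightarrow> real) set" where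
  "cocycles_W A U k = {\<omega>. form_on U k \<omega> \<and> flat_form A U (Suc k) (ext_d U \<omega>)}"

definition cohom_rel_W :: "(real^'n::finite) set \<Rightarrow> (real^'n) set \<Rightarrow> nat \<Rightarrow> ((real^'n \<Rightarrow> 'n list \<Rightarrow> real) \<times> (real^'n \<Rightarrow> 'n list \<Rightarrow> real)) set" where
  "cohom_rel_W A U k = {(\<omega>, \<omega>'). \<omega> \<in> cocycles_W A U k \<and> \<omega>' \<in> cocycles_W A U k \<and>
      (\<exists>\<eta>. prev_form U k \<eta> \<and> flat_form A U k (\<lambda>x is. \<omega> x is - \<omega>' x is - ext_d U \<eta> x is))}"

definition cohom_W :: "(real^'n::finite) set \<Rightarrow> (real^'n) set \<Rightarrow> nat \<Rightarrow> (real^'n \<Rightarrow> 'n list \<Rightarrow> real) set set" where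
  "cohom_W A U k = cocycles_W A U k // cohom_rel_W A U k"

text \<open>The map H^k(J_A): sends the class of omega in H^k(Omega(U)) to the class of J_A(omega).\<close>
definition cohom_J :: "(real^'n::finite) set \<Rightarrow> (real^'n) set \<Rightarrow> nat \<Rightarrow> (real^'n \<Rightarrow> 'n list \<Rightarrow> real) set \<Rightarrow> (real^'n \<Rightarrow> 'n list \<Rightarrow> real) set" where
  "cohom_J A U k X = cohom_rel_W A U k `` X"

text \<open>J_A is a quasi-isomorphism: it induces bijections (linear, hence isomorphisms) in every degree.\<close>
definition J_quasi_iso :: "(real^'n::finite) set \<Rightarrow> (real^'n) set \<Rightarrow> bool" where
  "J_quasi_iso A U \<longleftrightarrow> (\<forall>k. bij_betw (cohom_J A U k) (cohom_dR U k) (cohom_W A U k))"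

end

theory Submission
 imports Defs "HOL-Complex_Analysis.Complex_Analysis"
begin

text \<open>It suffices that the complex of forms flat on \<open>A\<close> is acyclic. The pullback along \<open>\<pi>\<close> of a closed form
  flat on \<open>A\<close> is flat on \<open>B\<close>. In quadrant charts there are homotopies that preserve \<open>B\<close> and collapse a
  neighbourhood of each coordinate hyperplane onto it; through them the pullback is cohomologous, by a primitive flat on
  \<open>B\<close>, to a form vanishing near \<open>B\<close>. That primitive can be pushed forward along \<open>\<pi>\<close>: its derivatives
  only involve division by powers of the Jacobian determinant, which vanishes at most on \<open>B\<close> and therefore, by the
  Lojasiewicz inequality, is bounded below by a power of the distance to \<open>B\<close>; so the push-forward extends by zero to a
  form flat on \<open>A\<close>. The original form is thus cohomologous, through flat forms, to one vanishing near \<open>A\<close>, and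
  since \<open>A\<close> is a deformation retract of \<open>U\<close> the latter has a primitive vanishing near \<open>A\<close>.

  The Lojasiewicz inequality comes from a covering of the origin by analytic maps that turn a given germ into a
  monomial times a unit. They are composed of Tschirnhaus shifts (implicit function theorem), substitutions
  \<open>x = \<plusminus> y\<^sup>N\<close> and blow-ups, by induction on the number of variables and on the order in the last one.\<close>

text \<open>A primitive of a flat form has to be flat again, and near a singular point of
  \<open>A\<close> no homotopy respecting \<open>A\<close> is at hand. Upstairs there is one: in a
  quadrant chart, multiplying coordinates by nonnegative factors keeps or kills signs, and a closed
  union of quadrants is stable under both. The charts cannot be combined by cutting off the form,
  since that destroys closedness; the local deformations are applied one after another, each moving
  points so little that the vanishing already achieved survives.

  Going down again divides by powers of the Jacobian. Flatness beats every power of the distance to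
  \<open>B\<close>, so the Jacobian has to dominate some power of that distance. But
  \<open>B\<close> is described by signs and its distance is not an analytic function; substituting
  squares in each orthant replaces it by a polynomial. Two analytic germs can be compared once their
  product is a monomial times a unit, because factors of such a germ are again of this kind.\<close>

no_notation fps_nth (infixl \<open>$\<close> 75)

section \<open>Smooth and flat functions\<close>

lemma partial_eqI: "(f has_derivative D) (at x) ==> partial i f x = D (axis i 1)"
 unfolding partial_def by (metis frechet_derivative_at)

lemma has_derivative_partials:
 fixes f :: "real^'n::finite => real"
 assumes "f differentiable (at x)"
 shows "(f has_derivative (%h. SUM i:UNIV. h$i * partial i f x)) (at x)"
proof -
 let ?D = "frechet_derivative f (at x)"
 have d: "(f has_derivative ?D) (at x)" using assms frechet_derivative_works by blast
 then have lin: "linear ?D" using has_derivative_linear by blast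
 have "?D h = (SUM i:UNIV. h$i * partial i f x)" for h
 proof -
  have "?D h = ?D (SUM i:UNIV. h$i *\<^sub>R axis i 1)"
   using basis_expansion[of h] by (simp add: scalar_mult_eq_scaleR)
  also have "\<dots> = (SUM i:UNIV. h$i *\<^sub>R ?D (axis i 1))"
   using lin by (simp add: linear_sum linear_scale)
  finally show ?thesis by (simp add: partial_def)
 qed
 then have "?D = (%h. SUM i:UNIV. h$i * partial i f x)" by (rule ext)
 with d show ?thesis by (rule back_subst[of "%D. (f has_derivative D) (at x)"])
qed

lemma partial_cong:
 assumes "open U" "x : U" "!!y. y : U ==> f y = g y"
 shows "partial i f x = partial i g x"
proof -
 have "(f has_derivative D) (at x) \<longleftrightarrow> (g has_derivative D) (at x)" for D
  by (metis assms has_derivative_transform_within_open)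
 then show ?thesis unfolding partial_def frechet_derivative_def by simp
qed

lemma differentiable_cong:
 assumes "open U" "x : U" "!!y. y : U ==> f y = g y"
 shows "f differentiable (at x) \<longleftrightarrow> g differentiable (at x)"
 unfolding differentiable_def by (metis assms has_derivative_transform_within_open)

lemma partial_const [simp]: "partial i (%_. c) x = 0"
 by (simp add: partial_eqI[OF has_derivative_const])

lemma partial_nth: "partial i (%x. x $ j) x = (if i = j then 1 else 0)"
 by (subst partial_eqI[OF bounded_linear_imp_has_derivative[OF bounded_linear_vec_nth]])
  (simp add: axis_def)

lemma partial_add:
 assumes "f differentiable (at x)" "g differentiable (at x)"
 shows "partial i (%x. f x + g x) x = partial i f x + partial i g x"
 unfolding partial_def[of i f] partial_def[of i g]
 using assms[unfolded frechet_derivative_works] by (intro partial_eqI has_derivative_add)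

lemma partial_mult:
 assumes "f differentiable (at x)" "g differentiable (at x)"
 shows "partial i (%x. f x * g x) x = f x * partial i g x + partial i f x * g x"
 unfolding partial_def[of i f] partial_def[of i g]
 using assms[unfolded frechet_derivative_works] by (intro partial_eqI has_derivative_mult)

lemma partial_cmult:
 assumes "f differentiable (at x)"
 shows "partial i (%x. c * f x) x = c * partial i f x"
 using partial_mult[of "%_. c" x f i] assms by simp

lemma partial_minus:
 assumes "f differentiable (at x)" "g differentiable (at x)"
 shows "partial i (%x. f x - g x) x = partial i f x - partial i g x"
 unfolding partial_def[of i f] partial_def[of i g]
 using assms[unfolded frechet_derivative_works] by (intro partial_eqI has_derivative_diff)

lemma partial_sum:
 assumes "!!k. k : K ==> f k differentiable (at x)"
 shows "partial i (%x. SUM k:K. f k x) x = (SUM k:K. partial i (f k) x)"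
proof -
 have "((%x. SUM k:K. f k x) has_derivative (%h. SUM k:K. frechet_derivative (f k) (at x) h)) (at x)"
  using assms frechet_derivative_works by (intro has_derivative_sum) blast
 from partial_eqI[OF this] show ?thesis by (simp add: partial_def)
qed

lemma has_derivative_vecI:
 fixes f :: "'a::real_normed_vector => real^'n::finite"
 assumes "!!j. ((%x. f x $ j) has_derivative D j) (at x)"
 shows "(f has_derivative (%h. \<chi> j. D j h)) (at x)"
proof -
 have eq: "v = (SUM j:UNIV. v $ j *\<^sub>R axis j 1)" for v :: "real^'n"
  using basis_expansion[of v] by (simp add: scalar_mult_eq_scaleR)
 have "((%x. SUM j:UNIV. f x $ j *\<^sub>R axis j 1) has_derivative
   (%h. SUM j:UNIV. D j h *\<^sub>R (axis j 1 :: real^'n))) (at x)"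
  by (intro has_derivative_sum has_derivative_scaleR_left assms)
 moreover have "(%x. SUM j:UNIV. f x $ j *\<^sub>R axis j 1) = f" using eq by auto
 moreover have "(%h. SUM j:UNIV. D j h *\<^sub>R (axis j 1 :: real^'n)) = (%h. \<chi> j. D j h)"
  using eq[of "\<chi> j. D j _"] by (intro ext) simp
 ultimately show ?thesis by simp
qed

lemma has_derivative_compose_partials:
 fixes f :: "real^'m::finite => real^'n::finite"
 assumes "g differentiable (at (f x))" "!!j. (%y. f y $ j) differentiable (at x)"
 shows "((%x. g (f x)) has_derivative
  (%h. SUM j:UNIV. (SUM i:UNIV. h$i * partial i (%y. f y $ j) x) * partial j g (f x))) (at x)"
proof -
 have "(f has_derivative (%h. \<chi> j. SUM i:UNIV. h$i * partial i (%y. f y $ j) x)) (at x)"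
  by (intro has_derivative_vecI has_derivative_partials assms)
 from diff_chain_at[OF this has_derivative_partials[OF assms(1)]]
 show ?thesis by (simp add: o_def)
qed

lemma partial_compose:
 fixes f :: "real^'m::finite => real^'n::finite"
 assumes "g differentiable (at (f x))" "!!j. (%y. f y $ j) differentiable (at x)"
 shows "partial i (%x. g (f x)) x = (SUM j:UNIV. partial j g (f x) * partial i (%y. f y $ j) x)"
proof -
 have "(SUM k:UNIV. axis i 1 $ k * c k) = c i" for c :: "'m => real"
  by (simp add: axis_def if_distrib[of "%a. a * _"] cong: if_cong)
 note ax = this
 show ?thesis
  unfolding partial_eqI[OF has_derivative_compose_partials[OF assms]] ax by (simp only: mult.commute)
qed

lemma differentiable_compose_vec:
 fixes f :: "real^'m::finite => real^'n::finite" and g :: "real^'n => real"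
 assumes "g differentiable (at (f x))" "!!j. (%y. f y $ j) differentiable (at x)"
 shows "(%x. g (f x)) differentiable (at x)"
 using has_derivative_compose_partials[of g f x] assms unfolding differentiable_def by blast

lemma partial_divide1:
 assumes "f differentiable (at x)" "f x ~= (0::real)"
 shows "partial i (%x. 1 / f x) x = - partial i f x * (1 / f x) * (1 / f x)"
proof -
 have "((%x. 1 / f x) has_derivative (%h. - 1 * (inverse (f x) * frechet_derivative f (at x) h * inverse (f x)) + 0 / f x)) (at x)"
  by (rule has_derivative_divide) (use assms frechet_derivative_works in auto)
 from partial_eqI[OF this] show ?thesis by (simp add: partial_def field_simps)
qed

lemma has_real_derivative_line:
 fixes f :: "real^'n::finite => real"
 assumes "f differentiable (at (p + t *\<^sub>R v))"
 shows "((%t. f (p + t *\<^sub>R v)) has_real_derivative (SUM i:UNIV. v$i * partial i f (p + t *\<^sub>R v))) (at t)"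
proof -
 have "((%t. p + t *\<^sub>R v) has_derivative (%h. h *\<^sub>R v)) (at t)"
  by (auto intro!: derivative_eq_intros)
 from diff_chain_at[OF this has_derivative_partials[OF assms]]
 have "((%t. f (p + t *\<^sub>R v)) has_derivative (%h. SUM i:UNIV. (h * v$i) * partial i f (p + t *\<^sub>R v))) (at t)"
  by (simp add: o_def)
 moreover have "(%h. SUM i:UNIV. (h * v$i) * partial i f (p + t *\<^sub>R v)) = (*) (SUM i:UNIV. v$i * partial i f (p + t *\<^sub>R v))"
  by (intro ext) (simp add: sum_distrib_left mult_ac)
 ultimately show ?thesis
  unfolding has_field_derivative_def by (rule back_subst[of "%D. (_ has_derivative D) (at t)"])
qed

lemma has_real_derivative_axis:
 fixes f :: "real^'n::finite => real"
 assumes "f differentiable (at (p + t *\<^sub>R axis i 1))"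
 shows "((%t. f (p + t *\<^sub>R axis i 1)) has_real_derivative partial i f (p + t *\<^sub>R axis i 1)) (at t)"
proof -
 have "(SUM k:UNIV. axis i 1 $ k * c k) = c i" for c :: "'n => real"
  by (simp add: axis_def if_distrib[of "%a. a * _"] cong: if_cong)
 then show ?thesis using has_real_derivative_line[OF assms] by simp
qed

text \<open>A common recursive form of smoothness (\<^term>\<open>A = {}\<close>) and of flatness along \<^term>\<open>A\<close>.\<close>

primrec CF :: "nat => (real^'n::finite) set => (real^'n) set => (real^'n => real) => bool" where
 "CF 0 A U f \<longleftrightarrow> (ALL x:A. f x = 0)"
| "CF (Suc m) A U f \<longleftrightarrow> (ALL x:A. f x = 0) & (ALL x:U. f differentiable (at x)) & (ALL i. CF m A U (partial i f))"

lemma iter_partial_snoc: "iter_partial (js @ [i]) f = iter_partial js (partial i f)"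
 by (induction js) auto

lemma CF_iff:
 "CF m A U f \<longleftrightarrow> (ALL js. length js <= m --> (ALL x:A. iter_partial js f x = 0)) &
  (ALL js. length js < m --> (ALL x:U. iter_partial js f differentiable (at x)))"
proof (induction m arbitrary: f)
 case 0 then show ?case by auto
next
 case (Suc m)
 \<comment> \<open>Lists are split at their last entry because \<open>iter_partial\<close> applies
   that derivative first, as the recursion of \<open>CF\<close> does.\<close>
 have all: "(ALL js. P js) \<longleftrightarrow> P [] & (ALL i js. P (js @ [i]))" for P :: "'a list => bool"
  by (metis rev_exhaust)
 show ?case
  unfolding CF.simps(2) Suc all[of "%js. length js <= Suc m --> _ js"]
   all[of "%js. length js < Suc m --> _ js"]
  by (auto simp: iter_partial_snoc)
qed

lemma flat_on_iff: "flat_on A U f \<longleftrightarrow> (ALL m. CF m A U f)"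
 unfolding flat_on_def smooth_on_def CF_iff by (meson lessI order_refl)

lemma smooth_on_eq_flat: "smooth_on U f \<longleftrightarrow> flat_on {} U f"
 by (simp add: flat_on_def)

lemma smooth_on_iff: "smooth_on U f \<longleftrightarrow> (ALL m. CF m {} U f)"
 by (simp add: smooth_on_eq_flat flat_on_iff)

lemma CF_cong:
 assumes "open U" "A <= U" "!!x. x : U ==> f x = g x"
 shows "CF m A U f \<longleftrightarrow> CF m A U g"
 using assms(3)
proof (induction m arbitrary: f g)
 case 0 then show ?case using assms by (metis CF.simps(1) subsetD)
next
 case (Suc m)
 have "CF m A U (partial i f) \<longleftrightarrow> CF m A U (partial i g)" for i
  by (rule Suc.IH) (use partial_cong[OF assms(1)] Suc.prems in blast)
 moreover have "x : U ==> f differentiable (at x) \<longleftrightarrow> g differentiable (at x)" for x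
  using differentiable_cong[OF assms(1)] Suc.prems by blast
 ultimately show ?case using Suc.prems assms(2) by (auto simp: subset_iff)
qed

lemma flat_on_cong:
 assumes "open U" "A <= U" "!!x. x : U ==> f x = g x"
 shows "flat_on A U f \<longleftrightarrow> flat_on A U g"
proof -
 have "CF m A U f \<longleftrightarrow> CF m A U g" for m by (rule CF_cong[OF assms(1,2)]) (rule assms(3))
 then show ?thesis by (simp add: flat_on_iff)
qed

lemma smooth_on_cong:
 assumes "open U" "!!x. x : U ==> f x = g x"
 shows "smooth_on U f \<longleftrightarrow> smooth_on U g"
 unfolding smooth_on_eq_flat by (rule flat_on_cong[OF assms(1) _ assms(2)]) auto

lemma CF_Suc_imp: "CF (Suc m) A U f ==> CF m A U f"
 by (induction m arbitrary: f) auto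

lemma CF_const0: "CF m A U (%_. 0)"
proof (induction m)
 case (Suc m)
 have "partial i (%_. 0) = (%_. 0)" for i :: 'a by auto
 then show ?case using Suc by auto
qed auto

lemma CF_const: "CF m {} U (%_. c)"
proof (cases m)
 case (Suc k)
 have "partial i (%_. c) = (%_. 0)" for i :: 'a by auto
 then show ?thesis using Suc CF_const0 by auto
qed simp

lemma CF_add:
 assumes "open U" "A <= U"
 shows "CF m A U f ==> CF m A U g ==> CF m A U (%x. f x + g x)"
proof (induction m arbitrary: f g)
 case (Suc m)
 have "CF m A U (partial i (%x. f x + g x))" for i
  by (subst CF_cong[OF assms, of _ "%x. partial i f x + partial i g x"])
   (use Suc in \<open>auto intro!: partial_add\<close>)
 then show ?case using Suc.prems by auto
qed auto

lemma CF_sum: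
 assumes "open U" "A <= U" "!!k. k : K ==> CF m A U (f k)"
 shows "CF m A U (%x. SUM k:K. f k x)"
proof (cases "finite K")
 case True
 then show ?thesis using assms(3)
  by (induction K) (auto intro!: CF_const0 CF_add[OF assms(1,2)])
qed (simp add: CF_const0)

text \<open>Each Leibniz term keeps a derivative of \<open>f\<close>, so flatness survives
  multiplication by any smooth factor.\<close>

lemma CF_mult:
 assumes "open U" "A <= U"
 shows "CF m A U f ==> CF m {} U g ==> CF m A U (%x. f x * g x)"
proof (induction m arbitrary: f g)
 case (Suc m)
 have "CF m A U (partial i (%x. f x * g x))" for i
 proof (subst CF_cong[OF assms, of _ "%x. f x * partial i g x + partial i f x * g x"])
  show "CF m A U (%x. f x * partial i g x + partial i f x * g x)"
   using Suc CF_Suc_imp[OF Suc.prems(1)] CF_Suc_imp[OF Suc.prems(2)]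
   by (intro CF_add[OF assms]) auto
 qed (use Suc.prems in \<open>auto intro!: partial_mult\<close>)
 then show ?case using Suc.prems by auto
qed auto

lemma CF_compose:
 fixes f :: "real^'m::finite => real^'n::finite"
 assumes "open U" "A <= U" "open U'" "A' <= U'" "f ` U <= U'" "f ` A <= A'"
 shows "CF m A' U' g ==> (!!j. CF m {} U (%x. f x $ j)) ==> CF m A U (%x. g (f x))"
proof (induction m arbitrary: g)
 case 0 then show ?case using assms by auto
next
 case (Suc m)
 have dg: "x : U ==> g differentiable (at (f x))" for x using Suc.prems assms by auto
 have df: "x : U ==> (%y. f y $ j) differentiable (at x)" for x j using Suc.prems(2)[of j] by auto
 have "CF m A U (partial i (%x. g (f x)))" for i
 proof (subst CF_cong[OF assms(1,2), of _ "%x. SUM j:UNIV. partial j g (f x) * partial i (%y. f y $ j) x"])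
  show "CF m A U (%x. SUM j:UNIV. partial j g (f x) * partial i (%y. f y $ j) x)"
   using Suc CF_Suc_imp[OF Suc.prems(1)] CF_Suc_imp[OF Suc.prems(2)]
   by (intro CF_sum[OF assms(1,2)] CF_mult[OF assms(1,2)]) auto
 qed (use partial_compose[of g f] dg df in blast)
 moreover have "x : U ==> (%x. g (f x)) differentiable (at x)" for x
  using differentiable_compose_vec[of g f x] dg df by blast
 moreover have "x : A ==> g (f x) = 0" for x using Suc.prems(1) assms(6) by auto
 ultimately show ?case by auto
qed

lemma CF_divide1:
 assumes "open U" "!!x. x : U ==> f x ~= 0"
 shows "CF m {} U f ==> CF m {} U (%x. 1 / f x)"
proof (induction m)
 case (Suc m)
 have d: "x : U ==> f differentiable (at x)" for x using Suc.prems by auto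
 have e: "{} <= U" by simp
 have "CF m {} U (partial i (%x. 1 / f x))" for i
 proof (subst CF_cong[OF assms(1) e, of _ "%x. (-1) * (partial i f x * (1 / f x) * (1 / f x))"])
  show "CF m {} U (%x. (-1) * (partial i f x * (1 / f x) * (1 / f x)))"
   using Suc CF_Suc_imp[OF Suc.prems(1)] by (intro CF_mult[OF assms(1) e] CF_const) auto
 qed (use partial_divide1 d assms in force)
 moreover have "x : U ==> (%x. 1 / f x) differentiable (at x)" for x
  using d assms by (intro differentiable_divide) auto
 ultimately show ?case by auto
qed auto

lemma smooth_on_const [simp]: "smooth_on U (%_. c)"
 by (simp add: smooth_on_iff CF_const)

lemma flat_on_zero [simp]: "flat_on A U (%_. 0)"
 by (simp add: flat_on_iff CF_const0)

lemma smooth_on_nth [simp]: "smooth_on U (%x. x $ j)"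
 unfolding smooth_on_iff
proof
 fix m
 show "CF m {} U (%x. x $ j)"
 proof (cases m)
  case (Suc k)
  have "partial i (%x. x $ j) = (%_. if i = j then 1 else 0)" for i :: 'a
   by (auto simp: partial_nth)
  then show ?thesis using Suc CF_const
   by (auto intro!: bounded_linear_imp_differentiable bounded_linear_vec_nth)
 qed simp
qed

lemma flat_on_subset: "flat_on A U f ==> B <= A ==> W <= U ==> flat_on B W f"
 unfolding flat_on_def smooth_on_def by blast

lemma smooth_on_subset: "smooth_on U f ==> W <= U ==> smooth_on W f"
 unfolding smooth_on_def by blast

lemma smooth_on_locally: "(!!x. x : U ==> EX W. x : W & smooth_on W f) ==> smooth_on U f"
 unfolding smooth_on_def by blast

lemma flat_on_imp_smooth: "flat_on A U f ==> smooth_on U f"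
 by (simp add: flat_on_def)

lemma flat_on_imp_zero: "flat_on A U f ==> x : A ==> f x = 0"
 by (metis flat_on_def iter_partial.simps(1))

lemma smooth_on_imp_differentiable: "smooth_on U f ==> x : U ==> f differentiable (at x)"
 by (metis smooth_on_def iter_partial.simps(1))

lemma smooth_on_imp_continuous_on: "smooth_on U f ==> continuous_on U f"
 by (meson continuous_at_imp_continuous_on differentiable_imp_continuous_within smooth_on_imp_differentiable)

lemma flat_on_partial: "flat_on A U f ==> flat_on A U (partial i f)"
 unfolding flat_on_def smooth_on_def by (metis iter_partial_snoc)

lemma smooth_on_partial: "smooth_on U f ==> smooth_on U (partial i f)"
 unfolding smooth_on_eq_flat by (rule flat_on_partial)

lemma flat_on_add: "open U ==> A <= U ==> flat_on A U f ==> flat_on A U g ==> flat_on A U (%x. f x + g x)"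
 by (simp add: flat_on_iff CF_add)

lemma flat_on_sum: "open U ==> A <= U ==> (!!k. k : K ==> flat_on A U (f k)) ==> flat_on A U (%x. SUM k:K. f k x)"
 by (simp add: flat_on_iff CF_sum)

lemma flat_on_mult: "open U ==> A <= U ==> flat_on A U f ==> smooth_on U g ==> flat_on A U (%x. f x * g x)"
 by (simp add: flat_on_iff smooth_on_iff CF_mult)

lemma flat_on_mult2: "open U ==> A <= U ==> smooth_on U f ==> flat_on A U g ==> flat_on A U (%x. f x * g x)"
 using flat_on_mult[of U A g f] by (simp add: mult.commute)

lemma flat_on_diff: "open U ==> A <= U ==> flat_on A U f ==> flat_on A U g ==> flat_on A U (%x. f x - g x)"
 using flat_on_add[of U A f "%x. (-1) * g x"] flat_on_mult2[of U A "%_. -1" g] by simp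

lemma smooth_on_add: "open U ==> smooth_on U f ==> smooth_on U g ==> smooth_on U (%x. f x + g x)"
 by (simp add: smooth_on_iff CF_add)

lemma smooth_on_sum: "open U ==> (!!k. k : K ==> smooth_on U (f k)) ==> smooth_on U (%x. SUM k:K. f k x)"
 by (simp add: smooth_on_iff CF_sum)

lemma smooth_on_mult: "open U ==> smooth_on U f ==> smooth_on U g ==> smooth_on U (%x. f x * g x)"
 by (simp add: smooth_on_iff CF_mult)

lemma smooth_on_diff: "open U ==> smooth_on U f ==> smooth_on U g ==> smooth_on U (%x. f x - g x)"
 unfolding smooth_on_eq_flat by (rule flat_on_diff) auto

lemma smooth_on_divide1: "open U ==> smooth_on U f ==> (!!x. x : U ==> f x ~= 0) ==> smooth_on U (%x. 1 / f x)"
 by (simp add: smooth_on_iff CF_divide1)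

lemma smooth_on_divide: "open U ==> smooth_on U f ==> smooth_on U g ==> (!!x. x : U ==> g x ~= 0) ==> smooth_on U (%x. f x / g x)"
 using smooth_on_mult[OF _ _ smooth_on_divide1, of U f g] by simp

lemma smooth_on_prod: "open U ==> (!!k. k : K ==> smooth_on U (f k)) ==> smooth_on U (%x. PROD k:K. f k x)"
 by (induction K rule: infinite_finite_induct) (auto intro!: smooth_on_mult)

lemma smooth_on_power: "open U ==> smooth_on U f ==> smooth_on U (%x. f x ^ k)"
 by (induction k) (auto intro!: smooth_on_mult)

abbreviation smooth_map_on :: "(real^'m::finite) set => (real^'m => real^'n::finite) => bool" where
 "smooth_map_on U f \<equiv> (ALL j. smooth_on U (%x. f x $ j))"

lemma flat_on_compose:
 assumes "open U" "A <= U" "open U'" "A' <= U'" "f ` U <= U'" "f ` A <= A'"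
  and "flat_on A' U' g" "smooth_map_on U f"
 shows "flat_on A U (%x. g (f x))"
 using CF_compose[OF assms(1-6)] assms(7,8) unfolding flat_on_iff smooth_on_iff by blast

lemma smooth_on_compose:
 assumes "open U" "open U'" "f ` U <= U'" "smooth_on U' g" "smooth_map_on U f"
 shows "smooth_on U (%x. g (f x))"
 using flat_on_compose[of U "{}" U' "{}" f g] assms by (simp add: smooth_on_eq_flat)

lemma smooth_map_on_imp_continuous_on: "smooth_map_on U f ==> continuous_on U f"
 using continuous_on_vec_lambda[of U "%j x. f x $ j"] by (simp add: smooth_on_imp_continuous_on)


section \<open>Symmetry of second partial derivatives\<close>

lemma mixed_difference:
 fixes f :: "real^'n::finite => real"
 assumes f: "smooth_on U f" and s: "0 < s" and sub: "cball x (2 * s) <= U"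
 shows "EX xi:cball x (2 * s). f (x + s *\<^sub>R axis i 1 + s *\<^sub>R axis j 1) - f (x + s *\<^sub>R axis i 1)
   - f (x + s *\<^sub>R axis j 1) + f x = s * s * partial j (partial i f) xi"
proof -
 have inU: "x + a *\<^sub>R axis i 1 + b *\<^sub>R axis j 1 : cball x (2 * s)" if "0 <= a" "a <= s" "0 <= b" "b <= s" for a b
 proof -
  have "norm (a *\<^sub>R axis i 1 + b *\<^sub>R axis j 1 :: real^'n) <= a + b"
   using norm_triangle_ineq[of "a *\<^sub>R axis i 1" "b *\<^sub>R axis j 1 :: real^'n"] that by simp
  then show ?thesis using that
   by (metis (no_types, lifting) add.assoc add_mono dist_0_norm dist_add_cancel2 dist_commute mem_cball
     add.commute mult_2 order_trans norm_minus_cancel diff_add_cancel dist_norm add_diff_cancel_left')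
 qed
 define ph where "ph a = f (x + a *\<^sub>R axis i 1 + s *\<^sub>R axis j 1) - f (x + a *\<^sub>R axis i 1)" for a
 have d1: "(ph has_real_derivative partial i f (x + a *\<^sub>R axis i 1 + s *\<^sub>R axis j 1) - partial i f (x + a *\<^sub>R axis i 1)) (at a)"
  if "0 <= a" "a <= s" for a
 proof -
  have "f differentiable (at (x + s *\<^sub>R axis j 1 + a *\<^sub>R axis i 1))"
   using smooth_on_imp_differentiable[OF f] inU[of a s] sub that s by (auto simp: add_ac)
  from has_real_derivative_axis[OF this]
  have "((%a. f (x + a *\<^sub>R axis i 1 + s *\<^sub>R axis j 1)) has_real_derivative partial i f (x + a *\<^sub>R axis i 1 + s *\<^sub>R axis j 1)) (at a)"
   by (simp add: add_ac)
  moreover have "f differentiable (at (x + a *\<^sub>R axis i 1))"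
   using smooth_on_imp_differentiable[OF f] inU[of a 0] sub that s by auto
  note has_real_derivative_axis[OF this]
  ultimately show ?thesis unfolding ph_def by (rule DERIV_diff)
 qed
 obtain a where a: "0 < a" "a < s" and 1: "ph s - ph 0 = s * (partial i f (x + a *\<^sub>R axis i 1 + s *\<^sub>R axis j 1) - partial i f (x + a *\<^sub>R axis i 1))"
  using MVT2[OF s d1] by auto
 have d2: "((%b. partial i f (x + a *\<^sub>R axis i 1 + b *\<^sub>R axis j 1)) has_real_derivative
   partial j (partial i f) (x + a *\<^sub>R axis i 1 + b *\<^sub>R axis j 1)) (at b)" if "0 <= b" "b <= s" for b
  using smooth_on_imp_differentiable[OF smooth_on_partial[OF f]] inU[of a b] sub that a
  by (intro has_real_derivative_axis) auto
 obtain b where b: "0 < b" "b < s" and 2: "partial i f (x + a *\<^sub>R axis i 1 + s *\<^sub>R axis j 1) - partial i f (x + a *\<^sub>R axis i 1)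
   = s * partial j (partial i f) (x + a *\<^sub>R axis i 1 + b *\<^sub>R axis j 1)"
  using MVT2[OF s d2] by auto
 show ?thesis
  using inU[of a b] a b 1 2 by (intro bexI[of _ "x + a *\<^sub>R axis i 1 + b *\<^sub>R axis j 1"]) (auto simp: ph_def)
qed

text \<open>The second difference over the square spanned by \<open>s\<close> along \<open>i\<close>
  and \<open>j\<close> is symmetric in the two directions, while \<open>mixed_difference\<close>
  identifies it with \<open>s * s\<close> times either mixed derivative at points near
  \<open>x\<close>; continuity then rules out a gap.\<close>

lemma partial_commute:
 fixes f :: "real^'n::finite => real"
 assumes "open U" "smooth_on U f" "x : U"
 shows "partial i (partial j f) x = partial j (partial i f) x"
proof (rule ccontr)
 assume ne: "partial i (partial j f) x ~= partial j (partial i f) x"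
 define e where "e = \<bar>partial i (partial j f) x - partial j (partial i f) x\<bar> / 2"
 have e: "e > 0" using ne by (simp add: e_def)
 have lim: "EX r>0. ALL xi:ball x r. \<bar>partial k (partial l f) xi - partial k (partial l f) x\<bar> < e" for k l
 proof -
  have "continuous (at x) (partial k (partial l f))"
   using smooth_on_imp_continuous_on[OF smooth_on_partial[OF smooth_on_partial[OF assms(2)]]] assms(1,3)
   by (metis continuous_on_eq_continuous_at)
  then show ?thesis using e unfolding continuous_at_eps_delta
   by (metis dist_commute dist_real_def mem_ball)
 qed
 obtain r1 where r1: "r1 > 0" "ALL xi:ball x r1. \<bar>partial i (partial j f) xi - partial i (partial j f) x\<bar> < e" using lim by blast
 obtain r2 where r2: "r2 > 0" "ALL xi:ball x r2. \<bar>partial j (partial i f) xi - partial j (partial i f) x\<bar> < e" using lim by blast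
 obtain r3 where r3: "r3 > 0" "ball x r3 <= U" using assms by (meson open_contains_ball)
 \<comment> \<open>The points supplied by \<open>mixed_difference\<close> lie within
   \<open>2 * s\<close> of \<open>x\<close>; dividing by 3 keeps them inside all three
   balls.\<close>
 define s where "s = min r1 (min r2 r3) / 3"
 have s: "s > 0" "2 * s < r1" "2 * s < r2" "2 * s < r3" using r1 r2 r3 by (auto simp: s_def)
 have sub: "cball x (2 * s) <= U" using r3 s by (auto simp: subset_iff)
 obtain xi where xi: "xi : cball x (2 * s)" "f (x + s *\<^sub>R axis i 1 + s *\<^sub>R axis j 1) - f (x + s *\<^sub>R axis i 1)
   - f (x + s *\<^sub>R axis j 1) + f x = s * s * partial j (partial i f) xi"
  using mixed_difference[OF assms(2) s(1) sub] by blast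
 obtain \<zeta> where \<zeta>: "\<zeta> : cball x (2 * s)" "f (x + s *\<^sub>R axis j 1 + s *\<^sub>R axis i 1) - f (x + s *\<^sub>R axis j 1)
   - f (x + s *\<^sub>R axis i 1) + f x = s * s * partial i (partial j f) \<zeta>"
  using mixed_difference[OF assms(2) s(1) sub] by blast
 have "s * s * partial j (partial i f) xi = s * s * partial i (partial j f) \<zeta>"
  using xi(2) \<zeta>(2) unfolding add.assoc add.commute[of "s *\<^sub>R axis j 1"] by linarith
 then have "partial j (partial i f) xi = partial i (partial j f) \<zeta>" using s by simp
 moreover have "\<bar>partial j (partial i f) xi - partial j (partial i f) x\<bar> < e"
  using r2(2) xi(1) s(3) by auto
 moreover have "\<bar>partial i (partial j f) \<zeta> - partial i (partial j f) x\<bar> < e"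
  using r1(2) \<zeta>(1) s(2) by auto
 ultimately show False unfolding e_def by argo
qed

subsection \<open>Integration over a parameter\<close>

text \<open>Time becomes the extra coordinate \<open>None\<close>, so that a homotopy is a map
  between coordinate spaces and the calculus of forms applies to the cylinder unchanged.\<close>

definition pair :: "real^'n::finite => real => real^('n option)" where
 "pair x t = (\<chi> k. case k of None => t | Some i => x $ i)"

lemma pair_nth [simp]: "pair x t $ None = t" "pair x t $ Some i = x $ i"
 by (auto simp: pair_def)

lemma continuous_on_pair [continuous_intros]:
 assumes "continuous_on S f" "continuous_on S g"
 shows "continuous_on S (%s. pair (f s) (g s))"
 unfolding pair_def
proof (rule continuous_on_vec_lambda)
 show "continuous_on S (%s. case k of None => g s | Some i => f s $ i)" for k
  using assms by (cases k) (auto intro: continuous_intros)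
qed

lemma differentiable_pair:
 fixes g :: "real^('n::finite option) => real"
 assumes "g differentiable (at (pair x t))"
 shows "((%x. g (pair x t)) has_derivative (%h. SUM i:UNIV. h$i * partial (Some i) g (pair x t))) (at x)"
  and "(%x. g (pair x t)) differentiable (at x)"
  and "partial i (%x. g (pair x t)) x = partial (Some i) g (pair x t)"
  and "((%t. g (pair x t)) has_real_derivative partial None g (pair x t)) (at t)"
proof -
 have c: "(%y. pair y t $ k) differentiable (at x)" for k
  by (cases k) (auto intro!: bounded_linear_imp_differentiable bounded_linear_vec_nth)
 have p: "partial i (%y. pair y t $ k) x = (if k = Some i then 1 else 0)" for i k
  by (cases k) (auto simp: partial_nth)
 show P: "partial i (%x. g (pair x t)) x = partial (Some i) g (pair x t)" for i
  by (subst partial_compose[where f = "%x. pair x t"]) (use assms c in \<open>auto simp: p if_distrib cong: if_cong\<close>)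
 show D: "(%x. g (pair x t)) differentiable (at x)"
  by (rule differentiable_compose_vec[where f = "%x. pair x t"]) (use assms c in auto)
 show "((%x. g (pair x t)) has_derivative (%h. SUM i:UNIV. h$i * partial (Some i) g (pair x t))) (at x)"
  using has_derivative_partials[OF D] by (simp add: P)
 have *: "pair x 0 + s *\<^sub>R axis None 1 = pair x s" for s
  by (auto simp: vec_eq_iff pair_def axis_def split: option.split)
 show "((%t. g (pair x t)) has_real_derivative partial None g (pair x t)) (at t)"
  using has_real_derivative_axis[of g "pair x 0" t None] assms by (simp add: *)
qed

lemma has_derivative_integral_parameter:
 fixes g :: "real^('n::finite option) => real"
 assumes D: "open D" "open U" and sub: "!!x t. x : U ==> t : {0..1} ==> pair x t : D"
  and d: "!!z. z : D ==> g differentiable (at z)" and c: "!!i. continuous_on D (partial i g)"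
  and x: "x : U"
 shows "(%x. integral {0..1} (%t. g (pair x t))) differentiable (at x)"
  and "partial i (%x. integral {0..1} (%t. g (pair x t))) x = integral {0..1} (%t. partial (Some i) g (pair x t))"
proof -
 obtain r where r: "r > 0" "ball x r <= U" using assms by (meson open_contains_ball)
 \<comment> \<open>The gradient in the spatial directions, packaged as a bounded linear map because
   \<open>leibniz_rule\<close> asks for a continuous family of those.\<close>
 define F :: "real^'n => real => (real^'n) \<Rightarrow>\<^sub>L real" where
  "F x t = (SUM i:UNIV. partial (Some i) g (pair x t) *\<^sub>R Blinfun (%h. h $ i))" for x t
 have F: "blinfun_apply (F x t) h = (SUM i:UNIV. h$i * partial (Some i) g (pair x t))" for x t h
  unfolding F_def by (simp add: blinfun.bilinear_simps blinfun.sum_left bounded_linear_Blinfun_apply bounded_linear_vec_nth mult.commute)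
 have sb: "(%(x,t). pair x t) ` (ball x r \<times> {0..1}) <= D" using sub r by auto
 have cp: "continuous_on (ball x r \<times> {0..1}) (%(x,t). partial i g (pair x t))" for i
  unfolding case_prod_unfold
  by (rule continuous_on_compose2[OF c[of i]]) (use sb in \<open>auto intro!: continuous_intros\<close>)
 have cF: "continuous_on (ball x r \<times> cbox 0 1) (%(x,t). F x t)"
  unfolding F_def case_prod_unfold
  using cp by (intro continuous_on_sum continuous_on_scaleR continuous_intros) (auto simp: case_prod_unfold)
 have cg: "continuous_on D g"
  using d by (meson continuous_at_imp_continuous_on differentiable_imp_continuous_within)
 have int: "(%t. g (pair y t)) integrable_on cbox 0 1" if "y : ball x r" for y
  using sub that r
  by (intro integrable_continuous continuous_on_compose2[OF cg] continuous_intros) auto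
 have der: "((%x. integral (cbox 0 1) (%t. g (pair x t))) has_derivative
   blinfun_apply (integral (cbox 0 1) (F x))) (at x within ball x r)"
 proof (rule leibniz_rule[OF _ int cF])
  fix y t assume "y : ball x r" "t : cbox (0::real) 1"
  then have "g differentiable (at (pair y t))" using d sub r by auto
  from differentiable_pair(1)[OF this] show "((%x. g (pair x t)) has_derivative blinfun_apply (F y t)) (at y within ball x r)"
   unfolding F[abs_def] by (rule has_derivative_at_withinI)
 qed (use r in auto)
 then have der: "((%x. integral {0..1} (%t. g (pair x t))) has_derivative
   blinfun_apply (integral {0..1} (F x))) (at x)"
  using r by (simp add: at_within_open[OF _ open_ball])
 then show "(%x. integral {0..1} (%t. g (pair x t))) differentiable (at x)"
  by (auto simp: differentiable_def)
 have "(%t. F x t) integrable_on {0..1}"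
 proof -
  have "continuous_on {0..1} (%t. (%(x,t). F x t) (x, t))"
   by (rule continuous_on_compose2[OF cF]) (use r in \<open>auto intro!: continuous_intros\<close>)
  then show ?thesis by (simp add: integrable_continuous_interval)
 qed
 then have "blinfun_apply (integral {0..1} (F x)) (axis i 1) = integral {0..1} (%t. blinfun_apply (F x t) (axis i 1))"
  by (rule blinfun_apply_integral)
 moreover have "(SUM k:UNIV. axis i 1 $ k * c k) = c i" for c :: "'n => real"
  by (simp add: axis_def if_distrib[of "%a. a * _"] cong: if_cong)
 ultimately show "partial i (%x. integral {0..1} (%t. g (pair x t))) x = integral {0..1} (%t. partial (Some i) g (pair x t))"
  using partial_eqI[OF der] by (simp add: F)
qed

lemma flat_on_integral_parameter:
 fixes g :: "real^('n::finite option) => real"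
 assumes D: "open D" "open U" and sub: "!!x t. x : U ==> t : {0..1} ==> pair x t : D"
  and g: "flat_on A' D g" and A: "A <= U" "!!x t. x : A ==> t : {0..1} ==> pair x t : A'"
 shows "flat_on A U (%x. integral {0..1} (%t. g (pair x t)))"
proof -
 have "CF m A U (%x. integral {0..1} (%t. g (pair x t)))" if "flat_on A' D g" for m g
  using that
 proof (induction m arbitrary: g)
  case 0
  have "integral {0..1} (%t. g (pair x t)) = 0" if "x : A" for x
   by (intro integral_unique has_integral_is_0) (use that flat_on_imp_zero[OF 0] A in auto)
  then show ?case by simp
 next
  case (Suc m)
  have z: "integral {0..1} (%t. g (pair x t)) = 0" if "x : A" for x
   by (intro integral_unique has_integral_is_0) (use that flat_on_imp_zero[OF Suc.prems] A in auto)
  have dg: "z : D ==> g differentiable (at z)" for z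
   using Suc.prems flat_on_imp_smooth smooth_on_imp_differentiable by blast
  have cg: "continuous_on D (partial i g)" for i
   using Suc.prems flat_on_imp_smooth smooth_on_partial smooth_on_imp_continuous_on by blast
  have "CF m A U (partial i (%x. integral {0..1} (%t. g (pair x t))))" for i
  proof (subst CF_cong[OF D(2) A(1), of _ "%x. integral {0..1} (%t. partial (Some i) g (pair x t))"])
   show "CF m A U (%x. integral {0..1} (%t. partial (Some i) g (pair x t)))"
    by (rule Suc.IH) (rule flat_on_partial[OF Suc.prems])
  qed (rule has_derivative_integral_parameter(2)[OF D sub dg cg])
  then show ?case
   using z has_derivative_integral_parameter(1)[OF D sub dg cg] by simp
 qed
 then show ?thesis using g by (simp add: flat_on_iff)
qed

subsection \<open>Cutoff functions\<close>

text \<open>In a family closed under differentiation, with \<open>s\<close> giving the index of the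
  derivative, the induction on the order can run over all members at once.\<close>

lemma smooth_on_real_family:
 fixes rh :: "'p => real => real"
 assumes "open U" "smooth_on U q" and d: "!!p t. (rh p has_real_derivative rh (s p) t) (at t)"
 shows "smooth_on U (%x. rh p (q x))"
proof -
 have dq: "((%x. rh p (q x)) has_derivative (%h. frechet_derivative q (at x) h * rh (s p) (q x))) (at x)"
  if "x : U" for p x
 proof -
  have "(q has_derivative frechet_derivative q (at x)) (at x)"
   using smooth_on_imp_differentiable[OF assms(2) that] frechet_derivative_works by blast
  from diff_chain_at[OF this d[of p, unfolded has_field_derivative_def]]
  show ?thesis by (simp add: o_def mult.commute)
 qed
 have "CF m {} U (%x. rh p (q x))" for m p
 proof (induction m arbitrary: p)
  case (Suc m)
  have "CF m {} U (partial i (%x. rh p (q x)))" for i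
  proof (subst CF_cong[OF assms(1), of _ _ "%x. partial i q x * rh (s p) (q x)"])
   show "CF m {} U (%x. partial i q x * rh (s p) (q x))"
    using CF_mult[OF assms(1), of "{}"] Suc smooth_on_partial[OF assms(2)] by (simp add: smooth_on_iff)
  qed (use partial_eqI[OF dq] in \<open>auto simp: partial_def\<close>)
  then show ?case using dq by (auto simp: differentiable_def)
 qed simp
 then show ?thesis by (simp add: smooth_on_iff)
qed

text \<open>The polynomial in \<open>1 / t\<close> makes the family stable under differentiation;
  the bump itself is the case \<open>p = 1\<close>.\<close>

definition exp_bump :: "real poly => real => real" where
 "exp_bump p t = (if t > 0 then poly p (1 / t) * exp (- (1 / t)) else 0)"

lemma poly_exp_tendsto_0: "((%s. poly p s * exp (- s)) \<longlongrightarrow> (0::real)) at_top"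
proof -
 have "((%s. SUM i<=degree p. coeff p i * (s ^ i / exp s)) \<longlongrightarrow> (SUM i<=degree p. coeff p i * 0)) at_top"
  by (intro tendsto_intros tendsto_power_div_exp_0)
 moreover have "poly p s * exp (- s) = (SUM i<=degree p. coeff p i * (s ^ i / exp s))" for s :: real
  by (simp add: poly_altdef sum_distrib_right exp_minus divide_inverse mult.assoc)
 ultimately show ?thesis by simp
qed

lemma exp_bump_derivative:
 "(exp_bump p has_real_derivative exp_bump (monom 1 2 * (p - pderiv p)) t) (at t)"
proof -
 consider "t > 0" | "t < 0" | "t = 0" by linarith
 then show ?thesis
 proof cases
  case 1
  have i: "((%t. 1 / t) has_real_derivative - ((1 / t)^2)) (at t)"
   using 1 by (auto intro!: derivative_eq_intros simp: power2_eq_square)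
  have pd: "((%t. poly p (1 / t)) has_real_derivative poly (pderiv p) (1 / t) * - ((1 / t)^2)) (at t)"
   by (rule DERIV_chain2[OF poly_DERIV i])
  have "((%t. exp (- (1 / t))) has_real_derivative exp (- (1 / t)) * - (- ((1 / t)^2))) (at t)"
   by (rule DERIV_chain2[OF DERIV_exp DERIV_minus[OF i]])
  from DERIV_mult[OF pd this]
  have "((%t. poly p (1 / t) * exp (- (1 / t))) has_real_derivative
   poly (monom 1 2 * (p - pderiv p)) (1 / t) * exp (- (1 / t))) (at t)"
   by (rule DERIV_cong) (simp add: poly_monom algebra_simps)
  moreover have "exp_bump (monom 1 2 * (p - pderiv p)) t = poly (monom 1 2 * (p - pderiv p)) (1 / t) * exp (- (1 / t))"
   using 1 by (simp add: exp_bump_def)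
  ultimately have d: "((%t. poly p (1 / t) * exp (- (1 / t))) has_real_derivative exp_bump (monom 1 2 * (p - pderiv p)) t) (at t)"
   by simp
  show ?thesis
   by (rule has_field_derivative_transform_within_open[OF d, of "{0<..}"]) (use 1 in \<open>simp_all add: exp_bump_def\<close>)
 next
  case 2
  then have d: "((%_. 0) has_real_derivative exp_bump (monom 1 2 * (p - pderiv p)) t) (at t)"
   by (simp add: exp_bump_def)
  show ?thesis
   by (rule has_field_derivative_transform_within_open[OF d, of "{..<0}"]) (use 2 in \<open>simp_all add: exp_bump_def\<close>)
 next
  case 3
  \<comment> \<open>The difference quotient from the right is again polynomial times exponential:
    division by \<open>h\<close> multiplies the polynomial by its variable.\<close>
  have "((%h. poly (p * [:0, 1:]) (1 / h) * exp (- (1 / h))) \<longlongrightarrow> 0) (at_right 0)"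
   by (rule filterlim_compose[OF poly_exp_tendsto_0])
    (auto simp: divide_inverse filterlim_inverse_at_top_right)
  then have "((%h. (exp_bump p (0 + h) - exp_bump p 0) / h) \<longlongrightarrow> 0) (at_right 0)"
  proof (rule Lim_transform_eventually)
   have "h > 0 ==> poly (p * [:0, 1:]) (1 / h) * exp (- (1 / h)) = (exp_bump p (0 + h) - exp_bump p 0) / h" for h
    by (simp add: exp_bump_def)
   then show "\<forall>\<^sub>F h in at_right 0. poly (p * [:0, 1:]) (1 / h) * exp (- (1 / h)) = (exp_bump p (0 + h) - exp_bump p 0) / h"
    by (simp add: eventually_at_filter)
  qed
  moreover have "((%h. (exp_bump p (0 + h) - exp_bump p 0) / h) \<longlongrightarrow> 0) (at_left 0)"
  proof (rule Lim_transform_eventually)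
   have "h < 0 ==> 0 = (exp_bump p (0 + h) - exp_bump p 0) / h" for h
    by (simp add: exp_bump_def)
   then show "\<forall>\<^sub>F h in at_left 0. 0 = (exp_bump p (0 + h) - exp_bump p 0) / h"
    by (simp add: eventually_at_filter)
  qed simp
  ultimately have "(exp_bump p has_real_derivative 0) (at 0)"
   unfolding DERIV_def by (rule filterlim_split_at[rotated])
  then show ?thesis using 3 by (simp add: exp_bump_def)
 qed
qed

definition smooth_step :: "real => real" where
 "smooth_step t = exp_bump 1 t / (exp_bump 1 t + exp_bump 1 (1 - t))"

lemma smooth_step_denominator: "exp_bump 1 t + exp_bump 1 (1 - t) > 0"
 by (auto simp: exp_bump_def add_pos_pos)

lemma smooth_step_bounds: "0 <= smooth_step t" "smooth_step t <= 1"
 using smooth_step_denominator[of t] by (auto simp: smooth_step_def exp_bump_def divide_simps)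

lemma smooth_step_eq_0: "t <= 0 ==> smooth_step t = 0"
 by (auto simp: smooth_step_def exp_bump_def)

lemma smooth_step_eq_1: "t >= 1 ==> smooth_step t = 1"
 by (auto simp: smooth_step_def exp_bump_def)

lemma smooth_on_smooth_step:
 assumes "open U" "smooth_on U q"
 shows "smooth_on U (%x. smooth_step (q x))"
proof -
 have 1: "smooth_on U (%x. exp_bump 1 (q x))"
  by (rule smooth_on_real_family[OF assms]) (rule exp_bump_derivative)
 have 2: "smooth_on U (%x. exp_bump 1 (1 - q x))"
  by (rule smooth_on_real_family[OF assms(1) smooth_on_diff[OF assms(1) smooth_on_const assms(2)]])
   (rule exp_bump_derivative)
 show ?thesis unfolding smooth_step_def
  by (rule smooth_on_divide[OF assms(1) 1 smooth_on_add[OF assms(1) 1 2]])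
   (use smooth_step_denominator in \<open>metis less_irrefl\<close>)
qed

text \<open>The squared distance is a polynomial, so smoothness is not lost at the centre
  \<open>p\<close>.\<close>

definition cutoff :: "real^'n::finite => real => real => real^'n => real" where
 "cutoff p r R x = smooth_step ((R^2 - (dist p x)^2) / (R^2 - r^2))"

lemma cutoff_props:
 assumes "0 < r" "r < R"
 shows "x : cball p r ==> cutoff p r R x = 1" "x ~: ball p R ==> cutoff p r R x = 0"
  "0 <= cutoff p r R x" "cutoff p r R x <= 1"
proof -
 have *: "r^2 < R^2" using assms by (simp add: power2_eq_square mult_strict_mono)
 show "cutoff p r R x = 1" if "x : cball p r"
 proof -
  have "(dist p x)^2 <= r^2" using that by (simp add: power_mono)
  then show ?thesis using * by (simp add: cutoff_def smooth_step_eq_1)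
 qed
 show "cutoff p r R x = 0" if "x ~: ball p R"
 proof -
  have "R^2 <= (dist p x)^2" using that assms by (simp add: power_mono)
  then show ?thesis using * by (simp add: cutoff_def smooth_step_eq_0 divide_le_0_iff)
 qed
qed (simp_all add: cutoff_def smooth_step_bounds)

lemma smooth_on_cutoff: "open U ==> smooth_on U (cutoff p r R)"
proof -
 assume U: "open U"
 have "(dist p x)^2 = (SUM i:UNIV. (p$i - x$i) * (p$i - x$i))" for x
  by (simp add: dist_norm power2_norm_eq_inner inner_vec_def)
 then have "cutoff p r R = (%x. smooth_step ((R^2 - (SUM i:UNIV. (p$i - x$i) * (p$i - x$i))) * (1 / (R^2 - r^2))))"
  by (simp add: fun_eq_iff cutoff_def)
 then show ?thesis
  by (simp only:) (intro smooth_on_smooth_step smooth_on_mult smooth_on_diff smooth_on_sum smooth_on_const smooth_on_nth U)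
qed


section \<open>Differential forms\<close>

subsection \<open>Index lists\<close>

definition rm :: "nat => 'a list => 'a list" where
 "rm j xs = take j xs @ drop (Suc j) xs"

definition ins :: "nat => 'a => 'a list => 'a list" where
 "ins j a xs = take j xs @ a # drop j xs"

lemma length_rm: "j < length xs ==> length (rm j xs) = length xs - 1"
 by (auto simp: rm_def)

lemma length_ins: "j <= length xs ==> length (ins j a xs) = Suc (length xs)"
 by (auto simp: ins_def)

lemma rm_ins: "j <= length xs ==> rm j (ins j a xs) = xs"
 by (auto simp: rm_def ins_def)

lemma ins_rm: "j < length xs ==> ins j (xs ! j) (rm j xs) = xs"
 by (auto simp: rm_def ins_def id_take_nth_drop[symmetric] min_def)

lemma nth_ins: "j <= length xs ==> ins j a xs ! j = a"
 by (auto simp: ins_def nth_append)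

lemma nth_rm: "j < length xs ==> Suc l < length xs ==> rm j xs ! l = (if l < j then xs ! l else xs ! Suc l)"
 by (auto simp: rm_def nth_append min_def)

lemma rm_rm:
 assumes "j <= l" "Suc l < length xs"
 shows "rm l (rm j xs) = rm j (rm (Suc l) xs)"
proof (rule nth_equalityI)
 show "length (rm l (rm j xs)) = length (rm j (rm (Suc l) xs))"
  using assms by (simp add: length_rm)
 fix i assume "i < length (rm l (rm j xs))"
 then show "rm l (rm j xs) ! i = rm j (rm (Suc l) xs) ! i"
  using assms by (auto simp: length_rm nth_rm)
qed

lemma rm_Cons [simp]: "rm 0 (x # xs) = xs" "rm (Suc j) (x # xs) = x # rm j xs"
 by (auto simp: rm_def)

lemma rm_map: "rm j (map f xs) = map f (rm j xs)"
 by (simp add: rm_def take_map drop_map)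

lemma rm_zip: "length xs = length ys ==> rm j (zip xs ys) = zip (rm j xs) (rm j ys)"
 by (simp add: rm_def take_zip drop_zip)

lemma finite_lists_of_length [simp]: "finite {js :: 'n::finite list. length js = k}"
 using finite_lists_length_eq[of "UNIV :: 'n set" k] by simp

lemma sum_lists_ins:
 fixes F :: "'n::finite list => real"
 assumes "j <= k"
 shows "(SUM js | length js = Suc k. F js) = (SUM m:UNIV. SUM js | length js = k. F (ins j m js))"
proof -
 have "(SUM m:UNIV. SUM js | length js = k. F (ins j m js)) =
   (SUM (m, js):UNIV \<times> {js. length js = k}. F (ins j m js))"
  by (simp add: sum.cartesian_product)
 also have "\<dots> = (SUM js | length js = Suc k. F js)"
  by (rule sum.reindex_bij_witness[where i = "%js. (js ! j, rm j js)" and j = "%(m, js). ins j m js"])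
   (use assms in \<open>auto simp: length_ins length_rm ins_rm rm_ins nth_ins\<close>)
 finally show ?thesis by simp
qed

lemma prod_list_map2_ins:
 fixes g :: "'a => 'b => real"
 assumes "j < length xs" "length xs = Suc (length js)"
 shows "prod_list (map2 g xs (ins j m js)) = g (xs ! j) m * prod_list (map2 g (rm j xs) js)"
proof -
 have "zip xs (ins j m js) = zip (take j xs @ xs ! j # drop (Suc j) xs) (take j js @ m # drop j js)"
  using assms by (simp add: ins_def id_take_nth_drop[symmetric])
 also have "\<dots> = zip (take j xs) (take j js) @ (xs ! j, m) # zip (drop (Suc j) xs) (drop j js)"
  using assms by (subst zip_append) auto
 finally have 1: "zip xs (ins j m js) = zip (take j xs) (take j js) @ (xs ! j, m) # zip (drop (Suc j) xs) (drop j js)" .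
 have "zip (rm j xs) js = zip (take j xs @ drop (Suc j) xs) (take j js @ drop j js)"
  by (simp add: rm_def)
 also have "\<dots> = zip (take j xs) (take j js) @ zip (drop (Suc j) xs) (drop j js)"
  using assms by (subst zip_append) auto
 finally show ?thesis unfolding 1 by simp
qed

text \<open>Moving \<open>u\<close> to the front takes \<open>length xs\<close> adjacent
  transpositions.\<close>

lemma alternating_move:
 assumes "alternating c"
 shows "c (xs @ u # ys) = (-1) ^ length xs * c (u # xs @ ys)"
proof (induction xs arbitrary: ys rule: rev_induct)
 case (snoc x xs)
 let ?l = "xs @ x # u # ys"
 have "c (?l[length xs := ?l ! Suc (length xs), Suc (length xs) := ?l ! length xs]) = - c ?l"
  using assms unfolding alternating_def by (metis One_nat_def add_Suc_right length_Cons length_append less_add_Suc1 n_not_Suc_n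
   add.commute less_Suc_eq plus_1_eq_Suc not_less_eq less_add_same_cancel1 zero_less_Suc)
 moreover have "?l[length xs := ?l ! Suc (length xs), Suc (length xs) := ?l ! length xs] = xs @ u # x # ys"
  by (simp add: nth_append list_update_append)
 ultimately have "c ((xs @ [x]) @ u # ys) = - c (xs @ u # x # ys)" by simp
 also have "\<dots> = - ((-1) ^ length xs * c (u # xs @ x # ys))" by (simp add: snoc)
 finally show ?case by simp
qed simp

lemma alternating_ins:
 assumes "alternating c" "p <= length js"
 shows "c (ins p m js) = (-1) ^ p * c (m # js)"
 using alternating_move[OF assms(1), of "take p js" m "drop p js"] assms(2) by (simp add: ins_def)

text \<open>The index pairs with \<open>j <= l\<close> correspond to those with \<open>l < j\<close>
  by \<open>(j, l) -> (Suc l, j)\<close>, which flips the sign. This one cancellation serves both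
  \<open>d d = 0\<close> and the commutation of \<open>d\<close> with pullback.\<close>

lemma sum_alternating_pairs_eq_0:
 fixes T :: "nat => nat => real"
 assumes "!!j l. j <= l ==> l < k ==> T j l = T (Suc l) j"
 shows "(SUM j<Suc k. SUM l<k. (-1) ^ (j + l) * T j l) = 0"
proof -
 have sg: "0 < a ==> (-1::real) ^ (a + b - Suc 0) = - ((-1) ^ (a + b))" for a b by (cases a) auto
 define S1 where "S1 = {(j, l). j <= l & l < k}"
 define S2 where "S2 = {(j, l). l < j & j < Suc k}"
 have fin: "finite S1" "finite S2"
  by (rule finite_subset[of _ "{..k} \<times> {..k}"]; force simp: S1_def S2_def)+
 have S: "{..<Suc k} \<times> {..<k} = S1 Un S2" "S1 Int S2 = {}" by (auto simp: S1_def S2_def)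
 have "(SUM (j, l):S2. (-1) ^ (j + l) * T j l) = (SUM (j, l):S1. - ((-1) ^ (j + l) * T j l))"
  by (rule sum.reindex_bij_witness[where i = "%(j, l). (Suc l, j)" and j = "%(j, l). (l, j - 1)"])
   (use assms sg in \<open>auto simp: S1_def S2_def add.commute\<close>)
 then have "(SUM (j, l):S1 Un S2. (-1) ^ (j + l) * T j l) = 0"
  using S fin by (subst sum.union_disjoint) (auto simp: case_prod_unfold sum_negf)
 then show ?thesis by (simp add: sum.cartesian_product S(1)[symmetric])
qed

subsection \<open>The exterior derivative\<close>

lemma ext_d_eq:
 "ext_d U om x is = (if x : U then SUM j<length is. (-1)^j * partial (is!j) (%y. om y (rm j is)) x else 0)"
 by (simp add: ext_d_def rm_def)

lemma form_onD:
 assumes "form_on U k om"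
 shows "x ~: U ==> om x is = 0" "length is ~= k ==> om x is = 0" "alternating (om x)" "smooth_on U (%x. om x is)"
 using assms unfolding form_on_def by auto

lemma form_on_differentiable: "form_on U k om ==> x : U ==> (%x. om x is) differentiable (at x)"
 using form_onD(4) smooth_on_imp_differentiable by blast

lemma form_on_zero [simp]: "form_on U k (%_ _. 0)"
 by (simp add: form_on_def alternating_def)

lemma form_on_combine:
 assumes "open U" "form_on U k om" "form_on U k ew"
 shows "form_on U k (%x is. a * om x is + b * ew x is)"
 using assms unfolding form_on_def alternating_def
 by (auto intro!: smooth_on_add smooth_on_mult)

lemma form_on_diff:
 assumes "open U" "form_on U k om" "form_on U k ew"
 shows "form_on U k (%x is. om x is - ew x is)"
 using form_on_combine[OF assms, of 1 "-1"] by simp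

lemma form_on_add:
 assumes "open U" "form_on U k om" "form_on U k ew"
 shows "form_on U k (%x is. om x is + ew x is)"
 using form_on_combine[OF assms, of 1 1] by simp

lemma ext_d_zero_length: "form_on U k om ==> length is ~= Suc k ==> ext_d U om x is = 0"
 unfolding ext_d_eq by (auto intro!: sum.neutral simp: form_onD(2) length_rm)

lemma ext_d_diff:
 assumes "form_on U k om" "form_on U k ew"
 shows "ext_d U (%x is. om x is - ew x is) = (%x is. ext_d U om x is - ext_d U ew x is)"
 by (intro ext) (auto simp: ext_d_eq sum_subtractf[symmetric] partial_minus form_on_differentiable[OF assms(1)]
  form_on_differentiable[OF assms(2)] right_diff_distrib intro!: sum.cong)

lemma ext_d_add:
 assumes "form_on U k om" "form_on U k ew"
 shows "ext_d U (%x is. om x is + ew x is) = (%x is. ext_d U om x is + ext_d U ew x is)"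
 by (intro ext) (auto simp: ext_d_eq sum.distrib[symmetric] partial_add form_on_differentiable[OF assms(1)]
  form_on_differentiable[OF assms(2)] distrib_left intro!: sum.cong)

lemma ext_d_cong:
 assumes "open W" "x : W" "W <= U" "W <= U'" "!!y is. y : W ==> om y is = ew y is"
 shows "ext_d U om x is = ext_d U' ew x is"
proof -
 have "partial i (%y. om y js) x = partial i (%y. ew y js) x" for i js
  by (rule partial_cong[OF assms(1,2)]) (rule assms(5))
 then show ?thesis using assms(2-4) by (auto simp: ext_d_eq)
qed

lemma ext_d_zero [simp]: "ext_d U (%_ _. 0) = (%_ _. 0)"
 by (intro ext) (simp add: ext_d_eq)

lemma smooth_on_ext_d:
 assumes "open U" "form_on U k om"
 shows "smooth_on U (%x. ext_d U om x is)"
proof (subst smooth_on_cong[OF assms(1)])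
 show "ext_d U om x is = (SUM j<length is. (-1)^j * partial (is!j) (%y. om y (rm j is)) x)" if "x : U" for x
  using that by (simp add: ext_d_eq)
 show "smooth_on U (%x. SUM j<length is. (-1)^j * partial (is!j) (%y. om y (rm j is)) x)"
  by (intro smooth_on_sum smooth_on_mult smooth_on_const smooth_on_partial form_onD(4)[OF assms(2)] assms(1))
qed

lemma alternating_swapI:
 assumes "!!A u B v C. c (A @ v # B @ u # C) = - c (A @ u # B @ v # C)"
 shows "alternating c"
 unfolding alternating_def
proof (intro allI impI)
 have *: "c (xs[i := xs!j, j := xs!i]) = - c xs" if "i < j" "j < length xs" for xs :: "'a list" and i j
 proof -
  define A B C where "A = take i xs" and "B = take (j - Suc i) (drop (Suc i) xs)" and "C = drop (Suc j) xs"
  have 1: "xs = A @ xs ! i # drop (Suc i) xs" using that by (simp add: A_def id_take_nth_drop[symmetric])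
  have 2: "drop (Suc i) xs = B @ xs ! j # C"
   using id_take_nth_drop[of "j - Suc i" "drop (Suc i) xs"] that by (simp add: B_def C_def)
  have xs: "xs = A @ xs ! i # B @ xs ! j # C" using 1 2 by simp
  have lA: "length A = i" "length B = j - Suc i" using that by (auto simp: A_def B_def)
  have ij: "i = length A" "j = length (A @ [undefined] @ B)" using lA that by auto
  have "(A @ a # B @ b # C)[i := b, j := a] = ((A @ [b] @ B) @ b # C)[j := a]" for a b
   by (simp add: ij(1))
  also have "((A @ [b] @ B) @ b # C)[j := a] = (A @ [b] @ B) @ a # C" for a b
   by (subst list_update_append) (simp add: ij(2))
  finally have "(A @ a # B @ b # C)[i := b, j := a] = A @ b # B @ a # C" for a b by simp
  then have "xs[i := xs!j, j := xs!i] = A @ xs!j # B @ xs!i # C" using xs by metis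
  then show ?thesis using assms[of A "xs!j" B "xs!i" C] xs by simp
 qed
 fix xs :: "'a list" and i j assume "i < length xs & j < length xs & i ~= j"
 then show "c (xs[i := xs!j, j := xs!i]) = - c xs"
  using *[of i j xs] *[of j i xs] list_update_swap[of i j xs "xs!j" "xs!i"] by (metis linorder_neqE_nat)
qed

lemma alternating_swap:
 assumes "alternating c"
 shows "c (A @ v # B @ u # C) = - c (A @ u # B @ v # C)"
proof -
 have "c (A @ v # B @ u # C) = (-1) ^ length A * ((-1) ^ Suc (length A + length B) * c (u # v # A @ B @ C))"
  using alternating_move[OF assms, of A v "B @ u # C"] alternating_move[OF assms, of "v # A @ B" u C] by simp
 also have "\<dots> = - ((-1) ^ length A * ((-1) ^ (length A + length B) * c (u # v # A @ B @ C)))" by simp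
 finally have 1: "c (A @ v # B @ u # C) = \<dots>" .
 have "c (A @ u # B @ v # C) = (-1) ^ length A * ((-1) ^ Suc (length A + length B) * c (v # u # A @ B @ C))"
  using alternating_move[OF assms, of A u "B @ v # C"] alternating_move[OF assms, of "u # A @ B" v C] by simp
 moreover have "c (v # u # A @ B @ C) = - c (u # v # A @ B @ C)"
  using alternating_move[OF assms, of "[v]" u "A @ B @ C"] by simp
 ultimately show ?thesis using 1 by simp
qed

lemma nth_rm_middle [simp]: "(X @ w # Y) ! length X = w" "rm (length X) (X @ w # Y) = X @ Y"
 by (auto simp: rm_def)

text \<open>Interchanging \<open>u\<close> and \<open>v\<close> trades the two summands that delete
  one of them, where the sign comes from carrying the surviving entry across \<open>B\<close>; every
  other summand changes sign because \<open>om\<close> is alternating.\<close>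

lemma alternating_ext_d:
 assumes "form_on U k om"
 shows "alternating (ext_d U om x)"
proof (rule alternating_swapI)
 fix A B C :: "'a list" and u v
 define t where "t xs j = (-1)^j * partial (xs!j) (%y. om y (rm j xs)) x" for xs j
 show "ext_d U om x (A @ v # B @ u # C) = - ext_d U om x (A @ u # B @ v # C)"
 proof (cases "x : U")
  case True
  have neg: "partial w (%y. om y Z') x = s * partial w (%y. om y Z) x" if "!!y. om y Z' = s * om y Z" for w Z Z' s
   using partial_cmult[OF form_on_differentiable[OF assms True]] that by simp
  note alt = form_onD(3)[OF assms]
  define a b where "a = length A" and "b = Suc (length A + length B)"
  \<comment> \<open>The transposition of summation indices that matches the interchange of the two
    entries.\<close>
  define ta where "ta j = (if j = a then b else if j = b then a else j)" for j
  have tX: "t (X @ w # Y) (length X) = (-1) ^ length X * partial w (%y. om y (X @ Y)) x" for X w Y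
   by (simp add: t_def)
  have 1: "t (A @ v # B @ u # C) a = - t (A @ u # B @ v # C) b" for u v
  proof -
   have "om y (A @ B @ u # C) = (-1) ^ length B * om y (A @ u # B @ C)" for y
    using alternating_move[OF alt, of y "A @ B" u C] alternating_move[OF alt, of y A u "B @ C"]
    by (simp add: power_add)
   from neg[OF this] show ?thesis
    using tX[of A v "B @ u # C"] tX[of "A @ u # B" v C] by (simp add: a_def b_def power_add)
  qed
  have 2: "t (A @ v # B @ u # C) b = - t (A @ u # B @ v # C) a"
   using 1[of u v] by simp
  have 3: "t (A @ v # B @ u # C) j = - t (A @ u # B @ v # C) j"
   if j: "j < length (A @ u # B @ v # C)" "j ~= a" "j ~= b" for j
  proof -
   consider "j < a" | "a < j" "j < b" | "b < j" using j by linarith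
   then show ?thesis
   proof cases
    case 1
    then obtain X w Y where A: "A = X @ w # Y" "length X = j"
     by (metis a_def id_take_nth_drop length_take min.absorb4)
    show ?thesis
     using neg[of "X @ Y @ v # B @ u # C" "-1" "X @ Y @ u # B @ v # C" w]
      tX[of X w "Y @ v # B @ u # C"] tX[of X w "Y @ u # B @ v # C"]
      alternating_swap[OF alt, of _ "X @ Y" v B u C] A by simp
   next
    case 2
    then have "j - Suc a < length B" by (auto simp: a_def b_def)
    then obtain X w Y where B: "B = X @ w # Y" "length X = j - Suc a"
     by (metis id_take_nth_drop length_take min.absorb4)
    have l: "length (A @ v # X) = j" "length (A @ u # X) = j" using B 2 by (auto simp: a_def)
    show ?thesis
     using neg[of "A @ v # X @ Y @ u # C" "-1" "A @ u # X @ Y @ v # C" w]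
      tX[of "A @ v # X" w "Y @ u # C"] tX[of "A @ u # X" w "Y @ v # C"]
      alternating_swap[OF alt, of _ A v "X @ Y" u C] B l by simp
   next
    case 3
    then have "j - Suc b < length C" using j by (auto simp: a_def b_def)
    then obtain X w Y where C: "C = X @ w # Y" "length X = j - Suc b"
     by (metis id_take_nth_drop length_take min.absorb4)
    have l: "length (A @ v # B @ u # X) = j" "length (A @ u # B @ v # X) = j" using C 3 by (auto simp: b_def)
    show ?thesis
     using neg[of "A @ v # B @ u # X @ Y" "-1" "A @ u # B @ v # X @ Y" w]
      tX[of "A @ v # B @ u # X" w Y] tX[of "A @ u # B @ v # X" w Y]
      alternating_swap[OF alt, of _ A v B u "X @ Y"] C l by simp
   qed
  qed
  have "(SUM j<length (A @ u # B @ v # C). t (A @ v # B @ u # C) j)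
    = (SUM j<length (A @ u # B @ v # C). - t (A @ u # B @ v # C) j)"
   by (rule sum.reindex_bij_witness[where i = ta and j = ta])
    (use 1[of v u] 2 3 in \<open>auto simp: ta_def a_def b_def\<close>)
  then show ?thesis using True by (simp add: ext_d_eq t_def sum_negf)
 qed (simp add: ext_d_eq)
qed

lemma form_on_ext_d:
 assumes "open U" "form_on U k om"
 shows "form_on U (Suc k) (ext_d U om)"
proof -
 have "x ~: U ==> ext_d U om x is = 0" for x "is" by (simp add: ext_d_eq)
 then show ?thesis
  using ext_d_zero_length[OF assms(2)] alternating_ext_d[OF assms(2)] smooth_on_ext_d[OF assms]
  unfolding form_on_def by blast
qed

text \<open>The two orders of deleting a pair of entries carry opposite signs, and symmetry of
  second derivatives makes the terms equal.\<close>

lemma ext_d_ext_d: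
 assumes "open U" "form_on U k om"
 shows "ext_d U (ext_d U om) = (%_ _. 0)"
proof (intro ext)
 fix x "is"
 show "ext_d U (ext_d U om) x is = 0"
 proof (cases "x : U & is ~= []")
  case True
  define k where "k = length is - 1"
  have len: "length is = Suc k" using True by (simp add: k_def)
  define T where "T j l = partial (is!j) (partial (rm j is ! l) (%y. om y (rm l (rm j is)))) x" for j l
  have "partial (is!j) (%y. ext_d U om y (rm j is)) x = (SUM l<k. (-1)^l * T j l)" if "j < Suc k" for j
  proof -
   have "partial (is!j) (%y. ext_d U om y (rm j is)) x
     = partial (is!j) (%y. SUM l<k. (-1)^l * partial (rm j is ! l) (%z. om z (rm l (rm j is))) y) x"
    by (rule partial_cong[OF assms(1)]) (use True that len in \<open>auto simp: ext_d_eq length_rm\<close>)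
   also have "\<dots> = (SUM l<k. (-1)^l * T j l)"
    using True smooth_on_imp_differentiable[OF smooth_on_partial[OF form_onD(4)[OF assms(2)]]]
    by (subst partial_sum) (auto simp: T_def partial_cmult)
   finally show ?thesis .
  qed
  then have "ext_d U (ext_d U om) x is = (SUM j<Suc k. SUM l<k. (-1)^(j + l) * T j l)"
   using True len by (auto simp: ext_d_eq[of U "ext_d U om"] sum_distrib_left power_add mult.assoc
    simp del: sum.lessThan_Suc intro!: sum.cong)
  also have "\<dots> = 0"
  proof (rule sum_alternating_pairs_eq_0)
   fix j l assume jl: "j <= l" "l < k"
   then have "rm l (rm j is) = rm j (rm (Suc l) is)" "rm j is ! l = is ! Suc l" "rm (Suc l) is ! j = is ! j"
    using len by (auto simp: rm_rm nth_rm)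
   then show "T j l = T (Suc l) j"
    using partial_commute[OF assms(1) form_onD(4)[OF assms(2)], of x] True by (simp add: T_def)
  qed
  finally show ?thesis .
 qed (auto simp: ext_d_eq)
qed


subsection \<open>Pullback\<close>

text \<open>Multilinear expansion of \<open>om\<close> on the images of the basis vectors under the
  differential of \<open>f\<close>. Summing over all index lists, not only increasing ones, avoids
  minors and factorials.\<close>

definition pull :: "(real^'m::finite) set => (real^'m => real^'n::finite) =>
  (real^'n => 'n list => real) => real^'m => 'm list => real" where
 "pull D f om x is = (if x : D then SUM js | length js = length is.
   om (f x) js * prod_list (map2 (%i j. partial i (%y. f y $ j) x) is js) else 0)"

lemma smooth_on_prod_list:
 assumes "open U" "!!p. p : set ps ==> smooth_on U (h p)"
 shows "smooth_on U (%x. prod_list (map (%p. h p x) ps))"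
 using assms(2) by (induction ps) (auto intro!: smooth_on_mult assms(1))

lemma prod_list_swap:
 fixes xs :: "real list"
 assumes "i < length xs" "j < length xs"
 shows "prod_list (xs[i := xs!j, j := xs!i]) = prod_list xs"
 using mset_swap[of j xs i] assms by (metis prod_mset_prod_list list_update_swap list_update_id)

lemma alternating_pull:
 fixes om :: "real^'n::finite => 'n list => real"
 shows "(!!x. alternating (om x)) ==> alternating (pull D f om x)"
 unfolding alternating_def
proof (intro allI impI, goal_cases)
 case (1 xs i j)
 define g where "g = (%i j. partial i (%y. f y $ j) x)"
 define sw :: "'n list => 'n list" where "sw ys = ys[i := ys!j, j := ys!i]" for ys
 have ss: "sw (sw ys) = ys" if "length ys = length xs" for ys
  using 1 that by (intro nth_equalityI) (auto simp: sw_def nth_list_update)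
 have zp: "prod_list (map2 g (xs[i := xs!j, j := xs!i]) (sw js)) = prod_list (map2 g xs js)"
  if "length js = length xs" for js
 proof -
  have "map2 g (xs[i := xs!j, j := xs!i]) (sw js) = (map2 g xs js)[i := map2 g xs js ! j, j := map2 g xs js ! i]"
   using 1 that by (intro nth_equalityI) (auto simp: sw_def nth_list_update)
  then show ?thesis using prod_list_swap[of i "map2 g xs js" j] 1 that by simp
 qed
 have alt: "om (f x) (sw js) = - om (f x) js" if "length js = length xs" for js
  using 1 that unfolding sw_def by auto
 have "(SUM js | length js = length xs. om (f x) js * prod_list (map2 g (xs[i := xs!j, j := xs!i]) js))
   = (SUM js | length js = length xs. om (f x) (sw js) * prod_list (map2 g (xs[i := xs!j, j := xs!i]) (sw js)))"
  by (rule sum.reindex_bij_witness[where i = sw and j = sw]) (use ss in \<open>auto simp: sw_def\<close>)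
 also have "\<dots> = (SUM js | length js = length xs. - (om (f x) js * prod_list (map2 g xs js)))"
  by (intro sum.cong refl) (simp add: alt zp)
 finally show ?case by (simp add: pull_def g_def sum_negf)
qed

lemma smooth_on_pull_coeff:
 assumes "open D" "smooth_map_on D f"
 shows "smooth_on D (%x. prod_list (map2 (%i j. partial i (%y. f y $ j) x) is js))"
proof -
 have "smooth_on D (%x. prod_list (map (%p. partial (fst p) (%y. f y $ snd p) x) (zip is js)))"
  by (rule smooth_on_prod_list[OF assms(1)]) (use assms(2) smooth_on_partial in blast)
 then show ?thesis by (simp add: case_prod_unfold)
qed

lemma flat_on_pull:
 assumes D: "open D" "A <= D" "open U" "A' <= U" "f ` D <= U" "f ` A <= A'" "smooth_map_on D f"
  and om: "!!is. flat_on A' U (%x. om x is)"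
 shows "flat_on A D (%x. pull D f om x is)"
proof (subst flat_on_cong[OF D(1,2)])
 show "flat_on A D (%x. SUM js | length js = length is.
   om (f x) js * prod_list (map2 (%i j. partial i (%y. f y $ j) x) is js))"
  by (intro flat_on_sum flat_on_mult smooth_on_pull_coeff flat_on_compose[OF D(1-6) om] D)
qed (simp add: pull_def)

lemma form_on_pull:
 assumes D: "open D" "open U" "f ` D <= U" "smooth_map_on D f" and om: "form_on U k om"
 shows "form_on D k (pull D f om)"
 unfolding form_on_def
proof (intro conjI allI impI)
 show "alternating (pull D f om x)" for x by (rule alternating_pull) (rule form_onD(3)[OF om])
 show "smooth_on D (%x. pull D f om x is)" for "is"
  using flat_on_pull[of D "{}" U "{}" f om "is"] D form_onD(4)[OF om] by (simp add: smooth_on_eq_flat)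
 show "pull D f om x is = 0" if "x ~: D \<or> length is ~= k" for x "is"
  using that by (auto simp: pull_def form_onD(2)[OF om] intro!: sum.neutral)
qed

lemma flat_form_pull:
 assumes "open D" "A <= D" "open U" "A' <= U" "f ` D <= U" "f ` A <= A'" "smooth_map_on D f"
  and "flat_form A' U k om"
 shows "flat_form A D k (pull D f om)"
 using assms flat_on_pull[OF assms(1-7)] form_on_pull[of D U f k om] unfolding flat_form_def by blast

lemma pull_cong:
 assumes "open W" "x : W" "W <= D" "W <= D'" "!!y. y : W ==> f y = g y"
 shows "pull D f om x is = pull D' g om x is"
proof -
 have "partial i (%y. f y $ j) x = partial i (%y. g y $ j) x" for i j
  by (rule partial_cong[OF assms(1,2)]) (simp add: assms(5))
 then show ?thesis using assms by (auto simp: pull_def)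
qed

lemma partial_prod_list:
 assumes "!!h. h : set hs ==> h differentiable (at x)"
 shows "partial i (%y. prod_list (map (%h. h y) hs)) x =
   (SUM l<length hs. partial i (hs ! l) x * prod_list (map (%h. h x) (rm l hs)))
  & (%y. prod_list (map (%h. h y) hs)) differentiable (at x)"
 using assms
proof (induction hs)
 case (Cons h hs)
 have d: "(%y. prod_list (map (%h. h y) hs)) differentiable (at x)" "h differentiable (at x)"
  using Cons by auto
 have "partial i (%y. prod_list (map (%h. h y) (h # hs))) x =
   h x * partial i (%y. prod_list (map (%h. h y) hs)) x + partial i h x * prod_list (map (%h. h x) hs)"
  using partial_mult[OF d(2,1)] by simp
 also have "partial i (%y. prod_list (map (%h. h y) hs)) x =
   (SUM l<length hs. partial i (hs ! l) x * prod_list (map (%h. h x) (rm l hs)))"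
  using Cons by auto
 finally show ?case using differentiable_mult[OF d(2,1)]
  by (simp add: sum.lessThan_Suc_shift sum_distrib_left mult.left_commute add.commute del: sum.lessThan_Suc)
qed (simp add: partial_const)

text \<open>In the derivative of a pulled-back coefficient, \<open>A j\<close> collects the terms
  where it falls on \<open>om\<close> and \<open>B j\<close> those where it falls on the
  differential of \<open>f\<close>. The latter contain second derivatives of \<open>f\<close>,
  symmetric against an alternating form, and cancel in the alternating sum.\<close>

lemma ext_d_pull:
 fixes f :: "real^'m::finite => real^'n::finite"
 assumes D: "open D" "open U" "f ` D <= U" "smooth_map_on D f" and om: "form_on U k om"
 shows "ext_d D (pull D f om) = pull D f (ext_d U om)"
proof (intro ext)
 fix x "is"
 show "ext_d D (pull D f om) x is = pull D f (ext_d U om) x is"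
 proof (cases "x : D & length is = Suc k")
  case False
  then consider "x ~: D" | "length is ~= Suc k" by blast
  then show ?thesis
  proof cases
   case 1 then show ?thesis by (simp add: ext_d_eq pull_def)
  next
   case 2 then show ?thesis
    using ext_d_zero_length[OF form_on_pull[OF D om] 2] form_onD(2)[OF form_on_pull[OF D form_on_ext_d[OF D(2) om]] 2]
    by simp
  qed
 next
  case True
  then have x: "x : D" and len: "length is = Suc k" by auto
  have fx: "f x : U" using x D by auto
  define g where "g i j y = partial i (%y. f y $ j) y" for i j y
  define P where "P rs js y = prod_list (map2 (%i j. g i j y) rs js)" for rs js y
  have df: "(%y. f y $ j) differentiable (at x)" for j using D(4) x smooth_on_imp_differentiable by blast
  have dg: "g i j differentiable (at x)" for i j
   unfolding g_def using D(4) x smooth_on_imp_differentiable smooth_on_partial by blast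
  have dom: "(%y. om y js) differentiable (at (f x))" for js by (rule form_on_differentiable[OF om fx])
  have dP: "P rs js differentiable (at x)"
   and P': "length rs = length js ==> partial i (P rs js) x =
    (SUM l<length js. partial i (g (rs!l) (js!l)) x * P (rm l rs) (rm l js) x)" for rs js i
  proof -
   have eq: "P rs js y = prod_list (map (%h. h y) (map2 (%i j y. g i j y) rs js))" for y
    by (simp add: P_def o_def case_prod_unfold)
   have "h : set (map2 (%i j y. g i j y) rs js) ==> h differentiable (at x)" for h
    using dg by auto
   note pl = partial_prod_list[of "map2 (%i j y. g i j y) rs js" x i, OF this]
   have Pe: "P rs js = (%y. prod_list (map (%h. h y) (map2 (%i j y. g i j y) rs js)))"
    by (rule ext) (rule eq)
   show "P rs js differentiable (at x)" unfolding Pe using pl by blast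
   assume l: "length rs = length js"
   show "partial i (P rs js) x = (SUM l<length js. partial i (g (rs!l) (js!l)) x * P (rm l rs) (rm l js) x)"
   proof -
    let ?hs = "map2 (%i j y. g i j y) rs js"
    have "partial i (P rs js) x = (SUM l<length ?hs. partial i (?hs ! l) x * prod_list (map (%h. h x) (rm l ?hs)))"
     unfolding Pe using pl by blast
    also have "\<dots> = (SUM l<length js. partial i (g (rs!l) (js!l)) x * P (rm l rs) (rm l js) x)"
     using l by (intro sum.cong) (auto simp: P_def rm_map rm_zip o_def case_prod_unfold)
    finally show ?thesis .
   qed
  qed
  define A where "A j = (SUM m:UNIV. SUM js | length js = k. partial m (%z. om z js) (f x) * (g (is!j) m x * P (rm j is) js x))" for j
  define B where "B j = (SUM js | length js = k. om (f x) js * (SUM l<k. partial (is!j) (g (rm j is!l) (js!l)) x * P (rm l (rm j is)) (rm l js) x))" for j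
  have trm: "partial (is!j) (%y. pull D f om y (rm j is)) x = A j + B j" if j: "j < Suc k" for j
  proof -
   have lr: "length (rm j is) = k" using j len by (simp add: length_rm)
   have domf: "(%y. om (f y) js) differentiable (at x)" for js
    using differentiable_compose_vec[where g = "%z. om z js" and f = f] dom df by blast
   have "partial (is!j) (%y. pull D f om y (rm j is)) x
     = partial (is!j) (%y. SUM js | length js = k. om (f y) js * P (rm j is) js y) x"
    by (rule partial_cong[OF D(1) x]) (simp add: pull_def P_def g_def lr)
   also have "\<dots> = (SUM js | length js = k. partial (is!j) (%y. om (f y) js * P (rm j is) js y) x)"
    using differentiable_mult[OF domf dP] by (intro partial_sum) auto
   also have "\<dots> = (SUM js | length js = k. om (f x) js * partial (is!j) (P (rm j is) js) x
     + (SUM m:UNIV. partial m (%z. om z js) (f x) * g (is!j) m x) * P (rm j is) js x)"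
    by (intro sum.cong refl)
     (simp add: partial_mult[OF domf dP] partial_compose[where g = "%z. om z _" and f = f, OF dom df] g_def)
   also have "\<dots> = B j + (SUM js | length js = k. (SUM m:UNIV. partial m (%z. om z js) (f x) * g (is!j) m x) * P (rm j is) js x)"
    unfolding sum.distrib B_def by (simp add: P' lr)
   also have "(SUM js | length js = k. (SUM m:UNIV. partial m (%z. om z js) (f x) * g (is!j) m x) * P (rm j is) js x) = A j"
    unfolding A_def sum_distrib_right by (subst sum.swap) (simp add: mult.assoc)
   finally show ?thesis by simp
  qed
  have B0: "(SUM j<Suc k. (-1)^j * B j) = 0"
  proof (cases k)
   case (Suc k')
   \<comment> \<open>Bringing entry \<open>l\<close> of the index list of \<open>om\<close> to the
     front costs \<open>(-1)^l\<close> and leaves a term invariant under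
     \<open>(j, l) -> (Suc l, j)\<close>.\<close>
   define T where "T j l = (SUM m:UNIV. SUM js | length js = k'. om (f x) (m # js) *
     (partial (is!j) (g (rm j is!l) m) x * P (rm l (rm j is)) js x))" for j l
   have "B j = (SUM l<k. (-1)^l * T j l)" if "j < Suc k" for j
   proof -
    have "B j = (SUM l<k. SUM js | length js = k. om (f x) js * (partial (is!j) (g (rm j is!l) (js!l)) x * P (rm l (rm j is)) (rm l js) x))"
     unfolding B_def sum_distrib_left by (rule sum.swap)
    also have "\<dots> = (SUM l<k. (-1)^l * T j l)"
    proof (intro sum.cong refl)
     fix l assume "l : {..<k}"
     then have l: "l <= k'" using Suc by auto
     have "(SUM js | length js = k. om (f x) js * (partial (is!j) (g (rm j is!l) (js!l)) x * P (rm l (rm j is)) (rm l js) x))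
      = (SUM m:UNIV. SUM js | length js = k'. om (f x) (ins l m js) * (partial (is!j) (g (rm j is!l) m) x * P (rm l (rm j is)) js x))"
      unfolding Suc by (subst sum_lists_ins[OF l]) (use l in \<open>auto simp: nth_ins rm_ins intro!: sum.cong\<close>)
     also have "\<dots> = (-1)^l * T j l"
      unfolding T_def sum_distrib_left
      by (intro sum.cong refl) (use l in \<open>simp add: alternating_ins[OF form_onD(3)[OF om]] mult.assoc\<close>)
     finally show "(SUM js | length js = k. om (f x) js * (partial (is!j) (g (rm j is!l) (js!l)) x * P (rm l (rm j is)) (rm l js) x)) = (-1)^l * T j l" .
    qed
    finally show ?thesis .
   qed
   then have "(SUM j<Suc k. (-1)^j * B j) = (SUM j<Suc k. SUM l<k. (-1)^(j + l) * T j l)"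
    by (intro sum.cong refl) (simp add: sum_distrib_left power_add mult.assoc)
   also have "\<dots> = 0"
   proof (rule sum_alternating_pairs_eq_0)
    fix j l assume jl: "j <= l" "l < k"
    then have eq: "rm l (rm j is) = rm j (rm (Suc l) is)" "rm j is ! l = is ! Suc l" "rm (Suc l) is ! j = is ! j"
     using len by (auto simp: rm_rm nth_rm)
    have "partial a (g b m) x = partial b (g a m) x" for a b m
     using partial_commute[OF D(1), of "%y. f y $ m" x a b] D(4) x
     by (simp add: g_def[abs_def])
    then show "T j l = T (Suc l) j" unfolding T_def eq by simp
   qed
   finally show ?thesis .
  qed (simp add: B_def)
  have "ext_d D (pull D f om) x is = (SUM j<Suc k. (-1)^j * (A j + B j))"
   using x len trm by (simp add: ext_d_eq del: sum.lessThan_Suc)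
  also have "\<dots> = (SUM j<Suc k. (-1)^j * A j)"
   using B0 by (simp add: distrib_left sum.distrib del: sum.lessThan_Suc)
  also have "\<dots> = (SUM j<Suc k. (-1)^j * (SUM ms | length ms = Suc k. partial (ms!j) (%z. om z (rm j ms)) (f x) * P is ms x))"
  proof (intro sum.cong refl arg_cong2[where f = "(*)"])
   fix j assume "j : {..<Suc k}"
   then have j: "j <= k" by auto
   show "A j = (SUM ms | length ms = Suc k. partial (ms!j) (%z. om z (rm j ms)) (f x) * P is ms x)"
    unfolding A_def
    by (subst sum_lists_ins[OF j]) (use j len in \<open>auto simp: nth_ins rm_ins P_def prod_list_map2_ins intro!: sum.cong\<close>)
  qed
  also have "\<dots> = (SUM ms | length ms = Suc k. (SUM j<Suc k. (-1)^j * partial (ms!j) (%z. om z (rm j ms)) (f x)) * P is ms x)"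
   unfolding sum_distrib_left sum_distrib_right by (subst sum.swap) (simp add: mult.assoc)
  also have "\<dots> = pull D f (ext_d U om) x is"
   using x len fx by (simp add: pull_def ext_d_eq P_def g_def del: sum.lessThan_Suc)
  finally show ?thesis .
 qed
qed

text \<open>A product of sums expanded over all choices of indices; together with the chain rule it
  is functoriality of \<open>pull\<close>.\<close>

lemma prod_list_map2_sum:
 fixes a :: "'a => 'b::finite => real"
 assumes "length xs = length ls"
 shows "prod_list (map2 (%i l. SUM j:UNIV. a i j * b j l) xs ls) =
  (SUM js | length js = length xs. prod_list (map2 a xs js) * prod_list (map2 b js ls))"
 using assms
proof (induction xs ls rule: list_induct2)
 case (Cons x xs l ls)
 have "(SUM js | length js = Suc (length xs). prod_list (map2 a (x # xs) js) * prod_list (map2 b js (l # ls)))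
  = (SUM m:UNIV. SUM js | length js = length xs. (a x m * b m l) * (prod_list (map2 a xs js) * prod_list (map2 b js ls)))"
  by (subst sum_lists_ins[of 0]) (auto simp: ins_def mult_ac intro!: sum.cong)
 also have "\<dots> = (SUM m:UNIV. a x m * b m l) * (SUM js | length js = length xs. prod_list (map2 a xs js) * prod_list (map2 b js ls))"
  by (simp add: sum_product)
 finally show ?case using Cons by simp
qed simp

lemma pull_pull:
 fixes f :: "real^'m::finite => real^'n::finite" and g :: "real^'l::finite => real^'m"
 assumes "g ` D <= E" "smooth_map_on D g" "smooth_map_on E f"
 shows "pull D g (pull E f om) = pull D (%x. f (g x)) om"
proof (intro ext)
 fix x "is"
 show "pull D g (pull E f om) x is = pull D (%x. f (g x)) om x is"
 proof (cases "x : D")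
  case True
  then have gx: "g x : E" using assms by auto
  define a where "a i j = partial i (%y. g y $ j) x" for i j
  define b where "b j l = partial j (%y. f y $ l) (g x)" for j l
  have c: "partial i (%y. f (g y) $ l) x = (SUM j:UNIV. a i j * b j l)" for i l
   unfolding a_def b_def
   by (subst partial_compose[of "%y. f y $ l" g x i])
    (use smooth_on_imp_differentiable[OF assms(2)[rule_format]]
      smooth_on_imp_differentiable[OF assms(3)[rule_format]] True gx in \<open>auto simp: mult.commute\<close>)
  have "pull D (%x. f (g x)) om x is = (SUM ls | length ls = length is. om (f (g x)) ls *
    (SUM js | length js = length is. prod_list (map2 a is js) * prod_list (map2 b js ls)))"
   using True by (simp add: pull_def c prod_list_map2_sum)
  also have "\<dots> = (SUM js | length js = length is. (SUM ls | length ls = length is. om (f (g x)) ls * prod_list (map2 b js ls)) * prod_list (map2 a is js))"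
   unfolding sum_distrib_left sum_distrib_right by (subst sum.swap) (simp add: mult_ac)
  also have "\<dots> = pull D g (pull E f om) x is"
   using True gx by (simp add: pull_def a_def b_def)
  finally show ?thesis by simp
 qed (simp add: pull_def)
qed

lemma pull_id:
 assumes "x : D"
 shows "pull D (%x. x) om x is = om x is"
proof -
 have "length xs = length js ==> prod_list (map2 (%i j. if i = j then 1 else 0 :: real) xs js) = (if js = xs then 1 else 0)" for xs js :: "'a list"
  by (induction xs js rule: list_induct2) auto
 then have "pull D (%x. x) om x is = (SUM js | length js = length is. om x js * (if js = is then 1 else 0))"
  using assms by (auto simp: pull_def partial_nth intro!: sum.cong)
 then show ?thesis by (simp add: if_distrib cong: if_cong)
qed

subsection \<open>The homotopy formula\<close>

text \<open>Integration along the fibre: contract the form on the cylinder with the time direction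
  by putting \<open>None\<close> in the first slot, then integrate over time.\<close>

definition homotopy_op :: "(real^'n::finite) set => (real^('n option)) set => (real^('n option) => real^'m::finite) =>
  (real^'m => 'm list => real) => real^'n => 'n list => real" where
 "homotopy_op U D h om x is =
  (if x : U then integral {0..1} (%t. pull D h om (pair x t) (None # map Some is)) else 0)"

text \<open>An open \<open>D\<close> around the cylinder over \<open>U\<close> makes two-sided
  derivatives available at the end points of the time interval.\<close>

locale homotopy_data =
 fixes U :: "(real^'n::finite) set" and D and h :: "real^('n option) => real^'m::finite" and U'
 assumes opens: "open U" "open D" "open U'" and sub: "!!x t. x : U ==> t : {0..1} ==> pair x t : D"
  and h: "h ` D <= U'" "smooth_map_on D h"
begin

lemma flat_on_homotopy_op:
 assumes om: "form_on U' k om" "!!is. flat_on A' U' (%x. om x is)" and A: "A <= U" "A' <= U'"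
  and hA: "!!x t. x : A ==> t : {0..1} ==> h (pair x t) : A'"
 shows "flat_on A U (%x. homotopy_op U D h om x is)"
proof (subst flat_on_cong[OF opens(1) A(1)])
 let ?A = "{pair x t | x t. x : A & t : {0..1}}"
 have 1: "?A <= D" using sub A(1) by blast
 have 2: "h ` ?A <= A'" using hA by blast
 have 3: "flat_on ?A D (%z. pull D h om z (None # map Some is))"
  by (rule flat_on_pull[OF opens(2) 1 opens(3) A(2) h(1) 2 h(2) om(2)])
 show "flat_on A U (%x. integral {0..1} (%t. pull D h om (pair x t) (None # map Some is)))"
  by (rule flat_on_integral_parameter[OF opens(2,1) sub 3 A(1)]) blast+
qed (simp add: homotopy_op_def)

lemma form_on_homotopy_op:
 assumes om: "form_on U' (Suc k) om"
 shows "form_on U k (homotopy_op U D h om)"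
 unfolding form_on_def
proof (intro conjI allI impI)
 note pf = form_on_pull[OF opens(2,3) h om]
 show "homotopy_op U D h om x is = 0" if "x ~: U \<or> length is ~= k" for x "is"
  using that by (auto simp: homotopy_op_def form_onD(2)[OF pf])
 show "smooth_on U (%x. homotopy_op U D h om x is)" for "is"
  using flat_on_homotopy_op[OF om, of "{}" "{}"] form_onD(4)[OF om] by (simp add: smooth_on_eq_flat)
 show "alternating (homotopy_op U D h om x)" for x
 proof (rule alternating_swapI)
  fix A u B v C
  have "pull D h om z (None # map Some (A @ v # B @ u # C)) = - pull D h om z (None # map Some (A @ u # B @ v # C))" for z
   using alternating_swap[OF form_onD(3)[OF pf], of z "None # map Some A" "Some v" "map Some B" "Some u" "map Some C"] by simp
  then show "homotopy_op U D h om x (A @ v # B @ u # C) = - homotopy_op U D h om x (A @ u # B @ v # C)"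
   by (simp add: homotopy_op_def)
 qed
qed

lemma prev_form_homotopy_op:
 assumes om: "form_on U' k om"
 shows "prev_form U k (homotopy_op U D h om)"
proof (cases k)
 case 0
 have "pull D h om z (None # xs) = 0" for z xs
  using form_onD(2)[OF form_on_pull[OF opens(2,3) h om]] 0 by simp
 then show ?thesis using 0 by (simp add: prev_form_def homotopy_op_def fun_eq_iff)
next
 case (Suc m)
 then show ?thesis using form_on_homotopy_op[of m om] om by (simp add: prev_form_def)
qed

lemma pull_pair:
 assumes "x : U" "t : {0..1}"
 shows "pull U (%x. h (pair x t)) om x is = pull D h om (pair x t) (map Some is)"
proof -
 have d: "(%z. h z $ j) differentiable (at (pair x t))" for j
  using smooth_on_imp_differentiable[OF h(2)[rule_format] sub[OF assms]] .
 have "map2 (%i j. partial i (%y. h (pair y t) $ j) x) is js =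
   map2 (%i j. partial i (%y. h y $ j) (pair x t)) (map Some is) js" for js
  by (simp add: differentiable_pair(3)[OF d] zip_map1 o_def case_prod_unfold)
 then show ?thesis using assms sub by (simp add: pull_def)
qed

text \<open>The component of \<open>d (h^* om) = 0\<close> whose first slot is \<open>None\<close>
  expresses the time derivative of the coefficients through spatial derivatives of the contracted
  form; integrating over time gives the difference of the end pullbacks on one side and
  \<open>d\<close> of the fibre integral on the other.\<close>

lemma homotopy_formula:
 assumes om: "form_on U' k om" and closed: "ext_d U' om = (%_ _. 0)" and x: "x : U"
 shows "pull U (%x. h (pair x 1)) om x is - pull U (%x. h (pair x 0)) om x is = ext_d U (homotopy_op U D h om) x is"
proof -
 define W where "W = pull D h om"
 have W: "form_on D k W" unfolding W_def by (rule form_on_pull[OF opens(2,3) h om])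
 have "ext_d D W = pull D h (%_ _. 0)" unfolding W_def ext_d_pull[OF opens(2,3) h om] closed ..
 then have dW: "ext_d D W z js = 0" for z js by (simp add: pull_def)
 have dif: "z : D ==> (%z. W z js) differentiable (at z)" for z js
  by (rule form_on_differentiable[OF W])
 have cont: "continuous_on D (partial k (%z. W z js))" for k js
  using smooth_on_imp_continuous_on[OF smooth_on_partial[OF form_onD(4)[OF W]]] .
 define Q where "Q j t = partial (Some (is!j)) (%z. W z (None # map Some (rm j is))) (pair x t)" for j t
 have eq: "partial None (%z. W z (map Some is)) (pair x t) = (SUM j<length is. (-1)^j * Q j t)" if "t : {0..1}" for t
 proof -
  have "0 = ext_d D W (pair x t) (None # map Some is)" by (simp add: dW)
  also have "\<dots> = partial None (%z. W z (map Some is)) (pair x t) + (SUM j<length is. - ((-1)^j * Q j t))"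
   using sub[OF x that] by (simp add: ext_d_eq sum.lessThan_Suc_shift Q_def rm_map del: sum.lessThan_Suc cong: sum.cong_simp)
  finally show ?thesis by (simp add: sum_negf)
 qed
 have ci: "continuous_on {0..1} (%t. F (pair x t))" if "continuous_on D F" for F :: "real^('n option) => real"
  by (rule continuous_on_compose2[OF that]) (use sub x in \<open>auto intro!: continuous_intros\<close>)
 have Qi: "Q j integrable_on {0..1}" for j
  unfolding Q_def by (intro integrable_continuous_interval ci cont)
 have "((%t. partial None (%z. W z (map Some is)) (pair x t)) has_integral
   W (pair x 1) (map Some is) - W (pair x 0) (map Some is)) {0..1}"
 proof (rule fundamental_theorem_of_calculus)
  show "((%t. W (pair x t) (map Some is)) has_vector_derivative partial None (%z. W z (map Some is)) (pair x t)) (at t within {0..1})"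
   if "t : {0..1}" for t
   using differentiable_pair(4)[OF dif[OF sub[OF x that]]]
   by (meson has_real_derivative_iff_has_vector_derivative has_vector_derivative_at_within)
 qed simp
 then have "W (pair x 1) (map Some is) - W (pair x 0) (map Some is)
   = integral {0..1} (%t. partial None (%z. W z (map Some is)) (pair x t))"
  by (simp add: integral_unique)
 also have "\<dots> = integral {0..1} (%t. SUM j<length is. (-1)^j * Q j t)"
  using eq by (intro Henstock_Kurzweil_Integration.integral_cong) auto
 also have "\<dots> = (SUM j<length is. (-1)^j * integral {0..1} (Q j))"
  by (subst Henstock_Kurzweil_Integration.integral_sum) (auto intro!: integrable_on_cmult_left Qi)
 also have "\<dots> = (SUM j<length is. (-1)^j * partial (is!j) (%y. homotopy_op U D h om y (rm j is)) x)"
 proof (intro sum.cong refl arg_cong2[where f = "(*)"])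
  fix j
  have "partial (is!j) (%y. homotopy_op U D h om y (rm j is)) x
    = partial (is!j) (%y. integral {0..1} (%t. W (pair y t) (None # map Some (rm j is)))) x"
   by (rule partial_cong[OF opens(1) x]) (simp add: homotopy_op_def W_def)
  also have "\<dots> = integral {0..1} (Q j)"
   unfolding Q_def by (rule has_derivative_integral_parameter(2)[OF opens(2,1) sub dif cont x])
  finally show "integral {0..1} (Q j) = partial (is!j) (%y. homotopy_op U D h om y (rm j is)) x" by simp
 qed
 finally show ?thesis using x by (simp add: pull_pair W_def ext_d_eq)
qed

end


section \<open>Partitions of unity\<close>

text \<open>The balls of radius \<open>r p\<close> already cover while those of radius
  \<open>4 * r p\<close> are still locally finite. The gap leaves room for supports of radius
  \<open>2 * r p\<close> and for regions that shrink in later constructions.\<close>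

lemma locally_finite_balls:
 fixes U :: "'a::euclidean_space set"
 assumes U: "open U" and rh: "!!p. p : U ==> rh p > (0::real)"
 obtains P :: "'a set" and r :: "'a => real" where "countable P" "P <= U"
  "!!p. p : P ==> 0 < r p & r p <= rh p & cball p (4 * r p) <= U"
  "U = (UN p:P. ball p (r p))"
  "!!x. x : U ==> EX W. open W & x : W & W <= U & finite {p:P. cball p (4 * r p) Int W ~= {}}"
proof -
 obtain C :: "nat => 'a set" where C: "!!n. compact (C n)" "!!n. C n <= U" "!!n. C n <= interior (C (Suc n))" "\<Union>(range C) = U"
  using open_Union_compact_subsets[OF U] by metis
 have mono: "m <= n ==> C m <= C n" for m n
  by (rule lift_Suc_mono_le[of C]) (meson C(3) interior_subset subset_trans)
 define m where "m p = (LEAST k. p : C k)" for p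
 have m: "p : C (m p)" if "p : U" for p
  unfolding m_def by (rule LeastI_ex) (use that C(4) in auto)
 have m_le: "p : C k ==> m p <= k" for p k unfolding m_def by (rule Least_le)
 \<comment> \<open>The ball is kept inside level \<open>m p + 1\<close> of the exhaustion and off
   level \<open>m p - 1\<close>; hence a neighbourhood of bounded level meets balls of bounded level
   only.\<close>
 have "EX s>0. s <= rh p & cball p (4 * s) <= interior (C (Suc (m p))) - (if m p = 0 then {} else C (m p - 1))" if "p : U" for p
 proof -
  have "open (interior (C (Suc (m p))) - (if m p = 0 then {} else C (m p - 1)))"
   using C(1) compact_imp_closed by (intro open_Diff open_interior) auto
  moreover have "p : interior (C (Suc (m p))) - (if m p = 0 then {} else C (m p - 1))"
   using m[OF that] C(3) m_le[of p "m p - 1"] by (auto simp: subset_iff)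
  ultimately obtain e where e: "e > 0" "cball p e <= interior (C (Suc (m p))) - (if m p = 0 then {} else C (m p - 1))"
   by (meson open_contains_cball)
  have "cball p (4 * min (e / 4) (rh p)) <= cball p e" by (rule subset_cball) simp
  then show ?thesis using e rh[OF that] by (intro exI[of _ "min (e / 4) (rh p)"]) auto
 qed
 then obtain r where r: "!!p. p : U ==> 0 < r p" "!!p. p : U ==> r p <= rh p"
  "!!p. p : U ==> cball p (4 * r p) <= interior (C (Suc (m p))) - (if m p = 0 then {} else C (m p - 1))"
  by metis
 \<comment> \<open>Compact shells that cover \<open>U\<close>. A point of shell \<open>k\<close> has
   level at least \<open>k - 1\<close>, so bounded levels involve finitely many shells.\<close>
 define S where "S k = C k - interior (if k = 0 then {} else C (k - 1))" for k
 have "EX F. finite F & F <= S k & S k <= (UN p:F. ball p (r p))" for k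
 proof -
  have "compact (S k)" unfolding S_def using C(1) by (intro compact_diff) auto
  moreover have "S k <= (UN p:S k. ball p (r p))" using r(1) C(2) by (force simp: S_def)
  ultimately show ?thesis by (meson compactE_image open_ball)
 qed
 then obtain F where F: "!!k. finite (F k)" "!!k. F k <= S k" "!!k. S k <= (UN p:F k. ball p (r p))" by metis
 have FU: "F k <= U" for k using F(2) C(2) by (force simp: S_def)
 have mS: "k <= Suc (m p)" if "p : S k" for p k
 proof (rule ccontr)
  assume "\<not> k <= Suc (m p)"
  then have k: "k ~= 0" "Suc (m p) <= k - 1" by auto
  have "p : interior (C (Suc (m p)))" using that m[of p] C(2,3) by (force simp: S_def)
  then have "p : interior (C (k - 1))" using interior_mono[OF mono[OF k(2)]] by blast
  then show False using that k by (auto simp: S_def)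
 qed
 show thesis
 proof (rule that[of "\<Union>k. F k" r])
  show "countable (\<Union>k. F k)" using F(1) by (auto intro: countable_finite)
  show "(\<Union>k. F k) <= U" using FU by auto
  show "0 < r p & r p <= rh p & cball p (4 * r p) <= U" if "p : (\<Union>k. F k)" for p
  proof -
   have "p : U" using that FU by auto
   then show ?thesis using r[of p] C(2) interior_subset by blast
  qed
  show "U = (UN p:(\<Union>k. F k). ball p (r p))"
  proof
   show "U <= (UN p:(\<Union>k. F k). ball p (r p))"
   proof
    fix x assume x: "x : U"
    have "x : S (m x)" using m[OF x] m_le[of x "m x - 1"] interior_subset by (fastforce simp: S_def)
    then show "x : (UN p:(\<Union>k. F k). ball p (r p))" using F(3) by fastforce
   qed
   show "(UN p:(\<Union>k. F k). ball p (r p)) <= U"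
   proof
    fix x assume "x : (UN p:(\<Union>k. F k). ball p (r p))"
    then obtain k p where p: "p : F k" "x : ball p (r p)" by auto
    have pU: "p : U" using p FU by auto
    have "x : cball p (4 * r p)" using p r(1)[OF pU] by auto
    then show "x : U" using r(3)[OF pU] C(2) interior_subset by blast
   qed
  qed
  show "EX W. open W & x : W & W <= U & finite {p:(\<Union>k. F k). cball p (4 * r p) Int W ~= {}}" if "x : U" for x
  proof (intro exI conjI)
   define N where "N = m x"
   show "open (interior (C (Suc N)))" by simp
   show "x : interior (C (Suc N))" using m[OF that] C(3) by (auto simp: N_def)
   show "interior (C (Suc N)) <= U" using C(2) interior_subset by blast
   have "{p:(\<Union>k. F k). cball p (4 * r p) Int interior (C (Suc N)) ~= {}} <= (UN k<=N + 3. F k)"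
   proof
    fix p assume "p : {p:(\<Union>k. F k). cball p (4 * r p) Int interior (C (Suc N)) ~= {}}"
    then obtain k y where k: "p : F k" "y : cball p (4 * r p)" "y : interior (C (Suc N))" by blast
    have kC: "y : C (Suc N)" using k(3) interior_subset by blast
    have pU: "p : U" using k FU by auto
    have "y : interior (C (Suc (m p))) - (if m p = 0 then {} else C (m p - 1))"
     using r(3)[OF pU] k(2) by blast
    then have "m p = 0 \<or> y ~: C (m p - 1)" by (simp split: if_splits)
    have "m p <= Suc (Suc N)"
    proof (rule ccontr)
     assume n: "\<not> m p <= Suc (Suc N)"
     then have "Suc N <= m p - 1" by linarith
     then have "y : C (m p - 1)" using mono kC by blast
     then show False using \<open>m p = 0 \<or> y ~: C (m p - 1)\<close> n by simp
    qed
    moreover have "k <= Suc (m p)" using mS[of p k] F(2) k(1) by blast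
    ultimately have "k <= N + 3" by linarith
    then show "p : (UN k<=N + 3. F k)" using k(1) by blast
   qed
   then show "finite {p:(\<Union>k. F k). cball p (4 * r p) Int interior (C (Suc N)) ~= {}}"
    by (rule finite_subset) (use F(1) in simp)
  qed
 qed
qed

text \<open>Restricting to the nonzero terms gives the pointwise finite sum also for infinite
  \<open>P\<close>, where \<open>sum\<close> over all of \<open>P\<close> would return 0.\<close>

definition lfsum :: "'i set => ('i => 'a => real) => 'a => real" where
 "lfsum P g x = (SUM p | p : P & g p x ~= 0. g p x)"

lemma lfsum_eq:
 assumes "finite F" "F <= P" "!!p. p : P - F ==> g p x = 0"
 shows "lfsum P g x = (SUM p:F. g p x)"
 unfolding lfsum_def by (rule sum.mono_neutral_left) (use assms in auto)

lemma flat_on_locally: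
 assumes "!!x. x : U ==> EX W. x : W & flat_on (A Int W) W f" "A <= U"
 shows "flat_on A U f"
 using assms unfolding flat_on_def smooth_on_def by blast

lemma flat_on_lfsum:
 assumes U: "open U" "A <= U" and g: "!!p. p : P ==> flat_on A U (g p)"
  and lf: "!!x. x : U ==> EX W. open W & x : W & finite {p:P. EX y:W. g p y ~= 0}"
 shows "flat_on A U (lfsum P g)"
proof (rule flat_on_locally[OF _ U(2)])
 fix x assume x: "x : U"
 obtain W where W: "open W" "x : W" "finite {p:P. EX y:W. g p y ~= 0}" using lf[OF x] by auto
 let ?F = "{p:P. EX y:W. g p y ~= 0}"
 have eq: "lfsum P g y = (SUM p:?F. g p y)" if "y : W Int U" for y
  by (rule lfsum_eq[OF W(3)]) (use that in auto)
 have o: "open (W Int U)" "A Int (W Int U) <= W Int U" using W U by auto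
 have "flat_on (A Int (W Int U)) (W Int U) (%y. SUM p:?F. g p y)"
 proof (rule flat_on_sum[OF o])
  show "flat_on (A Int (W Int U)) (W Int U) (g p)" if "p : ?F" for p
   by (rule flat_on_subset[OF g]) (use that in auto)
 qed
 moreover have "flat_on (A Int (W Int U)) (W Int U) (lfsum P g) \<longleftrightarrow> flat_on (A Int (W Int U)) (W Int U) (%y. SUM p:?F. g p y)"
  by (rule flat_on_cong[OF o]) (rule eq)
 ultimately have "flat_on (A Int (W Int U)) (W Int U) (lfsum P g)" by simp
 then show "EX W. x : W & flat_on (A Int W) W (lfsum P g)" using x W(2) by (intro exI[of _ "W Int U"]) simp
qed

lemma smooth_on_lfsum:
 assumes "open U" "!!p. p : P ==> smooth_on U (g p)"
  and "!!x. x : U ==> EX W. open W & x : W & finite {p:P. EX y:W. g p y ~= 0}"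
 shows "smooth_on U (lfsum P g)"
 using flat_on_lfsum[OF assms(1) empty_subsetI assms(2)[unfolded smooth_on_eq_flat] assms(3)]
 by (simp only: smooth_on_eq_flat)

lemma partition_of_unity:
 fixes U :: "(real^'n::finite) set"
 assumes U: "open U" and rh: "!!p. p : U ==> rh p > (0::real)"
 obtains P r py where "P <= U" "!!p. p : P ==> 0 < r p & r p <= rh p & cball p (4 * r p) <= U"
  "!!x. x : U ==> EX W. open W & x : W & W <= U & finite {p:P. cball p (4 * r p) Int W ~= {}}"
  "!!p. p : P ==> smooth_on U (py p)" "!!p x. p : P ==> 0 <= py p x"
  "!!p x. p : P ==> py p x ~= 0 ==> x : ball p (2 * r p)" "!!x. x : U ==> lfsum P py x = 1"
proof -
 obtain P r where P: "P <= U" "!!p. p : P ==> 0 < r p & r p <= rh p & cball p (4 * r p) <= U"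
  "U = (UN p:P. ball p (r p))"
  "!!x. x : U ==> EX W. open W & x : W & W <= U & finite {p:P. cball p (4 * r p) Int W ~= {}}"
  by (rule locally_finite_balls[OF U, of rh]) (use rh in blast)+
 define b where "b p = cutoff p (r p) (2 * r p)" for p
 have b: "x : cball p (r p) ==> b p x = 1" "b p x ~= 0 ==> x : ball p (2 * r p)" "0 <= b p x" if "p : P" for p x
  using cutoff_props[of "r p" "2 * r p"] P(2)[OF that] unfolding b_def by auto
 have lf: "EX W. open W & x : W & W <= U & finite {p:P. EX y:W. b p y ~= 0}" if xU: "x : U" for x
 proof -
  obtain W where W: "open W" "x : W" "W <= U" "finite {p:P. cball p (4 * r p) Int W ~= {}}"
   using P(4)[OF xU] by (elim exE conjE) (rule that)
  have "{p:P. EX y:W. b p y ~= 0} <= {p:P. cball p (4 * r p) Int W ~= {}}"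
  proof
   fix p assume "p : {p:P. EX y:W. b p y ~= 0}"
   then obtain y where y: "p : P" "y : W" "b p y ~= 0" by auto
   have "dist p y < 2 * r p" "0 < r p" using b(2)[OF y(1,3)] P(2)[OF y(1)] by auto
   then have "y : cball p (4 * r p)" by simp
   then show "p : {p:P. cball p (4 * r p) Int W ~= {}}" using y(1,2) by auto
  qed
  from finite_subset[OF this W(4)] show ?thesis using W(1-3) by blast
 qed
 have sb: "smooth_on U (lfsum P b)"
 proof (rule smooth_on_lfsum[OF U])
  show "smooth_on U (b p)" for p unfolding b_def by (rule smooth_on_cutoff[OF U])
  show "EX W. open W & x : W & finite {p:P. EX y:W. b p y ~= 0}" if "x : U" for x
   using lf[OF that] by (elim exE conjE) (intro exI conjI)
 qed
 have fin: "finite {p:P. b p x ~= 0}" if xU: "x : U" for x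
 proof -
  obtain W where "x : W" "finite {p:P. EX y:W. b p y ~= 0}" using lf[OF xU] by (elim exE conjE) (rule that)
  then show ?thesis by (auto elim: finite_subset[rotated])
 qed
 have pos: "lfsum P b x > 0" if xU: "x : U" for x
 proof -
  obtain p where p: "p : P" "x : ball p (r p)" using xU P(3) by blast
  then have "b p x = 1" using b(1) by auto
  then show ?thesis unfolding lfsum_def
   using p b(3) fin[OF xU] by (intro sum_pos2[of _ p]) auto
 qed
 define py where "py p x = (if x : U then b p x / lfsum P b x else 0)" for p x
 show thesis
 proof (rule that[of P r py])
  show "smooth_on U (py p)" if "p : P" for p
  proof (subst smooth_on_cong[OF U])
   show "smooth_on U (%x. b p x / lfsum P b x)"
    by (rule smooth_on_divide[OF U _ sb]) (use pos smooth_on_cutoff[OF U] in \<open>force simp: b_def\<close>)+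
  qed (simp add: py_def)
  show "0 <= py p x" if "p : P" for p x using b(3)[OF that] pos[of x] by (auto simp: py_def intro!: divide_nonneg_pos)
  show "x : ball p (2 * r p)" if "p : P" "py p x ~= 0" for p x
   using b(2)[OF that(1)] that(2) by (auto simp: py_def split: if_splits)
  show "lfsum P py x = 1" if "x : U" for x
  proof -
   have "lfsum P py x = (SUM p:{p:P. b p x ~= 0}. py p x)"
    by (rule lfsum_eq[OF fin[OF that]]) (auto simp: py_def)
   also have "\<dots> = (SUM p:{p:P. b p x ~= 0}. b p x) / lfsum P b x"
    unfolding sum_divide_distrib using that by (simp add: py_def)
   also have "(SUM p:{p:P. b p x ~= 0}. b p x) = lfsum P b x" by (simp add: lfsum_def)
   finally show ?thesis using pos[OF that] by simp
  qed
 qed (use P in auto)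
qed

text \<open>\<open>\<kappa>\<close> adds up the partition functions centred in \<open>N\<close>. The
  radii are such that balls centred in \<open>N\<close> stay in \<open>N\<close> and balls centred
  elsewhere miss \<open>A\<close>; so near \<open>A\<close> all active functions are counted, and
  near a point outside \<open>N\<close> none is.\<close>

lemma smooth_urysohn:
 fixes U :: "(real^'n::finite) set"
 assumes U: "open U" and A: "closedin (top_of_set U) A" and N: "open N" "A <= N" "N <= U"
 obtains \<kappa> N1 where "smooth_on U \<kappa>" "open N1" "A <= N1" "N1 <= N" "!!x. x : N1 ==> \<kappa> x = 1"
  "!!x. x : U - N ==> EX W. open W & x : W & (ALL y:W. \<kappa> y = 0)"
proof -
 obtain C where "closed C" "A = U Int C" using A closedin_closed by blast
 then have "U - A = U - C" "closed C" by auto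
 then have UA: "open (U - A)" using U by (simp add: open_Diff)
 have "EX s>0. if p : N then ball p (4 * s) <= N else ball p (4 * s) <= U - A" if "p : U" for p
 proof -
  obtain e where "e > 0" "if p : N then ball p e <= N else ball p e <= U - A"
  proof (cases "p : N")
   case True
   then obtain e where "e > 0" "ball p e <= N" using N(1) open_contains_ball by blast
   then show ?thesis using True by (intro that[of e]) auto
  next
   case False
   then have "p : U - A" using N(2) \<open>p : U\<close> by blast
   then obtain e where "e > 0" "ball p e <= U - A" using UA open_contains_ball by blast
   then show ?thesis using False by (intro that[of e]) auto
  qed
  then show ?thesis by (intro exI[of _ "e / 4"]) auto
 qed
 then obtain rh where rh: "!!p. p : U ==> rh p > 0" "!!p. p : U ==> if p : N then ball p (4 * rh p) <= N else ball p (4 * rh p) <= U - A"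
  by metis
 obtain P r py where P: "P <= U" "!!p. p : P ==> 0 < r p & r p <= rh p & cball p (4 * r p) <= U"
  "!!x. x : U ==> EX W. open W & x : W & W <= U & finite {p:P. cball p (4 * r p) Int W ~= {}}"
  and py: "!!p. p : P ==> smooth_on U (py p)" "!!p x. p : P ==> 0 <= py p x"
  "!!p x. p : P ==> py p x ~= 0 ==> x : ball p (2 * r p)" "!!x. x : U ==> lfsum P py x = 1"
  by (rule partition_of_unity[OF U, of rh]) (use rh(1) in blast)+
 \<comment> \<open>Local finiteness: a point lying outside the closed supports has a neighbourhood
   missing all of them.\<close>
 have avoid: "EX W. open W & x : W & W <= U & (ALL p:Q. ALL y:W. py p y = 0)"
  if x: "x : U" and Q: "Q <= P" "!!p. p : Q ==> x ~: cball p (2 * r p)" for x Q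
 proof -
  obtain W where W: "open W" "x : W" "W <= U" "finite {p:P. cball p (4 * r p) Int W ~= {}}"
   using P(3)[OF x] by (elim exE conjE) (rule that)
  let ?F = "{p:Q. cball p (4 * r p) Int W ~= {}}"
  have fin: "finite ?F" using W(4) Q(1) by (auto elim: finite_subset[rotated])
  let ?W = "W - (UN p:?F. cball p (2 * r p))"
  have "open ?W" using W(1) fin by (intro open_Diff closed_UN) auto
  moreover have "x : ?W" using W(2) Q(2) by auto
  moreover have "py p y = 0" if "p : Q" "y : ?W" for p y
  proof (rule ccontr)
   assume "py p y ~= 0"
   then have d: "dist p y < 2 * r p" "0 < r p" using py(3)[of p y] P(2)[of p] that Q(1) by auto
   then have "y : cball p (4 * r p)" by simp
   then have "p : ?F" using that by blast
   then have "y ~: cball p (2 * r p)" using that by blast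
   then show False using d by simp
  qed
  ultimately show ?thesis using W(3) by (intro exI[of _ ?W]) auto
 qed
 define \<kappa> where "\<kappa> = lfsum (P Int N) py"
 have lf: "EX W. open W & x : W & W <= U & finite {p:P. EX y:W. py p y ~= 0}" if xU: "x : U" for x
 proof -
  obtain W where W: "open W" "x : W" "W <= U" "finite {p:P. cball p (4 * r p) Int W ~= {}}"
   using P(3)[OF xU] by (elim exE conjE) (rule that)
  have "{p:P. EX y:W. py p y ~= 0} <= {p:P. cball p (4 * r p) Int W ~= {}}"
  proof
   fix p assume "p : {p:P. EX y:W. py p y ~= 0}"
   then obtain y where y: "p : P" "y : W" "py p y ~= 0" by auto
   have "dist p y < 2 * r p" "0 < r p" using py(3)[OF y(1,3)] P(2)[OF y(1)] by auto
   then have "y : cball p (4 * r p)" by simp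
   then show "p : {p:P. cball p (4 * r p) Int W ~= {}}" using y(1,2) by auto
  qed
  from finite_subset[OF this W(4)] show ?thesis using W(1-3) by blast
 qed
 have s\<kappa>: "smooth_on U \<kappa>"
  unfolding \<kappa>_def
 proof (rule smooth_on_lfsum[OF U])
  fix x assume "x : U"
  then obtain W where W: "open W" "x : W" "finite {p:P. EX y:W. py p y ~= 0}" using lf[of x] by auto
  have "finite {p:P Int N. EX y:W. py p y ~= 0}" by (rule finite_subset[OF _ W(3)]) auto
  then show "EX W. open W & x : W & finite {p:P Int N. EX y:W. py p y ~= 0}" using W by blast
 qed (use py(1) in auto)
 have one: "EX W. open W & x : W & W <= N & (ALL y:W. \<kappa> y = 1)" if "x : A" for x
 proof -
  have xU: "x : U" using that N by auto
  have "x ~: cball p (2 * r p)" if "p : P - N" for p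
  proof -
   have "cball p (2 * r p) <= ball p (4 * rh p)" using P(2)[of p] that by auto
   moreover have pU: "p : U" using P(1) that by blast
   have "x ~: ball p (4 * rh p)" using rh(2)[OF pU] that \<open>x : A\<close> by auto
   ultimately show ?thesis by blast
  qed
  then obtain W where W: "open W" "x : W" "W <= U" "!!p y. p : P - N ==> y : W ==> py p y = 0"
   using avoid[OF xU, of "P - N"] by auto
  have "\<kappa> y = 1" if "y : W" for y
  proof -
   have "{p : P. py p y ~= 0} = {p : P Int N. py p y ~= 0}" using W(4) that by auto
   then show ?thesis using py(4)[of y] W(3) that by (auto simp: \<kappa>_def lfsum_def)
  qed
  then show ?thesis using W N that by (intro exI[of _ "W Int N"]) auto
 qed
 show thesis
 proof (rule that[of \<kappa> "\<Union>{W. open W & W <= N & (ALL y:W. \<kappa> y = 1)}"])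
  show "A <= \<Union>{W. open W & W <= N & (ALL y:W. \<kappa> y = 1)}" using one by blast
  show "EX W. open W & x : W & (ALL y:W. \<kappa> y = 0)" if x: "x : U - N" for x
  proof -
   have "x ~: cball p (2 * r p)" if "p : P Int N" for p
   proof -
    have "cball p (2 * r p) <= ball p (4 * rh p)" using P(2)[of p] that by auto
    moreover have pU: "p : U" using P(1) that by blast
    have "x ~: ball p (4 * rh p)" using rh(2)[OF pU] that x by auto
    ultimately show ?thesis by blast
   qed
   then obtain W where W: "open W" "x : W" "W <= U" "!!p y. p : P Int N ==> y : W ==> py p y = 0"
    using avoid[of x "P Int N"] x by auto
   then have "ALL y:W. \<kappa> y = 0" by (auto simp: \<kappa>_def lfsum_def intro!: sum.neutral)
   then show ?thesis using W by blast
  qed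
 qed (use s\<kappa> in auto)
qed


section \<open>Closed forms vanishing near a deformation retract\<close>

lemma smooth_on_real_polynomial:
 assumes "real_polynomial_function f" "open D"
 shows "smooth_on D (%z. f (z $ k))"
 using assms(1)
proof (induction f rule: real_polynomial_function.induct)
 case (linear f)
 then have "f t = t * f 1" for t using linear_scale[OF bounded_linear.linear[OF linear], of t 1] by simp
 then have "(%z. f (z $ k)) = (%z. z $ k * f 1)" by (rule ext)
 then show ?case using smooth_on_mult[OF assms(2) smooth_on_nth smooth_on_const] by metis
qed (auto intro!: smooth_on_add smooth_on_mult assms(2))

definition prj :: "real^('n::finite option) => real^'n" where
 "prj z = (\<chi> i. z $ Some i)"

lemma prj_nth [simp]: "prj z $ i = z $ Some i"
 by (simp add: prj_def)

lemma prj_pair [simp]: "prj (pair x t) = x"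
 by (simp add: prj_def vec_eq_iff)

lemma continuous_on_prj: "continuous_on S prj"
 unfolding prj_def by (intro continuous_intros)

lemma open_prj_vimage: "open U ==> open {z. prj z : U}"
 using open_vimage[OF _ continuous_on_prj, of U] by (simp add: vimage_def)

text \<open>The given homotopy is merely continuous. It is replaced by an average of polynomial
  paths, close enough to stay in \<open>U\<close> and to end in \<open>N\<close>. The last
  conclusion makes the straight segment from a point of \<open>A\<close> to its final position
  available inside \<open>N\<close>.\<close>

lemma smooth_retraction_homotopy:
 fixes U A N :: "(real^'n::finite) set" and H :: "real \<times> (real^'n) => real^'n"
 assumes U: "open U" and N: "open N" "A <= U" and r: "!!x. x : U ==> r x : N" "!!x. x : A ==> r x = x"
  and H: "continuous_on ({0..1} \<times> U) H" "!!t x. t : {0..1} ==> x : U ==> H (t, x) : U"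
   "!!x. x : U ==> H (0, x) = x" "!!x. x : U ==> H (1, x) = r x"
 obtains D h where "homotopy_data U D h U" "!!x. x : U ==> h (pair x 0) = x"
  "!!x. x : U ==> h (pair x 1) : N" "!!a. a : A ==> closed_segment a (h (pair a 1)) <= N"
proof -
 have "EX e>0. (ALL t:{0..1}. ball (H (t, p)) e <= U) & ball (r p) e <= N" if p: "p : U" for p
 proof -
  have "continuous_on {0..1} (%t. H (t, p))"
   by (rule continuous_on_compose2[OF H(1)]) (use p in \<open>auto intro!: continuous_intros\<close>)
  then have "compact ((%t. H (t, p)) ` {0..1})" by (rule compact_continuous_image) simp
  moreover have "(%t. H (t, p)) ` {0..1} <= U" using H(2) p by blast
  ultimately obtain e1 where e1: "e1 > 0" "(UN x:(%t. H (t, p)) ` {0..1}. ball x e1) <= U"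
   by (rule compact_subset_open_imp_ball_epsilon_subset[OF _ U])
  obtain e2 where e2: "e2 > 0" "ball (r p) e2 <= N" by (rule openE[OF N(1) r(1)[OF p]])
  have "ball (H (t, p)) (min e1 e2) <= U" if "t : {0..1}" for t
  proof -
   have "ball (H (t, p)) (min e1 e2) <= ball (H (t, p)) e1" by (rule subset_ball) simp
   also have "\<dots> <= (UN x:(%t. H (t, p)) ` {0..1}. ball x e1)" using that by (intro UN_upper imageI) 
   also have "\<dots> <= U" by (rule e1(2))
   finally show ?thesis .
  qed
  moreover have "ball (r p) (min e1 e2) <= N"
   using subset_trans[OF subset_ball e2(2), of "min e1 e2"] by simp
  ultimately show ?thesis using e1(1) e2(1) by (intro exI[of _ "min e1 e2"]) auto
 qed
 then obtain e where e: "!!p. p : U ==> e p > 0" "!!p t. p : U ==> t : {0..1} ==> ball (H (t, p)) (e p) <= U"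
  "!!p. p : U ==> ball (r p) (e p) <= N" by metis
 have "EX rh>0. rh <= e p / 8 & (ALL y:ball p rh. ALL t:{0..1}. dist (H (t, y)) (H (t, p)) < e p / 8)" if p: "p : U" for p
 proof -
  obtain s where s: "s > 0" "cball p s <= U" using open_contains_cball_eq[OF U] p by metis
  have "continuous_on ({0..1} \<times> cball p s) H" by (rule continuous_on_subset[OF H(1)]) (use s in auto)
  then have "uniformly_continuous_on ({0..1} \<times> cball p s) H"
   by (rule compact_uniformly_continuous) (intro compact_Times compact_cball compact_Icc)
  then obtain d where d: "d > 0" "!!u v. u : {0..1} \<times> cball p s ==> v : {0..1} \<times> cball p s ==> dist v u < d ==> dist (H v) (H u) < e p / 8"
   by (rule uniformly_continuous_onE[of _ _ "e p / 8"]) (use e(1)[OF p] in auto)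
  have "dist (H (t, y)) (H (t, p)) < e p / 8" if "y : ball p (min (min d s) (e p / 8))" "t : {0..1}" for y t
   by (rule d(2)) (use that s in \<open>auto simp: dist_Pair_Pair dist_commute\<close>)
  then show ?thesis using d(1) s(1) e(1)[OF p] by (intro exI[of _ "min (min d s) (e p / 8)"]) auto
 qed
 then obtain rh where rh: "!!p. p : U ==> rh p > 0" "!!p. p : U ==> rh p <= e p / 8"
  "!!p y t. p : U ==> y : ball p (rh p) ==> t : {0..1} ==> dist (H (t, y)) (H (t, p)) < e p / 8" by metis
 \<comment> \<open>Correcting the approximating path by a constant makes it start exactly at
   \<open>p\<close>; therefore \<open>h\<close> will be exactly the identity at time 0.\<close>
 have "EX q. polynomial_function q & q 0 = p & (ALL t:{0..1}. dist (q t) (H (t, p)) < e p / 8)" if p: "p : U" for p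
 proof -
  have "continuous_on {0..1} (%t. H (t, p))"
   by (rule continuous_on_compose2[OF H(1)]) (use p in \<open>auto intro!: continuous_intros\<close>)
  then obtain g where g: "polynomial_function g" "!!t. t : {0..1} ==> norm (H (t, p) - g t) < e p / 16"
   using Stone_Weierstrass_polynomial_function[of "{0..1::real}" "%t. H (t, p)" "e p / 16"] e(1)[OF p] by auto
  have g0: "norm (p - g 0) < e p / 16" using g(2)[of 0] H(3)[OF p] by simp
  have tri: "dist (g t - g 0 + p) (H (t, p)) <= norm (H (t, p) - g t) + norm (p - g 0)" for t
   using norm_triangle_ineq4[of "p - g 0" "H (t, p) - g t"] by (simp add: dist_norm algebra_simps)
  have "dist (g t - g 0 + p) (H (t, p)) < e p / 8" if "t : {0..1}" for t
   using g0 tri[of t] g(2)[OF that] by linarith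
  moreover have "polynomial_function (%t. g t - g 0 + p)"
   by (intro polynomial_function_add polynomial_function_diff g(1) polynomial_function_const)
  ultimately show ?thesis by (intro exI[of _ "%t. g t - g 0 + p"]) simp
 qed
 then obtain q where q: "!!p. p : U ==> polynomial_function (q p)" "!!p. p : U ==> q p 0 = p"
  "!!p t. p : U ==> t : {0..1} ==> dist (q p t) (H (t, p)) < e p / 8" by metis
 have rh2: "p : U ==> rh p / 2 > 0" for p using rh(1) by simp
 obtain P s py where P: "P <= U" "!!p. p : P ==> 0 < s p & s p <= rh p / 2 & cball p (4 * s p) <= U"
  "!!x. x : U ==> EX W. open W & x : W & W <= U & finite {p:P. cball p (4 * s p) Int W ~= {}}"
  and py: "!!p. p : P ==> smooth_on U (py p)" "!!p x. p : P ==> 0 <= py p x"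
  "!!p x. p : P ==> py p x ~= 0 ==> x : ball p (2 * s p)" "!!x. x : U ==> lfsum P py x = 1"
  by (rule partition_of_unity[OF U, of "%p. rh p / 2"]) (use rh2 in blast)+
 have near: "x : ball p (rh p)" if "p : P" "py p x ~= 0" for p x
  using py(3)[OF that] P(2)[OF that(1)] by auto
 have lf: "EX W. open W & x : W & finite {p:P. EX y:W. py p y ~= 0}" if x: "x : U" for x
 proof -
  obtain W where W: "open W" "x : W" "W <= U" "finite {p:P. cball p (4 * s p) Int W ~= {}}"
   using P(3)[OF x] by (elim exE conjE) (rule that)
  have "{p:P. EX y:W. py p y ~= 0} <= {p:P. cball p (4 * s p) Int W ~= {}}"
  proof
   fix p assume "p : {p:P. EX y:W. py p y ~= 0}"
   then obtain y where y: "p : P" "y : W" "py p y ~= 0" by auto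
   have "dist p y < 2 * s p" "0 < s p" using py(3)[OF y(1,3)] P(2)[OF y(1)] by auto
   then have "y : cball p (4 * s p)" by simp
   then show "p : {p:P. cball p (4 * s p) Int W ~= {}}" using y(1,2) by auto
  qed
  from finite_subset[OF this W(4)] show ?thesis using W(1,2) by blast
 qed
 \<comment> \<open>Each centre contributes its own path, translated by \<open>x - p\<close>, with
   weight \<open>py p\<close>.\<close>
 define g where "g i p z = py p (prj z) * (z $ Some i - p $ i + q p (z $ None) $ i)" for i p z
 define h where "h z = (\<chi> i. lfsum P (g i) z)" for z
 define D0 where "D0 = {z :: real^('n option). prj z : U}"
 have D0: "open D0" unfolding D0_def by (rule open_prj_vimage[OF U])
 have "smooth_on D0 (lfsum P (g i))" for i
 proof (rule smooth_on_lfsum[OF D0])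
  show "smooth_on D0 (g i p)" if p: "p : P" for p
  proof -
   have pU: "p : U" using p P(1) by blast
   have 1: "smooth_on D0 (%z. py p (prj z))"
    by (rule smooth_on_compose[OF D0 U _ py(1)[OF p]]) (auto simp: D0_def)
   have "real_polynomial_function (%t. q p t $ i)"
    using q(1)[OF pU, unfolded polynomial_function_def, rule_format, OF bounded_linear_vec_nth[of i]]
    by (simp add: o_def)
   from smooth_on_real_polynomial[OF this D0] show ?thesis
    unfolding g_def[abs_def]
    by (intro smooth_on_mult smooth_on_add smooth_on_diff smooth_on_nth smooth_on_const 1 D0)
  qed
  show "EX W. open W & z : W & finite {p:P. EX y:W. g i p y ~= 0}" if "z : D0" for z
  proof -
   have "prj z : U" using that by (simp add: D0_def)
   from lf[OF this] obtain W where W: "open W" "prj z : W" "finite {p:P. EX y:W. py p y ~= 0}"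
    by (elim exE conjE) (rule that)
   have "{p:P. EX y:{z. prj z : W}. g i p y ~= 0} <= {p:P. EX y:W. py p y ~= 0}"
    by (auto simp: g_def)
   from finite_subset[OF this W(3)] show ?thesis using open_prj_vimage[OF W(1)] W(2)
    by (intro exI[of _ "{z. prj z : W}"]) simp
  qed
 qed
 then have sh: "smooth_map_on D0 h" by (simp add: h_def)
 have fin: "finite {p:P. py p x ~= 0}" if x: "x : U" for x
 proof -
  obtain W where W: "x : W" "finite {p:P. EX y:W. py p y ~= 0}"
   using lf[OF x] by (elim exE conjE) (rule that)
  show ?thesis by (rule finite_subset[OF _ W(2)]) (use W(1) in auto)
 qed
 have heq: "h (pair x t) = (SUM p | p : P & py p x ~= 0. py p x *\<^sub>R (x - p + q p t))" if "x : U" for x t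
 proof -
  have "lfsum P (g i) (pair x t) = (SUM p | p : P & py p x ~= 0. g i p (pair x t))" for i
   by (rule lfsum_eq[OF fin[OF that]]) (auto simp: g_def)
  then show ?thesis by (simp add: vec_eq_iff h_def g_def)
 qed
 have sum1: "(SUM p | p : P & py p x ~= 0. py p x) = 1" if "x : U" for x
  using py(4)[OF that] by (simp add: lfsum_def)
 have key: "EX m:U. (ALL t:{0..1}. h (pair x t) : ball (H (t, m)) (e m)) & (ALL t:{0..1}. H (t, x) : ball (H (t, m)) (e m))"
  if x: "x : U" for x
 proof -
  let ?F = "{p:P. py p x ~= 0}"
  have ne: "?F ~= {}" using sum1[OF x] by (metis (lifting) sum.empty zero_neq_one)
  \<comment> \<open>The active centre with the largest tolerance serves as reference: the four
    errors of at most \<open>e m / 8\<close> keep every active path in the ball about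
    \<open>H (t, m)\<close>, and convexity of the ball carries this to the average.\<close>
  have "Max (e ` ?F) : e ` ?F" using fin[OF x] ne by (intro Max_in) auto
  then obtain m where m: "m : ?F" "e m = Max (e ` ?F)" by auto
  have le: "e p <= e m" if "p : ?F" for p using fin[OF x] that unfolding m(2) by (intro Max_ge) auto
  have mU: "m : U" using m P(1) by blast
  have nm: "x : ball m (rh m)" using near m(1) by blast
  have 1: "dist (H (t, x)) (H (t, m)) < e m / 8" if "t : {0..1}" for t by (rule rh(3)[OF mU nm that])
  have 2: "x - p + q p t : ball (H (t, m)) (e m)" if p: "p : ?F" and t: "t : {0..1}" for p t
  proof -
   have pU: "p : U" using p P(1) by blast
   have np: "x : ball p (rh p)" using near p by blast
   have "norm (x - p) < e p / 8" using np rh(2)[OF pU] by (auto simp: dist_norm norm_minus_commute)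
   moreover have "norm (q p t - H (t, p)) < e p / 8" using q(3)[OF pU t] by (simp add: dist_norm)
   moreover have "norm (H (t, x) - H (t, p)) < e p / 8" using rh(3)[OF pU np t] by (simp add: dist_norm)
   moreover have "norm (H (t, x) - H (t, m)) < e m / 8" using 1[OF t] by (simp add: dist_norm)
   moreover have "norm (H (t, m) - (x - p + q p t)) <= norm (x - p) + norm (q p t - H (t, p)) + norm (H (t, x) - H (t, p)) + norm (H (t, x) - H (t, m))"
   proof -
    have "H (t, m) - (x - p + q p t) = - (x - p) - (q p t - H (t, p)) + (H (t, x) - H (t, p)) - (H (t, x) - H (t, m))" by simp
    also have "norm \<dots> <= norm (- (x - p) - (q p t - H (t, p)) + (H (t, x) - H (t, p))) + norm (H (t, x) - H (t, m))"
     by (rule norm_triangle_ineq4)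
    also have "norm (- (x - p) - (q p t - H (t, p)) + (H (t, x) - H (t, p))) <= norm (- (x - p) - (q p t - H (t, p))) + norm (H (t, x) - H (t, p))"
     by (rule norm_triangle_ineq)
    also have "norm (- (x - p) - (q p t - H (t, p))) <= norm (- (x - p)) + norm (q p t - H (t, p))"
     by (rule norm_triangle_ineq4)
    finally show ?thesis by (simp add: norm_minus_commute[of p x])
   qed
   ultimately have "norm (H (t, m) - (x - p + q p t)) < e m"
    using le[OF p] e(1)[OF pU] by linarith
   then show ?thesis by (simp add: dist_norm)
  qed
  have "h (pair x t) : ball (H (t, m)) (e m)" if t: "t : {0..1}" for t
   unfolding heq[OF x]
   by (rule convex_sum[OF fin[OF x] convex_ball sum1[OF x]]) (use py(2) 2 t in auto)
  moreover have "H (t, x) : ball (H (t, m)) (e m)" if t: "t : {0..1}" for t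
   using 1[OF t] e(1)[OF mU] by (simp add: dist_commute)
  ultimately show ?thesis using mU by blast
 qed
 define D where "D = {z:D0. h z : U}"
 have D: "open D"
  using continuous_open_preimage[OF smooth_map_on_imp_continuous_on[OF sh] D0 U] by (simp add: D_def vimage_def Int_def)
 show thesis
 proof (rule that[of D h])
  show "homotopy_data U D h U"
  proof
   show "pair x t : D" if xt: "x : U" "t : {0..1}" for x t
   proof -
    obtain m where m: "m : U" "h (pair x t) : ball (H (t, m)) (e m)" using key[OF xt(1)] xt(2) by blast
    then have "h (pair x t) : U" using e(2)[OF m(1) xt(2)] by blast
    then show ?thesis using xt by (simp add: D_def D0_def)
   qed
   show "h ` D <= U" by (auto simp: D_def)
   show "smooth_map_on D h" using smooth_on_subset[OF sh[rule_format]] by (auto simp: D_def)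
  qed (use U D in auto)
  show "h (pair x 0) = x" if "x : U" for x
  proof -
   have "h (pair x 0) = (SUM p | p : P & py p x ~= 0. py p x *\<^sub>R x)"
    unfolding heq[OF that] using q(2) P(1) by (intro sum.cong) auto
   also have "\<dots> = x" unfolding scaleR_sum_left[symmetric] sum1[OF that] by simp
   finally show ?thesis .
  qed
  show "h (pair x 1) : N" if xU: "x : U" for x
  proof -
   obtain m where m: "m : U" "h (pair x 1) : ball (H (1, m)) (e m)" using key[OF xU] by auto
   then show ?thesis using e(3)[OF m(1)] H(4)[OF m(1)] by auto
  qed
  show "closed_segment a (h (pair a 1)) <= N" if a: "a : A" for a
  proof -
   have aU: "a : U" using a N by blast
   obtain m where m: "m : U" "h (pair a 1) : ball (H (1, m)) (e m)" "H (1, a) : ball (H (1, m)) (e m)"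
    using key[OF aU] by auto
   have "closed_segment a (h (pair a 1)) <= ball (r m) (e m)"
    by (rule closed_segment_subset) (use m H(4) aU r(2)[OF a] convex_ball in auto)
   then show ?thesis using e(3)[OF m(1)] by blast
  qed
 qed
qed

definition restr :: "'a set => ('a => 'b => real) => 'a => 'b => real" where
 "restr W om x is = (if x : W then om x is else 0)"

lemma form_on_restr:
 assumes "open W" "W <= U" "form_on U k om"
 shows "form_on W k (restr W om)"
 unfolding form_on_def
proof (intro conjI allI impI)
 show "restr W om x is = 0" if "x ~: W \<or> length is ~= k" for x "is"
  using that form_onD(2)[OF assms(3)] by (auto simp: restr_def)
 show "alternating (restr W om x)" for x
  using form_onD(3)[OF assms(3), of x] by (auto simp: restr_def[abs_def] alternating_def)
 show "smooth_on W (%x. restr W om x is)" for "is"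
 proof (subst smooth_on_cong[OF assms(1)])
  show "smooth_on W (%x. om x is)" by (rule smooth_on_subset[OF form_onD(4)[OF assms(3)] assms(2)])
 qed (simp add: restr_def)
qed

lemma prev_form_ext_d:
 assumes "open U" "prev_form U k xi"
 shows "form_on U k (ext_d U xi)" "ext_d U (ext_d U xi) = (%_ _. 0)"
proof -
 have "form_on U k (ext_d U xi) & ext_d U (ext_d U xi) = (%_ _. 0)"
 proof (cases k)
  case 0
  then have "xi = (%_ _. 0)" using assms(2) by (simp add: prev_form_def)
  then show ?thesis by simp
 next
  case (Suc m)
  then have "form_on U m xi" using assms(2) by (simp add: prev_form_def)
  then show ?thesis using form_on_ext_d[OF assms(1)] ext_d_ext_d[OF assms(1)] Suc by blast
 qed
 then show "form_on U k (ext_d U xi)" "ext_d U (ext_d U xi) = (%_ _. 0)" by auto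
qed

lemma smooth_map_on_pair: "smooth_map_on U (%x. pair x c)"
proof
 show "smooth_on U (%x. pair x c $ k)" for k by (cases k) simp_all
qed

lemma deformation_retract_homotopy:
 fixes U :: "'a::euclidean_space set"
 assumes "deformation_retract_of A U"
 obtains H r where "continuous_on ({0..1} \<times> U) H" "!!t x. t : {0..1::real} ==> x : U ==> H (t, x) : U"
  "!!x. x : U ==> H (0, x) = x" "!!x. x : U ==> H (1, x) = r x" "!!x. x : U ==> r x : A"
  "!!x. x : A ==> r x = x" "A <= U"
proof -
 obtain r where hom: "homotopic_with_canon (%x. True) U U id r" and r: "retraction U A r"
  using assms unfolding deformation_retract_of_def by blast
 obtain H where H: "continuous_map (prod_topology (top_of_set {0..1}) (top_of_set U)) (top_of_set U) H"
  "!!x. H (0, x) = id x" "!!x. H (1::real, x) = r x"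
  using hom unfolding homotopic_with_def by blast
 have "continuous_on ({0..1} \<times> U) H & H : {0..1} \<times> U \<rightarrow> U"
  using H(1) by (simp add: prod_topology_subtopology_eu)
 then show thesis
  using that[of H r] H(2,3) r unfolding retraction_def by (auto simp: Pi_iff)
qed

text \<open>The end map \<open>f\<close> sends \<open>U\<close> into \<open>N\<close>, where
  \<open>om\<close> is 0, so the homotopy formula gives a primitive \<open>ew1\<close>. It is closed
  on \<open>N\<close>, hence \<open>f^* ew1\<close> is defined and closed on \<open>U\<close>, and
  near \<open>A\<close> it differs from \<open>ew1\<close> by an exact form \<open>d \<zeta>\<close>
  because \<open>f\<close> is joined to the identity by segments in \<open>N\<close>. Subtracting
  \<open>f^* ew1\<close> and adding \<open>d (\<kappa> \<zeta>)\<close> makes the primitive vanish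
  near \<open>A\<close>.\<close>

lemma vanishing_near_exact:
 fixes U A N :: "(real^'n::finite) set"
 assumes U: "open U" and A: "closedin (top_of_set U) A" and dr: "deformation_retract_of A U"
  and om: "form_on U k om" and closed: "ext_d U om = (%_ _. 0)"
  and N: "open N" "A <= N" "N <= U" and z: "!!x is. x : N ==> om x is = 0"
 obtains ew N1 where "prev_form U k ew" "ext_d U ew = om" "open N1" "A <= N1" "N1 <= U" "!!x is. x : N1 ==> ew x is = 0"
proof -
 obtain H r where H: "continuous_on ({0..1} \<times> U) H" "!!t x. t : {0..1::real} ==> x : U ==> H (t, x) : U"
  "!!x. x : U ==> H (0, x) = x" "!!x. x : U ==> H (1, x) = r x" and r: "!!x. x : U ==> r x : A"
  "!!x. x : A ==> r x = x" and AU: "A <= U"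
  by (rule deformation_retract_homotopy[OF dr]) blast
 have rN: "!!x. x : U ==> r x : N" using r(1) N(2) by blast
 obtain D h where hd: "homotopy_data U D h U" and h0: "!!x. x : U ==> h (pair x 0) = x"
  and h1: "!!x. x : U ==> h (pair x 1) : N" and seg: "!!a. a : A ==> closed_segment a (h (pair a 1)) <= N"
 proof (rule smooth_retraction_homotopy[OF U N(1) AU rN r(2) H])
  fix D h
  assume "homotopy_data U D h U" "!!x. x : U ==> h (pair x 0) = x" "!!x. x : U ==> h (pair x 1) : N"
   "!!a. a : A ==> closed_segment a (h (pair a 1)) <= N"
  then show thesis by (rule that)
 qed
 interpret homotopy_data U D h U by (rule hd)
 define f where "f x = h (pair x 1)" for x
 have sf: "smooth_map_on U f"
 proof
  fix j
  show "smooth_on U (%x. f x $ j)" unfolding f_def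
   by (rule smooth_on_compose[OF U opens(2) _ h(2)[rule_format] smooth_map_on_pair]) (use sub in auto)
 qed
 have fN: "f ` U <= N" using h1 by (auto simp: f_def)
 define K where "K = homotopy_op U D h om"
 have K: "prev_form U k K" unfolding K_def by (rule prev_form_homotopy_op[OF om])
 have dK: "ext_d U K x is = - om x is" if x: "x : U" for x "is"
 proof -
  have "pull U f om x is = 0" using z fN x by (auto simp: pull_def intro!: sum.neutral)
  moreover have "pull U (%x. h (pair x 0)) om x is = om x is"
   using pull_cong[OF U x, of U U "%x. h (pair x 0)" "%x. x"] h0 pull_id[OF x] by simp
  moreover have "pull U (%x. h (pair x 1)) om x is = pull U f om x is" by (simp add: f_def[abs_def])
  ultimately show ?thesis using homotopy_formula[OF om closed x, of "is"] by (simp add: K_def)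
 qed
 show thesis
 proof (cases k)
  case 0
  \<comment> \<open>In degree 0 the operator yields nothing, so \<open>om\<close>, being minus its
    differential, is zero.\<close>
  then have "K = (%_ _. 0)" using K by (simp add: prev_form_def)
  then have "om x is = 0" for x "is" using dK[of x "is"] form_onD(1)[OF om, of x "is"] by (cases "x : U") auto
  then have "om = (%_ _. 0)" by (intro ext)
  then show thesis using that[of "%_ _. 0" N] 0 N by (simp add: prev_form_def)
 next
  case (Suc m)
  then have Km: "form_on U m K" using K by (simp add: prev_form_def)
  define ew1 where "ew1 x is = 0 - K x is" for x "is"
  have ew1: "form_on U m ew1" unfolding ew1_def[abs_def] by (rule form_on_diff[OF U form_on_zero Km])
  have dew1: "ext_d U ew1 = om"
  proof (intro ext)
   fix x "is"
   show "ext_d U ew1 x is = om x is"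
    unfolding ew1_def[abs_def] ext_d_diff[OF form_on_zero Km]
    using dK[of x "is"] form_onD(1)[OF om, of x "is"] by (cases "x : U") (simp_all add: ext_d_eq[of U K])
  qed
  define om' where "om' = restr N ew1"
  have om': "form_on N m om'" unfolding om'_def by (rule form_on_restr[OF N(1,3) ew1])
  have dom': "ext_d N om' = (%_ _. 0)"
  proof (intro ext)
   fix x "is"
   show "ext_d N om' x is = 0"
   proof (cases "x : N")
    case True
    have "ext_d N om' x is = ext_d U ew1 x is"
     by (rule ext_d_cong[OF N(1) True]) (use N in \<open>auto simp: om'_def restr_def\<close>)
    then show ?thesis using z[OF True] by (simp add: dew1)
   qed (simp add: ext_d_eq)
  qed
  define pf where "pf = pull U f om'"
  have pf: "form_on U m pf" unfolding pf_def by (rule form_on_pull[OF U N(1) fN sf om'])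
  have dpf: "ext_d U pf = (%_ _. 0)"
   unfolding pf_def ext_d_pull[OF U N(1) fN sf om'] dom' by (intro ext) (simp add: pull_def)
  \<comment> \<open>The straight-line homotopy from the identity to \<open>f\<close>.\<close>
  define g where "g z = prj z + z $ None *\<^sub>R (f (prj z) - prj z)" for z
  define E where "E = {z. prj z : N}"
  have E: "open E" unfolding E_def by (rule open_prj_vimage[OF N(1)])
  have sg: "smooth_map_on E g"
  proof
   fix j
   have "smooth_on E (%z. f (prj z) $ j)"
    by (rule smooth_on_compose[OF E U _ sf[rule_format]]) (use N in \<open>auto simp: E_def\<close>)
   then show "smooth_on E (%z. g z $ j)" unfolding g_def
    by (simp) (intro smooth_on_add smooth_on_mult smooth_on_diff smooth_on_nth E)
  qed
  define D1 where "D1 = {z:E. g z : N}"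
  have D1: "open D1"
   using continuous_open_preimage[OF smooth_map_on_imp_continuous_on[OF sg] E N(1)] by (simp add: D1_def vimage_def Int_def)
  \<comment> \<open>The points whose whole time segment stays in the domain; open since the time
    interval is compact.\<close>
  define N' where "N' = {x. ALL t:{0..1}. pair x t : D1}"
  have N'N: "N' <= N" by (force simp: N'_def D1_def E_def)
  have AN': "A <= N'"
  proof
   fix a assume a: "a : A"
   have "g (pair a t) : closed_segment a (f a)" if "t : {0..1}" for t
    unfolding in_segment using that by (intro exI[of _ t]) (auto simp: g_def algebra_simps)
   then show "a : N'" using seg[OF a] a N(2) by (auto simp: N'_def D1_def E_def f_def)
  qed
  have oN': "open N'"
   unfolding open_contains_ball
  proof
   fix x assume x: "x : N'"
   have "compact (pair x ` {0..1})"
    by (intro compact_continuous_image continuous_on_pair continuous_on_const continuous_on_id compact_Icc)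
   moreover have "pair x ` {0..1} <= D1" using x by (auto simp: N'_def)
   ultimately obtain e where e: "e > 0" "(UN z:pair x ` {0..1}. ball z e) <= D1"
    by (rule compact_subset_open_imp_ball_epsilon_subset[OF _ D1])
   have "y : N'" if y: "y : ball x e" for y
    unfolding N'_def
   proof (intro CollectI ballI)
    fix t :: real assume t: "t : {0..1}"
    have "dist (pair x t) (pair y t) <= dist x y"
    proof -
     have "(SUM k:UNIV. (pair x t $ k - pair y t $ k)^2) = (SUM i:UNIV. (x $ i - y $ i)^2)"
      by (simp add: UNIV_option_conv sum.reindex)
     then show ?thesis by (simp add: dist_vec_def L2_set_def dist_real_def)
    qed
    then have "pair y t : ball (pair x t) e" using y by simp
    then show "pair y t : D1" using e(2) t by blast
   qed
   then show "EX e>0. ball x e <= N'" using e(1) by blast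
  qed
  have hd1: "homotopy_data N' D1 g N"
  proof
   show "pair x t : D1" if "x : N'" "t : {0..1}" for x t using that by (simp add: N'_def)
   show "g ` D1 <= N" by (auto simp: D1_def)
   show "smooth_map_on D1 g" using smooth_on_subset[OF sg[rule_format]] by (auto simp: D1_def)
  qed (use oN' D1 N in auto)
  define \<zeta> where "\<zeta> = homotopy_op N' D1 g om'"
  have \<zeta>: "prev_form N' m \<zeta>" unfolding \<zeta>_def by (rule homotopy_data.prev_form_homotopy_op[OF hd1 om'])
  have d\<zeta>: "ext_d N' \<zeta> x is = pf x is - ew1 x is" if x: "x : N'" for x "is"
  proof -
   have xN: "x : N" using x N'N by blast
   have "pull N' (%x. g (pair x 1)) om' x is = pf x is"
    unfolding pf_def by (rule pull_cong[OF oN' x]) (use N'N N in \<open>auto simp: g_def\<close>)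
   moreover have "pull N' (%x. g (pair x 0)) om' x is = pull N' (%x. x) om' x is"
    by (rule pull_cong[OF oN' x]) (auto simp: g_def)
   moreover have "pull N' (%x. x) om' x is = ew1 x is" using pull_id[OF x] xN by (simp add: om'_def restr_def)
   ultimately show ?thesis
    using homotopy_data.homotopy_formula[OF hd1 om' dom' x, of "is"] by (simp add: \<zeta>_def)
  qed
  have N'U: "N' <= U" using N'N N by blast
  obtain \<kappa> N1 where \<kappa>: "smooth_on U \<kappa>" "open N1" "A <= N1" "N1 <= N'" "!!x. x : N1 ==> \<kappa> x = 1"
   "!!x. x : U - N' ==> EX W. open W & x : W & (ALL y:W. \<kappa> y = 0)"
   by (rule smooth_urysohn[OF U A oN' AN' N'U]) blast
  define xi where "xi x is = (if x : N' then \<kappa> x * \<zeta> x is else 0)" for x "is"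
  have xi: "prev_form U m xi"
  proof (cases m)
   case 0
   then show ?thesis using \<zeta> by (simp add: prev_form_def xi_def fun_eq_iff)
  next
   case (Suc l)
   then have \<zeta>l: "form_on N' l \<zeta>" using \<zeta> by (simp add: prev_form_def)
   have "form_on U l xi" unfolding form_on_def
   proof (intro conjI allI impI)
    show "xi x is = 0" if "x ~: U \<or> length is ~= l" for x "is"
     using that form_onD(2)[OF \<zeta>l] N'U by (auto simp: xi_def)
    show "alternating (xi x)" for x
     using form_onD(3)[OF \<zeta>l, of x] by (auto simp: xi_def[abs_def] alternating_def)
    show "smooth_on U (%x. xi x is)" for "is"
    proof (rule smooth_on_locally)
     fix x assume x: "x : U"
     show "EX W. x : W & smooth_on W (%x. xi x is)"
     proof (cases "x : N'")
      case True
      have "smooth_on N' (%x. \<kappa> x * \<zeta> x is)"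
       by (rule smooth_on_mult[OF oN' smooth_on_subset[OF \<kappa>(1) N'U] form_onD(4)[OF \<zeta>l]])
      moreover have "smooth_on N' (%x. xi x is) \<longleftrightarrow> smooth_on N' (%x. \<kappa> x * \<zeta> x is)"
       by (rule smooth_on_cong[OF oN']) (simp add: xi_def)
      ultimately show ?thesis using True by blast
     next
      case False
      then obtain W where W: "open W" "x : W" "ALL y:W. \<kappa> y = 0" using \<kappa>(6)[of x] x by auto
      have "smooth_on W (%x. xi x is) \<longleftrightarrow> smooth_on W (%x. 0)"
       by (rule smooth_on_cong[OF W(1)]) (use W(3) in \<open>simp add: xi_def\<close>)
      then show ?thesis using W(2) smooth_on_const by blast
     qed
    qed
   qed
   then show ?thesis using Suc by (simp add: prev_form_def)
  qed
  \<comment> \<open>\<open>pf\<close> and \<open>ext_d U xi\<close> are closed, so \<open>d\<close>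
    is not affected; where \<open>\<kappa> = 1\<close> they cancel \<open>ew1\<close>.\<close>
  define ew where "ew x is = (ew1 x is - pf x is) + ext_d U xi x is" for x "is"
  note dxi = prev_form_ext_d[OF U xi]
  have d1: "form_on U m (%x is. ew1 x is - pf x is)" by (rule form_on_diff[OF U ew1 pf])
  have ewf: "form_on U m ew" unfolding ew_def[abs_def] by (rule form_on_add[OF U d1 dxi(1)])
  have dew: "ext_d U ew = om"
   unfolding ew_def[abs_def] ext_d_add[OF d1 dxi(1)] ext_d_diff[OF ew1 pf] dxi(2) dpf dew1 by simp
  have "ew x is = 0" if x: "x : N1" for x "is"
  proof -
   have xN': "x : N'" using x \<kappa>(4) by blast
   have "ext_d U xi x is = ext_d N' \<zeta> x is"
    by (rule ext_d_cong[OF \<kappa>(2) x]) (use \<kappa>(4,5) N'U in \<open>auto simp: xi_def\<close>)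
   then show ?thesis using d\<zeta>[OF xN'] by (simp add: ew_def)
  qed
  then show thesis
   using that[of ew N1] ewf dew \<kappa>(2,3,4) N'U Suc by (simp add: prev_form_def)
 qed
qed


section \<open>Pushing flat forms off a union of quadrants\<close>

text \<open>The smooth data of a local chart, with the inverse \<open>py\<close> named. Analyticity
  of \<open>py\<close> is carried separately, for the Lojasiewicz estimate.\<close>

definition quadrant_chart :: "(real^'n::finite) set => (real^'n) set => (real^'n) set => (real^'n => real^'n) => (real^'n => real^'n) => ('n => real) set => bool" where
 "quadrant_chart V B W ph py S \<longleftrightarrow> open W & W <= V & open (ph ` W) & smooth_map_on W ph & smooth_map_on (ph ` W) py &
  (ALL x:W. py (ph x) = x) & ph ` (B Int W) = ph ` W Int (UN si:S. quadrant si)"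

text \<open>For every small \<open>s > 0\<close> the point \<open>z + s *\<^sub>R ph b\<close> has
  exactly the signs of \<open>ph b\<close>, hence lies in the image of \<open>B\<close>; as
  \<open>s\<close> tends to 0, closedness of \<open>B\<close> puts \<open>py z\<close> into
  \<open>B\<close>.\<close>

lemma closed_under_sign_degeneration:
 assumes qc: "quadrant_chart V B W ph py S" and B: "closedin (top_of_set V) B"
  and b: "b : B Int W" and z: "z : ph ` W" and sg: "!!i. z $ i = 0 \<or> sgn (z $ i) = sgn (ph b $ i)"
 shows "py z : B"
proof (rule ccontr)
 assume nB: "py z ~: B"
 obtain C where C: "closed C" "B = V Int C" using B unfolding closedin_closed by blast
 have q: "open (ph ` W)" "smooth_map_on (ph ` W) py" "W <= V" and inv: "!!x. x : W ==> py (ph x) = x"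
  and Bq: "ph ` (B Int W) = ph ` W Int (UN si:S. quadrant si)"
  using qc unfolding quadrant_chart_def by blast+
 have "py z : - C" using nB z inv C q(3) by auto
 moreover have "open (ph ` W Int py -` (- C))"
  using continuous_open_preimage[OF smooth_map_on_imp_continuous_on[OF q(2)] q(1)] C(1) by blast
 ultimately obtain e where e: "e > 0" "ball z e <= ph ` W Int py -` (- C)"
  using z open_contains_ball by (metis (no_types, lifting) IntI vimageI)
 define s where "s = (e / 2) / (norm (ph b) + 1)"
 have s: "s > 0" using e by (simp add: s_def add_nonneg_pos)
 have "s * norm (ph b) < e"
 proof -
  have "s * norm (ph b) <= s * (norm (ph b) + 1)" using s by simp
  also have "s * (norm (ph b) + 1) = e / 2"
  proof -
   have "norm (ph b) + 1 ~= 0" using norm_ge_zero[of "ph b"] by linarith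
   then have "inverse (norm (ph b) + 1) * (norm (ph b) + 1) = 1" by (rule left_inverse)
   then show ?thesis by (simp only: s_def divide_inverse mult.assoc mult_1_right)
  qed
  also have "e / 2 < e" using e by simp
  finally show ?thesis .
 qed
 then have "z + s *\<^sub>R ph b : ball z e" using s by (simp add: dist_norm)
 then have in1: "z + s *\<^sub>R ph b : ph ` W" "py (z + s *\<^sub>R ph b) ~: C" using e(2) by auto
 obtain si where si: "si : S" "ph b : quadrant si" using b Bq by blast
 have "sgn ((z + s *\<^sub>R ph b) $ i) = si i" for i
 proof -
  have "si i = sgn (ph b $ i)" using si(2) by (simp add: quadrant_def)
  moreover have "ph b $ i > 0 ==> s * ph b $ i > 0" "ph b $ i < 0 ==> s * ph b $ i < 0"
   using s by (simp_all add: mult_pos_neg)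
  ultimately show ?thesis using sg[of i]
   by (cases "ph b $ i" "0 :: real" rule: linorder_cases) (auto simp: sgn_if split: if_splits)
 qed
 then have "z + s *\<^sub>R ph b : ph ` (B Int W)" unfolding Bq using in1(1) si(1) by (auto simp: quadrant_def)
 then obtain w where "w : B" "w : W" "z + s *\<^sub>R ph b = ph w" by blast
 then show False using in1(2) inv C by auto
qed

text \<open>Uniform continuity is taken on the closed \<open>e / 2\<close> neighbourhood
  \<open>L\<close> of \<open>K\<close>, because the second point may leave \<open>K\<close>.\<close>

lemma compact_uniform_margin:
 fixes g :: "'a::euclidean_space => 'b::metric_space"
 assumes K: "compact K" "K <= O'" "open O'" and g: "continuous_on O' g" and d: "d > (0::real)"
 obtains dw where "dw > 0" "!!z z'. z : K ==> dist z' z < dw ==> z' : O' & dist (g z') (g z) < d"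
proof -
 obtain e where e: "e > 0" "(UN x:K. ball x e) <= O'"
  by (rule compact_subset_open_imp_ball_epsilon_subset[OF K(1,3,2)])
 define L where "L = {x + y | x y. x : K & y : cball 0 (e / 2)}"
 have L: "compact L" unfolding L_def by (intro compact_sums K compact_cball)
 have LI: "z' : L" if "z : K" "dist z' z < e / 2" for z z'
 proof -
  have "z' = z + (z' - z)" "z' - z : cball 0 (e / 2)" using that by (auto simp: dist_norm norm_minus_commute[of z z'])
  then show ?thesis unfolding L_def using that(1) by blast
 qed
 have "L <= O'"
 proof
  fix w assume "w : L"
  then obtain x y where "w = x + y" "x : K" "norm y <= e / 2" by (auto simp: L_def)
  then have "w : ball x e" using e(1) by (simp add: dist_norm)
  then show "w : O'" using e(2) \<open>x : K\<close> by blast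
 qed
 then have "uniformly_continuous_on L g"
  using compact_uniformly_continuous[OF continuous_on_subset[OF g] L] by blast
 then obtain c where c: "c > 0" "!!x x'. x : L ==> x' : L ==> dist x' x < c ==> dist (g x') (g x) < d"
  using d by (rule uniformly_continuous_onE) blast
 show thesis
 proof (rule that[of "min c (e / 2)"])
  fix z z' assume zz: "z : K" "dist z' z < min c (e / 2)"
  have "z' : L" "z : L" using LI[of z z'] LI[of z z] zz e(1) by auto
  then show "z' : O' & dist (g z') (g z) < d" using c(2)[of z z'] zz \<open>L <= O'\<close> by auto
 qed (use c e in auto)
qed

text \<open>Zero for \<open>\<bar>s\<bar> <= ez\<close> and one from \<open>2 * ez\<close> on: the
  divisor 3 is \<open>2^2 - 1\<close>. Multiplying a coordinate by it collapses the slab of width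
  \<open>ez\<close> onto the hyperplane; using the square of \<open>s\<close> avoids the corner of
  the absolute value.\<close>

definition clamp_factor :: "real => real => real" where
 "clamp_factor ez s = smooth_step (((s / ez)^2 - 1) / 3)"

lemma clamp_factor:
 assumes "ez > 0"
 shows "0 <= clamp_factor ez s" "clamp_factor ez s <= 1" "\<bar>s\<bar> <= ez ==> clamp_factor ez s = 0"
  "\<bar>s * (1 - clamp_factor ez s)\<bar> <= 2 * ez"
proof -
 show b: "0 <= clamp_factor ez s" "clamp_factor ez s <= 1" by (simp_all add: clamp_factor_def smooth_step_bounds)
 show "clamp_factor ez s = 0" if "\<bar>s\<bar> <= ez"
 proof -
  have "\<bar>s / ez\<bar> <= 1" using that assms by (simp add: field_simps)
  then have "(s / ez)^2 <= 1" by (simp add: abs_square_le_1)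
  then show ?thesis by (simp add: clamp_factor_def smooth_step_eq_0)
 qed
 show "\<bar>s * (1 - clamp_factor ez s)\<bar> <= 2 * ez"
 proof (cases "\<bar>s\<bar> <= 2 * ez")
  case True
  have "\<bar>s * (1 - clamp_factor ez s)\<bar> <= \<bar>s\<bar> * 1" unfolding abs_mult using b by (intro mult_left_mono) auto
  then show ?thesis using True by simp
 next
  case False
  then have "2 <= \<bar>s / ez\<bar>" using assms by (simp add: field_simps)
  then have "2^2 <= \<bar>s / ez\<bar>^2" by (intro power_mono) auto
  then have "4 <= (s / ez)^2" unfolding power2_abs by simp
  then have "clamp_factor ez s = 1" by (simp add: clamp_factor_def smooth_step_eq_1)
  then show ?thesis using assms by simp
 qed
qed

text \<open>Every chart coordinate is multiplied by a factor that is nonnegative for times in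
  \<open>[0, 1]\<close>, so signs are kept or become 0 and \<open>B\<close> is preserved. At time 1
  the slabs around the hyperplanes have been collapsed, which pushes a whole neighbourhood of each
  point of \<open>B\<close> in the inner ball into \<open>B\<close>.\<close>

lemma flattening_homotopy:
 fixes V B :: "(real^'n::finite) set"
 assumes V: "open V" and B: "closedin (top_of_set V) B" and qc: "quadrant_chart V B W ph py S"
  and R: "0 < r" "r < R" "cball p R <= W" and d: "d > 0"
 obtains D h where "homotopy_data V D h V" "!!x. x : V ==> h (pair x 0) = x"
  "!!x t. x : B ==> t : {0..1} ==> h (pair x t) : B"
  "!!x. x : V ==> dist (h (pair x 1)) x < d"
  "!!z. prj z ~: cball p R ==> h z = prj z"
  "!!b. b : B Int cball p r ==> EX M. open M & b : M & (ALL x:M Int V. h (pair x 1) : B)"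
proof -
 have q: "open W" "W <= V" "open (ph ` W)" "smooth_map_on W ph" "smooth_map_on (ph ` W) py" and inv: "!!x. x : W ==> py (ph x) = x"
  using qc unfolding quadrant_chart_def by blast+
 have BV: "B <= V" using B closedin_subset by fastforce
 \<comment> \<open>The cutoff has to equal 1 on a neighbourhood of \<open>cball p r\<close>, hence
   the intermediate radius.\<close>
 define a where "a = (r + R) / 2"
 have a: "0 < a" "r < a" "a < R" using R by (auto simp: a_def)
 define \<kappa> where "\<kappa> = cutoff p a R"
 note cp = cutoff_props[OF a(1,3), where p = p, folded \<kappa>_def]
 have K: "compact (ph ` cball p R)"
  by (intro compact_continuous_image compact_cball continuous_on_subset[OF smooth_map_on_imp_continuous_on[OF q(4)]] R(3))
 have K2: "ph ` cball p R <= ph ` W" using R(3) by blast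
 obtain dw where dw: "dw > 0" "!!z z'. z : ph ` cball p R ==> dist z' z < dw ==> z' : ph ` W & dist (py z') (py z) < d"
  by (rule compact_uniform_margin[OF K K2 q(3) smooth_map_on_imp_continuous_on[OF q(5)] d]) blast
 \<comment> \<open>Each coordinate moves by at most \<open>2 * ez\<close>, so the displacement in
   the chart is at most \<open>2 * ez * CARD('n)\<close>, which must stay below
   \<open>dw\<close>.\<close>
 define ez where "ez = dw / (2 * real CARD('n) + 1) / 2"
 have ez: "ez > 0" "2 * ez * real CARD('n) < dw"
 proof -
  show "ez > 0" using dw(1) by (simp add: ez_def add_nonneg_pos)
  have "2 * ez * real CARD('n) < 2 * ez * (2 * real CARD('n) + 1)"
   using \<open>ez > 0\<close> by (intro mult_strict_left_mono) auto
  also have "\<dots> = dw" by (simp add: ez_def field_simps add_nonneg_eq_0_iff)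
  finally show "2 * ez * real CARD('n) < dw" .
 qed
 note cf = clamp_factor[OF ez(1)]
 \<comment> \<open>The factor is 1 at time 0 and outside the cutoff, and equals
   \<open>clamp_factor\<close> at time 1 where the cutoff is 1.\<close>
 define c where "c i z = 1 - z $ None * (\<kappa> (prj z) * (1 - clamp_factor ez (ph (prj z) $ i)))" for i z
 define y where "y z = (\<chi> i. ph (prj z) $ i * c i z)" for z
 define h where "h z = (if prj z : W then py (y z) else prj z)" for z
 define E where "E = {z :: real^('n option). prj z : W}"
 have E: "open E" unfolding E_def by (rule open_prj_vimage[OF q(1)])
 have sy: "smooth_map_on E y"
 proof
  fix i
  have 1: "smooth_on E (%z. ph (prj z) $ i)"
   by (rule smooth_on_compose[OF E q(1) _ q(4)[rule_format]]) (auto simp: E_def)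
  have 2: "smooth_on E (%z. \<kappa> (prj z))"
   unfolding \<kappa>_def by (rule smooth_on_compose[OF E open_UNIV _ smooth_on_cutoff[OF open_UNIV]]) auto
  have 3: "smooth_on E (%z. clamp_factor ez (ph (prj z) $ i))"
  proof -
   have "smooth_on E (%z. smooth_step (((ph (prj z) $ i * (1 / ez))^2 - 1) * (1 / 3)))"
    by (intro smooth_on_smooth_step smooth_on_mult smooth_on_diff smooth_on_power 1 smooth_on_const E)
   then show ?thesis by (simp add: clamp_factor_def)
  qed
  show "smooth_on E (%z. y z $ i)"
   unfolding y_def c_def vec_lambda_beta by (intro smooth_on_mult smooth_on_diff 1 2 3 smooth_on_const smooth_on_nth E)
 qed
 define D1 where "D1 = {z:E. y z : ph ` W}"
 have D1: "open D1"
  using continuous_open_preimage[OF smooth_map_on_imp_continuous_on[OF sy] E q(3)] by (simp add: D1_def vimage_def Int_def)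
 define D2 where "D2 = {z :: real^('n option). prj z : V - cball p R}"
 have D2: "open D2" unfolding D2_def by (rule open_prj_vimage) (use V in auto)
 have yph: "y z = ph (prj z)" if "\<kappa> (prj z) = 0 \<or> z $ None = 0" for z
  using that by (auto simp: y_def c_def vec_eq_iff)
 have hout: "h z = prj z" if "prj z ~: ball p R" for z
  using yph[of z] cp(2)[OF that] inv by (simp add: h_def)
 have dy: "dist (y (pair x t)) (ph x) < dw" if t: "t : {0..1}" for x t
 proof -
  have "\<bar>(y (pair x t) - ph x) $ i\<bar> <= 2 * ez" for i
  proof -
   have "(y (pair x t) - ph x) $ i = - (t * \<kappa> x) * (ph x $ i * (1 - clamp_factor ez (ph x $ i)))"
    by (simp add: y_def c_def algebra_simps)
   then have "\<bar>(y (pair x t) - ph x) $ i\<bar> = \<bar>t * \<kappa> x\<bar> * \<bar>ph x $ i * (1 - clamp_factor ez (ph x $ i))\<bar>"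
    by (simp add: abs_mult)
   also have "\<dots> <= 1 * (2 * ez)"
    using cf(4)[of "ph x $ i"] t cp(3,4)[of x] by (intro mult_mono) (auto simp: abs_mult mult_le_one)
   finally show ?thesis by simp
  qed
  then have "(SUM i:UNIV. \<bar>(y (pair x t) - ph x) $ i\<bar>) <= (SUM i:(UNIV::'n set). 2 * ez)" by (intro sum_mono)
  then have "norm (y (pair x t) - ph x) <= 2 * ez * real CARD('n)"
   using norm_le_l1_cart[of "y (pair x t) - ph x"] by (simp add: mult.commute)
  then show ?thesis using ez(2) by (simp add: dist_norm)
 qed
 have yW: "y (pair x t) : ph ` W & dist (py (y (pair x t))) x < d" if x: "x : W" and t: "t : {0..1}" for x t
 proof (cases "x : cball p R")
  case True
  then have "ph x : ph ` cball p R" by blast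
  from dw(2)[OF this dy[OF t]] show ?thesis using inv[OF x] by simp
 next
  case False
  then have "\<kappa> x = 0" using cp(2)[of x] by auto
  then have "y (pair x t) = ph x" using yph[of "pair x t"] by simp
  then show ?thesis using x inv d by auto
 qed
 show thesis
 proof (rule that[of "D1 Un D2" h])
  show "homotopy_data V (D1 Un D2) h V"
  proof
   show "pair x t : D1 Un D2" if "x : V" "t : {0..1}" for x t
    using that yW R(3) by (cases "x : W") (auto simp: D1_def D2_def E_def)
   show "h ` (D1 Un D2) <= V"
   proof
    fix w assume "w : h ` (D1 Un D2)"
    then obtain z where z: "z : D1 Un D2" "w = h z" by blast
    show "w : V"
    proof (cases "prj z : W & y z : ph ` W")
     case True
     then obtain u where "u : W" "y z = ph u" by blast
     then show ?thesis using True inv q(2) z by (auto simp: h_def)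
    next
     case False
     then have "z : D2" using z by (auto simp: D1_def E_def)
     then show ?thesis using hout[of z] z by (auto simp: D2_def)
    qed
   qed
   show "smooth_map_on (D1 Un D2) h"
   proof
    fix j
    show "smooth_on (D1 Un D2) (%z. h z $ j)"
    proof (rule smooth_on_locally)
     fix z assume "z : D1 Un D2"
     have s1: "smooth_on D1 (%z. h z $ j)"
     proof (subst smooth_on_cong[OF D1])
      show "smooth_on D1 (%z. py (y z) $ j)"
       by (rule smooth_on_compose[OF D1 q(3) _ q(5)[rule_format]])
        (use smooth_on_subset[OF sy[rule_format]] in \<open>auto simp: D1_def\<close>)
     qed (simp add: D1_def E_def h_def)
     have s2: "smooth_on D2 (%z. h z $ j)"
     proof (subst smooth_on_cong[OF D2])
      show "h z $ j = z $ Some j" if "z : D2" for z using hout[of z] that by (auto simp: D2_def)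
     qed simp
     show "EX W. z : W & smooth_on W (%z. h z $ j)" using \<open>z : D1 Un D2\<close> s1 s2 by blast
    qed
   qed
  qed (use V D1 D2 in auto)
  show "h (pair x 0) = x" if "x : V" for x
   using yph[of "pair x 0"] inv by (auto simp: h_def)
  show "h (pair x t) : B" if x: "x : B" and t: "t : {0..1}" for x t
  proof (cases "x : W")
   case True
   have "py (y (pair x t)) : B"
   proof (rule closed_under_sign_degeneration[OF qc B, of x])
    show "y (pair x t) : ph ` W" using yW[OF True t] by blast
    fix i
    have "t * (\<kappa> x * (1 - clamp_factor ez (ph x $ i))) <= 1"
     using t cp(3,4)[of x] cf(1,2)[of "ph x $ i"] by (intro mult_le_one mult_nonneg_nonneg) auto
    then have "c i (pair x t) >= 0" by (simp add: c_def)
    then show "y (pair x t) $ i = 0 \<or> sgn (y (pair x t) $ i) = sgn (ph x $ i)"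
     by (cases "c i (pair x t) = 0") (auto simp: y_def sgn_mult)
   qed (use x True in auto)
   then show ?thesis using True by (simp add: h_def)
  qed (use x in \<open>simp add: h_def\<close>)
  show "dist (h (pair x 1)) x < d" if "x : V" for x
   using yW[of x 1] d by (auto simp: h_def)
  show "h z = prj z" if "prj z ~: cball p R" for z using hout[of z] that by auto
  show "EX M. open M & b : M & (ALL x:M Int V. h (pair x 1) : B)" if b: "b : B Int cball p r" for b
  proof -
   have bW: "b : W" using b R a by (auto simp: subset_iff)
   have "continuous_on W ph" by (rule smooth_map_on_imp_continuous_on[OF q(4)])
   then have "open (W Int ph -` ball (ph b) ez)" by (rule continuous_open_preimage[OF _ q(1) open_ball])
   then have o: "open (W Int ph -` ball (ph b) ez Int ball p a)" by blast
   have "h (pair x 1) : B" if x: "x : W Int ph -` ball (ph b) ez Int ball p a" for x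
   proof -
    have xW: "x : W" using x by blast
    have k1: "\<kappa> x = 1" using cp(1)[of x] x by auto
    have "py (y (pair x 1)) : B"
    proof (rule closed_under_sign_degeneration[OF qc B, of b])
     show "y (pair x 1) : ph ` W" using yW[OF xW, of 1] by simp
     fix i
     have yi: "y (pair x 1) $ i = ph x $ i * clamp_factor ez (ph x $ i)" by (simp add: y_def c_def k1)
     have "dist (ph b) (ph x) < ez" using x by auto
     then have near: "\<bar>ph b $ i - ph x $ i\<bar> < ez"
      using component_le_norm_cart[of "ph b - ph x" i] by (simp add: dist_norm)
     \<comment> \<open>A coordinate of size at most \<open>ez\<close> has been collapsed to 0; a
       larger one differs from that of \<open>ph b\<close> by less than \<open>ez\<close> and has
       the same sign.\<close>
     show "y (pair x 1) $ i = 0 \<or> sgn (y (pair x 1) $ i) = sgn (ph b $ i)"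
     proof (cases "\<bar>ph x $ i\<bar> <= ez")
      case True
      then show ?thesis using yi cf(3) by simp
     next
      case False
      then have "sgn (ph x $ i) = sgn (ph b $ i)" using near by (auto simp: sgn_if abs_if split: if_splits)
      then show ?thesis using cf(1)[of "ph x $ i"] unfolding yi sgn_mult by (auto simp: sgn_if)
     qed
    qed (use b bW in auto)
    then show ?thesis using xW by (simp add: h_def)
   qed
   moreover have "b : W Int ph -` ball (ph b) ez Int ball p a" using bW b a ez(1) by auto
   ultimately show ?thesis using o by blast
  qed
 qed
qed


definition zero_germ :: "('a::topological_space => 'b => real) => 'a => bool" where
 "zero_germ om b \<longleftrightarrow> (EX M. open M & b : M & (ALL x:M. ALL is. om x is = 0))"

text \<open>The new form is the pullback by the end map of the homotopy. That map moves points by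
  less than \<open>d\<close> and preserves \<open>B\<close>, which gives the last conjunct:
  vanishing of \<open>om\<close> near all points of \<open>B\<close> within \<open>d\<close> of
  \<open>b\<close> passes to \<open>om'\<close> near \<open>b\<close>.\<close>

lemma flattening_step:
 fixes V B :: "(real^'n::finite) set"
 assumes V: "open V" and B: "closedin (top_of_set V) B" and qc: "quadrant_chart V B W ph py S"
  and R: "0 < r" "r < R" "cball p R <= W" and d: "d > 0"
  and om: "flat_form B V k om" "ext_d V om = (%_ _. 0)"
 shows "EX om' ew. flat_form B V k om' & ext_d V om' = (%_ _. 0) & prev_form V k ew & (ALL is. flat_on B V (%x. ew x is)) &
  (ALL x is. x : V --> om' x is - om x is = ext_d V ew x is) &
  (ALL x is. x ~: cball p R --> ew x is = 0) &
  (ALL b:B Int cball p r. zero_germ om' b) &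
  (ALL b:B. (ALL c:B. dist c b < d --> zero_germ om c) --> zero_germ om' b)"
proof -
 have BV: "B <= V" using B closedin_subset by fastforce
 obtain D h where hd: "homotopy_data V D h V" and h0: "!!x. x : V ==> h (pair x 0) = x"
  and hB: "!!x t. x : B ==> t : {0..1} ==> h (pair x t) : B"
  and hd1: "!!x. x : V ==> dist (h (pair x 1)) x < d"
  and hout: "!!z. prj z ~: cball p R ==> h z = prj z"
  and hM: "!!b. b : B Int cball p r ==> EX M. open M & b : M & (ALL x:M Int V. h (pair x 1) : B)"
 proof (rule flattening_homotopy[OF V B qc R d])
  fix D h
  assume "homotopy_data V D h V" "!!x. x : V ==> h (pair x 0) = x"
   "!!x t. x : B ==> t : {0..1} ==> h (pair x t) : B" "!!x. x : V ==> dist (h (pair x 1)) x < d"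
   "!!z. prj z ~: cball p R ==> h z = prj z"
   "!!b. b : B Int cball p r ==> EX M. open M & b : M & (ALL x:M Int V. h (pair x 1) : B)"
  then show thesis by (rule that)
 qed
 interpret homotopy_data V D h V by (rule hd)
 have omf: "form_on V k om" and omB: "!!is. flat_on B V (%x. om x is)" using om(1) by (auto simp: flat_form_def)
 define f where "f x = h (pair x 1)" for x
 have sf: "smooth_map_on V f"
 proof
  fix j
  show "smooth_on V (%x. f x $ j)" unfolding f_def
   by (rule smooth_on_compose[OF V opens(2) _ h(2)[rule_format] smooth_map_on_pair]) (use sub in auto)
 qed
 have fV: "f ` V <= V" using h(1) sub by (force simp: f_def)
 have fB: "f ` B <= B" using hB by (auto simp: f_def)
 define om' where "om' = pull V f om"
 define ew where "ew = homotopy_op V D h om"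
 have "flat_form B V k om'" unfolding om'_def by (rule flat_form_pull[OF V BV V BV fV fB sf om(1)])
 moreover have "ext_d V om' = (%_ _. 0)"
  unfolding om'_def ext_d_pull[OF V V fV sf omf] om(2) by (intro ext) (simp add: pull_def)
 moreover have "prev_form V k ew" unfolding ew_def by (rule prev_form_homotopy_op[OF omf])
 moreover have "flat_on B V (%x. ew x is)" for "is"
  unfolding ew_def by (rule flat_on_homotopy_op[OF omf omB BV BV hB])
 moreover have "om' x is - om x is = ext_d V ew x is" if x: "x : V" for x "is"
 proof -
  have "pull V (%x. h (pair x 0)) om x is = om x is"
   using pull_cong[OF V x, of V V "%x. h (pair x 0)" "%x. x"] h0 pull_id[OF x] by simp
  moreover have "pull V (%x. h (pair x 1)) om x is = om' x is" by (simp add: om'_def f_def[abs_def])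
  ultimately show ?thesis using homotopy_formula[OF omf om(2) x, of "is"] by (simp add: ew_def)
 qed
 \<comment> \<open>Where the homotopy does not depend on time its \<open>None\<close>-derivatives
   vanish, and each term of the contracted form contains one.\<close>
 moreover have "ew x is = 0" if x: "x ~: cball p R" for x "is"
 proof -
  have "pull D h om (pair x t) (None # map Some is) = 0" for t
  proof -
   have o: "open {z. prj z : - cball p R}" by (rule open_prj_vimage) auto
   have "partial None (%z. h z $ j) (pair x t) = partial None (%z. z $ Some j) (pair x t)" for j
    by (rule partial_cong[OF o]) (use hout x in auto)
   then have z: "partial None (%z. h z $ j) (pair x t) = 0" for j by (simp add: partial_nth)
   have "prod_list (map2 (%i j. partial i (%y. h y $ j) (pair x t)) (None # map Some is) js) = 0"
    if "length js = Suc (length is)" for js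
    using that by (cases js) (auto simp: z)
   then show ?thesis by (auto simp: pull_def intro!: sum.neutral)
  qed
  then show ?thesis by (simp add: ew_def homotopy_op_def)
 qed
 moreover have zg: "zero_germ om' b" if M: "open M" "b : M" "!!x is. x : M Int V ==> om (f x) is = 0" for b M
  unfolding zero_germ_def
 proof (intro exI conjI ballI allI)
  show "om' x is = 0" if "x : M" for x "is"
   using M(3) that by (auto simp: om'_def pull_def intro!: sum.neutral)
 qed (use M in auto)
 have "zero_germ om' b" if b: "b : B Int cball p r" for b
 proof -
  obtain M where M: "open M" "b : M" "ALL x:M Int V. h (pair x 1) : B" using hM[OF b] by (elim exE conjE) (rule that)
  have "om (f x) is = 0" if "x : M Int V" for x "is"
   using flat_on_imp_zero[OF omB] M(3) that by (auto simp: f_def)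
  then show ?thesis using zg M(1,2) by blast
 qed
 moreover have "zero_germ om' b" if b: "b : B" and c: "ALL c:B. dist c b < d --> zero_germ om c" for b
 proof -
  have bV: "b : V" using b BV by blast
  have "zero_germ om (f b)" using c hd1[OF bV] fB b by (auto simp: f_def)
  then obtain M where M: "open M" "f b : M" "ALL x:M. ALL is. om x is = 0" unfolding zero_germ_def by blast
  have "open (V Int f -` M)" by (rule continuous_open_preimage[OF smooth_map_on_imp_continuous_on[OF sf] V M(1)])
  then show ?thesis by (rule zg) (use bV M in auto)
 qed
 ultimately show ?thesis by blast
qed

lemma partial_lfsum:
 assumes "open W" "x : W" "finite F" "F <= P" "!!p y. p : P - F ==> y : W ==> g p y = 0"
  and "!!p. p : F ==> g p differentiable (at x)"
 shows "partial i (lfsum P g) x = (SUM p:F. partial i (g p) x)"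
proof -
 have "partial i (lfsum P g) x = partial i (%y. SUM p:F. g p y) x"
 proof (rule partial_cong[OF assms(1,2)])
  fix y assume "y : W"
  then show "lfsum P g y = (SUM p:F. g p y)" by (intro lfsum_eq[OF assms(3,4)] assms(5))
 qed
 also have "\<dots> = (SUM p:F. partial i (g p) x)" by (rule partial_sum) (rule assms(6))
 finally show ?thesis .
qed

text \<open>Flattening steps are strung along an enumeration of the covering balls. Displacements
  shrink fast enough to preserve earlier vanishing, and local finiteness makes the sequence of forms
  stationary near each point, so that the primitives add up.\<close>

lemma flat_cocycle_vanishing_near:
 fixes V B :: "(real^'n::finite) set"
 assumes V: "open V" and B: "closedin (top_of_set V) B"
  and ch: "!!p. p : V ==> EX W ph py S. p : W & quadrant_chart V B W ph py S"
  and om0: "flat_form B V k om0" "ext_d V om0 = (%_ _. 0)"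
 obtains ew where "prev_form V k ew" "!!is. flat_on B V (%x. ew x is)"
  "!!b. b : B ==> zero_germ (%x is. om0 x is + ext_d V ew x is) b"
proof -
 have BV: "B <= V" using B closedin_subset by fastforce
 have "EX rh>0. EX W ph py S. cball p (4 * rh) <= W & quadrant_chart V B W ph py S" if p: "p : V" for p
 proof -
  obtain W ph py S where W: "p : W" "quadrant_chart V B W ph py S" using ch[OF p] by blast
  then have "open W" by (simp add: quadrant_chart_def)
  then obtain e where e: "e > 0" "cball p e <= W" using W(1) open_contains_cball_eq by metis
  then have "cball p (4 * (e / 4)) <= W" by simp
  then show ?thesis using W(2) e(1) by (intro exI[of _ "e / 4"]) auto
 qed
 then obtain rh where rh: "!!p. p : V ==> rh p > 0" "!!p. p : V ==> EX W ph py S. cball p (4 * rh p) <= W & quadrant_chart V B W ph py S"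
  by metis
 obtain P r where P: "countable P" "P <= V" "!!p. p : P ==> 0 < r p & r p <= rh p & cball p (4 * r p) <= V"
  "V = (UN p:P. ball p (r p))"
  "!!x. x : V ==> EX W. open W & x : W & W <= V & finite {p:P. cball p (4 * r p) Int W ~= {}}"
  by (rule locally_finite_balls[OF V, of rh]) (use rh(1) in blast)+
 define I where "I = to_nat_on P ` P"
 define pt where "pt m = from_nat_into P m" for m
 have pt: "m : I ==> pt m : P" for m using P(1) by (auto simp: I_def pt_def)
 have pt_to: "p : P ==> pt (to_nat_on P p) = p" for p using P(1) by (simp add: pt_def)
 \<comment> \<open>Thanks to the halving, all later displacements together amount to at most
   \<open>r p\<close> for every earlier ball, so a region of radius \<open>2 * r p\<close> never
   shrinks below \<open>r p\<close>.\<close>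
 define d where "d m = (1/2)^(Suc m) * Min ((%j. if j : I then r (pt j) else 1) ` {..m})" for m :: nat
 have dpos: "d m > 0" for m
 proof -
  let ?S = "(%j. if j : I then r (pt j) else 1) ` {..m}"
  have "Min ?S : ?S" by (rule Min_in) auto
  then obtain j where "Min ?S = (if j : I then r (pt j) else 1)" by (elim imageE)
  moreover have "(if j : I then r (pt j) else 1) > 0" using P(3) pt by simp
  ultimately have "Min ?S > 0" by (simp only:)
  then show ?thesis unfolding d_def by (intro mult_pos_pos) simp_all
 qed
 have dle: "d m <= (1/2)^(Suc m) * r (pt j)" if "j <= m" "j : I" for j m
 proof -
  have "Min ((%j. if j : I then r (pt j) else 1) ` {..m}) <= r (pt j)"
   using that by (intro Min_le) (auto intro!: image_eqI[of _ _ j])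
  then show ?thesis unfolding d_def by (intro mult_left_mono) auto
 qed
 define good where "good om \<longleftrightarrow> flat_form B V k om & ext_d V om = (%_ _. 0)" for om
 define stp where "stp m om om' ew \<longleftrightarrow> good om' & prev_form V k ew & (ALL is. flat_on B V (%x. ew x is)) &
  (ALL x is. x : V --> om' x is - om x is = ext_d V ew x is) &
  (ALL x is. (m ~: I \<or> x ~: cball (pt m) (4 * r (pt m))) --> ew x is = 0) &
  (m : I --> (ALL b:B Int cball (pt m) (2 * r (pt m)). zero_germ om' b)) &
  (ALL b:B. (ALL c:B. dist c b < d m --> zero_germ om c) --> zero_germ om' b)" for m om om' ew
 have ex: "EX om' ew. stp m om om' ew" if g: "good om" for m om
 proof (cases "m : I")
  case True
  then have p: "pt m : P" "pt m : V" using pt P(2) by auto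
  have rp: "0 < r (pt m)" "r (pt m) <= rh (pt m)" using P(3)[OF p(1)] by auto
  obtain W ph py S where W: "cball (pt m) (4 * rh (pt m)) <= W" "quadrant_chart V B W ph py S" using rh(2)[OF p(2)] by blast
  have "cball (pt m) (4 * r (pt m)) <= cball (pt m) (4 * rh (pt m))" using rp by (intro subset_cball) auto
  then have W': "cball (pt m) (4 * r (pt m)) <= W" using W(1) by blast
  have rr: "0 < 2 * r (pt m)" "2 * r (pt m) < 4 * r (pt m)" using rp by auto
  show ?thesis
   using flattening_step[OF V B W(2) rr W' dpos[of m], of k om] g True unfolding stp_def good_def by auto
 next
  case False
  have "zero_germ om b" if "b : B" "ALL c:B. dist c b < d m --> zero_germ om c" for b
   using that dpos[of m] by auto
  \<comment> \<open>Indices outside the enumeration are idle steps.\<close>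
  then have "stp m om om (%_ _. 0)" using g False by (simp add: stp_def prev_form_def)
  then show ?thesis by blast
 qed
 define S1 where "S1 m om = (SOME om'. EX ew. stp m om om' ew)" for m om
 define S2 where "S2 m om = (SOME ew. stp m om (S1 m om) ew)" for m om
 have S: "stp m om (S1 m om) (S2 m om)" if "good om" for m om
 proof -
  have "EX ew. stp m om (S1 m om) ew" unfolding S1_def by (rule someI_ex[OF ex[OF that]])
  then show ?thesis unfolding S2_def by (rule someI_ex)
 qed
 define w where "w = rec_nat om0 S1"
 have w0: "w 0 = om0" and wS: "w (Suc m) = S1 m (w m)" for m by (simp_all add: w_def)
 have gw: "good (w m)" for m
 proof (induction m)
  case 0 then show ?case using om0 by (simp add: w0 good_def)
 next
  case (Suc m) then show ?case using S[OF Suc, of m] by (simp add: wS stp_def)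
 qed
 define e where "e m = S2 m (w m)" for m
 have st: "stp m (w m) (w (Suc m)) (e m)" for m using S[OF gw] by (simp add: wS e_def)
 have ep: "prev_form V k (e m)" and ef: "flat_on B V (%x. e m x is)" for m "is" using st[of m] by (auto simp: stp_def)
 have eq: "x : V ==> w (Suc m) x is - w m x is = ext_d V (e m) x is" for m x "is" using st[of m] by (auto simp: stp_def)
 have e0: "m ~: I \<or> x ~: cball (pt m) (4 * r (pt m)) ==> e m x is = 0" for m x "is" using st[of m] by (auto simp: stp_def)
 have z1: "m : I ==> b : B ==> b : cball (pt m) (2 * r (pt m)) ==> zero_germ (w (Suc m)) b" for m b
  using st[of m] by (auto simp: stp_def)
 have z2: "b : B ==> (!!c. c : B ==> dist c b < d m ==> zero_germ (w m) c) ==> zero_germ (w (Suc m)) b" for m b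
  using st[of m] by (auto simp: stp_def)
 \<comment> \<open>The radius on which vanishing is guaranteed after \<open>n\<close> further steps:
   it starts at twice the covering radius and stays above that radius.\<close>
 have zz: "zero_germ (w (Suc j + n)) b" if j: "j : I" and b: "b : B" "dist (pt j) b <= r (pt j) * (1 + (1/2)^n)" for j n b
  using b
 proof (induction n arbitrary: b)
  case 0
  then show ?case using z1[OF j, of b] by (simp add: mult.commute)
 next
  case (Suc n)
  have rp: "0 < r (pt j)" using P(3) pt[OF j] by blast
  have "zero_germ (w (Suc (Suc j + n))) b"
  proof (rule z2[OF Suc.prems(1)])
   fix c assume c: "c : B" "dist c b < d (Suc j + n)"
   have "(1/2::real)^(Suc (Suc j + n)) <= (1/2)^(Suc n)" by (intro power_decreasing) auto
   then have "(1/2)^(Suc (Suc j + n)) * r (pt j) <= (1/2)^(Suc n) * r (pt j)" using rp by (intro mult_right_mono) auto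
   moreover have "d (Suc j + n) <= (1/2)^(Suc (Suc j + n)) * r (pt j)" by (rule dle) (use j in auto)
   ultimately have "dist c b <= (1/2)^(Suc n) * r (pt j)" using c(2) by linarith
   moreover have "dist (pt j) c <= dist (pt j) b + dist c b" using dist_triangle2[of "pt j" c b] by simp
   ultimately have "dist (pt j) c <= r (pt j) * (1 + (1/2)^Suc n) + (1/2)^(Suc n) * r (pt j)"
    using Suc.prems(2) by linarith
   also have "\<dots> = r (pt j) * (1 + (1/2)^n)" by (simp add: algebra_simps)
   finally show "zero_germ (w (Suc j + n)) c" using Suc.IH[OF c(1)] by blast
  qed
  then show ?case by simp
 qed
 have lf: "EX W N. open W & x : W & W <= V & (ALL m y is. N <= m --> y : W --> e m y is = 0)" if x: "x : V" for x
 proof -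
  obtain W where W: "open W" "x : W" "W <= V" "finite {p:P. cball p (4 * r p) Int W ~= {}}"
   using P(5)[OF x] by (elim exE conjE) (rule that)
  let ?J = "to_nat_on P ` {p:P. cball p (4 * r p) Int W ~= {}}"
  have fin: "finite ?J" using W(4) by simp
  have "e m y is = 0" if "Suc (Max (insert 0 ?J)) <= m" "y : W" for m y "is"
  proof (rule e0, rule ccontr)
   assume "\<not> (m ~: I \<or> y ~: cball (pt m) (4 * r (pt m)))"
   then have m: "m : I" "y : cball (pt m) (4 * r (pt m))" by (simp_all only: de_Morgan_disj not_not)
   then obtain p where p: "p : P" "m = to_nat_on P p" unfolding I_def by (elim imageE)
   then have "p : {p:P. cball p (4 * r p) Int W ~= {}}" using pt_to[OF p(1)] m(2) that(2) by auto
   then have "m : ?J" using p(2) by (rule rev_image_eqI)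
   then have "m <= Max (insert 0 ?J)" using fin by (intro Max_ge) auto
   then show False using that(1) by simp
  qed
  then show ?thesis using W(1-3) by blast
 qed
 define ew where "ew x is = lfsum UNIV (%m x. e m x is) x" for x "is"
 have eweq: "lfsum UNIV (%m x. e m x is) y = (SUM m<N. e m y is)" if "!!m. N <= m ==> e m y is = 0" for y "is" N
  by (rule lfsum_eq) (use that in auto)
 have ewflat: "flat_on B V (%x. ew x is)" for "is"
  unfolding ew_def
 proof (rule flat_on_lfsum[OF V BV ef])
  fix x assume "x : V"
  then obtain W N where W: "open W" "x : W" "!!m y is. N <= m ==> y : W ==> e m y is = 0" using lf[of x] by metis
  have "{m : UNIV. EX y:W. e m y is ~= 0} <= {..<N}" using W(3) by (auto simp: not_le[symmetric])
  then show "EX W. open W & x : W & finite {m : UNIV. EX y:W. e m y is ~= 0}"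
   using W(1,2) finite_subset[OF _ finite_lessThan] by blast
 qed
 have ewprev: "prev_form V k ew"
 proof (cases k)
  case 0
  then have "e m = (%_ _. 0)" for m using ep[of m] by (simp add: prev_form_def)
  then show ?thesis using 0 by (simp add: prev_form_def ew_def[abs_def] lfsum_def)
 next
  case (Suc l)
  then have el: "form_on V l (e m)" for m using ep[of m] by (simp add: prev_form_def)
  have "form_on V l ew" unfolding form_on_def
  proof (intro conjI allI impI)
   show z: "ew x is = 0" if "x ~: V \<or> length is ~= l" for x "is"
    using that form_onD(1,2)[OF el] by (auto simp: ew_def lfsum_def intro!: sum.neutral)
   show "smooth_on V (%x. ew x is)" for "is" by (rule flat_on_imp_smooth[OF ewflat])
   show "alternating (ew x)" for x
   proof (cases "x : V")
    case True
    then obtain W N where W: "x : W" "!!m y is. N <= m ==> y : W ==> e m y is = 0" using lf[of x] by metis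
    have "ew x is = (SUM m<N. e m x is)" for "is" unfolding ew_def by (rule eweq) (use W in auto)
    then show ?thesis using form_onD(3)[OF el, of _ x]
     by (simp add: alternating_def sum_negf)
   next
    case False
    then have "ew x is = 0" for "is" using z by blast
    then show ?thesis by (simp add: alternating_def)
   qed
  qed
  then show ?thesis using Suc by (simp add: prev_form_def)
 qed
 have "zero_germ (%x is. om0 x is + ext_d V ew x is) b" if b: "b : B" for b
 proof -
  have bV: "b : V" using b BV by blast
  obtain W N where W: "open W" "b : W" "W <= V" "!!m y is. N <= m ==> y : W ==> e m y is = 0" using lf[OF bV] by metis
  obtain p where p: "p : P" "b : ball p (r p)" using bV P(4) by blast
  define j where "j = to_nat_on P p"
  have j: "j : I" "pt j = p" using p(1) pt_to by (auto simp: I_def j_def)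
  \<comment> \<open>By stage \<open>M\<close> the step for the ball containing \<open>b\<close> has
    been made, and no later primitive is felt on \<open>W\<close>.\<close>
  define M where "M = Suc j + N"
  have zM: "zero_germ (w M) b" unfolding M_def
  proof (rule zz[OF j(1) b])
   have "0 < r p" using P(3)[OF p(1)] by blast
   then have "r p <= r p * (1 + (1/2)^N)" by simp
   then show "dist (pt j) b <= r (pt j) * (1 + (1/2)^N)" using p(2) j(2) by (simp add: less_imp_le order_trans)
  qed
  have "om0 y is + ext_d V ew y is = w M y is" if y: "y : W" for y "is"
  proof -
   have yV: "y : V" using y W(3) by blast
   have dif: "(%x. e m x js) differentiable (at y)" for m js
    by (rule smooth_on_imp_differentiable[OF flat_on_imp_smooth[OF ef] yV])
   have "partial i (%x. ew x js) y = (SUM m<M. partial i (%x. e m x js) y)" for i js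
    unfolding ew_def by (rule partial_lfsum[OF W(1) y]) (use W(4) dif in \<open>auto simp: M_def\<close>)
   then have "ext_d V ew y is = (SUM m<M. ext_d V (e m) y is)"
    using yV by (simp add: ext_d_eq sum_distrib_left sum.swap[of _ "{..<M}"] del: sum.lessThan_Suc)
   also have "\<dots> = (SUM m<M. w (Suc m) y is - w m y is)" using eq[OF yV] by simp
   also have "\<dots> = w M y is - om0 y is"
    using sum_lessThan_telescope[of "%m. w m y is" M] by (simp only: w0)
   finally show ?thesis by simp
  qed
  moreover obtain Z where "open Z" "b : Z" "ALL x:Z. ALL is. w M x is = 0" using zM unfolding zero_germ_def by blast
  ultimately show ?thesis unfolding zero_germ_def using W(1,2) by (intro exI[of _ "W Int Z"]) auto
 qed
 then show thesis using that[of ew] ewprev ewflat by blast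
qed


section \<open>Real-analytic germs\<close>

text \<open>A germ at the origin is treated as analytic when it is the restriction to real points of a
  complex-differentiable function with continuous derivative; this makes closure under composition,
  parameter integrals and implicit functions immediate.\<close>

definition hold :: "real => (complex^'n::finite => complex) => ('n => complex^'n => complex) => bool" where
 "hold r F F' \<longleftrightarrow> 0 < r & (ALL z:ball 0 r. (F has_derivative (%h. SUM i:UNIV. h$i * F' i z)) (at z)) &
  (ALL i. continuous_on (ball 0 r) (F' i))"

definition cv :: "real^'n::finite => complex^'n" where
 "cv x = (\<chi> i. complex_of_real (x$i))"

definition ana :: "(real^'n::finite => real) => bool" where
 "ana f \<longleftrightarrow> (EX r F F'. hold r F F' & (ALL x:ball 0 r. F (cv x) = complex_of_real (f x)))"

lemma cv_nth [simp]: "cv x $ i = complex_of_real (x $ i)"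
 by (simp add: cv_def)

lemma norm_cv [simp]: "norm (cv x) = norm x"
 by (simp add: norm_vec_def)

lemma bounded_linear_cv: "bounded_linear cv"
 by (intro linear_conv_bounded_linear[THEN iffD1] linearI) (simp_all add: vec_eq_iff complex_eq_iff)

lemma norm_axis_complex: "norm (axis i w :: complex^'n::finite) = norm w"
proof -
 have "(SUM j:UNIV. (norm ((axis i w :: complex^'n) $ j))^2) = (SUM j:(UNIV::'n set). if j = i then (norm w)^2 else 0)"
  by (intro sum.cong) (auto simp: axis_def)
 then show ?thesis by (simp add: norm_vec_def L2_set_def)
qed

lemma has_derivative_vec_components:
 fixes f :: "'a::real_normed_vector => 'b::euclidean_space^'n::finite"
 assumes "!!j. ((%x. f x $ j) has_derivative D j) (at x)"
 shows "(f has_derivative (%h. \<chi> j. D j h)) (at x)"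
proof -
 have bl: "bounded_linear (axis j :: 'b => 'b^'n)" for j
  by (intro linear_conv_bounded_linear[THEN iffD1] linearI) (simp_all add: vec_eq_iff axis_def)
 have eq: "(SUM j:UNIV. axis j (v j)) = vec_lambda v" for v :: "'n => 'b"
  by (simp add: vec_eq_iff axis_def)
 have "((%x. SUM j:UNIV. axis j (f x $ j)) has_derivative (%h. SUM j:UNIV. axis j (D j h))) (at x)"
  by (intro has_derivative_sum bounded_linear.has_derivative[OF bl] assms)
 then show ?thesis by (simp add: eq)
qed

lemma holdD:
 assumes "hold r F F'"
 shows "0 < r" "z : ball 0 r ==> (F has_derivative (%h. SUM i:UNIV. h$i * F' i z)) (at z)"
  "continuous_on (ball 0 r) (F' i)" "continuous_on (ball 0 r) F"
proof -
 show "0 < r" "z : ball 0 r ==> (F has_derivative (%h. SUM i:UNIV. h$i * F' i z)) (at z)"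
  "continuous_on (ball 0 r) (F' i)" for z i using assms by (auto simp: hold_def)
 then show "continuous_on (ball 0 r) F"
  by (intro continuous_at_imp_continuous_on) (meson assms hold_def has_derivative_continuous)
qed

lemma hold_subset: "hold r F F' ==> 0 < s ==> s <= r ==> hold s F F'"
 unfolding hold_def by (meson continuous_on_subset subset_ball subsetD)

lemma hold_const: "0 < r ==> hold r (%_. c) (%_ _. 0)"
 by (simp add: hold_def)

lemma hold_nth: "0 < r ==> hold r (%z. z $ j) (%i _. if i = j then 1 else 0)"
 unfolding hold_def
 by (auto simp: if_distrib cong: if_cong intro!: bounded_linear_imp_has_derivative bounded_linear_vec_nth)

lemma hold_add: "hold r F F' ==> hold r G G' ==> hold r (%z. F z + G z) (%i z. F' i z + G' i z)"
 unfolding hold_def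
 by (auto simp: distrib_left sum.distrib intro!: has_derivative_add continuous_on_add)

lemma hold_mult:
 assumes F: "hold r F F'" and G: "hold r G G'"
 shows "hold r (%z. F z * G z) (%i z. F z * G' i z + F' i z * G z)"
 unfolding hold_def
proof (intro conjI ballI allI)
 fix z :: "complex^'a" assume z: "z : ball 0 r"
 have "((%z. F z * G z) has_derivative (%h. F z * (SUM i:UNIV. h$i * G' i z) + (SUM i:UNIV. h$i * F' i z) * G z)) (at z)"
  by (rule has_derivative_mult[OF holdD(2)[OF F z] holdD(2)[OF G z]])
 then show "((%z. F z * G z) has_derivative (%h. SUM i:UNIV. h$i * (F z * G' i z + F' i z * G z))) (at z)"
  by (simp add: sum_distrib_left sum_distrib_right sum.distrib distrib_left mult.assoc mult.left_commute)
qed (auto intro!: continuous_intros holdD[OF F] holdD[OF G])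

lemma hold_compose:
 fixes G :: "complex^'m::finite => complex^'n::finite"
 assumes F: "hold r F F'" and G: "!!j. hold s (%z. G z $ j) (G' j)" and sub: "G ` ball 0 s <= ball 0 r"
 shows "hold s (%z. F (G z)) (%i z. SUM j:UNIV. G' j i z * F' j (G z))"
 unfolding hold_def
proof (intro conjI ballI allI)
 show "0 < s" using holdD(1)[OF G] .
 have cG: "continuous_on (ball 0 s) G"
  using continuous_on_vec_lambda[of "ball 0 s" "%j z. G z $ j"] holdD(4)[OF G] by simp
 fix z :: "complex^'m" assume z: "z : ball 0 s"
 have "(G has_derivative (%h. \<chi> j. SUM i:UNIV. h$i * G' j i z)) (at z)"
  by (rule has_derivative_vec_components) (rule holdD(2)[OF G z])
 moreover have "G z : ball 0 r" using z sub by blast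
 from holdD(2)[OF F this] have "(F has_derivative (%h. SUM i:UNIV. h$i * F' i (G z))) (at (G z))" .
 ultimately have "(F \<circ> G has_derivative (%h. SUM i:UNIV. h$i * F' i (G z)) \<circ> (%h. \<chi> j. SUM i:UNIV. h$i * G' j i z)) (at z)"
  by (rule diff_chain_at)
 moreover have "(SUM j:UNIV. (SUM i:UNIV. h$i * G' j i z) * F' j (G z)) = (SUM i:UNIV. h$i * (SUM j:UNIV. G' j i z * F' j (G z)))" for h
  unfolding sum_distrib_left sum_distrib_right by (subst sum.swap) (simp add: mult.assoc)
 ultimately show "((%z. F (G z)) has_derivative (%h. SUM i:UNIV. h$i * (SUM j:UNIV. G' j i z * F' j (G z)))) (at z)"
  by (simp add: o_def)
next
 fix i
 have cG: "continuous_on (ball 0 s) G"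
  using continuous_on_vec_lambda[of "ball 0 s" "%j z. G z $ j"] holdD(4)[OF G] by simp
 have "continuous_on (ball 0 s) (%z. F' j (G z))" for j
  by (rule continuous_on_compose2[OF holdD(3)[OF F] cG sub])
 then show "continuous_on (ball 0 s) (%z. SUM j:UNIV. G' j i z * F' j (G z))"
  by (intro continuous_on_sum continuous_on_mult holdD(3)[OF G])
qed

text \<open>Two affine substitutions are needed, shifts along a circle for the Cauchy formula and
  scalings of one coordinate for the Taylor remainder; \<open>a\<close> and \<open>b\<close> cover
  both.\<close>

lemma hold_integral:
 fixes F :: "complex^'n::finite => complex"
 assumes F: "hold r F F'" and r': "0 < r'"
  and a: "!!j. continuous_on {0..1} (%s. a s j)" and b: "!!j. continuous_on {0..1} (%s. b s j)" and w: "continuous_on {0..1} w"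
  and M: "!!s z. s : {0..1::real} ==> z : ball 0 r' ==> M s z : ball 0 r" and Mdef: "M = (%s z. \<chi> j. a s j * z $ j + b s j)"
 shows "hold r' (%z. integral {0..1} (%s. w s * F (M s z))) (%i z. integral {0..1} (%s. w s * (a s i * F' i (M s z))))"
proof -
 have cM: "continuous_on (ball 0 r' \<times> {0..1}) (%p. M (snd p) (fst p))"
  unfolding Mdef
  by (intro continuous_on_vec_lambda continuous_intros continuous_on_compose2[OF a] continuous_on_compose2[OF b]) auto
 have Msub: "(%p. M (snd p) (fst p)) ` (ball 0 r' \<times> {0..1}) <= ball 0 r" using M by auto
 have c1: "continuous_on (ball 0 r' \<times> {0..1}) (%p. g (M (snd p) (fst p)))" if "continuous_on (ball 0 r) g" for g :: "complex^'n => complex"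
  by (rule continuous_on_compose2[OF that cM Msub])
 have cw: "continuous_on (ball 0 r' \<times> {0..1}) (%p. w (snd p))" "continuous_on (ball 0 r' \<times> {0..1}) (%p. a (snd p) i)"
  for i by (auto intro!: continuous_on_compose2[OF w] continuous_on_compose2[OF a] continuous_intros)
 define c where "c i z s = w s * (a s i * F' i (M s z))" for i z s
 have cc: "continuous_on (ball 0 r' \<times> {0..1}) (%p. c i (fst p) (snd p))" for i
  unfolding c_def by (intro continuous_on_mult cw c1 holdD(3)[OF F])
 define fx :: "complex^'n => real => (complex^'n) \<Rightarrow>\<^sub>L complex" where
  "fx z s = (SUM i:UNIV. blinfun_mult_left (c i z s) o\<^sub>L Blinfun (%h. h $ i))" for z s
 have fx: "blinfun_apply (fx z s) h = (SUM i:UNIV. h$i * c i z s)" for z s h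
  unfolding fx_def by (simp add: blinfun.sum_left bounded_linear_Blinfun_apply bounded_linear_vec_nth)
 have cfx: "continuous_on (ball 0 r' \<times> cbox 0 1) (%(z, s). fx z s)"
  unfolding fx_def case_prod_unfold using cc
  by (intro continuous_on_sum bounded_bilinear.continuous_on[OF bounded_bilinear_blinfun_compose]
    bounded_linear.continuous_on[OF bounded_linear_blinfun_mult_left] continuous_on_const) auto
 have one: "continuous_on {0..1} (%s. g (z, s))" if "continuous_on (ball 0 r' \<times> {0..1}) g" "z : ball 0 r'" for g :: "_ => 'z::topological_space" and z
  by (rule continuous_on_compose2[OF that(1)]) (use that(2) in \<open>auto intro!: continuous_intros\<close>)
 have int: "(%s. w s * F (M s z)) integrable_on cbox 0 1" if z: "z : ball 0 r'" for z
 proof -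
  have "continuous_on (ball 0 r' \<times> {0..1}) (%p. w (snd p) * F (M (snd p) (fst p)))"
   by (intro continuous_on_mult cw c1 holdD(4)[OF F])
  from one[OF this z] show ?thesis by (simp add: integrable_continuous_interval)
 qed
 have der: "((%z. w s * F (M s z)) has_derivative blinfun_apply (fx z s)) (at z within ball 0 r')"
  if z: "z : ball 0 r'" and s: "s : cbox 0 1" for z s
 proof -
  have "((%z. M s z) has_derivative (%h. \<chi> j. a s j * h $ j)) (at z)"
   unfolding Mdef by (rule has_derivative_vec_components) (auto intro!: derivative_eq_intros bounded_linear_imp_has_derivative bounded_linear_vec_nth)
  moreover have "(F has_derivative (%h. SUM i:UNIV. h$i * F' i (M s z))) (at (M s z))"
   by (rule holdD(2)[OF F M]) (use z s in auto)
  ultimately have "(F \<circ> (%z. M s z) has_derivative (%h. SUM i:UNIV. h$i * F' i (M s z)) \<circ> (%h. \<chi> j. a s j * h $ j)) (at z)"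
   by (rule diff_chain_at)
  then have "((%z. F (M s z)) has_derivative (%h. SUM i:UNIV. a s i * h$i * F' i (M s z))) (at z)" by (simp add: o_def)
  then have "((%z. w s * F (M s z)) has_derivative (%h. w s * (SUM i:UNIV. a s i * h$i * F' i (M s z)))) (at z)"
   by (rule has_derivative_mult_right)
  moreover have "(%h. w s * (SUM i:UNIV. a s i * h$i * F' i (M s z))) = blinfun_apply (fx z s)"
   by (intro ext) (simp add: fx c_def sum_distrib_left mult_ac)
  ultimately have "((%z. w s * F (M s z)) has_derivative blinfun_apply (fx z s)) (at z)" by (simp only:)
  then show ?thesis by (rule has_derivative_at_withinI)
 qed
 show ?thesis unfolding hold_def
 proof (intro conjI ballI allI r')
  fix z :: "complex^'n" assume z: "z : ball 0 r'"
  have "((%z. integral (cbox 0 1) (%s. w s * F (M s z))) has_derivative blinfun_apply (integral (cbox 0 1) (fx z))) (at z within ball 0 r')"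
   by (rule leibniz_rule[OF der int cfx z convex_ball])
  then have 1: "((%z. integral {0..1} (%s. w s * F (M s z))) has_derivative blinfun_apply (integral {0..1} (fx z))) (at z)"
   using z by (simp add: at_within_open[OF _ open_ball])
  have "continuous_on {0..1} (%s. fx z s)" using one[OF cfx[simplified] z] by simp
  then have "fx z integrable_on {0..1}" by (rule integrable_continuous_interval)
  then have "blinfun_apply (integral {0..1} (fx z)) h = integral {0..1} (%s. SUM i:UNIV. h$i * c i z s)" for h
   using blinfun_apply_integral[of "fx z" "{0..1}" h] by (simp add: fx)
  moreover have ci: "(%s. c i z s) integrable_on {0..1}" for i
   using one[OF cc z] by (intro integrable_continuous_interval) simp
  have "integral {0..1} (%s. SUM i:UNIV. h$i * c i z s) = (SUM i:UNIV. integral {0..1} (%s. h$i * c i z s))" for h :: "complex^'n"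
   by (rule Henstock_Kurzweil_Integration.integral_sum) (simp_all add: integrable_on_mult_right ci)
  then have "integral {0..1} (%s. SUM i:UNIV. h$i * c i z s) = (SUM i:UNIV. h$i * integral {0..1} (%s. c i z s))" for h :: "complex^'n"
   by simp
  ultimately have "blinfun_apply (integral {0..1} (fx z)) = (%h. SUM i:UNIV. h$i * integral {0..1} (%s. c i z s))"
   by (intro ext) (simp only:)
  with 1 show "((%z. integral {0..1} (%s. w s * F (M s z))) has_derivative
    (%h. SUM i:UNIV. h$i * integral {0..1} (%s. w s * (a s i * F' i (M s z))))) (at z)"
   by (simp only: c_def)
 next
  fix i
  have "continuous_on (ball 0 r') (%z. integral (cbox 0 1) (%s. c i z s))"
   by (rule integral_continuous_on_param) (use cc in \<open>simp add: case_prod_unfold\<close>)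
  then show "continuous_on (ball 0 r') (%z. integral {0..1} (%s. w s * (a s i * F' i (M s z))))"
   by (simp add: c_def)
 qed
qed

section \<open>Algebra, composition and derivatives of analytic germs\<close>

lemma anaE:
 assumes "ana f"
 obtains r F F' where "hold r F F'" "!!x. norm x < r ==> F (cv x) = complex_of_real (f x)"
 using assms unfolding ana_def by auto

lemma anaI: "hold r F F' ==> (!!x. norm x < r ==> F (cv x) = complex_of_real (f x)) ==> ana f"
 unfolding ana_def by (intro exI[of _ r] exI[of _ F] exI[of _ F']) auto

lemma ana_const [simp]: "ana (%_. c)"
 by (rule anaI[OF hold_const[OF zero_less_one]]) auto

lemma ana_nth [simp]: "ana (%x. x $ j)"
 by (rule anaI[OF hold_nth[OF zero_less_one, of j]]) auto

lemma ana_common: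
 assumes "ana f" "ana g"
 obtains r F F' G G' where "hold r F F'" "hold r G G'" "!!x. norm x < r ==> F (cv x) = complex_of_real (f x)"
  "!!x. norm x < r ==> G (cv x) = complex_of_real (g x)"
proof -
 obtain r F F' where F: "hold r F F'" "!!x. norm x < r ==> F (cv x) = complex_of_real (f x)" using assms(1) by (rule anaE) blast
 obtain s G G' where G: "hold s G G'" "!!x. norm x < s ==> G (cv x) = complex_of_real (g x)" using assms(2) by (rule anaE) blast
 show thesis
  by (rule that[OF hold_subset[OF F(1), of "min r s"] hold_subset[OF G(1), of "min r s"]])
   (use F G holdD(1)[OF F(1)] holdD(1)[OF G(1)] in auto)
qed

lemma ana_add: "ana f ==> ana g ==> ana (%x. f x + g x)"
 by (erule (1) ana_common, rule anaI, erule (1) hold_add) simp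

lemma ana_mult: "ana f ==> ana g ==> ana (%x. f x * g x)"
 by (erule (1) ana_common, rule anaI, erule (1) hold_mult) simp

lemma ana_diff: "ana f ==> ana g ==> ana (%x. f x - g x)"
 using ana_add[of f "%x. (-1) * g x"] ana_mult[of "%_. -1" g] by simp

lemma ana_sum: "(!!k. k : K ==> ana (f k)) ==> ana (%x. SUM k:K. f k x)"
 by (induction K rule: infinite_finite_induct) (auto intro!: ana_add)

lemma ana_prod: "(!!k. k : K ==> ana (f k)) ==> ana (%x. PROD k:K. f k x)"
 by (induction K rule: infinite_finite_induct) (auto intro!: ana_mult)

lemma ana_power: "ana f ==> ana (%x. f x ^ k)"
 by (induction k) (auto intro!: ana_mult)

lemma ana_compose:
 fixes si :: "real^'m::finite => real^'n::finite"
 assumes "ana f" "!!j. ana (%x. si x $ j)" "si 0 = 0"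
 shows "ana (%x. f (si x))"
proof -
 obtain r F F' where F: "hold r F F'" "!!x. norm x < r ==> F (cv x) = complex_of_real (f x)" using assms(1) by (rule anaE) blast
 have "EX s G G'. hold s G G' & (ALL x. norm x < s --> G (cv x) = complex_of_real (si x $ j))" for j
  using assms(2)[of j] by (rule anaE) blast
 then obtain s G G' where G: "!!j. hold (s j) (G j) (G' j)" "!!j x. norm x < s j ==> G j (cv x) = complex_of_real (si x $ j)"
  by metis
 define s0 where "s0 = Min (range s)"
 have s0: "0 < s0" "!!j. s0 <= s j" using holdD(1)[OF G(1)] by (auto simp: s0_def)
 define H where "H z = (\<chi> j. G j z)" for z
 have H: "hold s0 (%z. H z $ j) (G' j)" for j unfolding H_def by (simp, rule hold_subset[OF G(1) s0])
 have cH: "continuous_on (ball 0 s0) H"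
  unfolding H_def by (intro continuous_on_vec_lambda holdD(4)[OF hold_subset[OF G(1) s0]])
 have Hcv: "norm x < s0 ==> H (cv x) = cv (si x)" for x
  using G(2) s0(2) by (auto simp: H_def vec_eq_iff intro: less_le_trans)
 have "cv 0 = (0 :: complex^'m)" "cv 0 = (0 :: complex^'n)" by (simp_all add: vec_eq_iff)
 then have "H 0 = 0" using Hcv[of 0] s0(1) assms(3) by simp
 moreover have "open (ball 0 s0 Int H -` ball 0 r)" by (rule continuous_open_preimage[OF cH open_ball open_ball])
 ultimately obtain t where t: "t > 0" "ball 0 t <= ball 0 s0 Int H -` ball 0 r"
  using openE[of "ball 0 s0 Int H -` ball 0 r" 0] s0(1) holdD(1)[OF F(1)] by auto
 define t0 where "t0 = min t s0"
 have t0: "0 < t0" "t0 <= s0" using t s0 by (auto simp: t0_def)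
 have sub: "H ` ball 0 t0 <= ball 0 r" using t(2) by (auto simp: t0_def subset_iff)
 have "hold t0 (%z. F (H z)) (%i z. SUM j:UNIV. G' j i z * F' j (H z))"
  by (rule hold_compose[OF F(1) hold_subset[OF H t0] sub])
 then show ?thesis
 proof (rule anaI)
  fix x :: "real^'m" assume x: "norm x < t0"
  then have "cv x : ball 0 t0" by simp
  then have "H (cv x) : ball 0 r" using sub by blast
  then have "norm (si x) < r" using Hcv[of x] x t0 by simp
  then show "F (H (cv x)) = complex_of_real (f (si x))" using F(2) Hcv[of x] x t0 by simp
 qed
qed

lemma hold_restrict_real:
 assumes F: "hold r F F'" and f: "!!x. norm x < r ==> F (cv x) = complex_of_real (f x)" and x: "norm x < r"
 shows "f differentiable (at x)" "complex_of_real (partial i f x) = F' i (cv x)"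
proof -
 have "(F \<circ> cv has_derivative (%h. SUM i:UNIV. h$i * F' i (cv x)) \<circ> cv) (at x)"
  by (rule diff_chain_at[OF bounded_linear_imp_has_derivative[OF bounded_linear_cv] holdD(2)[OF F]]) (use x in simp)
 then have d: "((%x. F (cv x)) has_derivative (%h. SUM i:UNIV. complex_of_real (h$i) * F' i (cv x))) (at x)"
  by (simp add: o_def)
 have o: "open (ball 0 r)" "x : ball 0 r" using x by auto
 have d2: "((%x. complex_of_real (f x)) has_derivative (%h. SUM i:UNIV. complex_of_real (h$i) * F' i (cv x))) (at x)"
  by (rule has_derivative_transform_within_open[OF d o]) (use f in auto)
 from bounded_linear.has_derivative[OF bounded_linear_Re d2]
 show df: "f differentiable (at x)" by (auto simp: differentiable_def)
 then have "(f has_derivative frechet_derivative f (at x)) (at x)" by (simp add: frechet_derivative_works)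
 from bounded_linear.has_derivative[OF bounded_linear_of_real this]
 have "((%x. complex_of_real (f x)) has_derivative (%h. complex_of_real (frechet_derivative f (at x) h))) (at x)" .
 from has_derivative_unique[OF this d2]
 have "complex_of_real (frechet_derivative f (at x) (axis i 1)) = (SUM k:UNIV. complex_of_real (axis i 1 $ k) * F' k (cv x))"
  by (rule fun_cong)
 also have "\<dots> = (SUM k:UNIV. if k = i then F' k (cv x) else 0)"
  by (intro sum.cong) (auto simp: axis_def)
 finally show "complex_of_real (partial i f x) = F' i (cv x)" by (simp add: partial_def)
qed

text \<open>The Cauchy formula in the \<open>i\<close>-th coordinate, with the circle parametrised
  over \<open>[0, 1]\<close> and the argument in the shape required by \<open>hold_integral\<close>.
  The radius \<open>r / 4\<close> keeps the circle around a point of norm below \<open>r / 2\<close>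
  inside the ball.\<close>

lemma Cauchy_partial:
 assumes F: "hold r F F'" and z: "norm z < r / 2"
 defines "c \<equiv> (%s. complex_of_real (r / 4) * exp (2 * of_real pi * \<i> * of_real s))"
 shows "F' i z = integral {0..1} (%s. inverse (c s) * F (\<chi> j. 1 * z $ j + (if j = i then c s else 0)))"
proof -
 have r: "0 < r" by (rule holdD(1)[OF F])
 define ph where "ph w = F (\<chi> j. 1 * z $ j + (if j = i then w else 0))" for w
 have lin: "(\<chi> j. 1 * z $ j + (if j = i then w else 0)) = z + axis i w" for w :: complex
  by (simp add: vec_eq_iff axis_def)
 have d: "(ph has_field_derivative F' i (z + axis i w)) (at w)" if w: "w : ball 0 (r / 2)" for w
 proof -
  have "norm (z + axis i w) < r" using norm_triangle_ineq[of z "axis i w"] z w by (simp add: norm_axis_complex)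
  then have "(F has_derivative (%h. SUM k:UNIV. h$k * F' k (z + axis i w))) (at (z + axis i w))"
   by (intro holdD(2)[OF F]) simp
  moreover have "((%w. z + axis i w) has_derivative (%h. axis i h)) (at w)"
  proof -
   have "bounded_linear (axis i :: complex => complex^'a)"
    by (intro linear_conv_bounded_linear[THEN iffD1] linearI) (simp_all add: vec_eq_iff axis_def)
   from bounded_linear_imp_has_derivative[OF this] show ?thesis
    by (auto intro!: derivative_eq_intros)
  qed
  ultimately have "(F \<circ> (%w. z + axis i w) has_derivative (%h. SUM k:UNIV. h$k * F' k (z + axis i w)) \<circ> (%h. axis i h)) (at w)"
   by (intro diff_chain_at) 
  moreover have "(%h. SUM k:UNIV. h$k * F' k (z + axis i w)) \<circ> (%h. axis i h) = (*) (F' i (z + axis i w))"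
  proof
   fix h
   have "(SUM k:UNIV. axis i h $ k * F' k (z + axis i w)) = (SUM k:UNIV. if k = i then h * F' k (z + axis i w) else 0)"
    by (intro sum.cong) (auto simp: axis_def)
   then show "((%h. SUM k:UNIV. h$k * F' k (z + axis i w)) \<circ> (%h. axis i h)) h = F' i (z + axis i w) * h" by simp
  qed
  moreover have "F \<circ> (%w. z + axis i w) = ph" by (rule ext) (simp only: ph_def lin o_def)
  ultimately show ?thesis unfolding has_field_derivative_def by simp
 qed
 have hol: "ph holomorphic_on ball 0 (r / 2)"
  by (rule holomorphic_onI) (use d in \<open>meson field_differentiable_at_within field_differentiable_def\<close>)
 have ci: "((%u. ph u / (u - 0) ^ Suc 1) has_contour_integral (2 * pi * \<i> / fact 1 * (deriv ^^ 1) ph 0)) (circlepath 0 (r / 4))"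
  by (rule Cauchy_has_contour_integral_higher_derivative_circlepath)
   (use r in \<open>auto intro!: holomorphic_on_imp_continuous_on holomorphic_on_subset[OF hol]\<close>)
 have "deriv ph 0 = F' i z" using DERIV_imp_deriv[OF d[of 0]] r by (simp add: axis_def zero_vec_def[symmetric])
 then have ci': "((%u. ph u / u^2) has_contour_integral (2 * pi * \<i> * F' i z)) (circlepath 0 (r / 4))"
  using ci by (simp add: power2_eq_square)
 have cp: "circlepath 0 (r / 4) s = c s" for s
  by (simp add: circlepath_def part_circlepath_def linepath_def c_def mult_ac)
 have nz: "c s ~= 0" for s using r by (simp add: c_def)
 have "vector_derivative (circlepath 0 (r / 4)) (at s within {0..1}) = 2 * pi * \<i> * c s" if "s : {0..1}" for s
  using vector_derivative_circlepath01[of s 0 "r / 4"] that by (simp add: c_def mult_ac)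
 then have "ph (circlepath 0 (r / 4) s) / (circlepath 0 (r / 4) s)^2 * vector_derivative (circlepath 0 (r / 4)) (at s within {0..1}) =
   ph (c s) / (c s)^2 * (2 * pi * \<i> * c s)" if "s : {0..1}" for s
  using that by (simp add: cp)
 then have "((%s. ph (circlepath 0 (r / 4) s) / (circlepath 0 (r / 4) s)^2 * vector_derivative (circlepath 0 (r / 4)) (at s within {0..1})) has_integral (2 * pi * \<i> * F' i z)) {0..1}
  \<longleftrightarrow> ((%s. ph (c s) / (c s)^2 * (2 * pi * \<i> * c s)) has_integral (2 * pi * \<i> * F' i z)) {0..1}"
  by (rule has_integral_cong)
 then have "((%s. ph (c s) / (c s)^2 * (2 * pi * \<i> * c s)) has_integral (2 * pi * \<i> * F' i z)) {0..1}"
  using ci' unfolding has_contour_integral_def by (rule iffD1)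
 then have "((%s. inverse (2 * pi * \<i>) * (ph (c s) / (c s)^2 * (2 * pi * \<i> * c s))) has_integral inverse (2 * pi * \<i>) * (2 * pi * \<i> * F' i z)) {0..1}"
  by (rule has_integral_mult_right)
 moreover have "inverse (2 * pi * \<i>) * (ph (c s) / (c s)^2 * (2 * pi * \<i> * c s)) = inverse (c s) * ph (c s)" for s
  using nz[of s] by (simp add: field_simps power2_eq_square)
 moreover have "inverse (2 * pi * \<i>) * (2 * pi * \<i> * F' i z) = F' i z"
  by (simp add: field_simps)
 ultimately have "((%s. inverse (c s) * ph (c s)) has_integral F' i z) {0..1}" by (simp only:)
 then show ?thesis by (simp add: integral_unique ph_def)
qed

text \<open>The Cauchy integrand depends holomorphically on \<open>z\<close>, so the derivative
  belongs to the class again; one continuous derivative thus yields all higher ones.\<close>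

lemma hold_partial:
 assumes F: "hold r F F'"
 shows "EX G G'. hold (r / 2) G G' & (ALL z. norm z < r / 2 --> G z = F' i z)"
proof -
 have r: "0 < r" by (rule holdD(1)[OF F])
 define c where "c s = complex_of_real (r / 4) * exp (2 * of_real pi * \<i> * of_real s)" for s :: real
 have nz: "c s ~= 0" "norm (c s) = r / 4" for s using r by (simp_all add: c_def norm_mult)
 define M where "M s z = (\<chi> j. (1::complex) * z $ j + (if j = i then c s else 0))" for s and z :: "complex^'a"
 have Meq: "M s z = z + axis i (c s)" for s z by (simp add: M_def vec_eq_iff axis_def)
 have Mn: "norm (M s z) <= norm z + r / 4" for s z
  using norm_triangle_ineq[of z "axis i (c s)"] unfolding Meq norm_axis_complex nz(2) .
 have Mb: "M s z : ball 0 r" if "z : ball 0 (r / 2)" for s z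
  using that Mn[of s z] r unfolding mem_ball dist_0_norm by linarith
 have "hold (r / 2) (%z. integral {0..1} (%s. inverse (c s) * F (M s z))) (%k z. integral {0..1} (%s. inverse (c s) * (1 * F' k (M s z))))"
 proof (rule hold_integral[OF F, where a = "%_ _. 1" and b = "%s j. if j = i then c s else 0"])
  have cc: "continuous_on {0..1} c" unfolding c_def by (intro continuous_intros)
  then show "continuous_on {0..1} (%s. if j = i then c s else 0)" for j by (cases "j = i") auto
  show "continuous_on {0..1} (%s. inverse (c s))" using cc nz(1) by (intro continuous_on_inverse) auto
 qed (use r Mb in \<open>auto simp: M_def[abs_def]\<close>)
 moreover have "integral {0..1} (%s. inverse (c s) * F (M s z)) = F' i z" if "norm z < r / 2" for z
  unfolding M_def c_def by (rule Cauchy_partial[OF F that, symmetric])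
 ultimately show ?thesis by (intro exI conjI) auto
qed

lemma ana_partial:
 assumes "ana f"
 shows "ana (partial i f)" "eventually (%x. f differentiable (at x)) (nhds 0)"
proof -
 obtain r F F' where F: "hold r F F'" "!!x. norm x < r ==> F (cv x) = complex_of_real (f x)" using assms by (rule anaE) blast
 have r: "0 < r" by (rule holdD(1)[OF F(1)])
 obtain G G' where G: "hold (r / 2) G G'" "!!z. norm z < r / 2 ==> G z = F' i z" using hold_partial[OF F(1)] by blast
 show "ana (partial i f)"
  by (rule anaI[OF G(1)]) (use G(2) hold_restrict_real(2)[OF F] r in auto)
 show "eventually (%x. f differentiable (at x)) (nhds 0)"
  unfolding eventually_nhds_metric using hold_restrict_real(1)[OF F] r by auto
qed


section \<open>Taylor expansion and implicit functions in a chosen variable\<close>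

definition zn :: "'n => real^'n::finite => real^'n" where
 "zn n x = (\<chi> i. if i = n then 0 else x $ i)"

text \<open>Records which variables occur, so that an induction on their number can stay within the
  fixed index type.\<close>

definition dep :: "'n set => (real^'n::finite => 'b) => bool" where
 "dep I f \<longleftrightarrow> (ALL x y. (ALL i:I. x $ i = y $ i) --> f x = f y)"

lemma zn_nth [simp]: "zn n x $ i = (if i = n then 0 else x $ i)"
 by (simp add: zn_def)

lemma depD: "dep I f ==> (!!i. i : I ==> x $ i = y $ i) ==> f x = f y"
 by (auto simp: dep_def)

lemma dep_partial:
 assumes "dep I f"
 shows "dep I (partial i f)"
 unfolding dep_def
proof (intro allI impI)
 fix x y :: "real^'a" assume xy: "ALL i:I. x $ i = y $ i"
 have e: "f (x + h) = f (y + h)" for h by (rule depD[OF assms]) (use xy in auto)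
 have "(f has_derivative D) (at x) \<longleftrightarrow> (f has_derivative D) (at y)" for D
  unfolding has_derivative_at using e e[of 0] by simp
 then show "partial i f x = partial i f y" unfolding partial_def frechet_derivative_def by simp
qed

lemma dep_funpow: "dep I f ==> dep I ((partial n ^^ m) f)"
 by (induction m) (auto intro: dep_partial)

lemma ana_funpow: "ana f ==> ana ((partial n ^^ m) f)"
 by (induction m) (auto intro: ana_partial)

lemma ana_isCont: "ana f ==> isCont f 0"
 using eventually_nhds_x_imp_x[OF ana_partial(2)] differentiable_imp_continuous_within by blast

lemma norm_scale_le:
 fixes z :: "'b::real_normed_field^'n::finite"
 assumes "!!j. norm (a j) <= 1"
 shows "norm (\<chi> j. a j * z $ j) <= norm z"
 unfolding norm_vec_def
 by (intro L2_set_mono) (use assms in \<open>auto simp: norm_mult mult_left_le_one_le\<close>)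

text \<open>\<open>u\<close> is the integral form of the remainder, an average of the
  \<open>d\<close>-th derivative over scalings of coordinate \<open>n\<close>;
  \<open>hold_integral\<close> makes it analytic, and it involves no new variables.\<close>

lemma ana_taylor:
 fixes f :: "real^'n::finite => real"
 assumes f: "ana f" and d: "0 < d" and I: "dep I f"
 obtains u where "ana u" "u 0 = (partial n ^^ d) f 0 / fact d" "dep I u"
  "eventually (%x. f x = (SUM i<d. (partial n ^^ i) f (zn n x) / fact i * x $ n ^ i) + x $ n ^ d * u x) (nhds 0)"
proof -
 define g where "g = (partial n ^^ d) f"
 have "ana g" unfolding g_def by (rule ana_funpow[OF f])
 then obtain r F F' where F: "hold r F F'" "!!x. norm x < r ==> F (cv x) = complex_of_real (g x)" by (rule anaE) blast
 have r: "0 < r" by (rule holdD(1)[OF F(1)])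
 \<comment> \<open>The Taylor weight, whose integral \<open>1 / fact d\<close> yields the value of
   \<open>u\<close> at 0.\<close>
 define w where "w s = (1 - s) ^ (d - 1) / fact (d - 1)" for s :: real
 define sc where "sc s x = (\<chi> j. (if j = n then s else 1) * x $ j)" for s and x :: "real^'n"
 define u where "u x = integral {0..1} (%s. w s * g (sc s x))" for x
 define M where "M s z = (\<chi> j. complex_of_real (if j = n then s else 1) * z $ j + 0)" for s and z :: "complex^'n"
 have Mn: "norm (M s z) <= norm z" if "s : {0..1}" for s z
  unfolding M_def add_0_right by (rule norm_scale_le) (use that in auto)
 have scn: "norm (sc s x) <= norm x" if "s : {0..1}" for s x
  unfolding sc_def by (rule norm_scale_le) (use that in auto)
 have Mcv: "M s (cv x) = cv (sc s x)" for s x by (simp add: M_def sc_def vec_eq_iff)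
 have hu: "hold r (%z. integral {0..1} (%s. complex_of_real (w s) * F (M s z)))
   (%i z. integral {0..1} (%s. complex_of_real (w s) * (complex_of_real (if i = n then s else 1) * F' i (M s z))))"
 proof (rule hold_integral[OF F(1) r, where a = "%s j. complex_of_real (if j = n then s else 1)" and b = "%_ _. 0"])
  show "continuous_on {0..1} (%s. complex_of_real (if j = n then s else 1))" for j
   by (cases "j = n") (auto intro!: continuous_intros)
  show "continuous_on {0..1} (%s. complex_of_real (w s))" unfolding w_def by (intro continuous_intros) auto
  show "M s z : ball 0 r" if "s : {0..1}" "z : ball 0 r" for s z
   using Mn[OF that(1), of z] that(2) by simp
 qed (auto simp: M_def[abs_def])
 have anau: "ana u"
 proof (rule anaI[OF hu])
  fix x :: "real^'n" assume x: "norm x < r"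
  have "continuous_on {0..1} (%s. F (M s (cv x)))"
  proof (rule continuous_on_compose2[OF holdD(4)[OF F(1)]])
   show "continuous_on {0..1} (%s. M s (cv x))" unfolding M_def
   proof (intro continuous_on_vec_lambda continuous_on_add continuous_on_mult continuous_on_const)
    show "continuous_on {0..1} (%s. complex_of_real (if i = n then s else 1))" for i
     by (cases "i = n") (auto intro!: continuous_intros)
   qed
   show "(%s. M s (cv x)) ` {0..1} <= ball 0 r"
    using Mn[of _ "cv x"] x by (force simp del: ball_simps)
  qed
  then have int: "(%s. complex_of_real (w s) * F (M s (cv x))) integrable_on {0..1}"
   unfolding w_def by (intro integrable_continuous_interval continuous_intros) auto
  have eq: "complex_of_real (w s) * F (M s (cv x)) = complex_of_real (w s * g (sc s x))" if "s : {0..1}" for s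
   using F(2)[of "sc s x"] scn[OF that, of x] x by (simp add: Mcv)
  have 1: "Re (integral {0..1} (%s. complex_of_real (w s) * F (M s (cv x)))) = u x"
   unfolding integral_linear[OF int bounded_linear_Re, symmetric] u_def
   by (rule Henstock_Kurzweil_Integration.integral_cong) (simp add: eq)
  have 2: "Im (integral {0..1} (%s. complex_of_real (w s) * F (M s (cv x)))) = integral {0..1} (%s::real. 0)"
   unfolding integral_linear[OF int bounded_linear_Im, symmetric]
   by (rule Henstock_Kurzweil_Integration.integral_cong) (simp add: eq)
  show "integral {0..1} (%s. complex_of_real (w s) * F (M s (cv x))) = complex_of_real (u x)"
   by (rule complex_eqI) (use 1 2 in simp_all)
 qed
 have int_w: "integral {0..1} w = 1 / fact d"
 proof -
  have "((%s. (1 - s) ^ (d - 1) / fact (d - 1)) has_integral (- ((1 - 1) ^ d / fact d) - - ((1 - 0) ^ d / fact d))) {0..1::real}"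
  proof (rule fundamental_theorem_of_calculus)
   fix s :: real
   have "((%s. - ((1 - s) ^ d / fact d)) has_real_derivative (1 - s) ^ (d - 1) / fact (d - 1)) (at s within {0..1})"
    using d by (auto intro!: derivative_eq_intros simp: fact_reduce[OF d] field_simps)
   then show "((%s. - ((1 - s) ^ d / fact d)) has_vector_derivative (1 - s) ^ (d - 1) / fact (d - 1)) (at s within {0..1})"
    by (simp add: has_real_derivative_iff_has_vector_derivative)
  qed simp
  then have "(w has_integral 1 / fact d) {0..1}" using d by (simp add: w_def[abs_def] zero_power)
  then show ?thesis by (rule integral_unique)
 qed
 have u0: "u 0 = g 0 / fact d"
 proof -
  have "sc s 0 = 0" for s by (simp add: sc_def vec_eq_iff)
  then have "u 0 = integral {0..1} (%s. w s * g 0)" by (simp add: u_def)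
  also have "\<dots> = integral {0..1} w * g 0" by simp
  finally show ?thesis by (simp add: int_w)
 qed
 have depu: "dep I u"
  unfolding dep_def
 proof (intro allI impI)
  fix x y :: "real^'n" assume xy: "ALL i:I. x $ i = y $ i"
  have "g (sc s x) = g (sc s y)" for s
   unfolding g_def by (rule depD[OF dep_funpow[OF I]]) (use xy in \<open>simp add: sc_def\<close>)
  then show "u x = u y" by (simp add: u_def)
 qed
 have "ALL m:{..d}. eventually (%x. (partial n ^^ m) f differentiable (at x)) (nhds 0)"
  using ana_partial(2)[OF ana_funpow[OF f]] by blast
 then have "eventually (%x. ALL m:{..d}. (partial n ^^ m) f differentiable (at x)) (nhds 0)"
  by (intro eventually_ball_finite) auto
 then obtain e where e: "e > 0" "!!x m. norm x < e ==> m <= d ==> (partial n ^^ m) f differentiable (at x)"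
  unfolding eventually_nhds_metric by auto
 have "f x = (SUM i<d. (partial n ^^ i) f (zn n x) / fact i * x $ n ^ i) + x $ n ^ d * u x" if x: "norm x < e" for x
 proof -
  define Df where "Df m t = x $ n ^ m * (partial n ^^ m) f (sc t x)" for m t
  have sc: "sc t x = zn n x + (t * x $ n) *\<^sub>R axis n 1" for t
   by (auto simp: sc_def vec_eq_iff axis_def)
  have dd: "(Df m has_vector_derivative Df (Suc m) t) (at t within {0..1})" if m: "m < d" "0 <= t" "t <= 1" for m t
  proof -
   have "norm (sc t x) < e" using scn[of t x] x m by simp
   then have "(partial n ^^ m) f differentiable (at (zn n x + (t * x $ n) *\<^sub>R axis n 1))" using e(2)[of "sc t x" m] m sc by simp
   from has_real_derivative_axis[OF this]
   have 1: "((%s. (partial n ^^ m) f (zn n x + s *\<^sub>R axis n 1)) has_real_derivative (partial n ^^ Suc m) f (sc t x)) (at (t * x $ n))"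
    by (simp add: sc)
   have 2: "((%t. t * x $ n) has_real_derivative x $ n) (at t)" by (auto intro!: derivative_eq_intros)
   from DERIV_chain2[OF 1 2]
   have "((%t. x $ n ^ m * (partial n ^^ m) f (sc t x)) has_real_derivative x $ n ^ m * ((partial n ^^ Suc m) f (sc t x) * x $ n)) (at t)"
    unfolding sc by (rule DERIV_cmult)
   then have "(Df m has_real_derivative Df (Suc m) t) (at t)" by (simp add: Df_def[abs_def] mult_ac)
   then show ?thesis
    by (meson has_real_derivative_iff_has_vector_derivative has_vector_derivative_at_within)
  qed
  have sc1: "sc 1 x = x" and sc0: "sc 0 x = zn n x" by (simp_all add: sc_def vec_eq_iff)
  have "Df 0 1 = (SUM i<d. ((1 - 0) ^ i / fact i) *\<^sub>R Df i 0) + integral {0..1} (%s. ((1 - s) ^ (d - 1) / fact (d - 1)) *\<^sub>R Df d s)"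
   by (rule Taylor_integral[where p = d and Df = Df and f = "Df 0" and a = 0 and b = 1, OF d refl dd]) auto
  also have "integral {0..1} (%s. ((1 - s) ^ (d - 1) / fact (d - 1)) *\<^sub>R Df d s) = integral {0..1} (%s. x $ n ^ d * (w s * g (sc s x)))"
   by (rule Henstock_Kurzweil_Integration.integral_cong) (simp add: Df_def w_def g_def)
  also have "\<dots> = x $ n ^ d * u x" by (simp add: u_def)
  finally show ?thesis by (simp add: Df_def sc1 sc0 mult_ac)
 qed
 then have "eventually (%x. f x = (SUM i<d. (partial n ^^ i) f (zn n x) / fact i * x $ n ^ i) + x $ n ^ d * u x) (nhds 0)"
  unfolding eventually_nhds_metric using e(1) by auto
 then show thesis using that[OF anau _ depu] u0 by (simp add: g_def)
qed

text \<open>The inverse function theorem for the map that replaces coordinate \<open>n\<close> by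
  \<open>F z\<close>. \<open>T\<close> is the \<open>n\<close>-th component of the inverse, and its
  partial derivatives result from solving one linear equation for the \<open>n\<close>-th
  unknown.\<close>

lemma hold_implicit:
 fixes F :: "complex^'n::finite => complex"
 assumes F: "hold r F F'" and F0: "F 0 = 0" and n: "F' n 0 ~= 0"
 obtains s T T' U' where "hold s T T'" "open U'" "0 : U'"
  "!!z. z : U' ==> norm (\<chi> j. if j = n then F z else z $ j) < s ==> T (\<chi> j. if j = n then F z else z $ j) = z $ n"
proof -
 have r: "0 < r" by (rule holdD(1)[OF F])
 define \<Phi> where "\<Phi> z = (\<chi> j. if j = n then F z else z $ j)" for z
 have bla: "bounded_linear (axis n :: complex => complex^'n)"
  by (intro linear_conv_bounded_linear[THEN iffD1] linearI) (simp_all add: vec_eq_iff axis_def)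
 define zc where "zc h = (\<chi> j. if j = n then 0 else h $ j)" for h :: "complex^'n"
 have blz: "bounded_linear zc"
  by (intro linear_conv_bounded_linear[THEN iffD1] linearI) (simp_all add: vec_eq_iff zc_def)
 define \<Phi>' where "\<Phi>' z = Blinfun zc + (SUM i:UNIV. Blinfun (axis n) o\<^sub>L (blinfun_mult_left (F' i z) o\<^sub>L Blinfun (%h. h $ i)))" for z
 have \<Phi>': "blinfun_apply (\<Phi>' z) h = (\<chi> j. if j = n then (SUM i:UNIV. h $ i * F' i z) else h $ j)" for z h
  unfolding \<Phi>'_def
  by (simp add: blinfun.add_left blinfun.sum_left bounded_linear_Blinfun_apply bla blz bounded_linear_vec_nth vec_eq_iff zc_def axis_def)
 have der: "(\<Phi> has_derivative blinfun_apply (\<Phi>' z)) (at z)" if z: "z : ball 0 r" for z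
 proof -
  have "(\<Phi> has_derivative (%h. \<chi> j. if j = n then (SUM i:UNIV. h $ i * F' i z) else h $ j)) (at z)"
   unfolding \<Phi>_def
  proof (rule has_derivative_vec_components)
   fix j show "((%z. (\<chi> j. if j = n then F z else z $ j) $ j) has_derivative (%h. if j = n then (SUM i:UNIV. h $ i * F' i z) else h $ j)) (at z)"
    using holdD(2)[OF F z] by (cases "j = n") (auto intro!: bounded_linear_imp_has_derivative bounded_linear_vec_nth)
  qed
  then show ?thesis by (simp add: \<Phi>'[abs_def])
 qed
 have cont: "continuous_on (ball 0 r) \<Phi>'"
  unfolding \<Phi>'_def
  by (intro continuous_on_add continuous_on_const continuous_on_sum bounded_bilinear.continuous_on[OF bounded_bilinear_blinfun_compose]
    bounded_linear.continuous_on[OF bounded_linear_blinfun_mult_left] holdD(3)[OF F])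
 \<comment> \<open>Explicit left inverse of the derivative at 0, which differs from the identity in
   row \<open>n\<close> alone.\<close>
 define q where "q h = (\<chi> j. if j = n then (h $ n - (SUM i:UNIV - {n}. h $ i * F' i 0)) * inverse (F' n 0) else h $ j)" for h
 have blq: "bounded_linear q"
  by (intro linear_conv_bounded_linear[THEN iffD1] linearI)
   (simp_all add: q_def vec_eq_iff algebra_simps sum.distrib sum_distrib_left scaleR_sum_right)
 have "q (blinfun_apply (\<Phi>' 0) h) = h" for h
  using n by (simp add: q_def \<Phi>' vec_eq_iff sum.remove[of UNIV n] field_simps)
 then have inv: "Blinfun q o\<^sub>L \<Phi>' 0 = id_blinfun"
  by (intro blinfun_eqI) (simp add: bounded_linear_Blinfun_apply[OF blq])
 have z0: "0 : ball (0 :: complex^'n) r" using r by simp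
 obtain U' V G g' where U': "open U'" "U' <= ball 0 r" "0 : U'" and V: "open V" "\<Phi> 0 : V" and hom: "homeomorphism U' V \<Phi> G"
  and G: "!!y. y : V ==> (G has_derivative g' y) (at y)" "!!y. y : V ==> g' y = inv (blinfun_apply (\<Phi>' (G y)))"
  "!!y. y : V ==> bij (blinfun_apply (\<Phi>' (G y)))"
 proof (rule inverse_function_theorem[OF open_ball der cont z0 inv])
  fix U' V G g'
  assume "open U'" "U' <= ball 0 r" "0 : U'" "open V" "\<Phi> 0 : V" "homeomorphism U' V \<Phi> G"
   "!!y. y : V ==> (G has_derivative g' y) (at y)" "!!y. y : V ==> g' y = inv (blinfun_apply (\<Phi>' (G y)))"
   "!!y. y : V ==> bij (blinfun_apply (\<Phi>' (G y)))"
  then show thesis by (rule that)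
 qed
 have "\<Phi> 0 = 0" using F0 by (simp add: \<Phi>_def vec_eq_iff)
 then obtain s where s: "s > 0" "ball 0 s <= V" using openE[OF V] by metis
 have GU: "G y : U'" if "y : V" for y using hom that by (auto simp: homeomorphism_def)
 define T where "T y = G y $ n" for y
 define T' where "T' i y = (if i = n then inverse (F' n (G y)) else - F' i (G y) * inverse (F' n (G y)))" for i y
 have nz: "F' n (G y) ~= 0" if y: "y : V" for y
 proof
  assume 0: "F' n (G y) = 0"
  have "(SUM i:UNIV. axis n 1 $ i * F' i (G y)) = (SUM i:UNIV. if i = n then F' i (G y) else 0)"
   by (intro sum.cong) (auto simp: axis_def)
  then have "blinfun_apply (\<Phi>' (G y)) (axis n 1) = blinfun_apply (\<Phi>' (G y)) 0"
   using 0 by (auto simp: \<Phi>' vec_eq_iff axis_def)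
  then have "axis n 1 = (0 :: complex^'n)" using G(3)[OF y] by (meson bij_is_inj injD)
  then show False by (simp add: axis_eq_0_iff)
 qed
 have "hold s T T'" unfolding hold_def
 proof (intro conjI ballI allI)
  fix y :: "complex^'n" assume "y : ball 0 s"
  then have y: "y : V" using s by blast
  have "((%y. G y $ n) has_derivative (%h. g' y h $ n)) (at y)"
   by (rule bounded_linear.has_derivative[OF bounded_linear_vec_nth G(1)[OF y]])
  moreover have "g' y h $ n = (SUM i:UNIV. h $ i * T' i y)" for h
  proof -
   define k where "k = g' y h"
   have "blinfun_apply (\<Phi>' (G y)) k = h"
    unfolding k_def G(2)[OF y] by (rule surj_f_inv_f) (rule bij_is_surj[OF G(3)[OF y]])
   then have k: "(if j = n then (SUM i:UNIV. k $ i * F' i (G y)) else k $ j) = h $ j" for j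
    unfolding \<Phi>' by (simp add: vec_eq_iff)
   have "h $ n = k $ n * F' n (G y) + (SUM i:UNIV - {n}. k $ i * F' i (G y))"
    using k[of n] by (simp add: sum.remove[of UNIV n])
   also have "(SUM i:UNIV - {n}. k $ i * F' i (G y)) = (SUM i:UNIV - {n}. h $ i * F' i (G y))"
   proof (intro sum.cong refl)
    fix i assume "i : UNIV - {n}"
    then show "k $ i * F' i (G y) = h $ i * F' i (G y)" using k[of i] by simp
   qed
   finally have "k $ n = (h $ n - (SUM i:UNIV - {n}. h $ i * F' i (G y))) * inverse (F' n (G y))"
    using nz[OF y] by (simp add: field_simps)
   also have "\<dots> = h $ n * inverse (F' n (G y)) + (SUM i:UNIV - {n}. h $ i * (- F' i (G y) * inverse (F' n (G y))))"
    by (simp add: left_diff_distrib sum_distrib_right sum_negf mult.assoc)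
   also have "\<dots> = (SUM i:UNIV. h $ i * T' i y)"
    unfolding sum.remove[OF finite UNIV_I, of "%i. h $ i * T' i y" n] by (simp add: T'_def)
   finally show ?thesis by (simp add: k_def)
  qed
  ultimately show "(T has_derivative (%h. SUM i:UNIV. h $ i * T' i y)) (at y)"
   by (simp add: T_def[abs_def])
 next
  fix i
  have "continuous_on (ball 0 s) G" using hom s(2) by (auto simp: homeomorphism_def intro: continuous_on_subset)
  then have c: "continuous_on (ball 0 s) (%y. F' i (G y))" for i
   by (rule continuous_on_compose2[OF holdD(3)[OF F]]) (use GU U' s in blast)
  have "ALL y:ball 0 s. F' n (G y) ~= 0" using nz s(2) by blast
  then show "continuous_on (ball 0 s) (T' i)" unfolding T'_def[abs_def]
   by (cases "i = n") (auto intro!: continuous_intros c)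
 qed (use s in auto)
 then show thesis
 proof (rule that[OF _ U'(1,3)])
  fix z assume z: "z : U'" "norm (\<chi> j. if j = n then F z else z $ j) < s"
  have "G (\<Phi> z) = z" using hom z(1) by (auto simp: homeomorphism_def)
  then show "T (\<chi> j. if j = n then F z else z $ j) = z $ n" by (simp add: T_def \<Phi>_def)
 qed
qed

text \<open>The complex solution must be shown to be real at real points. The intermediate value
  theorem supplies a real solution, and since \<open>T\<close> inverts the coordinate map near 0 the
  two agree.\<close>

lemma ana_implicit:
 fixes g :: "real^'n::finite => real"
 assumes g: "ana g" and g0: "g 0 = 0" and n: "partial n g 0 ~= 0" and I: "dep I g"
 obtains th where "ana th" "th 0 = 0" "dep (I - {n}) th"
  "eventually (%x. g (zn n x + th x *\<^sub>R axis n 1) = 0) (nhds 0)"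
proof -
 obtain r F F' where F: "hold r F F'" "!!x. norm x < r ==> F (cv x) = complex_of_real (g x)" using g by (rule anaE) blast
 have r: "0 < r" by (rule holdD(1)[OF F(1)])
 have cv0: "cv 0 = (0 :: complex^'n)" by (simp add: vec_eq_iff)
 have F0: "F 0 = 0" using F(2)[of 0] r g0 cv0 by simp
 have Fn: "F' n 0 ~= 0" using hold_restrict_real(2)[OF F, of 0 n] r n cv0 by auto
 obtain s T T' U' where T: "hold s T T'" and U': "open U'" "0 : U'"
  and TU: "!!z. z : U' ==> norm (\<chi> j. if j = n then F z else z $ j) < s ==> T (\<chi> j. if j = n then F z else z $ j) = z $ n"
  by (rule hold_implicit[OF F(1) F0 Fn]) blast
 have s: "0 < s" by (rule holdD(1)[OF T])
 obtain e where e: "e > 0" "ball 0 e <= U'" using openE[OF U'] by metis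
 define c where "c = partial n g 0"
 have dg: "norm x < r ==> g differentiable (at x)" for x by (rule hold_restrict_real(1)[OF F])
 have contg: "continuous_on (ball 0 r) g"
  by (intro continuous_at_imp_continuous_on ballI differentiable_imp_continuous_within dg) simp
 have "((%t. sgn c * g (0 + t *\<^sub>R axis n 1)) has_real_derivative sgn c * partial n g (0 + 0 *\<^sub>R axis n 1)) (at 0)"
  by (intro DERIV_cmult has_real_derivative_axis) (use dg r in simp)
 then have dc: "((%t. sgn c * g (t *\<^sub>R axis n 1)) has_real_derivative \<bar>c\<bar>) (at 0)"
  by (simp add: c_def abs_sgn mult.commute)
 have cpos: "\<bar>c\<bar> > 0" using n by (simp add: c_def)
 obtain d1 where d1: "d1 > 0" "!!h. h > 0 ==> h < d1 ==> sgn c * g (0 *\<^sub>R axis n 1) < sgn c * g ((0 + h) *\<^sub>R axis n 1)"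
  using DERIV_pos_inc_right[OF dc cpos] by blast
 obtain d2 where d2: "d2 > 0" "!!h. h > 0 ==> h < d2 ==> sgn c * g ((0 - h) *\<^sub>R axis n 1) < sgn c * g (0 *\<^sub>R axis n 1)"
  using DERIV_pos_inc_left[OF dc cpos] by blast
 define ew where "ew = min (min d1 d2) (min e r) / 3"
 have ew: "0 < ew" "ew < d1" "ew < d2" "3 * ew <= e" "3 * ew <= r" using d1(1) d2(1) e(1) r by (auto simp: ew_def)
 have hi: "0 < sgn c * g (ew *\<^sub>R axis n 1)" and lo: "sgn c * g ((- ew) *\<^sub>R axis n 1) < 0"
  using d1(2)[of ew] d2(2)[of ew] ew g0 by auto
 \<comment> \<open>With the sign of the derivative as a factor, \<open>H\<close> is positive at
   \<open>ew\<close> and negative at \<open>- ew\<close> for all \<open>x\<close> near the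
   origin.\<close>
 define H where "H t x = sgn c * (g (zn n x + t *\<^sub>R axis n 1) - x $ n)" for t and x :: "real^'n"
 have zle: "norm (zn n x) <= norm x" for x :: "real^'n"
  unfolding norm_vec_def by (intro L2_set_mono) auto
 have inb: "norm (zn n x + t *\<^sub>R axis n 1) < r" "norm (zn n x + t *\<^sub>R axis n 1) < e" if "norm x < ew" "\<bar>t\<bar> <= ew" for x t
  using norm_triangle_ineq[of "zn n x" "t *\<^sub>R axis n 1"] zle[of x] that ew by auto
 have zbl: "continuous_on S (zn n)" for S :: "(real^'n) set"
  unfolding zn_def
 proof (rule continuous_on_vec_lambda)
  show "continuous_on S (%x. if i = n then 0 else x $ i)" for i by (cases "i = n") (auto intro!: continuous_intros)
 qed
 have cH: "continuous_on (ball 0 ew) (H t)" if "\<bar>t\<bar> <= ew" for t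
  unfolding H_def
  by (intro continuous_intros continuous_on_compose2[OF contg] zbl) (use inb that in auto)
 have H0: "H t 0 = sgn c * g (t *\<^sub>R axis n 1)" for t
 proof -
  have "zn n 0 = (0 :: real^'n)" by (simp add: vec_eq_iff)
  then show ?thesis by (simp add: H_def)
 qed
 have o1: "open (ball 0 ew Int H ew -` {0<..} Int (ball 0 ew Int H (- ew) -` {..<0}))"
  by (intro open_Int continuous_open_preimage cH) (use ew in auto)
 have "0 : ball 0 ew Int H ew -` {0<..} Int (ball 0 ew Int H (- ew) -` {..<0})"
  using hi lo ew by (simp add: H0)
 then obtain e2 where e2: "e2 > 0" "ball 0 e2 <= ball 0 ew Int H ew -` {0<..} Int (ball 0 ew Int H (- ew) -` {..<0})"
  using openE[OF o1] by metis
 have sol: "EX t. T (cv x) = complex_of_real t & g (zn n x + t *\<^sub>R axis n 1) = x $ n" if x: "norm x < min e2 s" for x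
 proof -
  have xb: "x : ball 0 ew Int H ew -` {0<..} Int (ball 0 ew Int H (- ew) -` {..<0})" using x e2(2) by auto
  have "EX t>=- ew. t <= ew & H t x = 0"
  proof (rule IVT')
   show "continuous_on {- ew..ew} (%t. H t x)" unfolding H_def
    by (intro continuous_intros continuous_on_compose2[OF contg]) (use inb xb in auto)
  qed (use xb ew in auto)
  then obtain t where t': "- ew <= t" "t <= ew" and Ht: "H t x = 0" by blast
  have t: "\<bar>t\<bar> <= ew" "H t x = 0" using t' Ht by auto
  then have gt: "g (zn n x + t *\<^sub>R axis n 1) = x $ n" using n by (simp add: H_def c_def sgn_zero_iff)
  define z where "z = cv (zn n x + t *\<^sub>R axis n 1)"
  have "norm z < e" using inb(2)[of x t] xb t by (simp add: z_def)
  then have zU: "z : U'" using e(2) by auto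
  have Fz: "F z = complex_of_real (x $ n)" unfolding z_def using F(2)[of "zn n x + t *\<^sub>R axis n 1"] inb(1)[of x t] xb t gt by simp
  have eq: "(\<chi> j. if j = n then F z else z $ j) = cv x"
   using Fz by (auto simp: vec_eq_iff z_def axis_def)
  have "T (cv x) = z $ n" using TU[OF zU] x unfolding eq by simp
  then show ?thesis using gt by (auto simp: z_def intro!: exI[of _ t])
 qed
 define th0 where "th0 x = Re (T (cv x))" for x
 have th0: "T (cv x) = complex_of_real (th0 x)" "g (zn n x + th0 x *\<^sub>R axis n 1) = x $ n" if "norm x < min e2 s" for x
  using sol[OF that] by (auto simp: th0_def)
 have m0: "0 < min e2 s" "min e2 s <= s" using e2(1) s by auto
 have ath0: "ana th0" by (rule anaI[OF hold_subset[OF T m0] th0(1)])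
 \<comment> \<open>Erasing the other coordinates makes the solution depend on \<open>I - {n}\<close>
   alone and sets coordinate \<open>n\<close> to 0, which turns the right-hand side
   \<open>x $ n\<close> of the solved equation into 0.\<close>
 define p where "p x = (\<chi> i. if i : I - {n} then x $ i else 0)" for x :: "real^'n"
 have p0: "p 0 = 0" by (simp add: p_def vec_eq_iff)
 have ple: "norm (p x) <= norm x" for x unfolding norm_vec_def by (intro L2_set_mono) (auto simp: p_def)
 have ap: "ana (%x. p x $ j)" for j by (cases "j : I - {n}") (auto simp: p_def)
 show thesis
 proof (rule that[of "%x. th0 (p x)"])
  show "ana (%x. th0 (p x))" by (rule ana_compose[OF ath0 ap p0])
  have z1: "zn n x + 0 *\<^sub>R axis n 1 = zn n x" for x :: "real^'n" by simp
  show "th0 (p 0) = 0"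
  proof -
   have eq: "(\<chi> j. if j = n then F 0 else 0 $ j) = (0 :: complex^'n)" using F0 by (simp add: vec_eq_iff)
   have "T 0 = 0 $ n" using TU[OF U'(2)] s unfolding eq by simp
   then show ?thesis by (simp add: p0 th0_def cv0)
  qed
  show "dep (I - {n}) (%x. th0 (p x))"
   unfolding dep_def
  proof (intro allI impI)
   fix x y :: "real^'n" assume "ALL i:I - {n}. x $ i = y $ i"
   then have "p x = p y" by (auto simp: p_def vec_eq_iff)
   then show "th0 (p x) = th0 (p y)" by simp
  qed
  have "g (zn n x + th0 (p x) *\<^sub>R axis n 1) = 0" if x: "norm x < min e2 s" for x
  proof -
   have "g (zn n x + th0 (p x) *\<^sub>R axis n 1) = g (zn n (p x) + th0 (p x) *\<^sub>R axis n 1)"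
    by (rule depD[OF I]) (auto simp: p_def)
   also have "\<dots> = p x $ n" by (rule th0(2)) (use ple[of x] x in auto)
   finally show ?thesis by (simp add: p_def)
  qed
  then show "eventually (%x. g (zn n x + th0 (p x) *\<^sub>R axis n 1) = 0) (nhds 0)"
   unfolding eventually_nhds_metric using m0(1) by (intro exI[of _ "min e2 s"]) auto
 qed
qed


subsection \<open>Germs that are a monomial times a unit\<close>

definition mo :: "('n => nat) => real^'n::finite => real" where
 "mo a x = (PROD i:UNIV. x $ i ^ a i)"

definition mon :: "(real^'n::finite => real) => bool" where
 "mon g \<longleftrightarrow> (EX a u. ana u & u 0 ~= 0 & eventually (%x. g x = mo a x * u x) (nhds 0))"

abbreviation zero_near :: "(real^'n::finite => real) => bool" where
 "zero_near f \<equiv> eventually (%x. f x = 0) (nhds 0)"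

definition amap :: "(real^'n::finite => real^'n) => bool" where
 "amap si \<longleftrightarrow> (ALL j. ana (%x. si x $ j)) & si 0 = 0"

lemma ana_mo [simp]: "ana (mo a)"
 unfolding mo_def[abs_def] by (intro ana_prod ana_power ana_nth)

lemma mo_nonzero_iff: "mo a x ~= 0 \<longleftrightarrow> (ALL i. x $ i = 0 --> a i = 0)"
 by (auto simp: mo_def)

lemma mo_eq_0: "x $ i = 0 ==> a i > 0 ==> mo a x = 0"
 using mo_nonzero_iff[of a x] by auto

lemma mo_add: "mo (%i. a i + b i) x = mo a x * mo b x"
 by (simp add: mo_def power_add prod.distrib)

lemma mo_mult: "mo (%i. k * a i) x = mo a x ^ k"
 by (simp add: mo_def power_mult[symmetric] prod_power_distrib mult.commute)

lemma mo_zero [simp]: "mo (%_. 0) x = 1"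
 by (simp add: mo_def)

lemma mo_single: "mo (%i. if i = l then k else 0) x = x $ l ^ k"
proof -
 have "mo (%i. if i = l then k else 0) x = (PROD i:UNIV. if i = l then x $ i ^ k else 1)"
  unfolding mo_def by (intro prod.cong) auto
 then show ?thesis by simp
qed

lemma mo_at_0: "a ~= (%_. 0) ==> mo a 0 = 0"
 by (auto simp: mo_def fun_eq_iff)

lemma amap_continuous: "amap si ==> isCont si 0"
proof -
 assume "amap si"
 then have "isCont (%x. si x $ j) 0" for j by (simp add: amap_def ana_isCont)
 then have "((%x. si x $ j) \<longlongrightarrow> si 0 $ j) (at 0)" for j by (simp add: isCont_def)
 then show ?thesis unfolding isCont_def by (intro vec_tendstoI)
qed

lemma eventually_amap:
 assumes "amap si" "eventually P (nhds 0)"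
 shows "eventually (%x. P (si x)) (nhds 0)"
proof -
 have "filterlim si (nhds 0) (nhds 0)"
  using amap_continuous[OF assms(1)] assms(1)
  by (simp add: isCont_def amap_def tendsto_at_iff_tendsto_nhds)
 then show ?thesis using assms(2) unfolding filterlim_iff by blast
qed

lemma ana_amap: "ana f ==> amap si ==> ana (%x. f (si x))"
 by (rule ana_compose) (auto simp: amap_def)

lemma amap_compose: "amap si ==> amap rh ==> amap (%x. si (rh x))"
 unfolding amap_def using ana_compose[of _ rh] by auto

lemma amapI: "(!!j. ana (%x. si x $ j)) ==> si 0 = 0 ==> amap si"
 by (simp add: amap_def)

lemma amap_zn: "amap (zn n)"
proof (rule amapI)
 show "ana (%x. zn n x $ j)" for j by (cases "j = n") auto
qed (simp add: vec_eq_iff)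

lemma amap_id: "amap (%x. x)"
 by (simp add: amap_def)

lemma ana_at_0: "eventually (%x. f x = g x) (nhds 0) ==> f 0 = g 0"
 by (rule eventually_nhds_x_imp_x)

lemma ana_nonzero_near: "ana u ==> u 0 ~= 0 ==> eventually (%x. u x ~= 0) (nhds 0)"
proof -
 assume "ana u" "u 0 ~= 0"
 then have "filterlim u (nhds (u 0)) (nhds 0)"
  using ana_isCont[of u] by (simp add: isCont_def tendsto_at_iff_tendsto_nhds)
 then show ?thesis by (rule tendsto_imp_eventually_ne) (rule \<open>u 0 ~= 0\<close>)
qed

lemma eventually_cube:
 assumes "eventually P (nhds (0 :: real^'n::finite))"
 obtains e where "e > 0" "!!x. (!!j. \<bar>x $ j\<bar> < e) ==> P x"
proof -
 obtain d where d: "d > 0" "!!x. dist x 0 < d ==> P x" using assms unfolding eventually_nhds_metric by blast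
 show thesis
 proof (rule that[of "d / CARD('n)"])
  show "d / CARD('n) > 0" using d(1) by simp
  fix x :: "real^'n" assume x: "!!j. \<bar>x $ j\<bar> < d / CARD('n)"
  have "norm x <= (SUM j:UNIV. \<bar>x $ j\<bar>)" by (rule norm_le_l1_cart)
  also have "\<dots> < (SUM j:(UNIV :: 'n set). d / CARD('n))" by (rule sum_strict_mono) (use x in auto)
  also have "\<dots> = d" by simp
  finally show "P x" by (intro d(2)) simp
 qed
qed

text \<open>Arbitrarily close to 0 there are points whose vanishing coordinates are exactly those in
  \<open>Z\<close>; such points decide which monomials vanish.\<close>

lemma eventually_line_witness:
 assumes "eventually P (nhds (0 :: real^'n::finite))" and Z: "!!x. (!!i. i : Z ==> x $ i = 0) ==> (!!i. i ~: Z ==> x $ i ~= 0) ==> \<not> P x"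
 shows False
proof -
 obtain e where e: "e > 0" "!!x. (!!j. \<bar>x $ j\<bar> < e) ==> P x" using eventually_cube[OF assms(1)] by metis
 define x :: "real^'n" where "x = (\<chi> i. if i : Z then 0 else e / 2)"
 have "P x" by (rule e(2)) (use e(1) in \<open>simp add: x_def\<close>)
 moreover have "\<not> P x" by (rule Z) (use e(1) in \<open>simp_all add: x_def\<close>)
 ultimately show False by simp
qed

text \<open>Germs form an integral domain. Near a point \<open>a\<close> with \<open>f a\<close>
  nonzero the other factor vanishes, and the identity theorem on the complex line from
  \<open>a\<close> to an arbitrary \<open>b\<close> transports this to \<open>b\<close>.\<close>

lemma zero_near_mult:
 assumes f: "ana f" and g: "ana g" and fg: "zero_near (%x. f x * g x)" and nf: "\<not> zero_near f"
 shows "zero_near g"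
proof -
 obtain r F F' G G' where F: "hold r F F'" and G: "hold r G G'" and Fr: "!!x. norm x < r ==> F (cv x) = complex_of_real (f x)"
  and Gr: "!!x. norm x < r ==> G (cv x) = complex_of_real (g x)" by (rule ana_common[OF f g]) blast
 obtain d where d: "d > 0" "!!x. norm x < d ==> f x * g x = 0" using fg unfolding eventually_nhds_metric by auto
 define e where "e = min d r"
 have e: "e > 0" "e <= r" "e <= d" using d(1) holdD(1)[OF F] by (auto simp: e_def)
 obtain a where a: "norm a < e" "f a ~= 0" using nf e(1) unfolding eventually_nhds_metric by auto
 have "f differentiable (at a)" by (rule hold_restrict_real(1)[OF F Fr]) (use a e in auto)
 then have "isCont f a" by (rule differentiable_imp_continuous_within)
 then have "eventually (%x. f x ~= 0) (nhds a)"
  using tendsto_imp_eventually_ne[of f "f a" "nhds a" 0] a(2) by (simp add: isCont_def tendsto_at_iff_tendsto_nhds)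
 then obtain s where s: "s > 0" "!!x. dist x a < s ==> f x ~= 0" unfolding eventually_nhds_metric by blast
 have "g b = 0" if b: "norm b < e" for b
 proof -
  define L where "L t = (\<chi> j. cv a $ j + t * (cv b $ j - cv a $ j))" for t :: complex
  define Om where "Om = {t. norm (L t) < r}"
  have Lr: "L (complex_of_real t) = cv (a + t *\<^sub>R (b - a))" for t by (simp add: L_def vec_eq_iff)
  have dL: "(L has_derivative (%h. \<chi> j. h * (cv b $ j - cv a $ j))) (at t)" for t
   unfolding L_def by (rule has_derivative_vec_components) (auto intro!: derivative_eq_intros)
  have cL: "continuous_on UNIV L"
   by (intro continuous_at_imp_continuous_on ballI has_derivative_continuous[OF dL])
  have oOm: "open Om"
   using open_vimage[OF open_ball cL, of 0 r] by (simp add: Om_def vimage_def)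
  have "convex Om"
  proof (rule convexI)
   fix t1 t2 :: complex and u v :: real
   assume t: "t1 : Om" "t2 : Om" and uv: "0 <= u" "0 <= v" "u + v = 1"
   have "L (u *\<^sub>R t1 + v *\<^sub>R t2) = u *\<^sub>R L t1 + v *\<^sub>R L t2"
   proof -
    have c: "complex_of_real u + complex_of_real v = 1" using uv(3) by (metis of_real_1 of_real_add)
    have "z + (complex_of_real u * t1 + complex_of_real v * t2) * w =
     complex_of_real u * (z + t1 * w) + complex_of_real v * (z + t2 * w)" for z w
    proof -
     have "complex_of_real u * (z + t1 * w) + complex_of_real v * (z + t2 * w) =
      (complex_of_real u + complex_of_real v) * z + (complex_of_real u * t1 + complex_of_real v * t2) * w"
      by (simp add: algebra_simps)
     then show ?thesis by (simp add: c)
    qed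
    then show ?thesis by (simp add: L_def vec_eq_iff scaleR_conv_of_real[where 'a = complex])
   qed
   then have "norm (L (u *\<^sub>R t1 + v *\<^sub>R t2)) <= u * norm (L t1) + v * norm (L t2)"
    using norm_triangle_ineq[of "u *\<^sub>R L t1" "v *\<^sub>R L t2"] uv by simp
   also have "\<dots> < r" by (rule convex_bound_lt) (use t uv in \<open>auto simp: Om_def\<close>)
   finally show "u *\<^sub>R t1 + v *\<^sub>R t2 : Om" by (simp add: Om_def)
  qed
  then have conn: "connected Om" by (rule convex_connected)
  have hol: "(%t. G (L t)) holomorphic_on Om"
  proof (rule holomorphic_onI)
   fix t assume "t : Om"
   then have "(G has_derivative (%h. SUM i:UNIV. h$i * G' i (L t))) (at (L t))"
    by (intro holdD(2)[OF G]) (simp add: Om_def)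
   from diff_chain_at[OF dL this]
   have "((%t. G (L t)) has_derivative (%h. SUM i:UNIV. h * (cv b $ i - cv a $ i) * G' i (L t))) (at t)"
    by (simp add: o_def)
   moreover have "(%h. SUM i:UNIV. h * (cv b $ i - cv a $ i) * G' i (L t)) = (*) (SUM i:UNIV. (cv b $ i - cv a $ i) * G' i (L t))"
    by (intro ext) (simp add: sum_distrib_left sum_distrib_right mult_ac)
   ultimately have "((%t. G (L t)) has_field_derivative (SUM i:UNIV. (cv b $ i - cv a $ i) * G' i (L t))) (at t)"
    by (simp add: has_field_derivative_def)
   then show "(%t. G (L t)) field_differentiable at t within Om"
    using field_differentiable_at_within field_differentiable_def by blast
  qed
  \<comment> \<open>For parameters below \<open>c\<close> the segment stays within \<open>s\<close>
    of \<open>a\<close>, where \<open>f\<close> has no zeros; these parameters accumulate at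
    0.\<close>
  define c where "c = s / (norm (b - a) + 1)"
  have c: "c > 0" using s(1) by (simp add: c_def add_nonneg_pos)
  define U where "U = complex_of_real ` {0<..<min c 1}"
  have inb: "norm (a + t *\<^sub>R (b - a)) < e" if "0 <= t" "t <= 1" for t
  proof -
   have "a + t *\<^sub>R (b - a) = (1 - t) *\<^sub>R a + t *\<^sub>R b" by (simp add: algebra_simps)
   then have "norm (a + t *\<^sub>R (b - a)) <= (1 - t) * norm a + t * norm b"
    using norm_triangle_ineq[of "(1 - t) *\<^sub>R a" "t *\<^sub>R b"] that by simp
   also have "\<dots> < e" by (rule convex_bound_lt) (use a b that in auto)
   finally show ?thesis .
  qed
  have Usub: "U <= Om"
  proof
   fix t assume "t : U"
   then obtain t' where t': "t = complex_of_real t'" "0 < t'" "t' < 1" by (auto simp: U_def)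
   have "norm (a + t' *\<^sub>R (b - a)) < e" by (rule inb) (use t' in auto)
   then show "t : Om" using e(2) by (simp add: Om_def Lr t'(1))
  qed
  have U0: "G (L t) = 0" if tU: "t : U" for t
  proof -
   obtain t' where t': "t = complex_of_real t'" "0 < t'" "t' < c" "t' < 1" using tU by (auto simp: U_def)
   have "t' * norm (b - a) <= t' * (norm (b - a) + 1)" using t' by simp
   also have "\<dots> < c * (norm (b - a) + 1)" using t' by (intro mult_strict_right_mono) (auto simp: add_nonneg_pos)
   also have "\<dots> = s"
   proof -
    have "norm (b - a) + 1 ~= 0" using norm_ge_zero[of "b - a"] by linarith
    then show ?thesis by (simp add: c_def)
   qed
   finally have "f (a + t' *\<^sub>R (b - a)) ~= 0" using t' by (intro s(2)) (simp add: dist_norm)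
   moreover have nb: "norm (a + t' *\<^sub>R (b - a)) < e" by (rule inb) (use t' in auto)
   ultimately have "g (a + t' *\<^sub>R (b - a)) = 0" using d(2)[of "a + t' *\<^sub>R (b - a)"] e(3) by simp
   then show ?thesis using Gr[of "a + t' *\<^sub>R (b - a)"] nb e(2) by (simp add: t'(1) Lr)
  qed
  have "0 islimpt U"
   unfolding islimpt_approachable
  proof (intro allI impI)
   fix ez :: real assume "ez > 0"
   define t where "t = min (min c 1) ez / 2"
   have "t > 0" "t < min c 1" "t < ez" using c \<open>ez > 0\<close> by (auto simp: t_def)
   then show "EX x':U. x' ~= 0 & dist x' 0 < ez"
    by (intro bexI[of _ "complex_of_real t"]) (auto simp: U_def)
  qed
  moreover have "0 : Om" "1 : Om" using a(1) b e(2) Lr[of 0] Lr[of 1] by (auto simp: Om_def)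
  ultimately have "G (L 1) = 0"
   using analytic_continuation[OF hol oOm conn Usub] U0 by blast
  then show ?thesis using Lr[of 1] Gr[of b] b e(2) by simp
 qed
 then show ?thesis unfolding eventually_nhds_metric using e(1) by auto
qed

lemma not_zero_near_prod:
 assumes "finite K" "!!k. k : K ==> ana (f k) & \<not> zero_near (f k)"
 shows "\<not> zero_near (%x. PROD k:K. f k x)"
 using assms
proof (induction K rule: finite_induct)
 case empty
 then show ?case using ana_at_0[of "%_. 1 :: real" "%_. 0"] by auto
next
 case (insert k K)
 then show ?case using zero_near_mult[of "f k" "%x. PROD k:K. f k x"] ana_prod[of K f] by auto
qed

lemma mo_unit_nonzero:
 assumes "ana u" "u 0 ~= 0" "eventually (%x. mo a x * u x = 0) (nhds 0)"
 shows False
proof (rule eventually_line_witness[of "%x. mo a x * u x = 0 & u x ~= 0" "{}"])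
 show "eventually (%x. mo a x * u x = 0 & u x ~= 0) (nhds 0)"
  using assms(3) ana_nonzero_near[OF assms(1,2)] by (rule eventually_conj)
qed (auto simp: mo_nonzero_iff)

lemma nth_not_zero_near: "\<not> zero_near (%x. x $ i)"
 using mo_unit_nonzero[of "%_. 1" "%j. if j = i then 1 else 0"] by (auto simp: mo_single)

lemma monI: "ana u ==> u 0 ~= 0 ==> (!!x. g x = mo a x * u x) ==> mon g"
proof -
 assume "ana u" "u 0 ~= 0" "!!x. g x = mo a x * u x"
 moreover from this(3) have "eventually (%x. g x = mo a x * u x) (nhds 0)" by (intro always_eventually allI)
 ultimately show ?thesis unfolding mon_def by blast
qed

lemma mon_cong: "mon g ==> eventually (%x. g x = h x) (nhds 0) ==> mon h"
proof -
 assume "mon g" and gh: "eventually (%x. g x = h x) (nhds 0)"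
 then obtain a u where u: "ana u" "u 0 ~= 0" "eventually (%x. g x = mo a x * u x) (nhds 0)" unfolding mon_def by blast
 have "eventually (%x. h x = mo a x * u x) (nhds 0)" using u(3) gh by eventually_elim simp
 then show ?thesis using u(1,2) unfolding mon_def by blast
qed

lemma mon_nth [simp]: "mon (%x. x $ i)"
 by (rule monI[of "%_. 1" _ "%j. if j = i then 1 else 0"]) (auto simp: mo_single)

lemma mon_unit: "ana u ==> u 0 ~= 0 ==> mon u"
 by (rule monI[of u _ "%_. 0"]) auto

lemma mon_mult: "mon f ==> mon g ==> mon (%x. f x * g x)"
proof -
 assume "mon f" "mon g"
 then obtain a u b v where u: "ana u" "u 0 ~= 0" "eventually (%x. f x = mo a x * u x) (nhds 0)"
  and v: "ana v" "v 0 ~= 0" "eventually (%x. g x = mo b x * v x) (nhds 0)" unfolding mon_def by blast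
 have "eventually (%x. f x * g x = mo (%i. a i + b i) x * (u x * v x)) (nhds 0)"
  using u(3) v(3) by eventually_elim (simp add: mo_add mult_ac)
 then show ?thesis unfolding mon_def using ana_mult[OF u(1) v(1)] u(2) v(2)
  by (intro exI[of _ "%i. a i + b i"] exI[of _ "%x. u x * v x"]) auto
qed

lemma mon_power: "mon f ==> mon (%x. f x ^ k)"
 by (induction k) (auto intro: mon_mult mon_unit)

lemma mon_not_zero_near: "mon g ==> \<not> zero_near g"
proof
 assume "mon g" and z: "zero_near g"
 then obtain a u where u: "ana u" "u 0 ~= 0" "eventually (%x. g x = mo a x * u x) (nhds 0)" unfolding mon_def by blast
 have "eventually (%x. mo a x * u x = 0) (nhds 0)" using u(3) z by eventually_elim simp
 then show False by (rule mo_unit_nonzero[OF u(1,2)])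
qed

lemma ana_divide_nth:
 assumes f: "ana f" and z: "zero_near (%x. f (zn i x))"
 obtains g where "ana g" "eventually (%x. f x = x $ i * g x) (nhds 0)"
proof -
 have dU: "dep UNIV f" unfolding dep_def by (simp add: vec_eq_iff[symmetric])
 obtain u where u: "ana u"
  "eventually (%x. f x = (SUM k<1. (partial i ^^ k) f (zn i x) / fact k * x $ i ^ k) + x $ i ^ 1 * u x) (nhds 0)"
  by (rule ana_taylor[OF f zero_less_one dU, of i])
 have "eventually (%x. f x = x $ i * u x) (nhds 0)" using u(2) z by eventually_elim simp
 then show thesis using that u(1) by blast
qed

text \<open>Unique factorization by hand, inducting on the total degree of the monomial: restricted
  to \<open>x $ i = 0\<close> the product vanishes, so one factor does, and the coordinate can be
  cancelled.\<close>

lemma mon_factor: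
 assumes "ana f" "ana g" "mon (%x. f x * g x)"
 shows "mon f"
proof -
 obtain a u where u: "ana u" "u 0 ~= 0" "eventually (%x. f x * g x = mo a x * u x) (nhds 0)"
  using assms(3) unfolding mon_def by blast
 have "mon f" if "(SUM i:UNIV. a i) = m" "ana f" "ana g" "eventually (%x. f x * g x = mo a x * u x) (nhds 0)" for m f g a
  using that
 proof (induction m arbitrary: f g a)
  case 0
  then have "a = (%_. 0)" by auto
  then have "f 0 * g 0 = u 0" using ana_at_0[OF 0(4)] by simp
  then have "f 0 ~= 0" using u(2) by auto
  then show ?case using 0(2) by (rule mon_unit[rotated])
 next
  case (Suc m)
  obtain i where i: "a i > 0" using Suc.prems(1) by (metis gr0I sum.neutral Zero_not_Suc)
  define b where "b = a(i := a i - 1)"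
  have ab: "mo a x = x $ i * mo b x" for x
  proof -
   have "a = (%j. (if j = i then 1 else 0) + b j)" using i by (auto simp: b_def)
   then show ?thesis by (metis mo_add mo_single power_one_right)
  qed
  have sb: "(SUM j:UNIV. b j) = m"
  proof -
   have "(SUM j:UNIV. a j) = (SUM j:UNIV. (if j = i then 1 else 0) + b j)" using i by (intro sum.cong) (auto simp: b_def)
   then show ?thesis using Suc.prems(1) by (simp add: sum.distrib)
  qed
  have "zero_near (%x. f (zn i x) * g (zn i x))"
   using eventually_amap[OF amap_zn Suc.prems(4), of i] by eventually_elim (simp add: ab)
  then consider "zero_near (%x. f (zn i x))" | "zero_near (%x. g (zn i x))"
   using zero_near_mult[OF ana_amap[OF Suc.prems(2) amap_zn] ana_amap[OF Suc.prems(3) amap_zn]] by blast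
  then show ?case
  proof cases
   case 1
   obtain f' where f': "ana f'" "eventually (%x. f x = x $ i * f' x) (nhds 0)" by (rule ana_divide_nth[OF Suc.prems(2) 1])
   have "zero_near (%x. x $ i * (f' x * g x - mo b x * u x))"
    using f'(2) Suc.prems(4) by eventually_elim (simp add: ab algebra_simps)
   then have "zero_near (%x. f' x * g x - mo b x * u x)"
    by (rule zero_near_mult[rotated 2])
     (auto intro!: ana_diff ana_mult f' Suc.prems u simp: nth_not_zero_near)
   then have "eventually (%x. f' x * g x = mo b x * u x) (nhds 0)" by eventually_elim simp
   from Suc.IH[OF sb f'(1) Suc.prems(3) this] have "mon (%x. x $ i * f' x)" by (intro mon_mult mon_nth)
   then show ?thesis by (rule mon_cong) (use f'(2) in eventually_elim, simp)
  next
   case 2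
   obtain g' where g': "ana g'" "eventually (%x. g x = x $ i * g' x) (nhds 0)" by (rule ana_divide_nth[OF Suc.prems(3) 2])
   have "zero_near (%x. x $ i * (f x * g' x - mo b x * u x))"
    using g'(2) Suc.prems(4) by eventually_elim (simp add: ab algebra_simps)
   then have "zero_near (%x. f x * g' x - mo b x * u x)"
    by (rule zero_near_mult[rotated 2])
     (auto intro!: ana_diff ana_mult g' Suc.prems u simp: nth_not_zero_near)
   then have "eventually (%x. f x * g' x = mo b x * u x) (nhds 0)" by eventually_elim simp
   from Suc.IH[OF sb Suc.prems(2) g'(1) this] show ?thesis .
  qed
 qed
 then show ?thesis using u assms by blast
qed

lemma mon_prod_factor:
 assumes "finite K" "!!k. k : K ==> ana (f k)" "mon (%x. PROD k:K. f k x)" "k : K"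
 shows "mon (f k)"
proof -
 have "(%x. PROD k:K. f k x) = (%x. f k x * (PROD k:K - {k}. f k x))" using assms(1,4) by (simp add: prod.remove)
 then show ?thesis using mon_factor[of "f k" "%x. PROD k:K - {k}. f k x"] assms ana_prod[of "K - {k}" f] by auto
qed

text \<open>Remove the common monomial. If divisibility failed both ways, the remaining difference
  \<open>E\<close> would vanish at 0 and hence on a coordinate hyperplane; but the remaining
  monomials have disjoint supports, and at suitable points of the hyperplane exactly one of them
  vanishes.\<close>

lemma comparable_exponents:
 assumes u: "ana u" "u 0 ~= 0" and v: "ana v" "v 0 ~= 0"
  and D: "zero_near (%x. mo a x * u x - mo b x * v x) \<or> mon (%x. mo a x * u x - mo b x * v x)"
 shows "(ALL i. a i <= b i) \<or> (ALL i. b i <= a i)"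
proof (rule ccontr)
 assume nc: "\<not> ((ALL i. a i <= b i) \<or> (ALL i. b i <= a i))"
 define m al \<beta> where "m i = min (a i) (b i)" and "al i = a i - min (a i) (b i)" and "\<beta> i = b i - min (a i) (b i)" for i
 obtain j j' where jj: "b j < a j" "a j' < b j'" using nc by (auto simp: not_le)
 then have j: "al j > 0" and j': "\<beta> j' > 0" by (simp_all add: al_def \<beta>_def)
 have disj: "al i = 0 \<or> \<beta> i = 0" for i by (auto simp: al_def \<beta>_def min_def)
 define E where "E x = mo al x * u x - mo \<beta> x * v x" for x
 have ab: "(%i. m i + al i) = a" "(%i. m i + \<beta> i) = b" by (auto simp: m_def al_def \<beta>_def)
 have ma: "mo a x = mo m x * mo al x" and mb: "mo b x = mo m x * mo \<beta> x" for x
  unfolding mo_add[symmetric] ab by (rule refl)+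
 have fac: "mo a x * u x - mo b x * v x = E x * mo m x" for x
  unfolding E_def ma mb by (simp only: algebra_simps)
 have aE: "ana E" unfolding E_def[abs_def] by (intro ana_diff ana_mult ana_mo u v)
 have "al ~= (%_. 0)" "\<beta> ~= (%_. 0)" using j j' by auto
 then have E0: "E 0 = 0" by (simp add: E_def mo_at_0)
 \<comment> \<open>Either \<open>E\<close> vanishes identically or it is a nonconstant monomial
   times a unit; both give a hyperplane on which it is 0.\<close>
 obtain k where k: "zero_near (%x. E (zn k x))"
 proof (cases "zero_near E")
  case True
  then show thesis using that[of undefined] eventually_amap[OF amap_zn True] by blast
 next
  case False
  have "\<not> zero_near (%x. E x * mo m x)"
   using zero_near_mult[OF aE ana_mo _ False] mo_unit_nonzero[of "%_. 1" m] by auto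
  then have "mon (%x. E x * mo m x)" using D fac by auto
  then have "mon E" by (rule mon_factor[OF aE ana_mo])
  then obtain c w where w: "ana w" "w 0 ~= 0" "eventually (%x. E x = mo c x * w x) (nhds 0)" unfolding mon_def by blast
  have "mo c 0 = 0" using ana_at_0[OF w(3)] E0 w(2) by simp
  then obtain k where "c k ~= 0" using mo_nonzero_iff[of c 0] by auto
  then have m0: "mo c (zn k x) = 0" for x using mo_nonzero_iff[of c "zn k x"] by auto
  have "zero_near (%x. E (zn k x))" using eventually_amap[OF amap_zn w(3), of k] by eventually_elim (simp add: m0)
  then show thesis by (rule that)
 qed
 have uv: "eventually (%x. u x ~= 0 & v x ~= 0) (nhds 0)"
  using ana_nonzero_near[OF u] ana_nonzero_near[OF v] by (rule eventually_conj)
 have ev: "eventually (%x. (E (zn k x) = 0 & u (zn k x) ~= 0 & v (zn k x) ~= 0)) (nhds 0)"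
  using k eventually_amap[OF amap_zn uv, of k] by eventually_elim simp
 show False
 \<comment> \<open>When \<open>k\<close> is no variable of the second monomial, also setting
   coordinate \<open>j\<close> to 0 kills the first and leaves the second.\<close>
 proof (cases "\<beta> k = 0")
  case True
  have "\<beta> j = 0" using disj[of j] j by auto
  show False
  proof (rule eventually_line_witness[OF ev, of "{k, j}"])
   fix x :: "real^'a" assume x: "!!i. i : {k, j} ==> x $ i = 0" "!!i. i ~: {k, j} ==> x $ i ~= 0"
   have "mo al (zn k x) = 0" by (rule mo_eq_0[of _ j]) (use x(1)[of j] j in simp_all)
   moreover have "mo \<beta> (zn k x) ~= 0"
    unfolding mo_nonzero_iff using True \<open>\<beta> j = 0\<close> x(2) by auto
   ultimately show "\<not> (E (zn k x) = 0 & u (zn k x) ~= 0 & v (zn k x) ~= 0)" by (simp add: E_def)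
  qed
 next
  case False
  then have "al k = 0" using disj[of k] by auto
  show False
  proof (rule eventually_line_witness[OF ev, of "{k}"])
   fix x :: "real^'a" assume x: "!!i. i : {k} ==> x $ i = 0" "!!i. i ~: {k} ==> x $ i ~= 0"
   have "mo \<beta> (zn k x) = 0" by (rule mo_eq_0[of _ k]) (use False in simp_all)
   moreover have "mo al (zn k x) ~= 0"
    unfolding mo_nonzero_iff using \<open>al k = 0\<close> x(2) by auto
   ultimately show "\<not> (E (zn k x) = 0 & u (zn k x) ~= 0 & v (zn k x) ~= 0)" by (simp add: E_def)
  qed
 qed
qed

lemma mon_amap:
 assumes u: "ana u" "u 0 ~= 0" "eventually (%x. g x = mo a x * u x) (nhds 0)" and rh: "amap rh" "!!i. a i ~= 0 ==> mon (%x. rh x $ i)"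
 shows "mon (%x. g (rh x))"
proof -
 have p: "mon (%x. PROD i:K. rh x $ i ^ a i)" if "finite K" for K
  using that
 proof (induction K rule: finite_induct)
  case (insert i K)
  have "mon (%x. rh x $ i ^ a i)"
  proof (cases "a i = 0")
   case True then show ?thesis by (simp add: mon_unit)
  next
   case False then show ?thesis by (intro mon_power rh(2))
  qed
  then show ?case using insert mon_mult by simp
 qed (simp add: mon_unit)
 have "rh 0 = 0" using rh(1) by (simp add: amap_def)
 then have "mon (%x. u (rh x))" by (intro mon_unit ana_amap[OF u(1) rh(1)]) (simp add: u(2))
 with p[OF finite] have "mon (%x. mo a (rh x) * u (rh x))" unfolding mo_def by (rule mon_mult)
 then show ?thesis
  by (rule mon_cong) (use eventually_amap[OF rh(1) u(3)] in eventually_elim, simp)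
qed


subsection \<open>Coverings by analytic maps\<close>

text \<open>The sizes \<open>e\<close> are chosen after the family and may differ from map to map,
  since each map comes with its own neighbourhood of validity; still finitely many images of these
  cubes contain a cube. Local statements at the sources can therefore be combined below.\<close>

definition cover :: "(real^'n::finite => real^'n) set => bool" where
 "cover S \<longleftrightarrow> (ALL e. (ALL si:S. e si > (0::real)) --> (EX T ew. finite T & T <= S & ew > 0 &
  (ALL y. (ALL j. \<bar>y $ j\<bar> < ew) --> (EX si:T. EX x. (ALL j. \<bar>x $ j\<bar> < e si) & si x = y))))"

text \<open>Such substitutions preserve \<open>dep I\<close>.\<close>

definition act :: "'n set => (real^'n::finite => real^'n) => bool" where
 "act I si \<longleftrightarrow> (ALL i. i ~: I --> (ALL x. si x $ i = x $ i)) & (ALL i:I. dep I (%x. si x $ i))"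

text \<open>The coordinates other than \<open>n\<close> must become monomials as well: powers of a
  coordinate split off by a blow-up then stay monomial under the maps found for the remaining
  factor. Coordinate \<open>n\<close> is exempt, since the shifts do not preserve it.\<close>

definition QS :: "'n set => 'n => (real^'n::finite => real) => (real^'n => real^'n) set => bool" where
 "QS I n f S \<longleftrightarrow> cover S & (ALL si:S. amap si & act I si & mon (%x. f (si x)) & (ALL i:I - {n}. mon (%x. si x $ i)))"

text \<open>The components other than \<open>n\<close> are monomials in those same variables, so
  composing with maps from \<open>QS\<close> keeps them monomials times units.\<close>

definition nice :: "'n set => 'n => (real^'n::finite => real^'n) => bool" where
 "nice I n si \<longleftrightarrow> amap si & act I si & (ALL i:I - {n}. EX a u. ana u & u 0 ~= 0 &
  eventually (%x. si x $ i = mo a x * u x) (nhds 0) & (ALL k. a k ~= 0 --> k : I - {n}))"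

lemma coverD:
 assumes "cover S" "!!si. si : S ==> e si > 0"
 obtains T ew where "finite T" "T <= S" "ew > 0" "!!y. (!!j. \<bar>y $ j\<bar> < ew) ==> EX si:T. EX x. (ALL j. \<bar>x $ j\<bar> < e si) & si x = y"
proof -
 have "ALL si:S. e si > 0" using assms(2) by blast
 with assms(1) obtain T ew where "finite T" "T <= S" "ew > 0"
  "ALL y. (ALL j. \<bar>y $ j\<bar> < ew) --> (EX si:T. EX x. (ALL j. \<bar>x $ j\<bar> < e si) & si x = y)"
  unfolding cover_def by (elim allE[of _ e]) blast
 then show thesis by (intro that[of T ew]) auto
qed

lemma coverI:
 fixes S :: "(real^'n::finite => real^'n) set"
 assumes "!!e. (!!si. si : S ==> e si > (0::real)) ==> EX T ew. finite T & T <= S & ew > 0 &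
  (ALL y. (ALL j. \<bar>y $ j\<bar> < ew) --> (EX si:T. EX x. (ALL j. \<bar>x $ j\<bar> < e si) & si x = y))"
 shows "cover S"
 unfolding cover_def
proof (intro allI impI)
 fix e :: "(real^'n => real^'n) => real" assume "ALL si:S. e si > 0"
 then have "!!si. si : S ==> e si > 0" by simp
 then show "EX T ew. finite T & T <= S & ew > 0 &
  (ALL y. (ALL j. \<bar>y $ j\<bar> < ew) --> (EX si:T. EX x. (ALL j. \<bar>x $ j\<bar> < e si) & si x = y))" by (rule assms)
qed

lemma cover_singleton:
 assumes "!!e. e > 0 ==> EX ew>0. ALL y. (ALL j. \<bar>y $ j\<bar> < ew) --> (EX x. (ALL j. \<bar>x $ j\<bar> < e) & si x = y)"
 shows "cover {si}"
proof (rule coverI)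
 fix e :: "(real^'a => real^'a) => real" assume e: "!!ta. ta : {si} ==> e ta > 0"
 obtain ew where "ew > 0" "ALL y. (ALL j. \<bar>y $ j\<bar> < ew) --> (EX x. (ALL j. \<bar>x $ j\<bar> < e si) & si x = y)"
  using assms[of "e si"] e by auto
 then show "EX T ew. finite T & T <= {si} & ew > 0 & (ALL y. (ALL j. \<bar>y $ j\<bar> < ew) --> (EX si:T. EX x. (ALL j. \<bar>x $ j\<bar> < e si) & si x = y))"
  by (intro exI[of _ "{si}"] exI[of _ ew]) auto
qed

lemma cover_id: "cover {%x. x}"
 by (rule cover_singleton) auto

text \<open>Sizes are prescribed backwards: the target cube reached by \<open>R si\<close> becomes
  the source size demanded of \<open>si\<close>.\<close>

lemma cover_compose:
 assumes S: "cover S" and R: "!!si. si : S ==> cover (R si)"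
 shows "cover {(%x. si (rh x)) | si rh. si : S & rh : R si}"
proof (rule coverI)
 fix e :: "(real^'a => real^'a) => real"
 assume e: "!!ta. ta : {(%x. si (rh x)) | si rh. si : S & rh : R si} ==> e ta > 0"
 have "EX T ew. finite T & T <= R si & ew > 0 & (ALL y. (ALL j. \<bar>y $ j\<bar> < ew) --> (EX rh:T. EX x. (ALL j. \<bar>x $ j\<bar> < e (%x. si (rh x))) & rh x = y))"
  if s: "si : S" for si
 proof -
  have pos: "e (%x. si (rh x)) > 0" if "rh : R si" for rh using e s that by blast
  obtain T ew where "finite T" "T <= R si" "ew > 0" "!!y. (!!j. \<bar>y $ j\<bar> < ew) ==> EX rh:T. EX x. (ALL j. \<bar>x $ j\<bar> < e (%x. si (rh x))) & rh x = y"
   by (rule coverD[OF R[OF s], of "%rh. e (%x. si (rh x))"]) (use pos in auto)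
  then show ?thesis by blast
 qed
 then obtain T ew where T: "!!si. si : S ==> finite (T si)" "!!si. si : S ==> T si <= R si" "!!si. si : S ==> ew si > 0"
  "!!si y. si : S ==> (!!j. \<bar>y $ j\<bar> < ew si) ==> EX rh:T si. EX x. (ALL j. \<bar>x $ j\<bar> < e (%x. si (rh x))) & rh x = y" by metis
 obtain T0 ew0 where T0: "finite T0" "T0 <= S" "ew0 > 0" "!!y. (!!j. \<bar>y $ j\<bar> < ew0) ==> EX si:T0. EX x. (ALL j. \<bar>x $ j\<bar> < ew si) & si x = y"
  by (rule coverD[OF S, of ew]) (use T(3) in auto)
 define U where "U = (UN si:T0. (%rh x. si (rh x)) ` T si)"
 have "EX ta:U. EX x. (ALL j. \<bar>x $ j\<bar> < e ta) & ta x = y" if y: "ALL j. \<bar>y $ j\<bar> < ew0" for y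
 proof -
  obtain si x where x: "si : T0" "ALL j. \<bar>x $ j\<bar> < ew si" "si x = y" using T0(4)[of y] y by blast
  obtain rh z where z: "rh : T si" "ALL j. \<bar>z $ j\<bar> < e (%x. si (rh x))" "rh z = x"
   using T(4)[of si x] x T0(2) by blast
  have "(%x. si (rh x)) : U" unfolding U_def using x(1) z(1) by blast
  then show ?thesis using z x(3) by (intro bexI[of _ "%x. si (rh x)"] exI[of _ z]) auto
 qed
 moreover have "finite U" unfolding U_def using T0(1,2) T(1) by (intro finite_UN_I finite_imageI) auto
 moreover have "U <= {(%x. si (rh x)) | si rh. si : S & rh : R si}" unfolding U_def using T(2) T0(2) by blast
 ultimately show "EX T ew. finite T & T <= {(%x. si (rh x)) | si rh. si : S & rh : R si} & ew > 0 &
  (ALL y. (ALL j. \<bar>y $ j\<bar> < ew) --> (EX si:T. EX x. (ALL j. \<bar>x $ j\<bar> < e si) & si x = y))" using T0(3) by blast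
qed

lemma dep_act: "dep I f ==> act I si ==> dep I (%x. f (si x))"
 unfolding act_def dep_def by blast

lemma act_compose:
 assumes "act I si" "act I rh"
 shows "act I (%x. si (rh x))"
 unfolding act_def
proof (intro conjI allI impI ballI)
 show "si (rh x) $ i = x $ i" if "i ~: I" for i x using assms that by (simp add: act_def)
 show "dep I (%x. si (rh x) $ i)" if "i : I" for i
  using dep_act[of I "%x. si x $ i" rh] assms that by (simp add: act_def)
qed

lemma act_id: "act I (%x. x)"
 by (auto simp: act_def dep_def)

lemma dep_zn: "dep I h ==> dep (I - {n}) (%x. h (zn n x))"
 unfolding dep_def by auto

lemma dep_mono: "dep J h ==> J <= I ==> dep I h"
 unfolding dep_def by blast

lemma act_mono: "act J si ==> J <= I ==> act I si"
proof -
 assume a: "act J si" "J <= I"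
 have "dep I (%x. si x $ i)" if "i : I" for i
 proof (cases "i : J")
  case True then show ?thesis using a dep_mono[of J "%x. si x $ i" I] by (auto simp: act_def)
 next
  case False
  then have "(%x. si x $ i) = (%x. x $ i)" using a by (auto simp: act_def)
  then show ?thesis using that by (auto simp: dep_def)
 qed
 then show ?thesis using a by (auto simp: act_def)
qed

lemma QS_cong: "QS I n f S ==> eventually (%x. f x = g x) (nhds 0) ==> QS I n g S"
 unfolding QS_def
proof (elim conjE, intro conjI ballI)
 fix si assume fg: "eventually (%x. f x = g x) (nhds 0)"
  and S: "ALL si:S. amap si & act I si & mon (%x. f (si x)) & (ALL i:I - {n}. mon (%x. si x $ i))" and si: "si : S"
 have A: "amap si" "mon (%x. f (si x))" using bspec[OF S si] by simp_all
 show "mon (%x. g (si x))" by (rule mon_cong[OF A(2) eventually_amap[OF A(1) fg]])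
qed simp_all

text \<open>Each map of a cover may either finish the task or be nice and leave a solvable problem;
  composing treats both kinds together.\<close>

lemma QS_step:
 assumes S: "cover S" and si: "!!si. si : S ==>
  (amap si & act I si & mon (%x. f (si x)) & (ALL i:I - {n}. mon (%x. si x $ i))) \<or> (nice I n si & (EX R. QS I n (%x. f (si x)) R))"
 shows "EX S'. QS I n f S'"
proof -
 have "EX R. cover R & (ALL rh:R. amap rh & act I rh & mon (%x. f (si (rh x))) & (ALL i:I - {n}. mon (%x. si (rh x) $ i)))
   & amap si & act I si" if s: "si : S" for si
  using si[OF s]
 proof
  assume "amap si & act I si & mon (%x. f (si x)) & (ALL i:I - {n}. mon (%x. si x $ i))"
  then show ?thesis using cover_id amap_id act_id by (intro exI[of _ "{%x. x}"]) auto
 next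
  assume "nice I n si & (EX R. QS I n (%x. f (si x)) R)"
  then obtain R where N: "nice I n si" and R: "QS I n (%x. f (si x)) R" by blast
  have "mon (%x. si (rh x) $ i)" if r: "rh : R" and i: "i : I - {n}" for rh i
  proof -
   obtain a u where u: "ana u" "u 0 ~= 0" "eventually (%x. si x $ i = mo a x * u x) (nhds 0)" "ALL k. a k ~= 0 --> k : I - {n}"
    using N i unfolding nice_def by blast
   show ?thesis
    by (rule mon_amap[OF u(1-3)]) (use R r u(4) in \<open>auto simp: QS_def\<close>)
  qed
  then show ?thesis using R N unfolding QS_def nice_def by blast
 qed
 then obtain R where R: "!!si. si : S ==> cover (R si)" "!!si rh. si : S ==> rh : R si ==> amap rh & act I rh & mon (%x. f (si (rh x))) & (ALL i:I - {n}. mon (%x. si (rh x) $ i))"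
  "!!si. si : S ==> amap si & act I si" by metis
 have "QS I n f {(%x. si (rh x)) | si rh. si : S & rh : R si}"
  unfolding QS_def
 proof (intro conjI ballI cover_compose S R(1))
  fix ta assume "ta : {(%x. si (rh x)) | si rh. si : S & rh : R si}"
  then obtain si rh where t: "ta = (%x. si (rh x))" "si : S" "rh : R si" unfolding mem_Collect_eq by (elim exE conjE)
  note r = R(2)[OF t(2,3)] and r' = R(3)[OF t(2)]
  show "amap ta" unfolding t(1) using conjunct1[OF r'] conjunct1[OF r] by (rule amap_compose)
  show "act I ta" unfolding t(1) using conjunct2[OF r'] conjunct1[OF conjunct2[OF r]] by (rule act_compose)
  show "mon (%x. f (ta x))" unfolding t(1) using r by (elim conjE)
  show "mon (%x. ta x $ i)" if "i : I - {n}" for i unfolding t(1) using r that by (elim conjE) (rule bspec)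
 qed
 then show ?thesis by blast
qed

lemma nice_coordI: "eventually (%x. si x $ i = x $ i) (nhds 0) ==> i : J ==>
 EX a u. ana u & u 0 ~= 0 & eventually (%x. si x $ i = mo a x * u x) (nhds 0) & (ALL k. a k ~= 0 --> k : J)"
 by (rule exI[of _ "%k. if k = i then 1 else 0"], rule exI[of _ "%_. 1"]) (simp add: mo_single)

text \<open>Setting the variables outside \<open>J\<close> to 0 does not change \<open>g\<close>; an
  exponent outside \<open>J\<close> would then make \<open>g\<close> vanish near 0.\<close>

lemma mon_dep:
 assumes "mon g" and J: "dep J g"
 obtains a u where "ana u" "u 0 ~= 0" "eventually (%x. g x = mo a x * u x) (nhds 0)" "!!k. a k ~= 0 ==> k : J" "dep J u"
proof -
 obtain a u where u: "ana u" "u 0 ~= 0" "eventually (%x. g x = mo a x * u x) (nhds 0)" using assms(1) unfolding mon_def by blast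
 define p where "p x = (\<chi> i. if i : J then x $ i else 0)" for x :: "real^'a"
 have ap: "amap p"
 proof (rule amapI)
  show "ana (%x. p x $ j)" for j by (cases "j : J") (auto simp: p_def)
 qed (simp add: p_def vec_eq_iff)
 have gp: "g (p x) = g x" for x by (rule depD[OF J]) (simp add: p_def)
 have ev: "eventually (%x. g x = mo a (p x) * u (p x)) (nhds 0)" using eventually_amap[OF ap u(3)] by (simp add: gp)
 have aJ: "k : J" if "a k ~= 0" for k
 proof (rule ccontr)
  assume "k ~: J"
  then have "mo a (p x) = 0" for x using that by (intro mo_eq_0[of _ k]) (auto simp: p_def)
  then have "zero_near g" using ev by simp
  then show False using mon_not_zero_near[OF assms(1)] by blast
 qed
 have "mo a (p x) = mo a x" for x
  unfolding mo_def
 proof (intro prod.cong refl)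
  fix i show "p x $ i ^ a i = x $ i ^ a i" using aJ[of i] by (cases "i : J"; cases "a i = 0") (auto simp: p_def)
 qed
 then have ev2: "eventually (%x. g x = mo a x * u (p x)) (nhds 0)" using ev by simp
 have "dep J (%x. u (p x))" unfolding dep_def
 proof (intro allI impI)
  fix x y :: "real^'a" assume "ALL i:J. x $ i = y $ i"
  then have "p x = p y" by (auto simp: p_def vec_eq_iff)
  then show "u (p x) = u (p y)" by simp
 qed
 then show thesis
  using that[OF ana_amap[OF u(1) ap] _ ev2 aJ] u(2) ap by (simp add: amap_def)
qed

section \<open>A one-variable criterion for a drop in order\<close>

lemma low_coeffs_vanish:
 assumes "eventually (%t. poly P t = t ^ d * B t) (nhds (0::real))" "isCont B 0" "i < d"
 shows "coeff P i = 0"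
 using assms
proof (induction d arbitrary: P i)
 case (Suc d)
 obtain c P' where P: "P = pCons c P'" by (cases P)
 have c0: "c = 0" using eventually_nhds_x_imp_x[OF Suc.prems(1)] by (simp add: P)
 have ev0: "eventually (%t. t * poly P' t = t * (t ^ d * B t)) (nhds 0)"
  using Suc.prems(1) by (simp add: P c0 mult.assoc)
 have ev: "eventually (%t. t ~= 0 --> poly P' t = t ^ d * B t) (nhds 0)"
  by (rule eventually_mono[OF ev0]) (metis mult_left_cancel)
 have l1: "((%t. poly P' t) \<longlongrightarrow> poly P' 0) (at 0)" by (intro tendsto_intros)
 have "((%t. t ^ d * B t) \<longlongrightarrow> 0 ^ d * B 0) (at 0)"
  using Suc.prems(2) by (intro tendsto_intros) (simp add: isCont_def)
 moreover have "eventually (%t. t ^ d * B t = poly P' t) (at 0)"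
  using ev unfolding eventually_at_filter by eventually_elim simp
 ultimately have "((%t. poly P' t) \<longlongrightarrow> 0 ^ d * B 0) (at 0)" by (rule Lim_transform_eventually)
 then have z: "poly P' 0 = 0 ^ d * B 0" using tendsto_unique[OF _ l1] by simp
 have "eventually (%t. poly P' t = t ^ d * B t) (nhds 0)"
  using ev by eventually_elim (use z in auto)
 from Suc.IH[OF this Suc.prems(2)] Suc.prems(3) show ?case by (cases i) (auto simp: P c0)
qed simp

text \<open>If the shifted polynomial had order \<open>d\<close> at \<open>t0\<close>, it would be a
  multiple of the \<open>d\<close>-th power of a linear form. The missing coefficient of degree
  \<open>d - 1\<close> forces \<open>t0 = 0\<close>, and then no lower coefficient could
  survive.\<close>

lemma no_pure_power:
 fixes c :: "nat => real"
 assumes d: "d > 0" and u: "u ~= 0" and c: "c (d - 1) = 0" "i0 < d" "c i0 ~= 0" and B: "isCont B 0"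
  and ev: "eventually (%t. (SUM i<d. c i * (t0 + t) ^ i) + (t0 + t) ^ d * u = t ^ d * B t) (nhds 0)"
 shows False
proof -
 define p where "p = (SUM i<d. monom (c i) i) + monom u d"
 have poly_p: "poly p s = (SUM i<d. c i * s ^ i) + s ^ d * u" for s
  by (simp add: p_def poly_sum poly_monom mult.commute)
 have cp: "coeff p i = (if i < d then c i else if i = d then u else 0)" for i
  by (auto simp: p_def coeff_sum)
 have dp: "degree p <= d" by (rule degree_le) (simp add: cp)
 define P where "P = pcompose p [:t0, 1:]"
 have "eventually (%t. poly P t = t ^ d * B t) (nhds 0)"
  using ev by (simp add: P_def poly_pcompose poly_p)
 note low = low_coeffs_vanish[OF this B]
 have "degree P <= d" using dp by (simp add: P_def degree_pcompose)
 then have "P = monom (coeff P d) d"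
  using low by (intro poly_eqI) (metis coeff_eq_0 coeff_monom le_less_trans linorder_neqE_nat)
 then have Pt: "poly P t = coeff P d * t ^ d" for t by (metis poly_monom)
 have "poly p s = poly (smult (coeff P d) ([:- t0, 1:] ^ d)) s" for s
 proof -
  have "poly p s = poly P (s - t0)" by (simp add: P_def poly_pcompose)
  then show ?thesis by (simp add: Pt)
 qed
 then have "poly p = poly (smult (coeff P d) ([:- t0, 1:] ^ d))" by (rule ext)
 then have peq: "p = smult (coeff P d) ([:- t0, 1:] ^ d)" by (simp only: poly_eq_poly_eq_iff)
 have co: "coeff p i = coeff P d * (of_nat (d choose i) * (- t0) ^ (d - i))" if "i <= d" for i
  by (subst peq) (simp add: coeff_linear_poly_power[OF that])
 have k: "coeff P d ~= 0" using co[of d] u by (auto simp: cp)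
 have "coeff P d * (of_nat (d choose (d - 1)) * (- t0) ^ (d - (d - 1))) = 0" using co[of "d - 1"] d c(1) by (simp add: cp)
 moreover have "d choose (d - 1) ~= 0" using d by (simp add: binomial_eq_0_iff)
 moreover have "d - (d - 1) = 1" using d by simp
 ultimately have "t0 = 0" using k by simp
 then have "coeff p i0 = 0" using co[of i0] c(2) by (simp add: zero_power)
 then show False using c by (simp add: cp)
qed

subsection \<open>Blowing up\<close>

lemma axis_lim: "filterlim (%t. axis n t :: real^'n::finite) (nhds 0) (nhds 0)"
proof -
 have "((%t. t *\<^sub>R axis n 1 :: real^'n) \<longlongrightarrow> 0 *\<^sub>R axis n 1) (nhds 0)"
  by (intro tendsto_scaleR tendsto_const filterlim_ident)
 moreover have "(%t. t *\<^sub>R axis n 1 :: real^'n) = (%t. axis n t)" by (rule ext) (simp add: vec_eq_iff axis_def)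
 ultimately show ?thesis by (simp only: scaleR_zero_left)
qed

lemma isCont_axis:
 fixes u :: "real^'n::finite => real"
 assumes "ana u"
 shows "isCont (%t. u (axis n t)) 0"
proof -
 have "filterlim u (nhds (u 0)) (nhds 0)" using ana_isCont[OF assms] by (simp add: isCont_def tendsto_at_iff_tendsto_nhds)
 from filterlim_compose[OF this axis_lim] have "filterlim (%t. u (axis n t)) (nhds (u 0)) (nhds 0)" .
 then have "((%t. u (axis n t)) \<longlongrightarrow> u 0) (at 0)" by (rule filterlim_mono) (simp_all add: at_within_def)
 moreover have "axis n 0 = (0 :: real^'n)" by (simp add: vec_eq_iff axis_def)
 ultimately show ?thesis by (simp only: isCont_def)
qed

text \<open>A point with \<open>\<bar>y $ l\<bar> < s * \<bar>y $ n\<bar>\<close>, where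
  \<open>s\<close> is the size allotted to \<open>rh2\<close>, is reached by \<open>rh2\<close>. For
  all others the slope \<open>y $ n / y $ l\<close> lies in the compact interval from
  \<open>- (1 / s)\<close> to \<open>1 / s\<close>, which finitely many centres \<open>t0\<close>
  cover.\<close>

lemma blowup_cover:
 fixes l n :: "'n::finite"
 assumes ln: "l ~= n"
 defines "rh1 \<equiv> %t0 x. (\<chi> j. if j = n then x $ l * (t0 + x $ n) else x $ j) :: real^'n"
  and "rh2 \<equiv> %x. (\<chi> j. if j = l then x $ l * x $ n else x $ j) :: real^'n"
 shows "cover (insert rh2 (range rh1))"
proof (rule coverI)
 fix e :: "(real^'n => real^'n) => real" assume e: "!!si. si : insert rh2 (range rh1) ==> e si > 0"
 define s where "s = e rh2"
 have s: "s > 0" using e by (simp add: s_def)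
 have e1: "e (rh1 t) > 0" for t using e by simp
 have sub: "{- (1 / s)..1 / s} <= (UN t:{- (1 / s)..1 / s}. ball t (e (rh1 t)))"
 proof
  fix t assume "t : {- (1 / s)..1 / s}"
  then show "t : (UN t:{- (1 / s)..1 / s}. ball t (e (rh1 t)))" using e1[of t] by (intro UN_I[of t]) auto
 qed
 obtain K where K: "K <= {- (1 / s)..1 / s}" "finite K" "{- (1 / s)..1 / s} <= (UN t:K. ball t (e (rh1 t)))"
 proof (rule compactE_image[OF compact_Icc _ sub])
  show "open (ball t (e (rh1 t)))" for t by simp
 qed (rule that)
 define ew where "ew = Min (insert s ((%t. e (rh1 t)) ` K))"
 have ew: "ew > 0" "ew <= s" "!!t. t : K ==> ew <= e (rh1 t)" using K(2) s e1 by (auto simp: ew_def)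
 have "EX si:insert rh2 (rh1 ` K). EX x. (ALL j. \<bar>x $ j\<bar> < e si) & si x = y" if y: "ALL j. \<bar>y $ j\<bar> < ew" for y
 proof (cases "\<bar>y $ l\<bar> < s * \<bar>y $ n\<bar>")
  case True
  then have yn: "y $ n ~= 0" by auto
  define x where "x = (\<chi> j. if j = l then y $ l / y $ n else y $ j)"
  have "\<bar>y $ l / y $ n\<bar> < s" using True yn by (simp add: divide_less_eq)
  moreover have "\<bar>y $ j\<bar> < s" for j using y ew(2) by (meson less_le_trans)
  ultimately have "ALL j. \<bar>x $ j\<bar> < e rh2" by (auto simp: x_def s_def)
  moreover have "rh2 x = y" using yn ln by (auto simp: rh2_def x_def vec_eq_iff)
  ultimately show ?thesis by blast
 next
  case False
  define t where "t = (if y $ l = 0 then 0 else y $ n / y $ l)"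
  have yt: "y $ n = y $ l * t"
  proof (cases "y $ l = 0")
   case True
   then have "s * \<bar>y $ n\<bar> <= 0" using False by simp
   then have "\<bar>y $ n\<bar> <= 0" using s by (simp add: mult_le_0_iff)
   then show ?thesis using True by simp
  qed (simp add: t_def)
  have "\<bar>t\<bar> <= 1 / s"
  proof (cases "y $ l = 0")
   case False
   then show ?thesis using \<open>\<not> \<bar>y $ l\<bar> < s * \<bar>y $ n\<bar>\<close> s by (simp add: t_def field_simps)
  qed (use s in \<open>simp add: t_def\<close>)
  then have "t : {- (1 / s)..1 / s}" by auto
  then obtain t0 where t0: "t0 : K" "t : ball t0 (e (rh1 t0))" using K(3) by blast
  define x where "x = (\<chi> j. if j = n then t - t0 else y $ j)"
  have "\<bar>y $ j\<bar> < e (rh1 t0)" for j using y ew(3)[OF t0(1)] by (meson less_le_trans)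
  moreover have "\<bar>t - t0\<bar> < e (rh1 t0)" using t0(2) by (simp add: dist_real_def abs_minus_commute)
  ultimately have "ALL j. \<bar>x $ j\<bar> < e (rh1 t0)" by (auto simp: x_def)
  moreover have "rh1 t0 x = y" using yt ln by (auto simp: rh1_def x_def vec_eq_iff)
  ultimately show ?thesis using t0(1) by blast
 qed
 then show "EX T ew. finite T & T <= insert rh2 (range rh1) & ew > 0 &
  (ALL y. (ALL j. \<bar>y $ j\<bar> < ew) --> (EX si:T. EX x. (ALL j. \<bar>x $ j\<bar> < e si) & si x = y))"
  using K(2) ew(1) by (intro exI[of _ "insert rh2 (rh1 ` K)"] exI[of _ ew]) auto
qed

text \<open>Blow up the plane of \<open>x $ l\<close> and \<open>x $ n\<close>. In the charts
  \<open>rh1\<close> a factor \<open>x $ l ^ d\<close> splits off and the exponent of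
  \<open>x $ l\<close> in the weight drops by one: if weight remains, the quotient is a unit for
  \<open>t0\<close> nonzero and the same problem with smaller weight for \<open>t0 = 0\<close>; if
  none remains, its order in \<open>x $ n\<close> is below \<open>d\<close>. In the chart
  \<open>rh2\<close> the quotient by \<open>x $ n ^ d\<close> is a unit.\<close>

lemma blowup_reduction:
 fixes f :: "real^'n::finite => real"
 assumes n: "n : I" and d: "0 < d"
  and IHQ: "!!g k. k < d ==> ana g ==> dep I g ==> (partial n ^^ k) g 0 ~= 0 ==> EX S. QS I n g S"
  and gq: "!!i. gq i ~= 0 ==> i : I - {n}" "gq ~= (%_. 0)"
  and c: "!!i. i < d ==> ana (c i)" "!!i. i < d ==> dep (I - {n}) (c i)" "c (d - 1) 0 = 0" "i0 < d" "c i0 0 ~= 0"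
  and u: "ana u" "dep I u" "u 0 ~= 0"
  and f: "!!x. f x = (SUM i<d. mo gq x ^ (d - i) * c i x * x $ n ^ i) + x $ n ^ d * u x"
 shows "EX S. QS I n f S"
 using gq u f
proof (induction "SUM i:UNIV. gq i" arbitrary: gq u f rule: less_induct)
 case less
 note gq = less.prems(1,2) and u = less.prems(3-5) and f = less.prems(6)
 obtain l where l: "gq l > 0" using gq(2) by auto
 have lI: "l : I - {n}" using gq(1) l by auto
 then have ln: "l ~= n" "l : I" by auto
 define rh1 where "rh1 = (%t0 x. (\<chi> j. if j = n then x $ l * (t0 + x $ n) else x $ j) :: real^'n)"
 define rh2 where "rh2 = (%x. (\<chi> j. if j = l then x $ l * x $ n else x $ j) :: real^'n)"
 have cov: "cover (insert rh2 (range rh1))" unfolding rh1_def rh2_def by (rule blowup_cover[OF ln(1)])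
 have am1: "amap (rh1 t)" for t
 proof (rule amapI)
  show "ana (%x. rh1 t x $ j)" for j by (cases "j = n") (auto simp: rh1_def intro!: ana_mult ana_add)
 qed (simp add: rh1_def vec_eq_iff)
 have am2: "amap rh2"
 proof (rule amapI)
  show "ana (%x. rh2 x $ j)" for j by (cases "j = l") (auto simp: rh2_def intro!: ana_mult)
 qed (simp add: rh2_def vec_eq_iff)
 have ac1: "act I (rh1 t)" for t using n ln by (auto simp: act_def rh1_def dep_def)
 have ac2: "act I rh2" using n ln by (auto simp: act_def rh2_def dep_def)
 have nice1: "nice I n (rh1 t)" for t
  unfolding nice_def
 proof (intro conjI ballI am1 ac1)
  fix i assume "i : I - {n}"
  then show "EX a u. ana u & u 0 ~= 0 & eventually (%x. rh1 t x $ i = mo a x * u x) (nhds 0) & (ALL k. a k ~= 0 --> k : I - {n})"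
   by (intro nice_coordI) (auto simp: rh1_def)
 qed
 have cdep: "c i (rh1 t x) = c i x" if "i < d" for i t x
  by (rule depD[OF c(2)[OF that]]) (auto simp: rh1_def)
 have gqn: "gq n = 0" using gq(1)[of n] by auto
 define gq' where "gq' = gq(l := gq l - 1)"
 have gqgq': "gq = (%i. (if i = l then 1 else 0) + gq' i)" using l by (auto simp: gq'_def)
 have mgq: "mo gq x = x $ l * mo gq' x" for x
  by (subst gqgq') (simp add: mo_add mo_single)
 have mrh1: "mo gq (rh1 t x) = mo gq x" for t x
  unfolding mo_def by (intro prod.cong refl) (auto simp: rh1_def gqn)
 have m0: "mo gq 0 = 0" by (rule mo_at_0[OF gq(2)])
 have case1: "EX R. QS I n (%x. f (rh1 t0 x)) R" for t0
 proof -
  define g where "g x = (SUM i<d. mo gq' x ^ (d - i) * c i x * (t0 + x $ n) ^ i) + (t0 + x $ n) ^ d * u (rh1 t0 x)" for x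
  have fg: "f (rh1 t0 x) = x $ l ^ d * g x" for x
  proof -
   have nn: "rh1 t0 x $ n = x $ l * (t0 + x $ n)" by (simp add: rh1_def)
   have "mo gq x ^ (d - i) * c i x * (x $ l * (t0 + x $ n)) ^ i = x $ l ^ d * (mo gq' x ^ (d - i) * c i x * (t0 + x $ n) ^ i)"
    if "i < d" for i
   proof -
    have "x $ l ^ d = x $ l ^ (d - i) * x $ l ^ i" using that by (simp add: power_add[symmetric])
    then show ?thesis by (simp add: mgq power_mult_distrib mult_ac)
   qed
   then have *: "(SUM i<d. mo gq x ^ (d - i) * c i x * (x $ l * (t0 + x $ n)) ^ i) = (SUM i<d. x $ l ^ d * (mo gq' x ^ (d - i) * c i x * (t0 + x $ n) ^ i))"
    by (intro sum.cong refl) simp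
   have "f (rh1 t0 x) = (SUM i<d. mo gq x ^ (d - i) * c i x * (x $ l * (t0 + x $ n)) ^ i) + (x $ l * (t0 + x $ n)) ^ d * u (rh1 t0 x)"
    unfolding f nn mrh1 by (simp add: cdep)
   moreover have "(x $ l * (t0 + x $ n)) ^ d = x $ l ^ d * (t0 + x $ n) ^ d" by (rule power_mult_distrib)
   ultimately have "f (rh1 t0 x) = (SUM i<d. x $ l ^ d * (mo gq' x ^ (d - i) * c i x * (t0 + x $ n) ^ i)) + x $ l ^ d * (t0 + x $ n) ^ d * u (rh1 t0 x)"
    by (simp only: *)
   then show ?thesis
    by (simp only: g_def distrib_left[of "x $ l ^ d"] sum_distrib_left mult.assoc)
  qed
  have ag: "ana g" unfolding g_def[abs_def]
   by (intro ana_add ana_sum ana_mult ana_power ana_mo ana_const ana_nth ana_amap[OF u(1) am1] c(1)) auto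
  have dg: "dep I g" unfolding dep_def
  proof (intro allI impI)
   fix x y :: "real^'n" assume xy: "ALL i:I. x $ i = y $ i"
   have "mo gq' x = mo gq' y" unfolding mo_def
   proof (intro prod.cong refl)
    fix i show "x $ i ^ gq' i = y $ i ^ gq' i"
    proof (cases "gq' i = 0")
     case False
     then have "gq i ~= 0" by (auto simp: gq'_def split: if_splits)
     then show ?thesis using gq(1) xy by auto
    qed simp
   qed
   moreover have "c i x = c i y" if "i < d" for i by (rule depD[OF c(2)[OF that]]) (use xy in auto)
   moreover have "u (rh1 t0 x) = u (rh1 t0 y)" by (rule depD[OF dep_act[OF u(2) ac1]]) (use xy in auto)
   moreover have "x $ n = y $ n" using xy n by auto
   ultimately show "g x = g y" unfolding g_def by simp
  qed
  have r0: "rh1 t0 0 = 0" using am1 by (simp add: amap_def)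
  have "EX S. QS I n g S"
  proof (cases "gq' = (%_. 0)")
   case False
   note m0' = mo_at_0[OF False]
   show ?thesis
   proof (cases "t0 = 0")
    case True
    have ur: "ana (%x. u (rh1 t0 x))" "dep I (%x. u (rh1 t0 x))" "u (rh1 t0 0) ~= 0"
     using ana_amap[OF u(1) am1] dep_act[OF u(2) ac1] u(3) r0 by auto
    show ?thesis
    proof (rule less.hyps[of gq' "%x. u (rh1 t0 x)" g, OF _ _ False ur])
     have "(SUM i:UNIV. gq i) = (SUM i:UNIV. (if i = l then 1 else 0) + gq' i)" by (subst gqgq') simp
     then show "(SUM i:UNIV. gq' i) < (SUM i:UNIV. gq i)" by (simp add: sum.distrib)
     show "i : I - {n}" if "gq' i ~= 0" for i
      using that gq(1)[of i] by (auto simp: gq'_def split: if_splits)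
     show "g x = (SUM i<d. mo gq' x ^ (d - i) * c i x * x $ n ^ i) + x $ n ^ d * u (rh1 t0 x)" for x
      by (simp add: g_def True)
    qed
   next
    case t0: False
    have "(SUM i<d. mo gq' 0 ^ (d - i) * c i 0 * (t0 + 0) ^ i) = 0"
     by (intro sum.neutral) (auto simp: m0' zero_power)
    then have "g 0 ~= 0" using t0 u(3) by (simp add: g_def r0)
    then have "QS I n g {%x. x}" unfolding QS_def using cover_id amap_id act_id mon_unit[OF ag] by auto
    then show ?thesis by blast
   qed
  next
   case True
   \<comment> \<open>With no weight left, \<open>g\<close> on the \<open>n\<close>-axis is a
     polynomial of degree \<open>d\<close> with missing term \<open>d - 1\<close> and some lower
     term; \<open>no_pure_power\<close> forbids order \<open>d\<close> at the centre.\<close>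
   have "EX k<d. (partial n ^^ k) g 0 ~= 0"
   proof (rule ccontr)
    assume "\<not> (EX k<d. (partial n ^^ k) g 0 ~= 0)"
    then have z: "k < d ==> (partial n ^^ k) g 0 = 0" for k by blast
    obtain U where U: "ana U" "eventually (%x. g x = (SUM i<d. (partial n ^^ i) g (zn n x) / fact i * x $ n ^ i) + x $ n ^ d * U x) (nhds 0)"
     by (rule ana_taylor[OF ag d dg, of n])
    note lim = axis_lim[of n] and B = isCont_axis[OF U(1), of n]
    have ev1: "eventually (%t. g (axis n t) = t ^ d * U (axis n t)) (nhds 0)"
    proof -
     have "eventually (%t. g (axis n t) = (SUM i<d. (partial n ^^ i) g (zn n (axis n t)) / fact i * axis n t $ n ^ i) + axis n t $ n ^ d * U (axis n t)) (nhds 0)"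
      using U(2) lim unfolding filterlim_iff by blast
     moreover have zz: "zn n (axis n t) = (0 :: real^'n)" for t :: real by (simp add: vec_eq_iff axis_def)
     have "(SUM i<d. (partial n ^^ i) g (zn n (axis n t)) / fact i * axis n t $ n ^ i) = 0" for t :: real
      unfolding zz by (intro sum.neutral) (simp add: z)
     ultimately show ?thesis by (simp add: axis_def)
    qed
    have ga: "g (axis n t) = (SUM i<d. c i 0 * (t0 + t) ^ i) + (t0 + t) ^ d * u 0" for t
    proof -
     have "rh1 t0 (axis n t) = 0" using ln by (simp add: rh1_def vec_eq_iff axis_def)
     moreover have "c i (axis n t) = c i 0" if "i < d" for i
      by (rule depD[OF c(2)[OF that]]) (auto simp: axis_def)
     ultimately show ?thesis by (simp add: g_def True axis_def)
    qed
    have "eventually (%t. (SUM i<d. c i 0 * (t0 + t) ^ i) + (t0 + t) ^ d * u 0 = t ^ d * U (axis n t)) (nhds 0)"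
     using ev1 by (simp add: ga)
    then show False by (rule no_pure_power[OF d u(3) c(3,4,5) B])
   qed
   then show ?thesis using IHQ ag dg by blast
  qed
  then obtain S where S: "QS I n g S" by blast
  have "QS I n (%x. f (rh1 t0 x)) S"
   unfolding QS_def fg using S lI by (auto simp: QS_def intro!: mon_mult mon_power)
  then show ?thesis by blast
 qed
 have case2: "mon (%x. f (rh2 x)) & (ALL i:I - {n}. mon (%x. rh2 x $ i))"
 proof
  have n2: "rh2 x $ n = x $ n" for x using ln by (simp add: rh2_def)
  \<comment> \<open>The factor \<open>x $ l ^ gq l\<close> contributes \<open>x $ n ^ gq l\<close>;
    one \<open>x $ n\<close> is set aside, to complete \<open>x $ n ^ i\<close> to
    \<open>x $ n ^ d\<close>.\<close>
  define dw where "dw i = (if i = n then gq l - 1 else 0) + gq i" for i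
  have mrh2: "mo gq (rh2 x) = x $ n * mo dw x" for x
  proof -
   have "mo gq (rh2 x) = (PROD i:UNIV. x $ i ^ gq i * (if i = l then x $ n ^ gq l else 1))"
    unfolding mo_def by (intro prod.cong refl) (auto simp: rh2_def power_mult_distrib)
   also have "\<dots> = mo gq x * x $ n ^ gq l" by (simp add: prod.distrib mo_def)
   also have "\<dots> = x $ n * (x $ n ^ (gq l - 1) * mo gq x)" using l by (simp add: power_eq_if)
   also have "\<dots> = x $ n * mo dw x" by (simp add: dw_def[abs_def] mo_add mo_single)
   finally show ?thesis .
  qed
  define E where "E x = (SUM i<d. mo dw x ^ (d - i) * c i (rh2 x)) + u (rh2 x)" for x
  have aE: "ana E" unfolding E_def[abs_def]
   by (intro ana_add ana_sum ana_mult ana_power ana_mo ana_amap[OF _ am2] u(1) c(1)) auto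
  have "dw l ~= 0" using l by (simp add: dw_def)
  then have "mo dw 0 = 0" by (intro mo_at_0) auto
  then have "(SUM i<d. mo dw 0 ^ (d - i) * c i (rh2 0)) = 0" by (intro sum.neutral) (auto simp: zero_power)
  moreover have "rh2 0 = 0" using am2 by (simp add: amap_def)
  ultimately have E0: "E 0 ~= 0" using u(3) by (simp add: E_def)
  have "f (rh2 x) = x $ n ^ d * E x" for x
  proof -
   have "(x $ n * mo dw x) ^ (d - i) * c i (rh2 x) * x $ n ^ i = x $ n ^ d * (mo dw x ^ (d - i) * c i (rh2 x))" if "i < d" for i
   proof -
    have "x $ n ^ d = x $ n ^ (d - i) * x $ n ^ i" using that by (simp add: power_add[symmetric])
    then show ?thesis by (simp add: power_mult_distrib mult_ac)
   qed
   then have *: "(SUM i<d. (x $ n * mo dw x) ^ (d - i) * c i (rh2 x) * x $ n ^ i) = (SUM i<d. x $ n ^ d * (mo dw x ^ (d - i) * c i (rh2 x)))"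
    by (intro sum.cong refl) simp
   show ?thesis unfolding f n2 mrh2 E_def * by (simp only: distrib_left sum_distrib_left)
  qed
  then show "mon (%x. f (rh2 x))" using mon_mult[OF mon_power[OF mon_nth] mon_unit[OF aE E0]] by simp
  show "ALL i:I - {n}. mon (%x. rh2 x $ i)"
  proof
   fix i show "mon (%x. rh2 x $ i)" using mon_mult[OF mon_nth mon_nth] by (cases "i = l") (auto simp: rh2_def)
  qed
 qed
 show ?case
  by (rule QS_step[OF cov]) (use case1 case2 am2 ac2 nice1 in blast)
qed


subsection \<open>Power series\<close>

text \<open>Summability at the diagonal point with entries \<open>rh\<close> dominates the
  complexified series and its termwise derivatives on a ball of half that radius: differentiation
  costs a factor \<open>e k i\<close>, and \<open>e k i <= 2 ^ e k i\<close> is paid for by the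
  halved radius.\<close>

lemma real_analytic_imp_ana:
 fixes f :: "real^'n::finite => real"
 assumes "real_analytic_at f x"
 shows "ana (%y. f (x + y))"
proof -
 obtain r c where r: "r > 0" and c: "!!y. y : ball x r ==> ((%al. c al * monomial_at x al y) has_sum f y) UNIV"
  using assms unfolding real_analytic_at_def by blast
 \<comment> \<open>Gives the diagonal point with entries \<open>rh\<close> a norm of at most
   \<open>r / 2\<close>.\<close>
 define rh where "rh = r / (2 * real CARD('n))"
 have rh: "rh > 0" "real CARD('n) * rh = r / 2" using r by (auto simp: rh_def)
 have sums: "((%al. c al * (PROD i:UNIV. y $ i ^ al i)) has_sum f (x + y)) UNIV" if "norm y < r" for y
  using c[of "x + y"] that by (simp add: dist_norm monomial_at_def)
 \<comment> \<open>Termwise differentiation concerns sequences; unconditional summability permits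
   any enumeration of the multi-indices.\<close>
 define e :: "nat => 'n => nat" where "e = from_nat_into UNIV"
 have inf: "infinite (UNIV :: ('n => nat) set)"
 proof
  assume "finite (UNIV :: ('n => nat) set)"
  then have "finite ((%al. al undefined) ` (UNIV :: ('n => nat) set))" by (rule finite_imageI)
  moreover have "(%al. al undefined) ` (UNIV :: ('n => nat) set) = UNIV"
   by (auto simp: image_iff intro!: exI[of _ "%_. _ :: nat"])
  ultimately show False by simp
 qed
 have e: "bij_betw e UNIV UNIV" unfolding e_def by (rule bij_betw_from_nat_into) (use inf in auto)
 define M where "M k = \<bar>c (e k)\<bar> * (PROD i:(UNIV::'n set). rh ^ e k i)" for k
 have M0: "M k >= 0" for k using rh by (auto simp: M_def intro!: mult_nonneg_nonneg prod_nonneg)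
 have summ: "summable M"
 proof -
  define y :: "real^'n" where "y = (\<chi> i. rh)"
  have "norm y <= (SUM i:UNIV. \<bar>y $ i\<bar>)" by (rule norm_le_l1_cart)
  also have "\<dots> < r" using rh r by (simp add: y_def)
  finally have "(%al. c al * (PROD i:UNIV. y $ i ^ al i)) summable_on UNIV"
   by (intro has_sum_imp_summable[OF sums])
  then have "(%al. norm (c al * (PROD i:UNIV. y $ i ^ al i))) summable_on UNIV"
   by (rule iffD1[OF summable_on_iff_abs_summable_on_real])
  then have "(%k. norm (c (e k) * (PROD i:UNIV. y $ i ^ e k i))) summable_on UNIV"
   using summable_on_reindex_bij_betw[OF e, of "%al. norm (c al * (PROD i:UNIV. y $ i ^ al i))"] by simp
  then have "summable (%k. norm (c (e k) * (PROD i:UNIV. y $ i ^ e k i)))" by (rule summable_on_imp_summable)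
  then show ?thesis using rh by (simp add: M_def[abs_def] y_def abs_mult abs_prod)
 qed
 define T where "T k z = complex_of_real (c (e k)) * (PROD j:UNIV. z $ j ^ e k j)" for k and z :: "complex^'n"
 define D where "D k i z = complex_of_real (c (e k)) * (of_nat (e k i) * z $ i ^ (e k i - 1) * (PROD j:UNIV - {i}. z $ j ^ e k j))" for k i and z :: "complex^'n"
 define S where "S = ball (0 :: complex^'n) (rh / 2)"
 have zS: "norm (z $ j) <= rh / 2" if "z : S" for z j
  using that Finite_Cartesian_Product.norm_nth_le[of z j] by (simp add: S_def)
 have Dbound: "norm (D k i z) <= M k * (2 / rh)" if z: "z : S" for k i z
 proof (cases "e k i = 0")
  case False
  have "norm (PROD j:UNIV - {i}. z $ j ^ e k j) <= (PROD j:UNIV - {i}. rh ^ e k j)"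
  proof -
   have "norm (PROD j:UNIV - {i}. z $ j ^ e k j) = (PROD j:UNIV - {i}. norm (z $ j) ^ e k j)"
    by (simp add: prod_norm[symmetric] norm_power)
   also have "\<dots> <= (PROD j:UNIV - {i}. rh ^ e k j)"
   proof (rule prod_mono)
    fix j show "0 <= norm (z $ j) ^ e k j & norm (z $ j) ^ e k j <= rh ^ e k j"
     using zS[OF z, of j] rh by (auto intro!: power_mono)
   qed
   finally show ?thesis .
  qed
  moreover have "norm (of_nat (e k i) * z $ i ^ (e k i - 1)) <= rh ^ e k i * (2 / rh)"
  proof -
   have "norm (z $ i ^ (e k i - 1)) <= (rh / 2) ^ (e k i - 1)"
    unfolding norm_power by (rule power_mono[OF zS[OF z]]) simp
   then have "norm (of_nat (e k i) * z $ i ^ (e k i - 1)) <= real (e k i) * (rh / 2) ^ (e k i - 1)"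
    by (simp add: norm_mult mult_left_mono)
   also have "\<dots> <= 2 ^ e k i * (rh / 2) ^ (e k i - 1)"
   proof (rule mult_right_mono)
    have "e k i < 2 ^ e k i" by (rule less_exp)
    then have "real (e k i) < real (2 ^ e k i)" unfolding of_nat_less_iff .
    then show "real (e k i) <= 2 ^ e k i" by simp
   qed (use rh in simp)
   also have "\<dots> = rh ^ e k i * (2 / rh)" using False rh by (cases "e k i") (auto simp: power_divide)
   finally show ?thesis .
  qed
  ultimately have "norm (of_nat (e k i) * z $ i ^ (e k i - 1)) * norm (PROD j:UNIV - {i}. z $ j ^ e k j) <= (rh ^ e k i * (2 / rh)) * (PROD j:UNIV - {i}. rh ^ e k j)"
   using rh by (intro mult_mono) auto
  also have "\<dots> = (PROD j:UNIV. rh ^ e k j) * (2 / rh)"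
   by (subst (2) prod.remove[of _ i]) auto
  finally have "\<bar>c (e k)\<bar> * (norm (of_nat (e k i) * z $ i ^ (e k i - 1)) * norm (PROD j:UNIV - {i}. z $ j ^ e k j)) <= \<bar>c (e k)\<bar> * ((PROD j:UNIV. rh ^ e k j) * (2 / rh))"
   by (rule mult_left_mono) simp
  moreover have "norm (D k i z) = \<bar>c (e k)\<bar> * (norm (of_nat (e k i) * z $ i ^ (e k i - 1)) * norm (PROD j:UNIV - {i}. z $ j ^ e k j))"
   unfolding D_def norm_mult by simp
  ultimately show ?thesis by (simp add: M_def mult.assoc)
 qed (use M0 rh in \<open>simp add: D_def\<close>)
 define G where "G i z = (\<Sum>k. D k i z)" for i z
 have ul: "uniform_limit S (%n z. SUM k<n. D k i z) (G i) sequentially" for i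
  unfolding G_def[abs_def] by (rule Weierstrass_m_test[OF Dbound]) (use summ in \<open>auto intro: summable_mult2\<close>)
 have Gc: "continuous_on S (G i)" for i
  by (rule uniform_limit_theorem[OF _ ul]) (auto simp: D_def intro!: always_eventually continuous_intros)
 have Td: "(T k has_derivative (%h. SUM i:UNIV. h $ i * D k i z)) (at z)" for k z
 proof -
  have p: "((%z::complex^'n. z $ j ^ m) has_derivative (%h. of_nat m * h $ j * z $ j ^ (m - 1))) (at z)" for j m
   by (rule has_derivative_power) (rule bounded_linear_imp_has_derivative[OF bounded_linear_vec_nth])
  have "((%z. complex_of_real (c (e k)) * (PROD j:UNIV. z $ j ^ e k j)) has_derivative
   (%h. complex_of_real (c (e k)) * (SUM i:UNIV. of_nat (e k i) * h $ i * z $ i ^ (e k i - 1) * (PROD j:UNIV - {i}. z $ j ^ e k j)))) (at z)"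
   by (rule has_derivative_mult_right[OF has_derivative_prod]) (rule p)
  moreover have "(%h. complex_of_real (c (e k)) * (SUM i:UNIV. of_nat (e k i) * h $ i * z $ i ^ (e k i - 1) * (PROD j:UNIV - {i}. z $ j ^ e k j)))
    = (%h. SUM i:UNIV. h $ i * D k i z)"
   by (simp add: D_def sum_distrib_left mult_ac fun_eq_iff)
  ultimately show ?thesis unfolding T_def[abs_def] by simp
 qed
 have S0: "(%k. T k 0) sums complex_of_real (f x)" and Tsums: "!!y. norm y < r ==> (%k. T k (cv y)) sums complex_of_real (f (x + y))"
 proof -
  show *: "(%k. T k (cv y)) sums complex_of_real (f (x + y))" if "norm y < r" for y
  proof -
   have "((%k. c (e k) * (PROD i:UNIV. y $ i ^ e k i)) has_sum f (x + y)) UNIV"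
    using sums[OF that] has_sum_reindex_bij_betw[OF e, of "%al. c al * (PROD i:UNIV. y $ i ^ al i)"] by simp
   then have "(%k. c (e k) * (PROD i:UNIV. y $ i ^ e k i)) sums f (x + y)" by (rule has_sum_imp_sums)
   then have "(%k. complex_of_real (c (e k) * (PROD i:UNIV. y $ i ^ e k i))) sums complex_of_real (f (x + y))" by (rule sums_of_real)
   then show ?thesis by (simp add: T_def)
  qed
  have "cv (0 :: real^'n) = 0" by (simp add: vec_eq_iff)
  then show "(%k. T k 0) sums complex_of_real (f x)" using *[of 0] r by simp
 qed
 have "EX F. ALL z:S. (%k. T k z) sums F z & (F has_derivative (%h. SUM i:UNIV. h $ i * G i z)) (at z within S)"
 proof (rule has_derivative_series)
  show "convex S" by (simp add: S_def)
  show "(T k has_derivative (%h. SUM i:UNIV. h $ i * D k i z)) (at z within S)" for k z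
   using Td by (rule has_derivative_at_withinI)
  show "0 : S" using rh by (simp add: S_def)
  show "(%k. T k 0) sums complex_of_real (f x)" by (rule S0)
  fix ez :: real assume ez: "ez > 0"
  define ez' where "ez' = ez / real CARD('n)"
  have ez': "ez' > 0" using ez by (simp add: ez'_def)
  have "eventually (%n. ALL z:S. dist (SUM k<n. D k i z) (G i z) < ez') sequentially" for i
   using ul[of i] ez' unfolding uniform_limit_iff by blast
  then have "eventually (%n. ALL i. ALL z:S. dist (SUM k<n. D k i z) (G i z) < ez') sequentially"
   by (intro eventually_all_finite)
  then show "eventually (%n. ALL z:S. ALL h. norm ((SUM k<n. SUM i:UNIV. h $ i * D k i z) - (SUM i:UNIV. h $ i * G i z)) <= ez * norm h) sequentially"
  proof (rule eventually_mono, intro ballI allI)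
   fix n z h assume H: "ALL i. ALL z:S. dist (SUM k<n. D k i z) (G i z) < ez'" and z: "z : S"
   have "(SUM k<n. SUM i:UNIV. h $ i * D k i z) - (SUM i:UNIV. h $ i * G i z) = (SUM i:UNIV. h $ i * ((SUM k<n. D k i z) - G i z))"
    by (subst sum.swap) (simp add: sum_subtractf[symmetric] right_diff_distrib sum_distrib_left)
   also have "norm \<dots> <= (SUM i:(UNIV::'n set). norm h * ez')"
   proof (rule sum_norm_le)
    fix i
    have "norm ((SUM k<n. D k i z) - G i z) <= ez'" using H z by (simp add: dist_norm less_imp_le)
    then show "norm (h $ i * ((SUM k<n. D k i z) - G i z)) <= norm h * ez'"
     unfolding norm_mult by (intro mult_mono) (auto simp: Finite_Cartesian_Product.norm_nth_le)
   qed
   also have "\<dots> = ez * norm h" by (simp add: ez'_def)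
   finally show "norm ((SUM k<n. SUM i:UNIV. h $ i * D k i z) - (SUM i:UNIV. h $ i * G i z)) <= ez * norm h" .
  qed
 qed
 then obtain F where F: "!!z. z : S ==> (%k. T k z) sums F z" "!!z. z : S ==> (F has_derivative (%h. SUM i:UNIV. h $ i * G i z)) (at z within S)" by blast
 have "open S" by (simp add: S_def)
 have "hold (rh / 2) F G"
  unfolding hold_def
 proof (intro conjI ballI allI)
  show "(F has_derivative (%h. SUM i:UNIV. h $ i * G i z)) (at z)" if "z : ball 0 (rh / 2)" for z
  proof -
   have z: "z : S" using that by (simp add: S_def)
   show ?thesis using F(2)[OF z] unfolding at_within_open[OF z \<open>open S\<close>] .
  qed
  show "continuous_on (ball 0 (rh / 2)) (G i)" for i using Gc by (simp add: S_def)
 qed (use rh in simp)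
 then show ?thesis
 proof (rule anaI)
  fix y :: "real^'n" assume y: "norm y < rh / 2"
  have "1 <= real CARD('n)" by (simp add: Suc_leI)
  then have "rh <= real CARD('n) * rh" using rh by (simp add: mult_le_cancel_right1)
  then have "norm y < r" using y rh r by linarith
  moreover have "cv y : S" using y by (simp add: S_def)
  ultimately show "F (cv y) = complex_of_real (f (x + y))"
   by (intro sums_unique2[OF F(1) Tsums])
 qed
qed

lemma partial_shift: "partial i (%y. f (x + y)) y = partial i f (x + y)"
proof -
 have "((%y. f (x + y)) has_derivative D) (at y) \<longleftrightarrow> (f has_derivative D) (at (x + y))" for D
 proof
  assume a: "((%y. f (x + y)) has_derivative D) (at y)"
  have "((%z. z - x) has_derivative (%h. h)) (at (x + y))" by (auto intro!: derivative_eq_intros)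
  from has_derivative_compose[OF this, of "%y. f (x + y)" D] a show "(f has_derivative D) (at (x + y))" by simp
 next
  assume a: "(f has_derivative D) (at (x + y))"
  have "((%z. x + z) has_derivative (%h. h)) (at y)" by (auto intro!: derivative_eq_intros)
  from has_derivative_compose[OF this, of f D] a show "((%y. f (x + y)) has_derivative D) (at y)" by simp
 qed
 then show ?thesis by (simp add: partial_def frechet_derivative_def)
qed

lemma differentiable_shift: "(%y. f (x + y)) differentiable (at 0) ==> f differentiable (at x)"
proof -
 assume a: "(%y. f (x + y)) differentiable (at 0)"
 have "((%z. z - x) has_derivative (%h. h)) (at x)" by (auto intro!: derivative_eq_intros)
 then show ?thesis using a has_derivative_compose[of "%z. z - x" "%h. h" x UNIV "%y. f (x + y)"]
  unfolding differentiable_def by fastforce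
qed

lemma ana_shift_partial: "ana (%y. f (x + y)) ==> ana (%y. partial i f (x + y))"
 using ana_partial(1)[of "%y. f (x + y)" i] by (simp add: partial_shift[abs_def])

lemma real_analytic_on_imp_smooth_on:
 assumes "real_analytic_on W f"
 shows "smooth_on W f"
 unfolding smooth_on_def
proof (intro allI ballI)
 fix js x assume x: "x : W"
 have "ana (%y. f (x + y))" using assms x real_analytic_imp_ana by (auto simp: real_analytic_on_def)
 then have "ana (%y. iter_partial js f (x + y))" by (induction js) (auto intro: ana_shift_partial)
 then have "(%y. iter_partial js f (x + y)) differentiable (at 0)"
  using ana_partial(2) eventually_nhds_x_imp_x by blast
 then show "iter_partial js f differentiable (at x)" by (rule differentiable_shift)
qed


subsection \<open>Monomialization\<close>

text \<open>Continuity of the inverse \<open>ta\<close> at 0 brings a small target cube back into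
  the prescribed source cube.\<close>

lemma cover_inverse:
 assumes ta: "amap ta" and inv: "!!y. si (ta y) = y"
 shows "cover {si}"
proof (rule cover_singleton)
 fix e :: real assume e: "e > 0"
 have "eventually (%x::real^'a. ALL j. \<bar>x $ j\<bar> < e) (nhds 0)"
  unfolding eventually_nhds_metric
 proof (intro exI[of _ e] conjI allI impI e)
  fix x :: "real^'a" and j assume "dist x 0 < e"
  then show "\<bar>x $ j\<bar> < e" using component_le_norm_cart[of x j] by simp
 qed
 then have "eventually (%x. ALL j. \<bar>ta x $ j\<bar> < e) (nhds 0)" by (rule eventually_amap[OF ta])
 then obtain ew where "ew > 0" "!!y. (!!j. \<bar>y $ j\<bar> < ew) ==> ALL j. \<bar>ta y $ j\<bar> < e" by (rule eventually_cube) blast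
 then show "EX ew>0. ALL y. (ALL j. \<bar>y $ j\<bar> < ew) --> (EX x. (ALL j. \<bar>x $ j\<bar> < e) & si x = y)"
  using inv by (intro exI[of _ ew]) auto
qed

text \<open>\<open>T\<close> selects signs, because even powers miss the negative values.\<close>

definition power_map :: "'n set => nat => 'n set => real^'n::finite => real^'n" where
 "power_map J N T x = (\<chi> k. if k : J then (if k : T then - 1 else 1) * x $ k ^ N else x $ k)"

lemma power_map_cover:
 fixes J :: "'n::finite set"
 assumes N: "0 < N"
 shows "cover (range (power_map J N))"
proof (rule coverI)
 fix e :: "(real^'n => real^'n) => real" assume e: "!!si. si : range (power_map J N) ==> e si > 0"
 define e0 where "e0 = Min (range (%T. e (power_map J N T)))"
 have e0: "e0 > 0" "!!T. e0 <= e (power_map J N T)" using e by (auto simp: e0_def)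
 define ew where "ew = min e0 (e0 ^ N)"
 have "EX si:range (power_map J N). EX x. (ALL j. \<bar>x $ j\<bar> < e si) & si x = y" if y: "ALL j. \<bar>y $ j\<bar> < ew" for y
 proof -
  define T where "T = {k. y $ k < 0}"
  define x where "x = (\<chi> k. if k : J then root N \<bar>y $ k\<bar> else y $ k)"
  have rN: "root N \<bar>y $ k\<bar> ^ N = \<bar>y $ k\<bar>" for k by (rule real_root_pow_pos2[OF N]) simp
  have "\<bar>x $ j\<bar> < e0" for j
  proof (cases "j : J")
   case True
   have "\<bar>y $ j\<bar> < e0 ^ N" using spec[OF y, of j] by (simp add: ew_def)
   then have "root N \<bar>y $ j\<bar> ^ N < e0 ^ N" by (simp only: rN)
   then have "root N \<bar>y $ j\<bar> < e0" by (rule power_less_imp_less_base) (use e0(1) in simp)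
   moreover have "0 <= root N \<bar>y $ j\<bar>" by (rule real_root_ge_zero) simp
   ultimately show ?thesis using True by (simp add: x_def)
  next
   case False
   then show ?thesis using spec[OF y, of j] by (simp add: x_def ew_def)
  qed
  then have "ALL j. \<bar>x $ j\<bar> < e (power_map J N T)" using e0(2)[of T] by (intro allI) (rule less_le_trans)
  moreover have "power_map J N T x = y"
  proof -
   have "power_map J N T x $ k = y $ k" for k
    by (cases "k : J"; cases "y $ k < 0") (simp_all add: power_map_def x_def T_def real_root_pow_pos2[OF N])
   then show ?thesis by (simp add: vec_eq_iff)
  qed
  ultimately show ?thesis by (intro bexI[of _ "power_map J N T"] exI[of _ x]) simp_all
 qed
 moreover have "ew > 0" using e0(1) by (simp add: ew_def)
 moreover have "finite (range (power_map J N))" by simp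
 ultimately show "EX T ew. finite T & T <= range (power_map J N) & ew > 0 &
  (ALL y. (ALL j. \<bar>y $ j\<bar> < ew) --> (EX si:T. EX x. (ALL j. \<bar>x $ j\<bar> < e si) & si x = y))"
  by (intro exI[of _ "range (power_map J N)"] exI[of _ ew]) auto
qed

lemma amap_power_map:
 assumes "0 < N"
 shows "amap (power_map J N T)"
proof (rule amapI)
 show "ana (%x. power_map J N T x $ j)" for j
 proof (cases "j : J")
  case True
  have "ana (%x. (if j : T then - 1 else 1) * x $ j ^ N)" by (intro ana_mult ana_const ana_power ana_nth)
  then show ?thesis using True by (simp add: power_map_def)
 qed (simp add: power_map_def)
qed (use assms in \<open>simp add: power_map_def vec_eq_iff\<close>)

lemma act_power_map: "J <= I ==> act I (power_map J N T)"
 by (auto simp: act_def power_map_def dep_def)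

lemma mo_power_map:
 assumes a: "!!k. a k ~= 0 ==> k : J"
 obtains s where "s ~= 0" "!!x. mo a (power_map J N T x) = s * mo (%k. N * a k) x"
proof
 define s where "s = (PROD k:UNIV. (if k : T then - 1 else 1 :: real) ^ a k)"
 show "s ~= 0" by (simp add: s_def)
 show "mo a (power_map J N T x) = s * mo (%k. N * a k) x" for x
  unfolding mo_def s_def prod.distrib[symmetric]
 proof (intro prod.cong refl)
  fix k
  show "power_map J N T x $ k ^ a k = (if k : T then - 1 else 1) ^ a k * x $ k ^ (N * a k)"
   using a[of k] by (cases "a k = 0") (auto simp: power_map_def power_mult_distrib power_mult power_minus_mult)
 qed
qed

lemma dep_mo: "(!!k. a k ~= 0 ==> k : J) ==> dep J (mo a)"
 unfolding dep_def
proof (intro allI impI)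
 fix x y :: "real^'a" assume a: "!!k. a k ~= 0 ==> k : J" and xy: "ALL i:J. x $ i = y $ i"
 show "mo a x = mo a y" unfolding mo_def
 proof (intro prod.cong refl)
  fix k show "x $ k ^ a k = y $ k ^ a k" using a[of k] xy by (cases "a k = 0") auto
 qed
qed

lemma dep_binop:
 fixes f :: "real^'n::finite => 'b" and g :: "real^'n => 'c"
 assumes "dep J f" "dep J g"
 shows "dep J (%x. h (f x) (g x))"
 unfolding dep_def
proof (intro allI impI)
 fix x y :: "real^'n" assume xy: "ALL i:J. x $ i = y $ i"
 have "f x = f y" by (rule depD[OF assms(1)]) (use xy in simp)
 moreover have "g x = g y" by (rule depD[OF assms(2)]) (use xy in simp)
 ultimately show "h (f x) (g x) = h (f y) (g y)" by simp
qed

lemmas dep_mult = dep_binop[where h = "(*) :: real => _"] and dep_diff = dep_binop[where h = "(-) :: real => _"]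

lemma dep_const: "dep J (%_. c)" and dep_nth: "i : J ==> dep J (%x. x $ i)"
 by (simp_all add: dep_def)

lemma dep_power: "dep J f ==> dep J (%x. f x ^ k :: real)"
 using dep_binop[of J f "%_. k" "(^)"] by (simp add: dep_const)

lemma dep_prod:
 fixes F :: "'i => real^'n::finite => real"
 assumes "!!i. i : K ==> dep J (F i)"
 shows "dep J (%x. PROD i:K. F i x :: real)"
 unfolding dep_def
proof (intro allI impI prod.cong refl)
 fix x y :: "real^'n" and i assume xy: "ALL i:J. x $ i = y $ i" and i: "i : K"
 show "F i x = F i y" by (rule depD[OF assms[OF i]]) (use xy in simp)
qed

text \<open>As in a Newton polygon, \<open>B i\<close> is the exponent of \<open>c i\<close> divided
  by \<open>d - i\<close>, cleared of denominators by \<open>d!\<close>. Pairwise comparability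
  provides a componentwise least one, \<open>gq\<close>. After the substitution of
  \<open>d!\<close>-th powers each \<open>c i\<close> is divisible by
  \<open>mo gq ^ (d - i)\<close>, with unit quotient for \<open>i0\<close>, as
  \<open>blowup_reduction\<close> requires.\<close>

lemma QS_comparable:
 fixes f :: "real^'n::finite => real"
 assumes n: "n : I" and d: "0 < d"
  and IHQ: "!!g k. k < d ==> ana g ==> dep I g ==> (partial n ^^ k) g 0 ~= 0 ==> EX S. QS I n g S"
  and K: "K <= {..<d}" "K ~= {}" "d - 1 ~: K"
  and cK: "!!i. i : K ==> mon (c i)" "!!i. i < d ==> i ~: K ==> zero_near (c i)" "!!i. i : K ==> c i 0 = 0"
  and cd: "!!i. i < d ==> dep (I - {n}) (c i)"
  and cmp: "!!i j. i : K ==> j : K ==> zero_near (%x. c i x ^ (fact d div (d - i)) - c j x ^ (fact d div (d - j))) \<or>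
    mon (%x. c i x ^ (fact d div (d - i)) - c j x ^ (fact d div (d - j)))"
  and u: "ana u" "dep I u" "u 0 ~= 0"
  and f: "!!x. f x = (SUM i<d. c i x * x $ n ^ i) + x $ n ^ d * u x"
 shows "EX S. QS I n f S"
proof -
 define J where "J = I - {n}"
 have J: "J <= I" by (auto simp: J_def)
 define m where "m i = (fact d div (d - i) :: nat)" for i
 have md: "m i * (d - i) = fact d" "m i > 0" if "i < d" for i
 proof -
  have "d - i dvd fact d" using that by (intro dvd_fact) auto
  then show "m i * (d - i) = fact d" by (simp add: m_def)
  then show "m i > 0" by (metis fact_nonzero gr0I mult_0)
 qed
 have fK: "finite K" using K(1) by (rule finite_subset) simp
 have Kd: "i < d" if "i : K" for i using K(1) that by auto
 have "EX av. ana (snd av) & snd av 0 ~= 0 & eventually (%x. c i x = mo (fst av) x * snd av x) (nhds 0) &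
   (ALL k. fst av k ~= 0 --> k : J) & dep J (snd av)" if i: "i : K" for i
 proof (rule mon_dep[OF cK(1)[OF i], of J])
  show "dep J (c i)" using cd[OF Kd[OF i]] by (simp add: J_def)
  fix a v assume "ana v" "v 0 ~= 0" "eventually (%x. c i x = mo a x * v x) (nhds 0)" "!!k. a k ~= 0 ==> k : J" "dep J v"
  then show "EX av. ana (snd av) & snd av 0 ~= 0 & eventually (%x. c i x = mo (fst av) x * snd av x) (nhds 0) &
   (ALL k. fst av k ~= 0 --> k : J) & dep J (snd av)" by (intro exI[of _ "(a, v)"]) simp
 qed
 then have "ALL i:K. EX av. ana (snd av) & snd av 0 ~= 0 & eventually (%x. c i x = mo (fst av) x * snd av x) (nhds 0) &
   (ALL k. fst av k ~= 0 --> k : J) & dep J (snd av)" by simp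
 from bchoice[OF this] obtain av where av: "ALL i:K. ana (snd (av i)) & snd (av i) 0 ~= 0 & eventually (%x. c i x = mo (fst (av i)) x * snd (av i) x) (nhds 0) &
   (ALL k. fst (av i) k ~= 0 --> k : J) & dep J (snd (av i))" ..
 define A where "A i = fst (av i)" for i
 define V where "V i = snd (av i)" for i
 have AV: "ana (V i)" "V i 0 ~= 0" "eventually (%x. c i x = mo (A i) x * V i x) (nhds 0)" "!!k. A i k ~= 0 ==> k : J" "dep J (V i)" if "i : K" for i
  using av that by (simp_all add: A_def V_def)
 define B where "B i k = m i * A i k" for i k
 have cmpB: "(ALL k. B i k <= B j k) \<or> (ALL k. B j k <= B i k)" if i: "i : K" and j: "j : K" for i j
 proof (rule comparable_exponents)
  show "ana (%x. V i x ^ m i)" "ana (%x. V j x ^ m j)" "V i 0 ^ m i ~= 0" "V j 0 ^ m j ~= 0"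
   using AV(1,2)[OF i] AV(1,2)[OF j] by (auto intro: ana_power)
  have ev: "eventually (%x. c i x ^ m i - c j x ^ m j = mo (B i) x * V i x ^ m i - mo (B j) x * V j x ^ m j) (nhds 0)"
   using AV(3)[OF i] AV(3)[OF j]
   by eventually_elim (simp add: B_def[abs_def] mo_mult power_mult_distrib)
  show "zero_near (%x. mo (B i) x * V i x ^ m i - mo (B j) x * V j x ^ m j) \<or> mon (%x. mo (B i) x * V i x ^ m i - mo (B j) x * V j x ^ m j)"
   using cmp[OF i j] unfolding m_def[symmetric]
  proof
   assume z: "zero_near (%x. c i x ^ m i - c j x ^ m j)"
   have "zero_near (%x. mo (B i) x * V i x ^ m i - mo (B j) x * V j x ^ m j)" using z ev by eventually_elim simp
   then show ?thesis ..
  next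
   assume "mon (%x. c i x ^ m i - c j x ^ m j)"
   from mon_cong[OF this ev] show ?thesis ..
  qed
 qed
 \<comment> \<open>Among pairwise comparable exponent vectors the one with least sum is least in
   every component.\<close>
 define i0 where "i0 = arg_min_on (%i. SUM k:UNIV. B i k) K"
 have i0: "i0 : K" unfolding i0_def by (rule arg_min_if_finite(1)[OF fK K(2)])
 have i0min: "(SUM k:UNIV. B i0 k) <= (SUM k:UNIV. B i k)" if "i : K" for i
  unfolding i0_def by (rule arg_min_least[OF fK K(2) that])
 define gq where "gq = B i0"
 have le: "gq k <= B i k" if i: "i : K" for i k
 proof (rule ccontr)
  assume nle: "\<not> gq k <= B i k"
  then have "ALL k. B i k <= B i0 k" using cmpB[OF i i0] by (auto simp: gq_def)
  then have "(SUM k:UNIV. B i k) < (SUM k:UNIV. B i0 k)" using nle by (intro sum_strict_mono_ex1) (auto simp: gq_def not_le)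
  then show False using i0min[OF i] by simp
 qed
 have gqJ: "k : I - {n}" if "gq k ~= 0" for k
  using AV(4)[OF i0, of k] that by (auto simp: gq_def B_def J_def)
 have gq0: "gq ~= (%_. 0)"
 proof
  assume g: "gq = (%_. 0)"
  have "A i0 = (%_. 0)"
  proof
   fix k
   have "m i0 * A i0 k = 0" using fun_cong[OF g, of k] by (simp add: gq_def B_def)
   then show "A i0 k = 0" using md(2)[OF Kd[OF i0]] by simp
  qed
  then have "mo (A i0) 0 * V i0 0 ~= 0" using AV(2)[OF i0] by simp
  moreover have "c i0 0 = mo (A i0) 0 * V i0 0" using eventually_nhds_x_imp_x[OF AV(3)[OF i0]] .
  ultimately show False using cK(3)[OF i0] by simp
 qed
 define N where "N = (fact d :: nat)"
 have N: "0 < N" by (simp add: N_def)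
 have step: "nice I n (power_map J N T) & (EX R. QS I n (%x. f (power_map J N T x)) R)" for T
 proof
  let ?p = "power_map J N T"
  note am = amap_power_map[OF N, of J T] and ac = act_power_map[OF J, of N T] and ac' = act_power_map[OF subset_refl, of J N T]
  have p0: "?p 0 = 0" using am by (simp add: amap_def)
  have pn: "?p x $ n = x $ n" for x by (simp add: power_map_def J_def)
  show "nice I n ?p"
   unfolding nice_def
  proof (intro conjI ballI am ac)
   fix i assume i: "i : I - {n}"
   show "EX a u. ana u & u 0 ~= 0 & eventually (%x. ?p x $ i = mo a x * u x) (nhds 0) & (ALL k. a k ~= 0 --> k : I - {n})"
    by (rule exI[of _ "%k. if k = i then N else 0"], rule exI[of _ "%_. if i : T then - 1 else 1"])
     (use i in \<open>auto simp: mo_single power_map_def J_def\<close>)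
  qed
  have "EX s. s ~= 0 & (ALL x. mo (A i) (?p x) = s * mo (%k. N * A i k) x)" if i: "i : K" for i
   by (rule mo_power_map[of "A i" J N T, OF AV(4)[OF i]]) auto
  then have "ALL i:K. EX s. s ~= 0 & (ALL x. mo (A i) (?p x) = s * mo (%k. N * A i k) x)" by simp
  from bchoice[OF this] obtain s where s: "ALL i:K. s i ~= 0 & (ALL x. mo (A i) (?p x) = s i * mo (%k. N * A i k) x)" ..
  define C where "C i = (if i : K then (%x. s i * mo (%k. B i k - gq k) x ^ (d - i) * V i (?p x)) else (%_. 0))" for i
  have cC: "eventually (%x. c i (?p x) = mo gq x ^ (d - i) * C i x) (nhds 0)" if i: "i < d" for i
  proof (cases "i : K")
   case True
   have NA: "(%k. N * A i k) = (%k. (d - i) * (gq k + (B i k - gq k)))"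
   proof
    fix k
    have "gq k + (B i k - gq k) = B i k" using le[OF True, of k] by simp
    then show "N * A i k = (d - i) * (gq k + (B i k - gq k))"
     unfolding N_def md(1)[OF i, symmetric] by (simp only: B_def mult_ac)
   qed
   have mN: "mo (%k. N * A i k) x = mo gq x ^ (d - i) * mo (%k. B i k - gq k) x ^ (d - i)" for x
    unfolding NA mo_mult mo_add power_mult_distrib ..
   have "eventually (%x. c i (?p x) = mo (A i) (?p x) * V i (?p x)) (nhds 0)"
    by (rule eventually_amap[OF am AV(3)[OF True]])
   then show ?thesis
   proof (rule eventually_mono)
    fix x assume x: "c i (?p x) = mo (A i) (?p x) * V i (?p x)"
    have "mo (A i) (?p x) = s i * mo (%k. N * A i k) x" using s True by simp
    then show "c i (?p x) = mo gq x ^ (d - i) * C i x" using True by (simp add: x mN C_def)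
   qed
  next
   case False
   then show ?thesis using eventually_amap[OF am cK(2)[OF i False]] by (simp add: C_def)
  qed
  define f' where "f' x = (SUM i<d. mo gq x ^ (d - i) * C i x * x $ n ^ i) + x $ n ^ d * u (?p x)" for x
  have "EX S. QS I n f' S"
  proof (rule blowup_reduction[OF n d _ gqJ gq0, where c = C and ?i0.0 = i0 and u = "%x. u (?p x)"])
   show "EX S. QS I n g S" if "k < d" "ana g" "dep I g" "(partial n ^^ k) g 0 ~= 0" for g k by (rule IHQ[OF that])
   show "ana (C i)" for i
   proof (cases "i : K")
    case True
    have "ana (%x. s i * mo (%k. B i k - gq k) x ^ (d - i) * V i (?p x))"
     by (intro ana_mult ana_const ana_power ana_mo ana_amap[OF AV(1)[OF True] am])
    then show ?thesis using True by (simp add: C_def)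
   qed (simp add: C_def)
   show "dep (I - {n}) (C i)" for i
   proof (cases "i : K")
    case True
    have "dep J (%x. s i * mo (%k. B i k - gq k) x ^ (d - i) * V i (?p x))"
    proof (intro dep_mult dep_const dep_power dep_mo dep_act[OF AV(5)[OF True] ac'])
     fix k assume "B i k - gq k ~= 0"
     then have "A i k ~= 0" by (cases "A i k = 0") (simp_all add: B_def)
     then show "k : J" by (rule AV(4)[OF True])
    qed
    then show ?thesis using True by (simp add: C_def J_def)
   qed (simp add: C_def dep_const)
   show "C (d - 1) 0 = 0" using K(3) by (simp add: C_def)
   show "i0 < d" by (rule Kd[OF i0])
   show "C i0 0 ~= 0" using i0 s AV(2)[OF i0] p0 by (simp add: C_def gq_def)
   show "ana (%x. u (?p x))" by (rule ana_amap[OF u(1) am])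
   show "dep I (%x. u (?p x))" by (rule dep_act[OF u(2) ac])
   show "u (?p 0) ~= 0" using u(3) p0 by simp
   show "f' x = (SUM i<d. mo gq x ^ (d - i) * C i x * x $ n ^ i) + x $ n ^ d * u (?p x)" for x by (rule f'_def)
  qed
  moreover have "eventually (%x. f' x = f (?p x)) (nhds 0)"
  proof -
   have "eventually (%x. ALL i:{..<d}. c i (?p x) = mo gq x ^ (d - i) * C i x) (nhds 0)"
    by (intro eventually_ball_finite) (use cC in auto)
   then show ?thesis
    by (rule eventually_mono) (simp add: f f'_def pn)
  qed
  ultimately show "EX R. QS I n (%x. f (?p x)) R" by (elim exE) (rule exI, rule QS_cong)
 qed
 show ?thesis
 proof (rule QS_step[OF power_map_cover[OF N, of J]])
  fix si assume "si : range (power_map J N)"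
  then obtain T where "si = power_map J N T" by (rule imageE)
  then show "(amap si & act I si & mon (%x. f (si x)) & (ALL i:I - {n}. mon (%x. si x $ i))) \<or> (nice I n si & (EX R. QS I n (%x. f (si x)) R))"
   using step[of T] by simp
 qed
qed


text \<open>The hypothesis for fewer variables is spent once, on the product of the nonzero
  coefficients, of the nonzero differences of their scaled powers, and of the coordinates. By
  \<open>mon_factor\<close> all of these become monomials times units at the same time.\<close>

lemma QS_of_coeffs:
 fixes f :: "real^'n::finite => real"
 assumes n: "n : I" and d: "0 < d"
  and IHQ: "!!g k. k < d ==> ana g ==> dep I g ==> (partial n ^^ k) g 0 ~= 0 ==> EX S. QS I n g S"
  and MI: "!!h. ana h ==> dep (I - {n}) h ==> \<not> zero_near h ==> EX S. cover S & (ALL si:S. amap si & act (I - {n}) si & mon (%x. h (si x)))"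
  and c: "!!i. i < d ==> ana (c i)" "!!i. i < d ==> dep (I - {n}) (c i)" "!!i. i < d ==> c i 0 = 0" "zero_near (c (d - 1))"
  and u: "ana u" "dep I u" "u 0 ~= 0"
  and f: "!!x. f x = (SUM i<d. c i x * x $ n ^ i) + x $ n ^ d * u x"
 shows "EX S. QS I n f S"
proof -
 define K where "K = {i. i < d & \<not> zero_near (c i)}"
 have K: "K <= {..<d}" "d - 1 ~: K" using c(4) by (auto simp: K_def)
 have fK: "finite K" using K(1) by (rule finite_subset) simp
 have Kd: "i < d" "\<not> zero_near (c i)" if "i : K" for i using that by (simp_all add: K_def)
 show ?thesis
 proof (cases "K = {}")
  case True
  have "eventually (%x. ALL i:{..<d}. c i x = 0) (nhds 0)"
   by (intro eventually_ball_finite) (use True in \<open>auto simp: K_def\<close>)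
  then have "eventually (%x. x $ n ^ d * u x = f x) (nhds 0)"
   by (rule eventually_mono) (simp add: f)
  then have "mon f" by (rule mon_cong[OF mon_mult[OF mon_power[OF mon_nth] mon_unit[OF u(1,3)]]])
  then have "QS I n f {%x. x}" by (simp add: QS_def cover_id amap_id act_id)
  then show ?thesis ..
 next
  case False
  define m where "m i = (fact d div (d - i) :: nat)" for i
  define D where "D = {(i, j). i : K & j : K & \<not> zero_near (%x. c i x ^ m i - c j x ^ m j)}"
  have fD: "finite D" by (rule finite_subset[of _ "K \<times> K"]) (use fK in \<open>auto simp: D_def\<close>)
  define e where "e = (%(i, j) x. c i x ^ m i - c j x ^ m j)"
  have e: "ana (e q)" "dep (I - {n}) (e q)" "\<not> zero_near (e q)" if q: "q : D" for q
  proof -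
   obtain i j where ij: "q = (i, j)" "i : K" "j : K" "\<not> zero_near (%x. c i x ^ m i - c j x ^ m j)" using q unfolding D_def by auto
   show "ana (e q)" "dep (I - {n}) (e q)" "\<not> zero_near (e q)"
    using ij(4) c(1,2) Kd(1)[OF ij(2)] Kd(1)[OF ij(3)] unfolding e_def ij(1) prod.case
    by (intro ana_diff ana_power dep_diff dep_power c(1,2) | simp)+
  qed
  define h1 where "h1 x = (PROD i:K. c i x)" for x
  define h2 where "h2 x = (PROD q:D. e q x)" for x
  \<comment> \<open>Including the coordinates is what makes the resulting maps
    \<open>nice\<close>.\<close>
  define h3 where "h3 x = (PROD i:I - {n}. x $ i)" for x :: "real^'n"
  have a: "ana h1" "ana h2" "ana h3" unfolding h1_def h2_def h3_def
   by (intro ana_prod e(1) c(1) Kd(1) ana_nth; assumption)+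
  have dp: "dep (I - {n}) h1" "dep (I - {n}) h2" "dep (I - {n}) h3" unfolding h1_def h2_def h3_def
   by (intro dep_prod e(2) c(2) Kd(1) dep_nth; assumption)+
  have nz: "\<not> zero_near h1" "\<not> zero_near h2" "\<not> zero_near h3" unfolding h1_def h2_def h3_def
   by (rule not_zero_near_prod; use fK fD e(1,3) c(1) Kd nth_not_zero_near in simp)+
  have a12: "ana (%x. h1 x * h2 x)" by (rule ana_mult[OF a(1,2)])
  have nz12: "\<not> zero_near (%x. h1 x * h2 x)" using nz(2) zero_near_mult[OF a(1,2) _ nz(1)] by (rule contrapos_nn)
  have "\<not> zero_near (%x. h1 x * h2 x * h3 x)" using nz(3) zero_near_mult[OF a12 a(3) _ nz12] by (rule contrapos_nn)
  from MI[OF ana_mult[OF a12 a(3)] dep_mult[OF dep_mult[OF dp(1,2)] dp(3)] this]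
  obtain S where S: "cover S" "ALL si:S. amap si & act (I - {n}) si & mon (%x. h1 (si x) * h2 (si x) * h3 (si x))" by (elim exE conjE)
  have "nice I n si & (EX R. QS I n (%x. f (si x)) R)" if s: "si : S" for si
  proof
   have am: "amap si" and ac: "act (I - {n}) si" and mn: "mon (%x. h1 (si x) * h2 (si x) * h3 (si x))"
    using bspec[OF S(2) s] by simp_all
   have ac': "act I si" by (rule act_mono[OF ac]) auto
   note A = ana_amap[OF a(1) am] ana_amap[OF a(2) am] ana_amap[OF a(3) am]
   have m12: "mon (%x. h1 (si x) * h2 (si x))" by (rule mon_factor[OF ana_mult[OF A(1,2)] A(3) mn])
   have m1: "mon (%x. h1 (si x))" by (rule mon_factor[OF A(1,2) m12])
   have m2: "mon (%x. h2 (si x))" by (rule mon_factor[OF A(2,1)]) (use m12 in \<open>simp only: mult.commute\<close>)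
   have m3: "mon (%x. h3 (si x))" by (rule mon_factor[OF A(3) ana_mult[OF A(1,2)]]) (use mn in \<open>simp only: mult.commute\<close>)
   have mc: "mon (%x. c i (si x))" if i: "i : K" for i
    by (rule mon_prod_factor[where f = "%i x. c i (si x)", OF fK _ m1[unfolded h1_def] i]) (rule ana_amap[OF c(1)[OF Kd(1)] am])
   have me: "mon (%x. e q (si x))" if q: "q : D" for q
    by (rule mon_prod_factor[where f = "%i x. e i (si x)", OF fD _ m2[unfolded h2_def] q]) (rule ana_amap[OF e(1) am])
   have mx: "mon (%x. si x $ i)" if i: "i : I - {n}" for i
    by (rule mon_prod_factor[where f = "%i x. si x $ i", OF _ _ m3[unfolded h3_def] i]) (use am in \<open>simp_all add: amap_def\<close>)
   show "nice I n si"
    unfolding nice_def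
   proof (intro conjI ballI am ac')
    fix i assume i: "i : I - {n}"
    show "EX a u. ana u & u 0 ~= 0 & eventually (%x. si x $ i = mo a x * u x) (nhds 0) & (ALL k. a k ~= 0 --> k : I - {n})"
    proof (rule mon_dep[OF mx[OF i]])
     show "dep (I - {n}) (%x. si x $ i)" using ac i by (simp add: act_def)
     fix a u assume "ana u" "u 0 ~= 0" "eventually (%x. si x $ i = mo a x * u x) (nhds 0)" "!!k. a k ~= 0 ==> k : I - {n}"
     then show ?thesis by (intro exI[of _ a] exI[of _ u] conjI allI impI)
    qed
   qed
   have s0: "si 0 = 0" using am by (simp add: amap_def)
   have sn: "si x $ n = x $ n" for x using ac by (simp add: act_def)
   show "EX R. QS I n (%x. f (si x)) R"
   proof (rule QS_comparable[OF n d _ K(1) False K(2), where c = "%i x. c i (si x)" and u = "%x. u (si x)"])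
    show "EX S. QS I n g S" if "k < d" "ana g" "dep I g" "(partial n ^^ k) g 0 ~= 0" for g k by (rule IHQ[OF that])
    show "mon (%x. c i (si x))" if "i : K" for i by (rule mc[OF that])
    show "zero_near (%x. c i (si x))" if "i < d" "i ~: K" for i
    proof (rule eventually_amap[OF am])
     show "zero_near (c i)" using that by (simp add: K_def)
    qed
    show "c i (si 0) = 0" if "i : K" for i unfolding s0 by (rule c(3)[OF Kd(1)[OF that]])
    show "dep (I - {n}) (%x. c i (si x))" if "i < d" for i by (rule dep_act[OF c(2)[OF that] ac])
    show "ana (%x. u (si x))" by (rule ana_amap[OF u(1) am])
    show "dep I (%x. u (si x))" by (rule dep_act[OF u(2) ac'])
    show "u (si 0) ~= 0" unfolding s0 by (rule u(3))
    show "f (si x) = (SUM i<d. c i (si x) * x $ n ^ i) + x $ n ^ d * u (si x)" for x unfolding f sn ..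
    fix i j assume i: "i : K" and j: "j : K"
    show "zero_near (%x. c i (si x) ^ (fact d div (d - i)) - c j (si x) ^ (fact d div (d - j))) \<or>
      mon (%x. c i (si x) ^ (fact d div (d - i)) - c j (si x) ^ (fact d div (d - j)))"
     unfolding m_def[symmetric]
    proof (cases "(i, j) : D")
     case True
     from me[OF True] show "zero_near (%x. c i (si x) ^ m i - c j (si x) ^ m j) \<or> mon (%x. c i (si x) ^ m i - c j (si x) ^ m j)"
      by (simp add: e_def)
    next
     case False
     then have "zero_near (%x. c i x ^ m i - c j x ^ m j)" using i j by (simp add: D_def)
     from eventually_amap[OF am this] show "zero_near (%x. c i (si x) ^ m i - c j (si x) ^ m j) \<or> mon (%x. c i (si x) ^ m i - c j (si x) ^ m j)" ..
    qed
   qed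
  qed
  then show ?thesis by (intro QS_step[OF S(1)]) simp
 qed
qed

lemma partial_eventually_cong:
 assumes "eventually (%x. f x = g x) (nhds 0)"
 shows "eventually (%x. partial i f x = partial i g x) (nhds 0)"
proof -
 obtain W where W: "open W" "0 : W" "!!x. x : W ==> f x = g x" using assms unfolding eventually_nhds by (elim exE conjE) blast
 show ?thesis unfolding eventually_nhds using W(1,2) partial_cong[OF W(1) _ W(3)] by (intro exI[of _ W]) simp
qed

text \<open>The shift has unit speed along \<open>n\<close> and so commutes with derivatives in that
  direction.\<close>

lemma partial_translate:
 fixes f :: "real^'n::finite => real"
 assumes f: "ana f" and ta: "amap ta" "!!x t. ta (x + t *\<^sub>R axis n 1) = ta x + t *\<^sub>R axis n 1"
 shows "eventually (%x. (partial n ^^ k) (%x. f (ta x)) x = (partial n ^^ k) f (ta x)) (nhds 0)"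
proof (induction k)
 case (Suc k)
 let ?g = "(partial n ^^ k) f"
 note ag = ana_funpow[OF f, where n = n and m = k]
 have "eventually (%x. partial n (%x. ?g (ta x)) x = partial n ?g (ta x)) (nhds 0)"
  using eventually_amap[OF ta(1) ana_partial(2)[OF ag]] ana_partial(2)[OF ana_amap[OF ag ta(1)]]
 proof eventually_elim
  case (elim x)
  have "((%t. ?g (ta x + t *\<^sub>R axis n 1)) has_real_derivative partial n ?g (ta x + 0 *\<^sub>R axis n 1)) (at 0)"
   by (rule has_real_derivative_axis) (use elim in simp)
  moreover have "((%t. ?g (ta (x + t *\<^sub>R axis n 1))) has_real_derivative partial n (%x. ?g (ta x)) (x + 0 *\<^sub>R axis n 1)) (at 0)"
   by (rule has_real_derivative_axis) (use elim in simp)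
  ultimately show ?case unfolding ta(2) by (simp add: DERIV_unique)
 qed
 then show ?case using partial_eventually_cong[OF Suc.IH, of n]
  by eventually_elim simp
qed simp

text \<open>Induction on the order in \<open>x $ n\<close>. The implicit solution \<open>th\<close>
  describes where the derivative of order \<open>d - 1\<close> vanishes; shifting that graph to
  \<open>x $ n = 0\<close> removes the coefficient of degree \<open>d - 1\<close>, the condition
  under which blowing up lowers the order.\<close>

lemma QS_order:
 fixes f :: "real^'n::finite => real"
 assumes n: "n : I"
  and MI: "!!h. ana h ==> dep (I - {n}) h ==> \<not> zero_near h ==> EX S. cover S & (ALL si:S. amap si & act (I - {n}) si & mon (%x. h (si x)))"
 shows "ana f ==> dep I f ==> (partial n ^^ d) f 0 ~= 0 ==> EX S. QS I n f S"
proof (induction d arbitrary: f rule: less_induct)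
 case (less d)
 note f = less.prems(1,2)
 show ?case
 proof (cases "EX k<d. (partial n ^^ k) f 0 ~= 0")
  case True
  then obtain k where "k < d" "(partial n ^^ k) f 0 ~= 0" by (elim exE conjE)
  then show ?thesis by (rule less.IH[OF _ f])
 next
  case False
  then have low: "(partial n ^^ k) f 0 = 0" if "k < d" for k using that by simp
  show ?thesis
  proof (cases "d = 0")
   case True
   then have "mon f" using less.prems(3) by (intro mon_unit[OF f(1)]) simp
   then have "QS I n f {%x. x}" by (simp add: QS_def cover_id amap_id act_id)
   then show ?thesis ..
  next
   case d: False
   define g where "g = (partial n ^^ (d - 1)) f"
   have pg: "partial n g = (partial n ^^ d) f" using d by (cases d) (simp_all add: g_def)
   obtain th where th: "ana th" "th 0 = 0" "dep (I - {n}) th" "eventually (%x. g (zn n x + th x *\<^sub>R axis n 1) = 0) (nhds 0)"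
   proof (rule ana_implicit[of g n I])
    show "ana g" unfolding g_def by (rule ana_funpow[OF f(1)])
    show "g 0 = 0" unfolding g_def by (rule low) (use d in simp)
    show "partial n g 0 ~= 0" unfolding pg by (rule less.prems(3))
    show "dep I g" unfolding g_def by (rule dep_funpow[OF f(2)])
   qed (rule that)
   have thn: "th y = th x" if "!!i. i ~= n ==> y $ i = x $ i" for x y by (rule depD[OF th(3)]) (use that in auto)
   define ta where "ta x = x + th x *\<^sub>R axis n 1" for x
   have tan: "ta x $ j = x $ j + (if j = n then th x else 0)" for x j by (simp add: ta_def axis_def)
   have am: "amap ta"
   proof (rule amapI)
    show "ana (%x. ta x $ j)" for j by (cases "j = n") (simp_all add: tan ana_add th(1))
   qed (simp add: ta_def th(2))
   have am': "amap (%x. x - th x *\<^sub>R axis n 1)"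
   proof (rule amapI)
    show "ana (%x. (x - th x *\<^sub>R axis n 1) $ j)" for j by (cases "j = n") (simp_all add: axis_def ana_diff th(1))
   qed (simp add: th(2))
   have cov: "cover {ta}"
   proof (rule cover_inverse[OF am'])
    fix y
    have "th (y - th y *\<^sub>R axis n 1) = th y" by (rule thn) (simp add: axis_def)
    then show "ta (y - th y *\<^sub>R axis n 1) = y" by (simp add: ta_def)
   qed
   have dI: "dep I th" by (rule dep_mono[OF th(3)]) auto
   have ac: "act I ta"
    unfolding act_def
   proof (intro conjI allI impI ballI)
    show "ta x $ i = x $ i" if "i ~: I" for i x using that n by (auto simp: tan)
    show "dep I (%x. ta x $ i)" if "i : I" for i
     unfolding tan using dep_binop[OF dep_nth[OF that] dI, of "%a b. a + (if i = n then b else 0)"] .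
   qed
   have tat: "ta (x + t *\<^sub>R axis n 1) = ta x + t *\<^sub>R axis n 1" for x t
   proof -
    have "th (x + t *\<^sub>R axis n 1) = th x" by (rule thn) (simp add: axis_def)
    then show ?thesis by (simp add: ta_def)
   qed
   define f1 where "f1 x = f (ta x)" for x
   have a1: "ana f1" and d1: "dep I f1" unfolding f1_def using ana_amap[OF f(1) am] dep_act[OF f(2) ac] by simp_all
   have pk: "eventually (%x. (partial n ^^ k) f1 x = (partial n ^^ k) f (ta x)) (nhds 0)" for k
    unfolding f1_def[abs_def] by (rule partial_translate[OF f(1) am tat])
   have ta0: "ta 0 = 0" by (simp add: ta_def th(2))
   have pk0: "(partial n ^^ k) f1 0 = (partial n ^^ k) f 0" for k using eventually_nhds_x_imp_x[OF pk[of k]] by (simp add: ta0)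
   obtain u where u: "ana u" "u 0 = (partial n ^^ d) f1 0 / fact d" "dep I u"
    "eventually (%x. f1 x = (SUM i<d. (partial n ^^ i) f1 (zn n x) / fact i * x $ n ^ i) + x $ n ^ d * u x) (nhds 0)"
    by (rule ana_taylor[OF a1 _ d1, where d = d and n = n]) (use d in simp)
   define c where "c i x = (partial n ^^ i) f1 (zn n x) / fact i" for i x
   have z0: "zn n (0 :: real^'n) = 0" by (simp add: vec_eq_iff)
   have "EX S. QS I n (%x. (SUM i<d. c i x * x $ n ^ i) + x $ n ^ d * u x) S"
   proof (rule QS_of_coeffs[OF n, where c = c and u = u and d = d])
    show "EX S. QS I n g S" if "k < d" "ana g" "dep I g" "(partial n ^^ k) g 0 ~= 0" for g k by (rule less.IH[OF that])
    show "EX S. cover S & (ALL si:S. amap si & act (I - {n}) si & mon (%x. h (si x)))"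
     if "ana h" "dep (I - {n}) h" "\<not> zero_near h" for h by (rule MI[OF that])
    show "0 < d" using d by simp
    show "ana (c i)" for i
     using ana_mult[OF ana_const[of "1 / fact i"] ana_amap[OF ana_funpow[OF a1] amap_zn]] by (simp add: c_def[abs_def])
    show "dep (I - {n}) (c i)" for i
     unfolding c_def using dep_binop[OF dep_zn[OF dep_funpow[OF d1]] dep_const, where h = "%a b. a / b"] .
    show "c i 0 = 0" if "i < d" for i using low[OF that] by (simp add: c_def z0 pk0)
    show "zero_near (c (d - 1))"
    proof (rule eventually_mono[OF eventually_conj[OF eventually_amap[OF amap_zn pk[of "d - 1"]] th(4)]])
     fix x assume elim: "(partial n ^^ (d - 1)) f1 (zn n x) = (partial n ^^ (d - 1)) f (ta (zn n x)) & g (zn n x + th x *\<^sub>R axis n 1) = 0"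
     have "th (zn n x) = th x" by (rule thn) simp
     then show "c (d - 1) x = 0" using elim by (simp add: c_def ta_def g_def)
    qed
    show "u 0 ~= 0" using less.prems(3) by (simp add: u(2) pk0)
   qed (use u in simp_all)
   then obtain S where "QS I n (%x. (SUM i<d. c i x * x $ n ^ i) + x $ n ^ d * u x) S" ..
   moreover have "eventually (%x. (SUM i<d. c i x * x $ n ^ i) + x $ n ^ d * u x = f1 x) (nhds 0)"
    using u(4) by (rule eventually_mono) (simp add: c_def)
   ultimately have "QS I n f1 S" by (rule QS_cong)
   then have "QS I n (%x. f (ta x)) S" by (simp add: f1_def[abs_def])
   moreover have "nice I n ta"
    unfolding nice_def
   proof (intro conjI ballI am ac)
    fix i assume i: "i : I - {n}"
    then show "EX a u. ana u & u 0 ~= 0 & eventually (%x. ta x $ i = mo a x * u x) (nhds 0) & (ALL k. a k ~= 0 --> k : I - {n})"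
     by (intro nice_coordI) (simp_all add: tan)
   qed
   ultimately have "nice I n ta & (EX R. QS I n (%x. f (ta x)) R)" by (intro conjI exI)
   then show ?thesis by (intro QS_step[OF cov]) simp
  qed
 qed
qed

lemma dep_UNIV: "dep UNIV f"
 unfolding dep_def
proof (intro allI impI)
 fix x y :: "real^'a" assume "ALL i:UNIV. x $ i = y $ i"
 then have "x = y" by (simp add: vec_eq_iff)
 then show "f x = f y" by simp
qed

text \<open>On the complex line through \<open>a\<close> the function is holomorphic, 0 at the
  origin and nonzero at \<open>a\<close>, so its zero at the origin has a finite order
  \<open>N\<close>. If all derivatives vanished, the Taylor expansion would divide it by the power
  \<open>Suc N\<close>.\<close>

lemma ana_line_order:
 fixes f :: "real^'n::finite => real"
 assumes f: "ana f" and f0: "f 0 = 0" and r: "hold r F F'" "!!x. norm x < r ==> F (cv x) = complex_of_real (f x)"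
  and a: "norm a < r" "f a ~= 0" and L: "amap L" "!!t. L (axis n t) = t *\<^sub>R a"
 shows "EX k. (partial n ^^ k) (%x. f (L x)) 0 ~= 0"
proof (rule ccontr)
 assume "\<not> (EX k. (partial n ^^ k) (%x. f (L x)) 0 ~= 0)"
 then have z: "(partial n ^^ k) (%x. f (L x)) 0 = 0" for k by simp
 have na: "norm a > 0" using a(2) f0 by auto
 define R where "R = r / norm a"
 have R: "R > 1" using a(1) na by (simp add: R_def)
 define q where "q t = F (\<chi> j. t * complex_of_real (a $ j))" for t
 have vn: "norm (\<chi> j. t * complex_of_real (a $ j)) = norm t * norm a" for t :: complex
 proof -
  have "(\<chi> j. t * complex_of_real (a $ j)) = (\<chi> j. t * cv a $ j)" by simp
  also have "norm \<dots> = norm t * norm (cv a)"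
   unfolding norm_vec_def by (simp add: norm_mult L2_set_right_distrib[symmetric])
  finally show ?thesis by simp
 qed
 have hol: "q holomorphic_on ball 0 R"
  unfolding holomorphic_on_def
 proof
  fix t :: complex assume t: "t : ball 0 R"
  have "(\<chi> j. t * complex_of_real (a $ j)) : ball 0 r" using t na by (simp add: vn R_def pos_less_divide_eq)
  note 1 = holdD(2)[OF r(1) this]
  have 2: "((%t. (\<chi> j. t * complex_of_real (a $ j)) :: complex^'n) has_derivative (%h. \<chi> j. h * complex_of_real (a $ j))) (at t)"
   by (rule has_derivative_vec_components) (auto intro!: derivative_eq_intros)
  have "(q has_derivative (%h. SUM i:UNIV. (h * complex_of_real (a $ i)) * F' i (\<chi> j. t * complex_of_real (a $ j)))) (at t)"
   unfolding q_def using has_derivative_compose[OF 2 1] by simp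
  moreover have "(%h. SUM i:UNIV. (h * complex_of_real (a $ i)) * F' i (\<chi> j. t * complex_of_real (a $ j)))
    = (*) (SUM i:UNIV. complex_of_real (a $ i) * F' i (\<chi> j. t * complex_of_real (a $ j)))"
   by (rule ext) (simp add: sum_distrib_left mult_ac)
  ultimately have "(q has_field_derivative (SUM i:UNIV. complex_of_real (a $ i) * F' i (\<chi> j. t * complex_of_real (a $ j)))) (at t)"
   unfolding has_field_derivative_def by simp
  then show "q field_differentiable at t within ball 0 R"
   using field_differentiable_at_within field_differentiable_def by blast
 qed
 have qr: "q (complex_of_real t) = complex_of_real (f (t *\<^sub>R a))" if "\<bar>t\<bar> < R" for t
 proof -
  have "(\<chi> j. complex_of_real t * complex_of_real (a $ j)) = cv (t *\<^sub>R a)" by (simp add: vec_eq_iff)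
  moreover have "norm (t *\<^sub>R a) < r" using that na by (simp add: R_def pos_less_divide_eq)
  ultimately show ?thesis using r(2) by (simp add: q_def)
 qed
 have q0: "q 0 = 0" using qr[of 0] R f0 by simp
 have q1: "q 1 ~= 0" using qr[of 1] R a(2) by simp
 have nc: "\<not> q constant_on ball 0 R"
 proof
  assume "q constant_on ball 0 R"
  then obtain w where w: "ALL t:ball 0 R. q t = w" unfolding constant_on_def ..
  have "q 0 = w" "q 1 = w" using w R by simp_all
  then show False using q0 q1 by simp
 qed
 have zR: "0 : ball 0 R" using R by simp
 obtain g rh N where g: "0 < N" "0 < rh" "ball (0::complex) rh <= ball 0 R" "g holomorphic_on ball 0 rh"
  "!!w. w : ball 0 rh ==> q w = (w - 0) ^ N * g w" "!!w. w : ball 0 rh ==> g w ~= 0"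
 proof (rule holomorphic_factor_zero_nonconstant[OF hol open_ball connected_ball zR q0 nc])
  fix g r n assume "0 < n" "0 < r" "ball (0::complex) r <= ball 0 R" "g holomorphic_on ball 0 r"
   "!!w. w : ball 0 r ==> q w = (w - 0) ^ n * g w" "!!w. w : ball 0 r ==> g w ~= 0"
  then show thesis by (intro that[of n r g])
 qed
 let ?h = "%x. f (L x)"
 have dU: "dep UNIV ?h" by (rule dep_UNIV)
 obtain u where u: "ana u"
  "eventually (%x. ?h x = (SUM i<Suc N. (partial n ^^ i) ?h (zn n x) / fact i * x $ n ^ i) + x $ n ^ Suc N * u x) (nhds 0)"
  by (rule ana_taylor[OF ana_amap[OF f L(1)] _ dU, of "Suc N" n]) simp
 have ev: "eventually (%t. f (t *\<^sub>R a) = t ^ Suc N * u (axis n t)) (nhds 0)"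
 proof -
  have zz: "zn n (axis n t) = (0 :: real^'n)" for t :: real by (simp add: vec_eq_iff axis_def)
  have "eventually (%t. ?h (axis n t) = (SUM i<Suc N. (partial n ^^ i) ?h (zn n (axis n t)) / fact i * axis n t $ n ^ i) + axis n t $ n ^ Suc N * u (axis n t)) (nhds 0)"
   by (rule iffD1[OF filterlim_iff axis_lim, rule_format, OF u(2)])
  then show ?thesis by (rule eventually_mono) (simp only: L(2) zz z div_0 mult_zero_left sum.neutral_const add_0_left axis_nth)
 qed
 have evr: "eventually (%t::real. \<bar>t\<bar> < rh) (nhds 0)"
  unfolding eventually_nhds_metric using g(2) by (intro exI[of _ rh]) (simp add: dist_real_def)
 have Rrh: "\<bar>t\<bar> < R" if "\<bar>t\<bar> < rh" for t
 proof -
  have "complex_of_real t : ball 0 rh" using that by simp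
  then have "complex_of_real t : ball 0 R" using g(3) by (rule rev_subsetD)
  then show ?thesis by simp
 qed
 have gl: "((%t. g (complex_of_real t)) \<longlongrightarrow> g 0) (at 0)"
 proof -
  have "isCont g (complex_of_real 0)"
   using holomorphic_on_imp_continuous_on[OF g(4)] g(2) by (simp add: continuous_on_eq_continuous_at)
  have c0: "isCont complex_of_real 0" by (intro continuous_intros)
  have "isCont (%t. g (complex_of_real t)) 0"
   by (rule isCont_o2[where f = complex_of_real and g = g and a = 0, OF c0]) (rule \<open>isCont g (complex_of_real 0)\<close>)
  then show ?thesis by (simp add: isCont_def)
 qed
 have eq: "eventually (%t. complex_of_real (t * u (axis n t)) = g (complex_of_real t)) (at 0)"
  using ev evr unfolding eventually_at_filter
 proof eventually_elim
  case (elim t)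
  show ?case
  proof (intro impI)
   assume t: "t ~= 0"
   have "complex_of_real t : ball 0 rh" using elim by simp
   from g(5)[OF this] have "complex_of_real (f (t *\<^sub>R a)) = complex_of_real t ^ N * g (complex_of_real t)"
    using qr[OF Rrh] elim by simp
   then have "complex_of_real t ^ N * (complex_of_real (t * u (axis n t))) = complex_of_real t ^ N * g (complex_of_real t)"
    using elim by (simp add: mult_ac)
   then show "complex_of_real (t * u (axis n t)) = g (complex_of_real t)" using t by simp
  qed
 qed
 have "((%t. complex_of_real (t * u (axis n t))) \<longlongrightarrow> complex_of_real (0 * u (axis n 0))) (at 0)"
  using isCont_axis[OF u(1), of n] by (intro tendsto_of_real tendsto_mult tendsto_ident_at) (simp add: isCont_def)
 from this eq have "((%t. g (complex_of_real t)) \<longlongrightarrow> complex_of_real (0 * u (axis n 0))) (at 0)"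
  by (rule Lim_transform_eventually)
 from tendsto_unique[OF _ this gl] have "g 0 = 0" by simp
 then show False using g(6)[of 0] g(2) by simp
qed


text \<open>A direction along which \<open>f\<close> is not identically zero is turned into the
  \<open>n\<close>-axis. Then \<open>f\<close> has finite order in \<open>x $ n\<close>, and the
  induction hypothesis for \<open>I - {n}\<close> is what \<open>QS_order\<close> asks for.\<close>

theorem monomialization:
 fixes f :: "real^'n::finite => real"
 shows "ana f ==> dep I f ==> \<not> zero_near f ==> EX S. cover S & (ALL si:S. amap si & act I si & mon (%x. f (si x)))"
proof (induction I arbitrary: f rule: finite_psubset_induct[OF finite])
 case (1 I)
 note f = "1.prems"
 show ?case
 proof (cases "f 0 = 0")
  case False
  then have "mon f" by (rule mon_unit[OF f(1)])
  then show ?thesis by (intro exI[of _ "{%x. x}"]) (simp add: cover_id amap_id act_id)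
 next
  case f0: True
  obtain r F F' where r: "hold r F F'" "!!x. norm x < r ==> F (cv x) = complex_of_real (f x)" by (rule anaE[OF f(1)]) (rule that)
  have "EX b. norm b < r & f b ~= 0"
  proof (rule ccontr)
   assume "\<not> (EX b. norm b < r & f b ~= 0)"
   then have "zero_near f" unfolding eventually_nhds_metric using holdD(1)[OF r(1)] by (intro exI[of _ r]) auto
   then show False using f(3) by simp
  qed
  then obtain b where b: "norm b < r" "f b ~= 0" by (elim exE conjE)
  \<comment> \<open>Erasing the coordinates outside \<open>I\<close> does not change the value of
    \<open>f\<close> and lets the linear map act within \<open>I\<close>.\<close>
  define a where "a = (\<chi> i. if i : I then b $ i else 0)"
  have fa: "f a = f b" by (rule depD[OF f(2)]) (simp add: a_def)
  have "norm a <= norm b" by (rule norm_le_componentwise_cart) (simp add: a_def)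
  then have a: "norm a < r" "f a ~= 0" using b fa by simp_all
  then have "a ~= 0" using f0 by auto
  then obtain n where n0: "a $ n ~= 0" by (auto simp: vec_eq_iff)
  have n: "n : I" using n0 by (auto simp: a_def split: if_splits)
  define L where "L x = (\<chi> j. if j = n then x $ n * a $ n else x $ j + x $ n * a $ j)" for x
  define L' where "L' y = (\<chi> j. if j = n then y $ n * (1 / a $ n) else y $ j - y $ n * (a $ j / a $ n))" for y
  have am: "amap L"
  proof (rule amapI)
   show "ana (%x. L x $ j)" for j by (cases "j = n") (simp_all add: L_def ana_add ana_mult)
  qed (simp add: L_def vec_eq_iff)
  have am': "amap L'"
  proof (rule amapI)
   show "ana (%x. L' x $ j)" for j
    using ana_mult[OF ana_nth ana_const, of n "1 / a $ n"] ana_diff[OF ana_nth ana_mult[OF ana_nth ana_const], of j n "a $ j / a $ n"]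
    by (cases "j = n") (simp_all add: L'_def)
  qed (simp add: L'_def vec_eq_iff)
  have "L (L' y) = y" for y using n0 by (simp add: L_def L'_def vec_eq_iff)
  then have cov: "cover {L}" by (intro cover_inverse[OF am'])
  have ac: "act I L"
   unfolding act_def
  proof (intro conjI allI impI ballI)
   show "L x $ i = x $ i" if "i ~: I" for i x using that n by (auto simp: L_def a_def)
   show "dep I (%x. L x $ i)" if "i : I" for i using that n by (auto simp: L_def dep_def)
  qed
  have "L (axis n t) = t *\<^sub>R a" for t by (simp add: L_def vec_eq_iff axis_def)
  from ana_line_order[OF f(1) f0 r a am this] obtain k where k: "(partial n ^^ k) (%x. f (L x)) 0 ~= 0" ..
  have "EX S. QS I n (%x. f (L x)) S"
  proof (rule QS_order[OF n _ ana_amap[OF f(1) am] dep_act[OF f(2) ac] k])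
   show "EX S. cover S & (ALL si:S. amap si & act (I - {n}) si & mon (%x. h (si x)))"
    if "ana h" "dep (I - {n}) h" "\<not> zero_near h" for h
    by (rule "1.IH"[OF _ that]) (use n in auto)
  qed
  then obtain S where S: "cover S" "ALL si:S. amap si & act I si & mon (%x. f (L (si x)))" unfolding QS_def by auto
  have c: "cover {(%x. L (rh x)) | si rh. si : {L} & rh : S}"
  proof -
   have "cover {(%x. si (rh x)) | si rh. si : {L} & rh : S}" by (rule cover_compose[OF cov S(1)])
   moreover have "{(%x. si (rh x)) | si rh. si : {L} & rh : S} = {(%x. L (rh x)) | si rh. si : {L} & rh : S}" by auto
   ultimately show ?thesis by simp
  qed
  show ?thesis
  proof (intro exI conjI ballI)
   show "cover {(%x. L (rh x)) | si rh. si : {L} & rh : S}" by (rule c)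
   fix ta assume "ta : {(%x. L (rh x)) | si rh. si : {L} & rh : S}"
   then obtain rh where t: "ta = (%x. L (rh x))" "rh : S" by auto
   have rh: "amap rh" "act I rh" "mon (%x. f (L (rh x)))" using bspec[OF S(2) t(2)] by simp_all
   show "amap ta" unfolding t(1) by (rule amap_compose[OF am rh(1)])
   show "act I ta" unfolding t(1) by (rule act_compose[OF ac rh(2)])
   show "mon (%x. f (ta x))" unfolding t(1) by (rule rh(3))
  qed
 qed
qed

subsection \<open>The Lojasiewicz inequality\<close>

text \<open>At points where a single coordinate vanishes, the inclusion of zero sets shows that
  every variable of the monomial of \<open>f\<close> occurs in that of \<open>h\<close>. A power of
  the latter exceeding all exponents of the former is then smaller on the unit cube, and the units
  are bounded on both sides.\<close>

lemma lojasiewicz_monomial: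
 fixes f h :: "real^'n::finite => real"
 assumes f: "mon f" and h: "mon h" and z: "eventually (%x. f x = 0 --> h x = 0) (nhds 0)"
 shows "EX N C. C > 0 & eventually (%x. \<bar>h x\<bar> ^ N <= C * \<bar>f x\<bar>) (nhds 0)"
proof -
 obtain a u where u: "ana u" "u 0 ~= 0" "eventually (%x. f x = mo a x * u x) (nhds 0)" using f unfolding mon_def by (elim exE conjE)
 obtain b v where v: "ana v" "v 0 ~= 0" "eventually (%x. h x = mo b x * v x) (nhds 0)" using h unfolding mon_def by (elim exE conjE)
 have ab: "b i > 0" if i: "a i > 0" for i
 proof (rule ccontr)
  assume nb: "\<not> b i > 0"
  have "eventually (%x. f x = mo a x * u x & h x = mo b x * v x & (f x = 0 --> h x = 0) & v x ~= 0) (nhds 0)"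
   by (intro eventually_conj u(3) v(3) z ana_nonzero_near[OF v(1,2)])
  then show False
  proof (rule eventually_line_witness[where Z = "{i}"])
   fix x :: "real^'n" assume x: "!!j. j : {i} ==> x $ j = 0" "!!j. j ~: {i} ==> x $ j ~= 0"
   have "mo a x = 0" by (rule mo_eq_0[of x i]) (use x(1) i in simp_all)
   moreover have "mo b x ~= 0" unfolding mo_nonzero_iff
   proof (intro allI impI)
    fix j assume "x $ j = 0"
    then have "j = i" using x(2)[of j] by (cases "j = i") simp_all
    then show "b j = 0" using nb by simp
   qed
   ultimately show "\<not> (f x = mo a x * u x & h x = mo b x * v x & (f x = 0 --> h x = 0) & v x ~= 0)" by auto
  qed
 qed
 define N where "N = (SUM i:UNIV. a i)"
 have aN: "a i <= N" for i unfolding N_def by (rule member_le_sum) simp_all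
 define C where "C = (\<bar>v 0\<bar> + 1) ^ N / (\<bar>u 0\<bar> / 2)"
 have C: "C > 0" using u(2) by (simp add: C_def)
 have ub: "eventually (%x. \<bar>u x\<bar> > \<bar>u 0\<bar> / 2) (nhds 0)"
 proof -
  have "(u \<longlongrightarrow> u 0) (nhds 0)" using ana_isCont[OF u(1)] by (simp add: isCont_def tendsto_at_iff_tendsto_nhds)
  then have "((%x. \<bar>u x\<bar>) \<longlongrightarrow> \<bar>u 0\<bar>) (nhds 0)" by (rule tendsto_rabs)
  then show ?thesis by (rule order_tendstoD(1)) (use u(2) in simp)
 qed
 have vb: "eventually (%x. \<bar>v x\<bar> < \<bar>v 0\<bar> + 1) (nhds 0)"
 proof -
  have "(v \<longlongrightarrow> v 0) (nhds 0)" using ana_isCont[OF v(1)] by (simp add: isCont_def tendsto_at_iff_tendsto_nhds)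
  then have "((%x. \<bar>v x\<bar>) \<longlongrightarrow> \<bar>v 0\<bar>) (nhds 0)" by (rule tendsto_rabs)
  then show ?thesis by (rule order_tendstoD(2)) simp
 qed
 have x1: "eventually (%x::real^'n. ALL j. \<bar>x $ j\<bar> <= 1) (nhds 0)"
  unfolding eventually_nhds_metric
 proof (intro exI[of _ 1] conjI allI impI)
  fix x :: "real^'n" and j assume "dist x 0 < 1"
  then show "\<bar>x $ j\<bar> <= 1" using component_le_norm_cart[of x j] by simp
 qed simp
 have "eventually (%x. \<bar>h x\<bar> ^ N <= C * \<bar>f x\<bar>) (nhds 0)"
 proof (rule eventually_mono[OF eventually_conj[OF eventually_conj[OF u(3) v(3)] eventually_conj[OF eventually_conj[OF ub vb] x1]]])
  fix x assume "(f x = mo a x * u x & h x = mo b x * v x) & (\<bar>u x\<bar> > \<bar>u 0\<bar> / 2 & \<bar>v x\<bar> < \<bar>v 0\<bar> + 1) & (ALL j. \<bar>x $ j\<bar> <= 1)"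
  then have x: "f x = mo a x * u x" "h x = mo b x * v x" "\<bar>u x\<bar> > \<bar>u 0\<bar> / 2" "\<bar>v x\<bar> < \<bar>v 0\<bar> + 1" "ALL j. \<bar>x $ j\<bar> <= 1" by simp_all
  have mm: "\<bar>mo b x\<bar> ^ N <= \<bar>mo a x\<bar>"
  proof -
   have "\<bar>mo b x\<bar> ^ N = (PROD i:UNIV. \<bar>x $ i\<bar> ^ (b i * N))"
    by (simp add: mo_def abs_prod power_abs prod_power_distrib power_mult)
   also have "\<dots> <= (PROD i:UNIV. \<bar>x $ i\<bar> ^ a i)"
   proof (rule prod_mono, intro conjI)
    fix i
    show "\<bar>x $ i\<bar> ^ (b i * N) <= \<bar>x $ i\<bar> ^ a i"
    proof (cases "a i = 0")
     case True
     then show ?thesis using x(5) by (simp add: power_le_one)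
    next
     case False
     then have "1 * N <= b i * N" using ab[of i] by (intro mult_le_mono1) simp
     then have "N <= b i * N" by (simp only: mult_1)
     then have "a i <= b i * N" by (rule le_trans[OF aN])
     then show ?thesis using x(5) by (intro power_decreasing) simp_all
    qed
   qed simp
   also have "\<dots> = \<bar>mo a x\<bar>" by (simp add: mo_def abs_prod power_abs)
   finally show ?thesis .
  qed
  have "\<bar>h x\<bar> ^ N = \<bar>mo b x\<bar> ^ N * \<bar>v x\<bar> ^ N" by (simp add: x(2) abs_mult power_mult_distrib)
  also have "\<dots> <= \<bar>mo a x\<bar> * (\<bar>v 0\<bar> + 1) ^ N" using x(4) by (intro mult_mono mm power_mono) simp_all
  also have "\<dots> = C * (\<bar>mo a x\<bar> * (\<bar>u 0\<bar> / 2))" using u(2) by (simp add: C_def)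
  also have "\<dots> <= C * (\<bar>mo a x\<bar> * \<bar>u x\<bar>)" using C x(3) by (intro mult_left_mono) simp_all
  finally show "\<bar>h x\<bar> ^ N <= C * \<bar>f x\<bar>" by (simp add: x(1) abs_mult)
 qed
 then show ?thesis using C by (intro exI conjI)
qed

text \<open>Monomializing the product makes both germs monomials times units on each source. An
  inequality between values at \<open>si x\<close> is an inequality at the image point, and finitely
  many images cover a neighbourhood.\<close>

theorem lojasiewicz:
 fixes f h :: "real^'n::finite => real"
 assumes f: "ana f" and h: "ana h" and z: "eventually (%x. f x = 0 --> h x = 0) (nhds 0)"
 obtains N C where "C > 0" "eventually (%x. \<bar>h x\<bar> ^ N <= C * \<bar>f x\<bar>) (nhds 0)"
proof (cases "zero_near h")
 case True
 have "eventually (%x. \<bar>h x\<bar> ^ 1 <= 1 * \<bar>f x\<bar>) (nhds 0)" by (rule eventually_mono[OF True]) simp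
 then show thesis by (intro that[of 1 1]) simp_all
next
 case nh: False
 have nf: "\<not> zero_near f"
 proof
  assume "zero_near f"
  then have "zero_near h" using z by eventually_elim simp
  then show False using nh by simp
 qed
 have nz: "\<not> zero_near (%x. f x * h x)" using nh zero_near_mult[OF f h _ nf] by (rule contrapos_nn)
 have "dep UNIV (%x. f x * h x)" by (rule dep_UNIV)
 from monomialization[OF ana_mult[OF f h] this nz]
 obtain S where S: "cover S" "ALL si:S. amap si & act UNIV si & mon (%x. f (si x) * h (si x))" by (elim exE conjE)
 have "EX NCe. snd (fst NCe) > 0 & snd NCe > 0 & (ALL x. (ALL j. \<bar>x $ j\<bar> < snd NCe) --> \<bar>h (si x)\<bar> ^ fst (fst NCe) <= snd (fst NCe) * \<bar>f (si x)\<bar>)" if s: "si : S" for si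
 proof -
  have am: "amap si" and mn: "mon (%x. f (si x) * h (si x))" using bspec[OF S(2) s] by simp_all
  have "mon (%x. f (si x))" by (rule mon_factor[OF ana_amap[OF f am] ana_amap[OF h am] mn])
  moreover have "mon (%x. h (si x))" by (rule mon_factor[OF ana_amap[OF h am] ana_amap[OF f am]]) (use mn in \<open>simp only: mult.commute\<close>)
  ultimately have "EX N C. C > 0 & eventually (%x. \<bar>h (si x)\<bar> ^ N <= C * \<bar>f (si x)\<bar>) (nhds 0)"
   by (rule lojasiewicz_monomial) (rule eventually_amap[OF am z])
  then obtain N C where NC: "C > 0" "eventually (%x. \<bar>h (si x)\<bar> ^ N <= C * \<bar>f (si x)\<bar>) (nhds 0)" by (elim exE conjE)
  show ?thesis
  proof (rule eventually_cube[OF NC(2)])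
   fix e :: real assume e: "e > 0" "!!x. (!!j. \<bar>x $ j\<bar> < e) ==> \<bar>h (si x)\<bar> ^ N <= C * \<bar>f (si x)\<bar>"
   have "ALL x. (ALL j. \<bar>x $ j\<bar> < e) --> \<bar>h (si x)\<bar> ^ N <= C * \<bar>f (si x)\<bar>" using e(2) by simp
   then show ?thesis using NC(1) e(1) by (intro exI[of _ "((N, C), e)"]) simp
  qed
 qed
 then have "ALL si:S. EX NCe. snd (fst NCe) > 0 & snd NCe > 0 & (ALL x. (ALL j. \<bar>x $ j\<bar> < snd NCe) --> \<bar>h (si x)\<bar> ^ fst (fst NCe) <= snd (fst NCe) * \<bar>f (si x)\<bar>)" by simp
 from bchoice[OF this] obtain q where q: "ALL si:S. snd (fst (q si)) > 0 & snd (q si) > 0 & (ALL x. (ALL j. \<bar>x $ j\<bar> < snd (q si)) --> \<bar>h (si x)\<bar> ^ fst (fst (q si)) <= snd (fst (q si)) * \<bar>f (si x)\<bar>)" ..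
 obtain T ew where T: "finite T" "T <= S" "ew > 0"
  and T4: "ALL y. (ALL j. \<bar>y $ j\<bar> < ew) --> (EX si:T. EX x. (ALL j. \<bar>x $ j\<bar> < snd (q si)) & si x = y)"
 proof (rule coverD[OF S(1), of "%si. snd (q si)"])
  show "0 < snd (q si)" if "si : S" for si using bspec[OF q that] by simp
  fix T ew assume a: "finite T" "T <= S" "(0::real) < ew"
   "!!y. (!!j. \<bar>y $ j\<bar> < ew) ==> EX si:T. EX x. (ALL j. \<bar>x $ j\<bar> < snd (q si)) & si x = y"
  have "ALL y. (ALL j. \<bar>y $ j\<bar> < ew) --> (EX si:T. EX x. (ALL j. \<bar>x $ j\<bar> < snd (q si)) & si x = y)" using a(4) by simp
  then show thesis by (rule that[OF a(1-3)])
 qed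
 \<comment> \<open>A common exponent above those of all sources; raising an exponent to
   \<open>N\<close> costs a bounded factor since \<open>h\<close> is bounded by
   \<open>H >= 1\<close>.\<close>
 define N where "N = (SUM si:T. fst (fst (q si)))"
 define C where "C = 1 + (SUM si:T. snd (fst (q si)))"
 have qT: "0 < snd (fst (q si))" "!!x. (ALL j. \<bar>x $ j\<bar> < snd (q si)) ==> \<bar>h (si x)\<bar> ^ fst (fst (q si)) <= snd (fst (q si)) * \<bar>f (si x)\<bar>" if "si : T" for si
  using bspec[OF q subsetD[OF T(2) that]] by simp_all
 have N: "fst (fst (q si)) <= N" if "si : T" for si
  unfolding N_def using that T(1) by (intro member_le_sum) simp_all
 have C: "snd (fst (q si)) <= C" if "si : T" for si
 proof -
  have "snd (fst (q si)) <= (SUM si:T. snd (fst (q si)))" using that T(1) qT(1) by (intro member_le_sum) (simp_all add: less_imp_le)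
  then show ?thesis by (simp add: C_def)
 qed
 have C0: "C > 0"
 proof -
  have "(SUM si:T. snd (fst (q si))) >= 0" using qT(1) by (intro sum_nonneg) (simp add: less_imp_le)
  then show ?thesis by (simp add: C_def)
 qed
 define H where "H = \<bar>h 0\<bar> + 1"
 have H: "H >= 1" by (simp add: H_def)
 have hb: "eventually (%x. \<bar>h x\<bar> < H) (nhds 0)"
 proof -
  have "(h \<longlongrightarrow> h 0) (nhds 0)" using ana_isCont[OF h] by (simp add: isCont_def tendsto_at_iff_tendsto_nhds)
  then have "((%x. \<bar>h x\<bar>) \<longlongrightarrow> \<bar>h 0\<bar>) (nhds 0)" by (rule tendsto_rabs)
  then show ?thesis by (rule order_tendstoD(2)) (simp add: H_def)
 qed
 have cu: "eventually (%x::real^'n. ALL j. \<bar>x $ j\<bar> < ew) (nhds 0)"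
  unfolding eventually_nhds_metric
 proof (intro exI[of _ ew] conjI allI impI T(3))
  fix x :: "real^'n" and j assume "dist x 0 < ew"
  then show "\<bar>x $ j\<bar> < ew" using component_le_norm_cart[of x j] by simp
 qed
 have "eventually (%y. \<bar>h y\<bar> ^ N <= (C * H ^ N) * \<bar>f y\<bar>) (nhds 0)"
 proof (rule eventually_mono[OF eventually_conj[OF hb cu]])
  fix y assume y: "\<bar>h y\<bar> < H & (ALL j. \<bar>y $ j\<bar> < ew)"
  obtain si x where x: "si : T" "ALL j. \<bar>x $ j\<bar> < snd (q si)" "si x = y" using spec[OF T4, of y] y by auto
  let ?k = "fst (fst (q si))"
  have "\<bar>h y\<bar> ^ N = \<bar>h y\<bar> ^ ?k * \<bar>h y\<bar> ^ (N - ?k)" using N[OF x(1)] by (simp add: power_add[symmetric])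
  also have "\<dots> <= (C * \<bar>f y\<bar>) * H ^ N"
  proof (rule mult_mono)
   have "\<bar>h y\<bar> ^ ?k <= snd (fst (q si)) * \<bar>f y\<bar>" using qT(2)[OF x(1,2)] x(3) by simp
   also have "\<dots> <= C * \<bar>f y\<bar>" using C[OF x(1)] by (rule mult_right_mono) simp
   finally show "\<bar>h y\<bar> ^ ?k <= C * \<bar>f y\<bar>" .
   have "\<bar>h y\<bar> ^ (N - ?k) <= H ^ (N - ?k)" using y by (intro power_mono) simp_all
   also have "\<dots> <= H ^ N" using H by (intro power_increasing) simp_all
   finally show "\<bar>h y\<bar> ^ (N - ?k) <= H ^ N" .
  qed (use C0 in simp_all)
  finally show "\<bar>h y\<bar> ^ N <= (C * H ^ N) * \<bar>f y\<bar>" by (simp add: mult_ac)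
 qed
 moreover have "C * H ^ N > 0" using C0 H by (simp add: zero_less_power)
 ultimately show thesis by (intro that)
qed


subsection \<open>Flat functions near a union of quadrants\<close>

lemma partial_segment_bound:
 fixes f :: "real^'n::finite => real"
 assumes c: "continuous_on (closed_segment b v) f" and d: "!!w. w : open_segment b v ==> f differentiable (at w)"
  and K: "!!w i. w : open_segment b v ==> \<bar>partial i f w\<bar> <= K i"
 shows "\<bar>f v - f b\<bar> <= (SUM i:UNIV. K i) * norm (v - b)"
proof (cases "v = b")
 case False
 define l where "l t = b + t *\<^sub>R (v - b)" for t :: real
 have os: "l t : open_segment b v" if "0 < t" "t < 1" for t
  unfolding in_segment l_def using that False by (intro conjI exI[of _ t]) (simp_all add: algebra_simps)
 have "continuous_on {0..1} (%t. f (l t))"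
 proof (rule continuous_on_compose2[OF c])
  show "continuous_on {0..1} l" unfolding l_def by (intro continuous_intros)
  show "l ` {0..1} <= closed_segment b v"
  proof
   fix x assume "x : l ` {0..1}"
   then obtain t where t: "x = l t" "t : {0..1}" by (rule imageE)
   show "x : closed_segment b v" unfolding in_segment t(1) l_def using t(2)
    by (intro exI[of _ t]) (simp add: algebra_simps)
  qed
 qed
 moreover have "((%t. f (l t)) has_real_derivative (SUM i:UNIV. (v - b) $ i * partial i f (l t))) (at t)" if "0 < t" "t < 1" for t
  unfolding l_def by (rule has_real_derivative_line) (use d[OF os[OF that]] in \<open>simp add: l_def\<close>)
 then have "((%t. f (l t)) has_derivative (%h. (SUM i:UNIV. (v - b) $ i * partial i f (l t)) * h)) (at t)" if "0 < t" "t < 1" for t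
  using that unfolding has_field_derivative_def by simp
 ultimately obtain xi where xi: "xi : {0<..<1}" "f (l 1) - f (l 0) = (SUM i:UNIV. (v - b) $ i * partial i f (l xi)) * (1 - 0)"
  using mvt[of 0 1 "%t. f (l t)" "%t h. (SUM i:UNIV. (v - b) $ i * partial i f (l t)) * h"] by auto
 have o: "l xi : open_segment b v" using xi(1) by (intro os) simp_all
 have "\<bar>f v - f b\<bar> = \<bar>SUM i:UNIV. (v - b) $ i * partial i f (l xi)\<bar>" using xi(2) by (simp add: l_def)
 also have "\<dots> <= (SUM i:UNIV. norm (v - b) * K i)"
 proof (rule order_trans[OF sum_abs sum_mono])
  fix i
  show "\<bar>(v - b) $ i * partial i f (l xi)\<bar> <= norm (v - b) * K i"
   unfolding abs_mult by (intro mult_mono component_le_norm_cart K[OF o]) simp_all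
 qed
 finally show ?thesis by (simp add: sum_distrib_right mult.commute)
qed simp

text \<open>Each integration along the segment from \<open>b\<close> to \<open>v\<close> turns a
  bound for the first derivatives into one with an extra factor of the distance.\<close>

lemma flat_decay:
 fixes a :: "real^'n::finite => real"
 assumes V: "cball p r <= V"
 shows "flat_on B V a ==> EX K>=0. ALL v:cball p r. ALL b:cball p r Int B. \<bar>a v\<bar> <= K * dist v b ^ M"
proof (induction M arbitrary: a)
 case 0
 have "continuous_on (cball p r) a"
  using smooth_on_imp_continuous_on[OF flat_on_imp_smooth[OF 0]] V by (rule continuous_on_subset)
 then have "bounded (a ` cball p r)" by (intro compact_imp_bounded compact_continuous_image compact_cball)
 then obtain K where K: "ALL x:cball p r. \<bar>a x\<bar> <= K" unfolding bounded_iff by auto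
 have "\<bar>a v\<bar> <= \<bar>K\<bar>" if "v : cball p r" for v using bspec[OF K that] by linarith
 then show ?case by (intro exI[of _ "\<bar>K\<bar>"]) simp
next
 case (Suc M)
 have "EX K>=0. ALL v:cball p r. ALL b:cball p r Int B. \<bar>partial i a v\<bar> <= K * dist v b ^ M" for i
  by (rule Suc.IH[OF flat_on_partial[OF Suc.prems]])
 then have "ALL i. EX K. K >= 0 & (ALL v:cball p r. ALL b:cball p r Int B. \<bar>partial i a v\<bar> <= K * dist v b ^ M)" by simp
 from choice[OF this] obtain K where K: "ALL i. K i >= 0 & (ALL v:cball p r. ALL b:cball p r Int B. \<bar>partial i a v\<bar> <= K i * dist v b ^ M)" ..
 have "\<bar>a v\<bar> <= (SUM i:UNIV. K i) * dist v b ^ Suc M" if v: "v : cball p r" and b: "b : cball p r Int B" for v b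
 proof -
  have seg: "closed_segment b v <= cball p r" using v b by (intro closed_segment_subset) auto
  have "\<bar>a v - a b\<bar> <= (SUM i:UNIV. K i * dist v b ^ M) * norm (v - b)"
  proof (rule partial_segment_bound)
   show "continuous_on (closed_segment b v) a"
    using smooth_on_imp_continuous_on[OF flat_on_imp_smooth[OF Suc.prems]] order_trans[OF seg V] by (rule continuous_on_subset)
   fix w assume w: "w : open_segment b v"
   have wc: "w : closed_segment b v" using w by (simp add: open_segment_def)
   have wr: "w : cball p r" using seg wc by (rule subsetD)
   show "a differentiable (at w)" by (rule smooth_on_imp_differentiable[OF flat_on_imp_smooth[OF Suc.prems]]) (rule subsetD[OF V wr])
   fix i
   have "dist w b <= dist v b" using dist_in_closed_segment[OF wc] by (simp add: dist_commute)
   then have "dist w b ^ M <= dist v b ^ M" by (rule power_mono) simp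
   then have "K i * dist w b ^ M <= K i * dist v b ^ M" using K by (intro mult_left_mono) simp_all
   moreover have "\<bar>partial i a w\<bar> <= K i * dist w b ^ M" using K wr b by simp
   ultimately show "\<bar>partial i a w\<bar> <= K i * dist v b ^ M" by simp
  qed
  moreover have "a b = 0" using flat_on_imp_zero[OF Suc.prems] b by simp
  ultimately show ?thesis by (simp add: dist_norm sum_distrib_right[symmetric] mult_ac)
 qed
 moreover have "(SUM i:UNIV. K i) >= 0" using K by (intro sum_nonneg) simp
 ultimately show ?case by (intro exI[of _ "SUM i:UNIV. K i"]) simp
qed

text \<open>The right side is the \<open>l1\<close> distance, in which the distance to a face of an
  orthant is a sum of absolute coordinates.\<close>

lemma local_lipschitz:
 fixes f :: "real^'m::finite => real^'n::finite"
 assumes f: "smooth_map_on W f" and p: "cball p r <= W"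
 shows "EX L>0. ALL x:cball p r. ALL y:cball p r. dist (f x) (f y) <= L * (SUM i:UNIV. \<bar>x $ i - y $ i\<bar>)"
proof -
 have "EX K. ALL x:cball p r. \<bar>partial i (%x. f x $ j) x\<bar> <= K" for i j
 proof -
  have "continuous_on (cball p r) (partial i (%x. f x $ j))"
   by (rule continuous_on_subset[OF smooth_on_imp_continuous_on[OF smooth_on_partial] p]) (use f in simp)
  then have "bounded (partial i (%x. f x $ j) ` cball p r)" by (intro compact_imp_bounded compact_continuous_image compact_cball)
  then show ?thesis unfolding bounded_iff by auto
 qed
 then have "ALL q. EX K. ALL x:cball p r. \<bar>partial (fst q) (%x. f x $ snd q) x\<bar> <= K" by simp
 from choice[OF this] obtain K where K: "ALL q. ALL x:cball p r. \<bar>partial (fst q) (%x. f x $ snd q) x\<bar> <= K q" ..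
 define L where "L = 1 + (SUM j:UNIV. \<bar>SUM i:UNIV. K (i, j)\<bar>)"
 have L: "L > 0" unfolding L_def by (rule add_pos_nonneg) (simp_all add: sum_nonneg)
 have "dist (f x) (f y) <= L * (SUM i:UNIV. \<bar>x $ i - y $ i\<bar>)" if x: "x : cball p r" and y: "y : cball p r" for x y
 proof -
  have seg: "closed_segment y x <= cball p r" using x y by (intro closed_segment_subset) auto
  have j: "\<bar>f x $ j - f y $ j\<bar> <= (SUM i:UNIV. K (i, j)) * norm (x - y)" for j
  proof (rule partial_segment_bound)
   show "continuous_on (closed_segment y x) (%x. f x $ j)"
    by (rule continuous_on_subset[OF smooth_on_imp_continuous_on order_trans[OF seg p]]) (use f in simp)
   fix w assume w: "w : open_segment y x"
   have wr: "w : cball p r" using seg w by (auto simp: open_segment_def)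
   show "(%x. f x $ j) differentiable (at w)"
    by (rule smooth_on_imp_differentiable[OF _ subsetD[OF p wr]]) (use f in simp)
   show "\<bar>partial i (%x. f x $ j) w\<bar> <= K (i, j)" for i using K[rule_format, of w "(i, j)"] wr by simp
  qed
  have "dist (f x) (f y) <= (SUM j:UNIV. \<bar>f x $ j - f y $ j\<bar>)" unfolding dist_norm using norm_le_l1_cart[of "f x - f y"] by simp
  also have "\<dots> <= (SUM j:UNIV. \<bar>SUM i:UNIV. K (i, j)\<bar> * norm (x - y))"
  proof (rule sum_mono)
   fix j
   have "(SUM i:UNIV. K (i, j)) * norm (x - y) <= \<bar>SUM i:UNIV. K (i, j)\<bar> * norm (x - y)" by (rule mult_right_mono) simp_all
   with j[of j] show "\<bar>f x $ j - f y $ j\<bar> <= \<bar>SUM i:UNIV. K (i, j)\<bar> * norm (x - y)" by linarith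
  qed
  also have "\<dots> = (L - 1) * norm (x - y)" by (simp add: L_def sum_distrib_right)
  also have "\<dots> <= L * (SUM i:UNIV. \<bar>x $ i - y $ i\<bar>)"
  proof (rule mult_mono)
   show "norm (x - y) <= (SUM i:UNIV. \<bar>x $ i - y $ i\<bar>)" using norm_le_l1_cart[of "x - y"] by simp
  qed (use L in simp_all)
  finally show ?thesis .
 qed
 then show ?thesis using L by (intro exI[of _ L]) simp
qed

text \<open>On the orthant with signs \<open>\<epsilon>\<close> the substitution \<open>z\<^sub>i = \<epsilon>\<^sub>i y\<^sub>i\<^sup>2\<close> turns the distance to a union of
  quadrants into an analytic function of \<open>y\<close>, up to comparison with a product over the faces.\<close>

lemma lojasiewicz_quadrants:
 fixes B :: "(real^'n::finite) set"
 assumes qc: "quadrant_chart V B W ph py S" and B: "closedin (top_of_set V) B"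
  and p: "p : B Int W" "ph p = 0" and py: "!!j. ana (%z. py z $ j)" and dw: "ana (%v. dw (p + v))"
  and nz: "!!v. v : V ==> dw v = 0 ==> v : B"
 obtains N C where "C > 0" "!!e. e > 0 ==> EX r>0. ALL v:ball p r. EX b:B. dist v b < e & dist v b ^ N <= C * \<bar>dw v\<bar>"
proof -
 have W: "open W" "W <= V" "open (ph ` W)" "smooth_map_on W ph" "smooth_map_on (ph ` W) py" and inv: "!!x. x : W ==> py (ph x) = x"
  using qc unfolding quadrant_chart_def by simp_all
 have inv': "ph (py z) = z" "py z : W" if "z : ph ` W" for z using that inv by auto
 have z0: "0 : ph ` W" using p by (metis IntD2 imageI)
 have py0: "py 0 = p" using inv[of p] p by simp
 obtain s where s: "s > 0" "cball 0 s <= ph ` W" using W(3) z0 by (meson open_contains_cball)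
 obtain L where L: "L > 0" "ALL x:cball 0 s. ALL y:cball 0 s. dist (py x) (py y) <= L * (SUM i:UNIV. \<bar>x $ i - y $ i\<bar>)"
  using local_lipschitz[OF W(5) s(2)] by (elim exE conjE)
 define sg where "sg T i = (if i : T then - 1 else 1 :: real)" for T and i :: 'n
 define q where "q T y = (\<chi> i. sg T i * (y $ i)\<^sup>2)" for T and y :: "real^'n"
 \<comment> \<open>The faces of the orthant with signs \<open>sg T\<close> along which
   \<open>B\<close> runs, each named by the set of coordinates vanishing on it.\<close>
 define JJ where "JJ T = {J. EX b:B Int W. ALL i. sgn (ph b $ i) = (if i : J then 0 else sg T i)}" for T
 \<comment> \<open>Since \<open>(y $ j)\<^sup>2\<close> is \<open>\<bar>z $ j\<bar>\<close>, the
   inner sum is the \<open>l1\<close> distance of \<open>z\<close> to the face \<open>J\<close>; the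
   product vanishes once one of these distances does.\<close>
 define h where "h T y = (PROD J:JJ T. SUM j:J. (y $ j)\<^sup>2)" for T and y :: "real^'n"
 have q0: "q T 0 = 0" for T by (simp add: q_def vec_eq_iff)
 have aq: "ana (%y. q T y $ i)" for T i
  using ana_mult[OF ana_const ana_power[OF ana_nth], of "sg T i" i 2] by (simp add: q_def)
 have am: "amap (q T)" for T by (rule amapI[OF aq q0])
 have af: "ana (%y. dw (py (q T y)))" for T
 proof -
  have "ana (%y. dw (p + (py (q T y) - p)))"
  proof (rule ana_compose[OF dw])
   show "ana (%y. (py (q T y) - p) $ j)" for j
    unfolding vector_minus_component by (intro ana_diff ana_const ana_amap[OF py am])
   show "py (q T 0) - p = 0" by (simp add: q0 py0)
  qed
  then show ?thesis by simp
 qed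
 have ah: "ana (h T)" for T unfolding h_def by (intro ana_prod ana_sum ana_power ana_nth)
 have near: "eventually (%z. z : ph ` W) (nhds 0)" using W(3) z0 by (rule eventually_nhds_in_open)
 have fh: "eventually (%y. dw (py (q T y)) = 0 --> h T y = 0) (nhds 0)" for T
 proof (rule eventually_mono[OF eventually_amap[OF am near]], rule impI)
  fix y assume y: "q T y : ph ` W" and "dw (py (q T y)) = 0"
  then have bB: "py (q T y) : B" using nz inv'(2)[OF y] W(2) by blast
  define J where "J = {i. y $ i = 0}"
  have "J : JJ T"
   unfolding JJ_def mem_Collect_eq
  proof (intro bexI[of _ "py (q T y)"] allI)
   show "py (q T y) : B Int W" using bB inv'(2)[OF y] by simp
   show "sgn (ph (py (q T y)) $ i) = (if i : J then 0 else sg T i)" for i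
    unfolding inv'(1)[OF y] by (simp add: q_def J_def sgn_mult sg_def, simp add: sgn_if)
  qed
  moreover have "(SUM j:J. (y $ j)\<^sup>2) = 0" by (simp add: J_def)
  ultimately show "h T y = 0" unfolding h_def by (intro prod_zero) auto
 qed
 have "EX NC. snd NC > 0 & eventually (%y. \<bar>h T y\<bar> ^ fst NC <= snd NC * \<bar>dw (py (q T y))\<bar>) (nhds 0)" for T
 proof (rule lojasiewicz[OF af ah fh])
  fix N C assume "C > 0" "eventually (%y. \<bar>h T y\<bar> ^ N <= C * \<bar>dw (py (q T y))\<bar>) (nhds 0)"
  then show ?thesis by (intro exI[of _ "(N, C)"]) simp
 qed
 then have "ALL T. EX NC. snd NC > 0 & eventually (%y. \<bar>h T y\<bar> ^ fst NC <= snd NC * \<bar>dw (py (q T y))\<bar>) (nhds 0)" by simp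
 from choice[OF this] obtain NC where NC: "ALL T. snd (NC T) > 0 & eventually (%y. \<bar>h T y\<bar> ^ fst (NC T) <= snd (NC T) * \<bar>dw (py (q T y))\<bar>) (nhds 0)" ..
 have "eventually (%y. ALL T. \<bar>h T y\<bar> ^ fst (NC T) <= snd (NC T) * \<bar>dw (py (q T y))\<bar>) (nhds 0)"
  by (intro eventually_all_finite) (use NC in simp)
 then obtain ew where ew: "ew > 0" "!!y. (!!j. \<bar>y $ j\<bar> < ew) ==> ALL T. \<bar>h T y\<bar> ^ fst (NC T) <= snd (NC T) * \<bar>dw (py (q T y))\<bar>"
  using eventually_cube by blast
 define k where "k T = card (JJ T) * fst (NC T)" for T
 define N where "N = (SUM T:UNIV. k T)"
 define C where "C = 1 + (SUM T:UNIV. L ^ k T * snd (NC T))"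
 have pos: "0 <= L ^ k T * snd (NC T)" for T using L(1) NC by (intro mult_nonneg_nonneg) (simp_all add: less_imp_le)
 have C: "C > 0" "L ^ k T * snd (NC T) <= C" for T
 proof -
  show "C > 0" unfolding C_def using pos by (intro add_pos_nonneg sum_nonneg) simp_all
  have "L ^ k T * snd (NC T) <= (SUM T:UNIV. L ^ k T * snd (NC T))" using pos by (intro member_le_sum) simp_all
  then show "L ^ k T * snd (NC T) <= C" by (simp add: C_def)
 qed
 have kN: "k T <= N" for T unfolding N_def by (rule member_le_sum) simp_all
 \<comment> \<open>Passing from the exponent \<open>k T\<close> to the common \<open>N\<close>
   requires distance at most 1, which the first bound secures close to \<open>p\<close>.\<close>
 have main: "EX b:B. dist v b <= L * (SUM i:UNIV. \<bar>ph v $ i\<bar>) & (dist v b <= 1 --> dist v b ^ N <= C * \<bar>dw v\<bar>)"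
  if v: "v : W" and zs: "ph v : cball 0 s" and zq: "!!i. \<bar>ph v $ i\<bar> < ew\<^sup>2" for v
 proof -
  define z where "z = ph v"
  define T where "T = {i. z $ i < 0}"
  define y where "y = (\<chi> i. sqrt \<bar>z $ i\<bar>)"
  have qy: "q T y = z"
  proof -
   have "q T y $ i = z $ i" for i by (simp add: q_def y_def sg_def T_def)
   then show ?thesis by (simp add: vec_eq_iff)
  qed
  have y2: "(y $ i)\<^sup>2 = \<bar>z $ i\<bar>" for i by (simp add: y_def)
  have "\<bar>y $ j\<bar> < ew" for j
  proof -
   have "sqrt \<bar>z $ j\<bar> < ew" using real_sqrt_less_mono[OF zq[of j]] ew(1) by (simp add: z_def)
   then show ?thesis by (simp add: y_def)
  qed
  from spec[OF ew(2)[OF this], of T] have loj: "\<bar>h T y\<bar> ^ fst (NC T) <= snd (NC T) * \<bar>dw v\<bar>"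
   using inv[OF v] by (simp add: qy z_def)
  define s' where "s' J = (SUM j:J. \<bar>z $ j\<bar>)" for J
  have s'0: "s' J >= 0" for J by (simp add: s'_def sum_nonneg)
  have hT: "h T y = (PROD J:JJ T. s' J)" by (simp add: h_def s'_def y2)
  have ne: "UNIV : JJ T" unfolding JJ_def using p by (auto intro!: bexI[of _ p])
  \<comment> \<open>A nearest face. The product of the distances to all faces is at least the
    smallest one to the power of their number.\<close>
  define J0 where "J0 = arg_min_on s' (JJ T)"
  have J0: "J0 : JJ T" "!!J. J : JJ T ==> s' J0 <= s' J"
   unfolding J0_def by (rule arg_min_if_finite(1), use ne in auto)[1] (rule arg_min_least, use ne in auto)
  obtain b' where b': "b' : B Int W" "!!i. sgn (ph b' $ i) = (if i : J0 then 0 else sg T i)" using J0(1) unfolding JJ_def by blast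
  \<comment> \<open>Projection to the nearest face; it only kills signs of \<open>b'\<close>, so it
    stays in \<open>B\<close> by \<open>closed_under_sign_degeneration\<close>.\<close>
  define z' where "z' = (\<chi> i. if i : J0 then 0 else z $ i)"
  have "norm z' <= norm z" by (rule norm_le_componentwise_cart) (simp add: z'_def)
  then have z's: "z' : cball 0 s" using zs by (simp add: z_def)
  have bB: "py z' : B"
  proof (rule closed_under_sign_degeneration[OF qc B b'(1)])
   show "z' : ph ` W" using s(2) z's by (rule subsetD)
   show "z' $ i = 0 \<or> sgn (z' $ i) = sgn (ph b' $ i)" for i
    unfolding b'(2) by (auto simp: z'_def sg_def T_def sgn_if)
  qed
  have "dist (py z) (py z') <= L * (SUM i:UNIV. \<bar>z $ i - z' $ i\<bar>)" using L(2) zs z's by (simp add: z_def)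
  moreover have "(SUM i:UNIV. \<bar>z $ i - z' $ i\<bar>) = s' J0"
  proof -
   have "(SUM i:UNIV. \<bar>z $ i - z' $ i\<bar>) = (SUM i:UNIV. if i : J0 then \<bar>z $ i\<bar> else 0)" by (intro sum.cong refl) (simp add: z'_def)
   then show ?thesis by (simp add: s'_def sum.If_cases)
  qed
  ultimately have d: "dist v (py z') <= L * s' J0" using inv[OF v] by (simp add: z_def)
  have "s' J0 <= s' UNIV" by (rule J0(2)[OF ne])
  then have "L * s' J0 <= L * (SUM i:UNIV. \<bar>ph v $ i\<bar>)" using L(1) by (intro mult_left_mono) (simp_all add: s'_def z_def)
  then have d1: "dist v (py z') <= L * (SUM i:UNIV. \<bar>ph v $ i\<bar>)" using d by linarith
  have d2: "dist v (py z') ^ N <= C * \<bar>dw v\<bar>" if le1: "dist v (py z') <= 1"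
  proof -
   have "s' J0 ^ card (JJ T) <= \<bar>h T y\<bar>"
   proof -
    have "s' J0 ^ card (JJ T) = (PROD J:JJ T. s' J0)" by simp
    also have "\<dots> <= (PROD J:JJ T. s' J)" using J0(2) s'0 by (intro prod_mono) simp
    finally show ?thesis unfolding hT by simp
   qed
   then have "(s' J0 ^ card (JJ T)) ^ fst (NC T) <= \<bar>h T y\<bar> ^ fst (NC T)" using s'0 by (intro power_mono) simp_all
   then have sk: "s' J0 ^ k T <= snd (NC T) * \<bar>dw v\<bar>" using loj by (simp add: k_def power_mult)
   have "dist v (py z') ^ N <= dist v (py z') ^ k T" using kN le1 by (intro power_decreasing) simp_all
   also have "\<dots> <= (L * s' J0) ^ k T" using d by (intro power_mono) simp_all
   also have "\<dots> = L ^ k T * s' J0 ^ k T" by (rule power_mult_distrib)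
   also have "\<dots> <= L ^ k T * (snd (NC T) * \<bar>dw v\<bar>)" using sk L(1) by (intro mult_left_mono) simp_all
   also have "\<dots> = (L ^ k T * snd (NC T)) * \<bar>dw v\<bar>" by simp
   also have "\<dots> <= C * \<bar>dw v\<bar>" by (rule mult_right_mono[OF C(2)]) simp
   finally show ?thesis .
  qed
  show ?thesis using bB d1 d2 by (intro bexI[of _ "py z'"]) simp_all
 qed
 show thesis
 proof (rule that[OF C(1), of N])
  fix e :: real assume e: "e > 0"
  have ct: "(ph \<longlongrightarrow> 0) (nhds p)"
  proof -
   have "continuous_on W ph" by (rule smooth_map_on_imp_continuous_on[OF W(4)])
   then have "isCont ph p" using W(1) p(1) by (simp add: continuous_on_eq_continuous_at)
   then have "(ph \<longlongrightarrow> ph p) (nhds p)" unfolding isCont_def tendsto_at_iff_tendsto_nhds .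
   then show ?thesis by (simp only: p(2))
  qed
  have ci: "((%v. ph v $ i) \<longlongrightarrow> 0) (nhds p)" for i using tendsto_vec_nth[OF ct, of i] by simp
  have e1: "eventually (%v. v : W) (nhds p)" using W(1) p(1) by (intro eventually_nhds_in_open) simp_all
  have e2: "eventually (%v. ph v : cball 0 s) (nhds p)"
   by (rule eventually_mono[OF tendstoD[OF ct s(1)]]) simp
  have e3: "eventually (%v. ALL i. \<bar>ph v $ i\<bar> < ew\<^sup>2) (nhds p)"
  proof (rule eventually_all_finite)
   fix i have "ew\<^sup>2 > 0" using ew(1) by simp
   from tendstoD[OF ci this] show "eventually (%v. \<bar>ph v $ i\<bar> < ew\<^sup>2) (nhds p)" by (rule eventually_mono) simp
  qed
  have "((%v. L * (SUM i:UNIV. \<bar>ph v $ i\<bar>)) \<longlongrightarrow> L * (SUM i:(UNIV::'n set). \<bar>0\<bar>)) (nhds p)"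
   by (intro tendsto_mult tendsto_const tendsto_sum tendsto_rabs ci)
  then have "eventually (%v. L * (SUM i:UNIV. \<bar>ph v $ i\<bar>) < min e 1) (nhds p)"
   by (rule order_tendstoD(2)) (use e in simp)
  with e1 e2 e3 have "eventually (%v. EX b:B. dist v b < e & dist v b ^ N <= C * \<bar>dw v\<bar>) (nhds p)"
  proof eventually_elim
   case (elim v)
   obtain b where b: "b : B" "dist v b <= L * (SUM i:UNIV. \<bar>ph v $ i\<bar>)" "dist v b <= 1 --> dist v b ^ N <= C * \<bar>dw v\<bar>"
    using main[of v] elim by blast
   have "dist v b < min e 1" using b(2) elim by linarith
   then show ?case using b by (intro bexI[of _ b]) simp_all
  qed
  then show "EX r>0. ALL v:ball p r. EX b:B. dist v b < e & dist v b ^ N <= C * \<bar>dw v\<bar>"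
  proof -
   assume "eventually (%v. EX b:B. dist v b < e & dist v b ^ N <= C * \<bar>dw v\<bar>) (nhds p)"
   then obtain d where d: "d > 0" "ALL v. dist v p < d --> (EX b:B. dist v b < e & dist v b ^ N <= C * \<bar>dw v\<bar>)"
    unfolding eventually_nhds_metric by (elim exE conjE)
   show ?thesis
   proof (intro exI[of _ d] conjI ballI d(1))
    fix v assume "v : ball p d"
    then have "dist v p < d" by (simp add: dist_commute)
    then show "EX b:B. dist v b < e & dist v b ^ N <= C * \<bar>dw v\<bar>" using d(2) by (elim allE impE)
   qed
  qed
 qed
qed

text \<open>Of the \<open>N * m + 1\<close> powers of the distance gained from flatness,
  \<open>N * m\<close> pay for the denominator and the last one tends to 0.\<close>

lemma flat_quotient_small:
 fixes B :: "(real^'n::finite) set"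
 assumes V: "open V" "p : V" and a: "flat_on B V a"
  and loj: "C > 0" "!!e. e > 0 ==> EX r>0. ALL v:ball p r. EX b:B. dist v b < e & dist v b ^ N <= C * \<bar>dw v\<bar>"
  and e: "e > 0"
 shows "EX r>0. ALL v:ball p r. dw v ~= 0 --> \<bar>a v / dw v ^ m\<bar> < e"
proof -
 obtain R where R: "R > 0" "cball p R <= V" using V by (meson open_contains_cball)
 obtain K where K: "K >= 0" "ALL v:cball p R. ALL b:cball p R Int B. \<bar>a v\<bar> <= K * dist v b ^ (Suc (N * m))"
  using flat_decay[OF R(2) a] by blast
 define e' where "e' = min (R / 2) (e / (K * C ^ m + 1))"
 have KC: "K * C ^ m + 1 > 0" using K(1) loj(1) by (intro add_nonneg_pos mult_nonneg_nonneg) simp_all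
 have e': "e' > 0" using R(1) e KC by (simp add: e'_def)
 obtain r where r: "r > 0" "ALL v:ball p r. EX b:B. dist v b < e' & dist v b ^ N <= C * \<bar>dw v\<bar>" using loj(2)[OF e'] by (elim exE conjE)
 have "\<bar>a v / dw v ^ m\<bar> < e" if v: "v : ball p (min r (R / 2))" and nz: "dw v ~= 0" for v
 proof -
  have "v : ball p r" using v by simp
  then obtain b where b: "b : B" "dist v b < e'" "dist v b ^ N <= C * \<bar>dw v\<bar>" using r(2) by blast
  have vR: "v : cball p R" using v R(1) by simp
  have "dist p b <= dist p v + dist v b" by (rule dist_triangle)
  then have bR: "b : cball p R Int B" using b(1,2) v by (simp add: e'_def)
  have "\<bar>a v\<bar> <= K * dist v b ^ (Suc (N * m))" using K(2) vR bR by blast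
  also have "\<dots> = K * (dist v b * (dist v b ^ N) ^ m)" by (simp add: power_mult)
  also have "\<dots> <= K * (dist v b * (C * \<bar>dw v\<bar>) ^ m)" using K(1) b(3) by (intro mult_left_mono power_mono) simp_all
  also have "\<dots> = (K * C ^ m * dist v b) * \<bar>dw v\<bar> ^ m" by (simp add: power_mult_distrib)
  finally have "\<bar>a v / dw v ^ m\<bar> <= K * C ^ m * dist v b" using nz by (simp add: abs_divide power_abs pos_divide_le_eq)
  also have "\<dots> <= (K * C ^ m + 1) * dist v b" by (rule mult_right_mono) simp_all
  also have "\<dots> < (K * C ^ m + 1) * (e / (K * C ^ m + 1))" using b(2) KC by (intro mult_strict_left_mono) (simp_all add: e'_def)
  also have "\<dots> = e" using KC by simp
  finally show ?thesis .
 qed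
 then show ?thesis using r(1) R(1) by (intro exI[of _ "min r (R / 2)"]) simp
qed


subsection \<open>Push-forward of flat forms\<close>

definition jac :: "(real^'n::finite => real^'n) => real^'n => real" where
 "jac f v = det (\<chi> j k. partial k (%x. f x $ j) v)"

lemma smooth_on_det:
 fixes m :: "real^'n::finite => real^'k::finite^'k"
 assumes "open V" "!!a b. smooth_on V (%v. m v $ a $ b)"
 shows "smooth_on V (%v. det (m v))"
 unfolding det_def by (intro smooth_on_sum smooth_on_mult smooth_on_const smooth_on_prod assms)

lemma ana_jac:
 assumes "!!j. ana (%y. f (p + y) $ j)"
 shows "ana (%y. jac f (p + y))"
 unfolding jac_def det_def
proof (intro ana_sum ana_mult ana_const ana_prod)
 fix si and i :: 'a
 show "ana (%y. (\<chi> j k. partial k (%x. f x $ j) (p + y)) $ i $ si i)"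
  using ana_shift_partial[of "%x. f x $ i" p "si i"] assms by simp
qed

lemma quotient_derivative_identity:
 fixes j :: real
 assumes "j ~= 0"
 shows "(p / j * j ^ m - a * (real m * j ^ (m - 1) * (q / j))) / (j ^ m * j ^ m) = (p * j - real m * a * q) / j ^ (m + 2)"
proof (cases m)
 case 0
 then show ?thesis using assms by (simp add: power2_eq_square)
next
 case (Suc l)
 have "(p / j * j ^ m - a * (real m * j ^ (m - 1) * (q / j))) = j ^ l * (p * j - real m * a * q) / j"
  using assms by (simp add: Suc diff_divide_distrib right_diff_distrib mult_ac)
 moreover have "j ^ m * j ^ m = j ^ l * j ^ (m + 2) / j" using assms by (simp add: Suc power_add mult_ac power2_eq_square)
 ultimately show ?thesis using assms by simp
qed

lemma prod_list_quotient:
 "length is = length js ==> prod_list (map2 (%i j. c i j / q) is js) = prod_list (map2 c is js) / (q :: real) ^ length is"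
 by (induction "is" js rule: list_induct2) simp_all

text \<open>Properness of \<open>\<pi>\<close> enters as \<open>closed_map\<close> and analyticity
  as \<open>loj\<close>. The quantifier over \<open>e\<close> provides comparison points of
  \<open>B\<close> close to \<open>v\<close>, so that they lie in the ball where the flat function
  is estimated.\<close>

locale blow_down =
 fixes U V A :: "(real^'n::finite) set" and \<pi> g :: "real^'n => real^'n"
 assumes U: "open U" and V: "open V" and A: "closedin (top_of_set U) A"
  and \<pi>: "smooth_map_on V \<pi>" "\<pi> ` V = U" and closed_map: "closed_map (top_of_set V) (top_of_set U) \<pi>"
  and g: "smooth_map_on (U - A) g" "!!y. y : U - A ==> g y : V" "!!y. y : U - A ==> \<pi> (g y) = y"
   "!!v. v : V ==> \<pi> v ~: A ==> g (\<pi> v) = v"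
  and loj: "!!p. p : V ==> \<pi> p : A ==> EX N C. C > 0 &
   (ALL e>0. EX r>0. ALL v:ball p r. EX b:{v:V. \<pi> v : A}. dist v b < e & dist v b ^ N <= C * \<bar>jac \<pi> v\<bar>)"
begin

abbreviation "B \<equiv> {v:V. \<pi> v : A}"

lemma A_subset: "A <= U"
 using closedin_subset[OF A] by simp

lemma openUA: "open (U - A)"
proof -
 obtain C where C: "closed C" "A = U Int C" using A unfolding closedin_closed by auto
 have "U - A = U - C" using C(2) by auto
 then show ?thesis using U C(1) by (simp add: open_Diff)
qed

lemma BV: "B <= V"
 by auto

lemma chain:
 assumes y: "y : U - A"
 shows "(SUM k:UNIV. partial k (%x. \<pi> x $ j) (g y) * partial i (%x. g x $ k) y) = (if i = j then 1 else 0)"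
proof -
 have "partial i (%x. \<pi> (g x) $ j) y = (SUM k:UNIV. partial k (%x. \<pi> x $ j) (g y) * partial i (%x. g x $ k) y)"
 proof (rule partial_compose[where g = "%x. \<pi> x $ j"])
  show "(%x. \<pi> x $ j) differentiable (at (g y))" using \<pi>(1) by (intro smooth_on_imp_differentiable[OF _ g(2)[OF y]]) simp
  show "(%x. g x $ k) differentiable (at y)" for k using g(1) by (intro smooth_on_imp_differentiable[OF _ y]) simp
 qed
 moreover have "partial i (%x. \<pi> (g x) $ j) y = partial i (%x. x $ j) y"
  by (rule partial_cong[OF openUA y]) (simp add: g(3))
 ultimately show ?thesis by (simp add: partial_nth)
qed

lemma jac_nonzero:
 assumes y: "y : U - A"
 shows "jac \<pi> (g y) ~= 0"
proof
 assume z: "jac \<pi> (g y) = 0"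
 have "(\<chi> j k. partial k (%x. \<pi> x $ j) (g y)) ** (\<chi> k i. partial i (%x. g x $ k) y) = mat 1"
  using chain[OF y] by (simp add: matrix_matrix_mult_def mat_def vec_eq_iff eq_commute)
 then have "jac \<pi> (g y) * det (\<chi> k i. partial i (%x. g x $ k) y) = 1"
  unfolding jac_def det_mul[symmetric] by (simp add: det_I)
 then show False using z by simp
qed

text \<open>The numerator in Cramer's rule for the derivative of \<open>g\<close>, written on
  \<open>V\<close> where it is smooth across \<open>B\<close>.\<close>

definition cof :: "'n => 'n => real^'n => real" where
 "cof i k v = det (\<chi> a b. if b = k then axis i 1 $ a else partial b (%x. \<pi> x $ a) v)"

lemma partial_g:
 assumes y: "y : U - A"
 shows "partial i (%x. g x $ k) y = cof i k (g y) / jac \<pi> (g y)"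
proof -
 let ?M = "(\<chi> j k. partial k (%x. \<pi> x $ j) (g y)) :: real^'n^'n"
 have d: "det ?M ~= 0" using jac_nonzero[OF y] by (simp add: jac_def)
 have "?M *v (\<chi> k. partial i (%x. g x $ k) y) = axis i 1"
  using chain[OF y] by (simp add: matrix_vector_mult_def vec_eq_iff axis_def eq_commute)
 then have "(\<chi> k. partial i (%x. g x $ k) y) = (\<chi> k. det (\<chi> a b. if b = k then axis i 1 $ a else ?M $ a $ b) / det ?M)"
  using cramer[OF d] by blast
 then have "(\<chi> k. partial i (%x. g x $ k) y) $ k = (\<chi> k. det (\<chi> a b. if b = k then axis i 1 $ a else ?M $ a $ b) / det ?M) $ k"
  by (rule arg_cong)
 moreover have "(\<chi> a b. if b = k then axis i 1 $ a else ?M $ a $ b) = (\<chi> a b. if b = k then axis i 1 $ a else partial b (%x. \<pi> x $ a) (g y))"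
  by (simp add: vec_eq_iff)
 ultimately show ?thesis by (simp only: cof_def jac_def vec_lambda_beta)
qed

lemma smooth_jac: "smooth_on V (jac \<pi>)"
 unfolding jac_def[abs_def] using \<pi>(1) by (intro smooth_on_det[OF V]) (simp add: smooth_on_partial)

lemma smooth_cof: "smooth_on V (cof i k)"
 unfolding cof_def[abs_def]
proof (rule smooth_on_det[OF V])
 show "smooth_on V (%v. (\<chi> a b. if b = k then axis i 1 $ a else partial b (%x. \<pi> x $ a) v) $ a $ b)" for a b
  using \<pi>(1) by (cases "b = k") (simp_all add: smooth_on_partial)
qed

text \<open>The Jacobian times the derivative of \<open>a\<close> composed with \<open>g\<close> in
  direction \<open>i\<close>, expressed on \<open>V\<close>.\<close>

definition der :: "'n => (real^'n => real) => real^'n => real" where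
 "der i a v = (SUM k:UNIV. partial k a v * cof i k v)"

lemma partial_compose_g:
 assumes a: "smooth_on V a" and y: "y : U - A"
 shows "partial i (%x. a (g x)) y = der i a (g y) / jac \<pi> (g y)" "(%x. a (g x)) differentiable (at y)"
proof -
 have d: "a differentiable (at (g y))" by (rule smooth_on_imp_differentiable[OF a g(2)[OF y]])
 have d': "(%x. g x $ k) differentiable (at y)" for k using g(1) by (intro smooth_on_imp_differentiable[OF _ y]) simp
 show "(%x. a (g x)) differentiable (at y)" by (rule differentiable_compose_vec[OF d d'])
 show "partial i (%x. a (g x)) y = der i a (g y) / jac \<pi> (g y)"
  unfolding partial_compose[OF d d'] by (simp add: partial_g[OF y] der_def sum_divide_distrib)
qed

text \<open>Numerators are flat on \<open>B\<close> and the exponent of the Jacobian is arbitrary: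
  the class is stable under partial derivatives and its members tend to 0 at
  \<open>A\<close>.\<close>

definition quot :: "(real^'n => real) => bool" where
 "quot F \<longleftrightarrow> (ALL x:A. F x = 0) & (EX a m. flat_on B V a & (ALL y:U - A. F y = a (g y) / jac \<pi> (g y) ^ m))"

lemma quotE:
 assumes "quot F"
 obtains a m where "flat_on B V a" "!!y. y : U - A ==> F y = a (g y) / jac \<pi> (g y) ^ m" "!!x. x : A ==> F x = 0"
proof -
 obtain a m where "flat_on B V a" "ALL y:U - A. F y = a (g y) / jac \<pi> (g y) ^ m" using assms unfolding quot_def by (elim conjE exE)
 moreover have "ALL x:A. F x = 0" using assms unfolding quot_def by (rule conjunct1)
 ultimately show thesis by (intro that[of a m]) simp_all
qed

lemma flat_der: "flat_on B V a ==> flat_on B V (der i a)"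
 unfolding der_def[abs_def] by (intro flat_on_sum[OF V BV] flat_on_mult[OF V BV] flat_on_partial smooth_cof)

lemma smooth_der: "smooth_on V a ==> smooth_on V (der i a)"
 unfolding der_def[abs_def] by (intro smooth_on_sum[OF V] smooth_on_mult[OF V] smooth_on_partial smooth_cof)

text \<open>Differentiation raises the exponent by 2, one Jacobian coming from the derivative of
  \<open>g\<close> and one from the quotient rule; the numerator stays flat.\<close>

lemma quot_partial_off:
 assumes a: "flat_on B V a" and F': "ALL y:U - A. F y = a (g y) / jac \<pi> (g y) ^ m"
 shows "!!y. y : U - A ==> F differentiable (at y)"
  and "flat_on B V (%v. der i a v * jac \<pi> v - real m * (a v * der i (jac \<pi>) v))"
  and "!!y. y : U - A ==> partial i F y =
   (der i a (g y) * jac \<pi> (g y) - real m * (a (g y) * der i (jac \<pi>) (g y))) / jac \<pi> (g y) ^ (m + 2)"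
proof -
 note sa = flat_on_imp_smooth[OF a] and F = bspec[OF F']
 let ?F = "%y. a (g y) / jac \<pi> (g y) ^ m"
 have gs: "g ` (U - A) <= V" using g(2) by auto
 have sm: "smooth_on (U - A) ?F"
  by (intro smooth_on_divide[OF openUA] smooth_on_power[OF openUA] smooth_on_compose[OF openUA V gs] sa smooth_jac)
   (use g(1) jac_nonzero in simp_all)
 have dF: "?F differentiable (at y)" if "y : U - A" for y by (rule smooth_on_imp_differentiable[OF sm that])
 show "F differentiable (at y)" if y: "y : U - A" for y
  using dF[OF y] differentiable_cong[OF openUA y F] by simp
 show "flat_on B V (%v. der i a v * jac \<pi> v - real m * (a v * der i (jac \<pi>) v))"
  by (intro flat_on_diff[OF V BV] flat_on_mult2[OF V BV, of "%_. real m"] flat_on_mult[OF V BV] flat_der a smooth_jac smooth_der smooth_on_const)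
 fix y assume y: "y : U - A"
 let ?l = "%t. y + t *\<^sub>R axis i 1" and ?j = "jac \<pi> (g y)"
 have l0: "?l 0 = y" by simp
 have "((%t. a (g (?l t))) has_real_derivative partial i (%x. a (g x)) (?l 0)) (at 0)"
  by (rule has_real_derivative_axis) (use partial_compose_g(2)[OF sa y] in simp)
 then have P: "((%t. a (g (?l t))) has_real_derivative der i a (g y) / ?j) (at 0)"
  unfolding l0 partial_compose_g(1)[OF sa y] .
 have "((%t. jac \<pi> (g (?l t))) has_real_derivative partial i (%x. jac \<pi> (g x)) (?l 0)) (at 0)"
  by (rule has_real_derivative_axis) (use partial_compose_g(2)[OF smooth_jac y] in simp)
 then have Q: "((%t. jac \<pi> (g (?l t))) has_real_derivative der i (jac \<pi>) (g y) / ?j) (at 0)"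
  unfolding l0 partial_compose_g(1)[OF smooth_jac y] .
 have Qm: "((%t. jac \<pi> (g (?l t)) ^ m) has_real_derivative real m * ?j ^ (m - 1) * (der i (jac \<pi>) (g y) / ?j)) (at 0)"
  using DERIV_power[OF Q, of m] by (simp add: mult_ac)
 have "((%t. ?F (?l t)) has_real_derivative
   (der i a (g y) / ?j * ?j ^ m - a (g y) * (real m * ?j ^ (m - 1) * (der i (jac \<pi>) (g y) / ?j))) / (?j ^ m * ?j ^ m)) (at 0)"
  using DERIV_divide[OF P Qm] jac_nonzero[OF y] by simp
 moreover have "((%t. ?F (?l t)) has_real_derivative partial i ?F (?l 0)) (at 0)"
  by (rule has_real_derivative_axis) (use dF[OF y] in simp)
 ultimately have "partial i ?F y = (der i a (g y) / ?j * ?j ^ m - a (g y) * (real m * ?j ^ (m - 1) * (der i (jac \<pi>) (g y) / ?j))) / (?j ^ m * ?j ^ m)"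
  unfolding l0 by (rule DERIV_unique[symmetric])
 also have "\<dots> = (der i a (g y) * ?j - real m * a (g y) * der i (jac \<pi>) (g y)) / ?j ^ (m + 2)"
  by (rule quotient_derivative_identity[OF jac_nonzero[OF y]])
 finally show "partial i F y = (der i a (g y) * ?j - real m * (a (g y) * der i (jac \<pi>) (g y))) / ?j ^ (m + 2)"
  using partial_cong[OF openUA y F, where i = i] by (simp add: mult.assoc)
qed

text \<open>Closedness of the map turns a neighbourhood of \<open>B\<close> into one of
  \<open>A\<close> whose preimage it contains.\<close>

lemma image_open:
 assumes "open O'" "B <= O'"
 shows "open (U - \<pi> ` (V - O'))" "A <= U - \<pi> ` (V - O')"
proof -
 have "closedin (top_of_set V) (V - O')" using assms(1) by (simp add: closedin_closed_eq[symmetric] Diff_eq closedin_closed_Int closed_Compl)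
 then have "closedin (top_of_set U) (\<pi> ` (V - O'))" using closed_map unfolding closed_map_def by simp
 then obtain C where C: "closed C" "\<pi> ` (V - O') = U Int C" unfolding closedin_closed by auto
 have "U - \<pi> ` (V - O') = U - C" using C(2) by auto
 then show "open (U - \<pi> ` (V - O'))" using U C(1) by (simp add: open_Diff)
 show "A <= U - \<pi> ` (V - O')" using A_subset assms(2) by auto
qed

lemma quot_small:
 assumes F: "quot F" and x: "x : A" and e: "e > 0"
 shows "eventually (%y. \<bar>F y\<bar> < e) (nhds x)"
proof -
 obtain a m where a: "flat_on B V a" "!!y. y : U - A ==> F y = a (g y) / jac \<pi> (g y) ^ m" and FA: "!!x. x : A ==> F x = 0"
  by (rule quotE[OF F]) (rule that)
 have "EX r>0. ALL v:ball p r. jac \<pi> v ~= 0 --> \<bar>a v / jac \<pi> v ^ m\<bar> < e" if p: "p : B" for p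
 proof -
  have pV: "p : V" "\<pi> p : A" using p by simp_all
  obtain N C where NC: "C > 0" "ALL e>0. EX r>0. ALL v:ball p r. EX b:B. dist v b < e & dist v b ^ N <= C * \<bar>jac \<pi> v\<bar>" using loj[OF pV] by (elim exE conjE)
  show ?thesis by (rule flat_quotient_small[where N = N, OF V pV(1) a(1) NC(1) _ e]) (use NC(2) in simp)
 qed
 then have "ALL p:B. EX r. r > 0 & (ALL v:ball p r. jac \<pi> v ~= 0 --> \<bar>a v / jac \<pi> v ^ m\<bar> < e)" by simp
 from bchoice[OF this] obtain r where r: "ALL p:B. r p > 0 & (ALL v:ball p (r p). jac \<pi> v ~= 0 --> \<bar>a v / jac \<pi> v ^ m\<bar> < e)" ..
 define O' where "O' = (UN p:B. ball p (r p))"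
 have O: "open O'" "B <= O'" unfolding O'_def using r by (auto intro!: open_UN) 
 note N = image_open[OF O]
 have "\<bar>F y\<bar> < e" if y: "y : U - \<pi> ` (V - O')" for y
 proof (cases "y : A")
  case False
  then have yU: "y : U - A" using y by simp
  have "g y : O'" using y g(2,3)[OF yU] by (metis DiffD2 DiffI imageI)
  then obtain p where p: "p : B" "g y : ball p (r p)" unfolding O'_def by (rule UN_E)
  show ?thesis unfolding a(2)[OF yU] using bspec[OF r p(1)] p(2) jac_nonzero[OF yU] by simp
 qed (use FA e in simp)
 then show ?thesis unfolding eventually_nhds using N x by (intro exI[of _ "U - \<pi> ` (V - O')"]) auto
qed

text \<open>Off \<open>A\<close> this is the quotient rule. On \<open>A\<close> the derivative is 0:
  the partial derivatives off \<open>A\<close> are quotients of the same class, hence small, and the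
  mean value theorem bounds \<open>F\<close> by them.\<close>

lemma quot_differentiable:
 assumes F: "quot F"
 shows "quot (partial i F)" "!!x. x : U ==> F differentiable (at x)"
proof -
 obtain a m where a: "flat_on B V a" "!!y. y : U - A ==> F y = a (g y) / jac \<pi> (g y) ^ m" and FA: "!!x. x : A ==> F x = 0"
  by (rule quotE[OF F]) (rule that)
 have "ALL y:U - A. F y = a (g y) / jac \<pi> (g y) ^ m" using a(2) by simp
 note off = quot_partial_off[OF a(1) this]
 \<comment> \<open>The candidate derivative, extended by 0; being in the class it is small near
   \<open>A\<close> before differentiability there is known.\<close>
 define G where "G i y = (if y : A then 0 else partial i F y)" for i y
 have G: "quot (G i)" for i
  unfolding quot_def
 proof (intro conjI exI ballI)
  show "flat_on B V (%v. der i a v * jac \<pi> v - real m * (a v * der i (jac \<pi>) v))" by (rule off(2))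
  show "G i y = (der i a (g y) * jac \<pi> (g y) - real m * (a (g y) * der i (jac \<pi>) (g y))) / jac \<pi> (g y) ^ (m + 2)" if "y : U - A" for y
   using off(3)[OF that] that by (simp add: G_def)
 qed (simp add: G_def)
 have cont: "continuous_on U F"
  unfolding continuous_on_eq_continuous_at[OF U]
 proof
  fix x assume x: "x : U"
  show "isCont F x"
  proof (cases "x : A")
   case True
   have "(F \<longlongrightarrow> F x) (nhds x)"
    unfolding tendsto_iff FA[OF True] using quot_small[OF F True] by simp
   then show ?thesis by (simp add: isCont_def tendsto_at_iff_tendsto_nhds)
  next
   case False
   then show ?thesis using off(1)[of x] x by (intro differentiable_imp_continuous_within) simp
  qed
 qed
 have hd: "(F has_derivative (%_. 0)) (at x)" if x: "x : A" for x
  unfolding has_derivative_at_alt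
 proof (intro conjI allI impI bounded_linear_zero)
  fix e :: real assume e: "e > 0"
  define e' where "e' = e / real CARD('n)"
  have e': "e' > 0" using e by (simp add: e'_def)
  have "eventually (%y. ALL i. \<bar>G i y\<bar> < e') (nhds x)"
   by (intro eventually_all_finite quot_small[OF G x e'])
  moreover have "eventually (%y. y : U) (nhds x)" using U x A_subset by (intro eventually_nhds_in_open) auto
  ultimately have "eventually (%y. (ALL i. \<bar>G i y\<bar> < e') & y : U) (nhds x)" by (rule eventually_conj)
  then obtain d where d: "d > 0" "ALL y. dist y x < d --> (ALL i. \<bar>G i y\<bar> < e') & y : U" unfolding eventually_nhds_metric by (elim exE conjE)
  have "norm (F y - F x - 0) <= e * norm (y - x)" if y: "norm (y - x) < d" for y
  proof -
   obtain C where C: "closed C" "A = U Int C" using A unfolding closedin_closed by auto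
   have seg: "closed_segment x y <= ball x d" using y d(1) by (intro closed_segment_subset) (simp_all add: dist_norm norm_minus_commute)
   have sd: "(ALL i. \<bar>G i w\<bar> < e') & w : U" if "w : closed_segment x y" for w
    using d(2) subsetD[OF seg that] by (simp add: dist_commute)
   have "compact (closed_segment x y Int C)" by (rule compact_Int_closed[OF compact_segment C(1)])
   moreover have "closed_segment x y Int C ~= {}" using x C(2) by auto
   moreover have "continuous_on (closed_segment x y Int C) (dist y)" by (intro continuous_intros)
   \<comment> \<open>The point of \<open>A\<close> on the segment closest to \<open>y\<close>.
     Beyond it the segment avoids \<open>A\<close>, so the partial derivatives are controlled there,
     and \<open>F\<close> is 0 at \<open>z\<close> itself.\<close>
   ultimately obtain z where z: "z : closed_segment x y Int C" "ALL w:closed_segment x y Int C. dist y z <= dist y w"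
    using continuous_attains_inf by blast
   have zA: "z : A" using z(1) sd[of z] C(2) by simp
   have sub: "closed_segment z y <= closed_segment x y" using z(1) by (intro closed_segment_subset) auto
   have off_w: "w : U - A" "\<bar>partial i F w\<bar> <= e'" if w: "w : open_segment z y" for w i
   proof -
    have wx: "w : closed_segment x y" using w sub by (auto simp: open_segment_def)
    have "dist y w < dist y z" using dist_in_open_segment[OF w] by (simp add: dist_commute)
    then have "w ~: C" using z(2) wx by force
    then show wU: "w : U - A" using sd[OF wx] C(2) by simp
    show "\<bar>partial i F w\<bar> <= e'" using sd[OF wx] wU by (simp add: G_def less_imp_le)
   qed
   have "\<bar>F y - F z\<bar> <= (SUM i:(UNIV::'n set). e') * norm (y - z)"
   proof (rule partial_segment_bound)
    show "continuous_on (closed_segment z y) F" by (rule continuous_on_subset[OF cont]) (use sub sd in auto)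
    show "F differentiable (at w)" if "w : open_segment z y" for w by (rule off(1)[OF off_w(1)[OF that]])
    show "\<bar>partial i F w\<bar> <= e'" if "w : open_segment z y" for w i by (rule off_w(2)[OF that])
   qed
   also have "\<dots> = e * norm (y - z)" by (simp add: e'_def)
   also have "\<dots> <= e * norm (y - x)"
    using dist_in_closed_segment[of z x y] z(1) e by (intro mult_left_mono) (simp_all add: dist_norm norm_minus_commute)
   finally show ?thesis using FA[OF zA] FA[OF x] by simp
  qed
  then show "EX d>0. ALL y. norm (y - x) < d --> norm (F y - F x - 0) <= e * norm (y - x)" using d(1) by (intro exI[of _ d]) simp
 qed
 show "F differentiable (at x)" if "x : U" for x
 proof (cases "x : A")
  case True then show ?thesis using hd unfolding differentiable_def by (intro exI)
 next
  case False then show ?thesis using off(1) that by simp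
 qed
 have "partial i F = G i"
 proof
  fix x show "partial i F x = G i x" using partial_eqI[OF hd, of x i] by (cases "x : A") (simp_all add: G_def)
 qed
 then show "quot (partial i F)" using G[of i] by simp
qed

lemma quot_flat:
 assumes "quot F"
 shows "flat_on A U F"
proof -
 have q: "quot (iter_partial js F)" for js by (induction js) (simp_all add: assms quot_differentiable(1))
 then have "iter_partial js F x = 0" if "x : A" for js x using q[of js] that unfolding quot_def by simp
 moreover have "iter_partial js F differentiable (at x)" if "x : U" for js x by (rule quot_differentiable(2)[OF q that])
 ultimately show ?thesis by (simp add: flat_on_def smooth_on_def)
qed

definition push :: "(real^'n => 'n list => real) => real^'n => 'n list => real" where
 "push ew x is = (if x : U - A then pull (U - A) g ew x is else 0)"

text \<open>Each first derivative of \<open>g\<close> is a cofactor over the Jacobian, so a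
  coefficient in degree \<open>k\<close> is a flat numerator over the \<open>k\<close>-th power of
  the Jacobian.\<close>

lemma flat_push:
 assumes ew: "!!is. flat_on B V (%x. ew x is)"
 shows "flat_on A U (%x. push ew x is)"
proof (rule quot_flat, unfold quot_def, intro conjI exI ballI)
 show "push ew x is = 0" if "x : A" for x using that by (simp add: push_def)
 have sm: "smooth_on V (%v. prod_list (map2 (%i j. cof i j v) is js))" for js
 proof -
  have "smooth_on V (%v. prod_list (map (%p. cof (fst p) (snd p) v) (zip is js)))"
   by (rule smooth_on_prod_list[OF V]) (rule smooth_cof)
  then show ?thesis by (simp add: case_prod_unfold)
 qed
 show "flat_on B V (%v. SUM js | length js = length is. ew v js * prod_list (map2 (%i j. cof i j v) is js))"
  by (intro flat_on_sum[OF V BV] flat_on_mult[OF V BV] ew sm)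
 fix y assume y: "y : U - A"
 have "push ew y is = (SUM js | length js = length is. ew (g y) js * prod_list (map2 (%i j. cof i j (g y) / jac \<pi> (g y)) is js))"
  using y by (simp add: push_def pull_def partial_g[OF y])
 also have "\<dots> = (SUM js | length js = length is. ew (g y) js * prod_list (map2 (%i j. cof i j (g y)) is js) / jac \<pi> (g y) ^ length is)"
  by (intro sum.cong refl) (simp add: prod_list_quotient)
 finally show "push ew y is = (SUM js | length js = length is. ew (g y) js * prod_list (map2 (%i j. cof i j (g y)) is js)) / jac \<pi> (g y) ^ length is"
  by (simp add: sum_divide_distrib)
qed

lemma form_on_push:
 assumes ew: "!!is. flat_on B V (%x. ew x is)" and f: "form_on V k ew"
 shows "form_on U k (push ew)"
proof -
 have gs: "g ` (U - A) <= V" using g(2) by auto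
 note fp = form_on_pull[OF openUA V gs g(1) f]
 show ?thesis
  unfolding form_on_def
 proof (intro conjI allI impI)
  show "push ew x is = 0" if "x ~: U \<or> length is ~= k" for x "is"
   using that form_onD(2)[OF fp, of "is" x] by (auto simp: push_def)
  show "alternating (push ew x)" for x
  proof (cases "x : U - A")
   case True
   then have "push ew x = pull (U - A) g ew x" by (simp add: push_def fun_eq_iff)
   then show ?thesis using form_onD(3)[OF fp] by simp
  next
   case False
   then have "push ew x = (%_. 0)" unfolding push_def fun_eq_iff by auto
   then show ?thesis by (simp add: alternating_def)
  qed
  show "smooth_on U (%x. push ew x is)" for "is" by (rule flat_on_imp_smooth[OF flat_push[OF ew]])
 qed
qed

lemma prev_form_push:
 assumes ew: "!!is. flat_on B V (%x. ew x is)" and f: "prev_form V k ew"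
 shows "prev_form U k (push ew)"
proof (cases "k = 0")
 case True
 then have "ew = (%_ _. 0)" using f by (simp add: prev_form_def)
 then have "push ew = (%_ _. 0)" by (simp add: push_def pull_def fun_eq_iff)
 then show ?thesis using True by (simp add: prev_form_def)
next
 case False
 then show ?thesis using form_on_push[OF ew] f by (simp add: prev_form_def)
qed

lemma ext_d_push:
 assumes f: "form_on V k ew" and x: "x : U - A"
 shows "ext_d U (push ew) x is = pull (U - A) g (ext_d V ew) x is"
proof -
 have gs: "g ` (U - A) <= V" using g(2) by auto
 have "ext_d U (push ew) x is = ext_d (U - A) (pull (U - A) g ew) x is"
  by (rule ext_d_cong[OF openUA x]) (auto simp: push_def)
 then show ?thesis by (simp add: ext_d_pull[OF openUA V gs g(1) f])
qed

lemma pull_pull_g: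
 assumes x: "x : U - A"
 shows "pull (U - A) g (pull V \<pi> om) x is = om x is"
proof -
 have gs: "g ` (U - A) <= V" using g(2) by auto
 have "pull (U - A) g (pull V \<pi> om) x is = pull (U - A) (%x. \<pi> (g x)) om x is"
  by (simp only: pull_pull[OF gs g(1) \<pi>(1)])
 also have "\<dots> = pull (U - A) (%x. x) om x is"
  by (rule pull_cong[OF openUA x]) (use g(3) in simp_all)
 finally show ?thesis by (simp only: pull_id[OF x])
qed

end


subsection \<open>Acyclicity of the flat forms\<close>

lemma flat_on_vanishing_near:
 assumes f: "smooth_on U f" and N: "open N" "A <= N" and z: "!!x. x : N ==> f x = 0"
 shows "flat_on A U f"
proof -
 have "flat_on N N f" using flat_on_cong[OF N(1) subset_refl z, of "%x. x"] flat_on_cong[OF N(1) subset_refl, of f "%_. 0"] z by simp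
 then have "iter_partial js f x = 0" if "x : A" for js x using that N(2) unfolding flat_on_def by auto
 then show ?thesis using f by (simp add: flat_on_def)
qed

lemma prev_form_as_form: "prev_form U k ew ==> form_on U (k - 1) ew"
 by (cases "k = 0") (simp_all add: prev_form_def)

lemma prev_form_diff:
 assumes "open U" "prev_form U k ew" "prev_form U k xi"
 shows "prev_form U k (%x is. ew x is - xi x is)" "ext_d U (%x is. ew x is - xi x is) = (%x is. ext_d U ew x is - ext_d U xi x is)"
proof -
 show "prev_form U k (%x is. ew x is - xi x is)"
  using assms by (cases "k = 0") (simp_all add: prev_form_def form_on_diff)
 show "ext_d U (%x is. ew x is - xi x is) = (%x is. ext_d U ew x is - ext_d U xi x is)"
  by (rule ext_d_diff[OF prev_form_as_form[OF assms(2)] prev_form_as_form[OF assms(3)]])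
qed

lemma prev_form_add:
 assumes "open U" "prev_form U k ew" "prev_form U k xi"
 shows "prev_form U k (%x is. ew x is + xi x is)" "ext_d U (%x is. ew x is + xi x is) = (%x is. ext_d U ew x is + ext_d U xi x is)"
proof -
 show "prev_form U k (%x is. ew x is + xi x is)"
  using assms by (cases "k = 0") (simp_all add: prev_form_def form_on_add)
 show "ext_d U (%x is. ew x is + xi x is) = (%x is. ext_d U ew x is + ext_d U xi x is)"
  by (rule ext_d_add[OF prev_form_as_form[OF assms(2)] prev_form_as_form[OF assms(3)]])
qed

lemma prev_form_zero: "prev_form U k (%_ _. 0)"
 by (simp add: prev_form_def)

lemma (in blow_down) flat_acyclic:
 assumes dr: "deformation_retract_of A U"
  and ch: "!!p. p : V ==> EX W ph py S. p : W & quadrant_chart V B W ph py S"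
  and om: "flat_form A U k om" "ext_d U om = (%_ _. 0)"
 shows "EX ew. prev_form U k ew & (ALL is. flat_on A U (%x. ew x is)) & ext_d U ew = om"
proof -
 have fom: "form_on U k om" and fl: "!!is. flat_on A U (%x. om x is)" using om(1) by (simp_all add: flat_form_def)
 obtain C where C: "closed C" "A = U Int C" using A unfolding closedin_closed by auto
 have "B = V Int \<pi> -` C" using \<pi>(2) C(2) by auto
 then have cB: "closedin (top_of_set V) B"
  using continuous_closedin_preimage[OF smooth_map_on_imp_continuous_on[OF \<pi>(1)] C(1)] by simp
 let ?om1 = "pull V \<pi> om"
 have pom: "flat_form B V k ?om1"
  by (rule flat_form_pull[OF V BV U A_subset _ _ \<pi>(1) om(1)]) (use \<pi>(2) in auto)
 have "ext_d V ?om1 = pull V \<pi> (ext_d U om)" by (rule ext_d_pull[OF V U _ \<pi>(1) fom]) (use \<pi>(2) in auto)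
 then have dom: "ext_d V ?om1 = (%_ _. 0)" by (simp add: om(2) pull_def fun_eq_iff)
 obtain ew where ew: "prev_form V k ew" "!!is. flat_on B V (%x. ew x is)"
  "!!b. b : B ==> zero_germ (%x is. ?om1 x is + ext_d V ew x is) b"
  by (rule flat_cocycle_vanishing_near[OF V cB ch pom dom]) (assumption | rule that)+
 define O' where "O' = \<Union>{M. open M & (ALL x:M. ALL is. ?om1 x is + ext_d V ew x is = 0)}"
 have O: "open O'" unfolding O'_def by (rule open_Union) simp
 have Oz: "?om1 x is + ext_d V ew x is = 0" if "x : O'" for x "is" using that unfolding O'_def by (elim UnionE) simp
 have BO: "B <= O'"
 proof
  fix b assume b: "b : B"
  obtain M where "open M" "b : M" "ALL x:M. ALL is. ?om1 x is + ext_d V ew x is = 0"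
   using ew(3)[OF b] unfolding zero_germ_def by (elim exE conjE)
  then show "b : O'" unfolding O'_def by (intro UnionI[of M]) simp_all
 qed
 define N where "N = U - \<pi> ` (V - O')"
 have N: "open N" "A <= N" "N <= U" using image_open[OF O BO] by (auto simp: N_def)
 have pp: "prev_form U k (push ew)" by (rule prev_form_push[OF ew(2,1)])
 note dp = prev_form_ext_d[OF U pp]
 define Om where "Om = (%x is. om x is + ext_d U (push ew) x is)"
 have fOm: "form_on U k Om" unfolding Om_def by (rule form_on_add[OF U fom dp(1)])
 have dOm: "ext_d U Om = (%_ _. 0)" unfolding Om_def ext_d_add[OF fom dp(1)] by (simp add: om(2) dp(2))
 \<comment> \<open>On \<open>A\<close> both summands vanish by flatness. Off \<open>A\<close> the
   form is the pullback by \<open>g\<close> of \<open>?om1 + ext_d V ew\<close>, and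
   \<open>g x\<close> lies in \<open>O'\<close>, where that sum is 0.\<close>
 have zOm: "Om x is = 0" if x: "x : N" for x "is"
 proof (cases "x : A")
  case True
  have "partial i (%y. push ew y js) x = 0" for i js
   by (rule flat_on_imp_zero[OF flat_on_partial[OF flat_push[OF ew(2)]] True])
  then have "ext_d U (push ew) x is = 0" by (simp add: ext_d_def)
  then show ?thesis using flat_on_imp_zero[OF fl True] by (simp add: Om_def)
 next
  case False
  then have xU: "x : U - A" using x N(3) by auto
  have "g x : O'"
  proof (rule ccontr)
   assume "g x ~: O'"
   then have "\<pi> (g x) : \<pi> ` (V - O')" using g(2)[OF xU] by (intro imageI) simp
   then show False using x g(3)[OF xU] by (simp add: N_def)
  qed
  note z = Oz[OF this]
  have "Om x is = pull (U - A) g ?om1 x is + pull (U - A) g (ext_d V ew) x is"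
   by (simp add: Om_def pull_pull_g[OF xU] ext_d_push[OF prev_form_as_form[OF ew(1)] xU])
  also have "\<dots> = (SUM js | length js = length is. (?om1 (g x) js + ext_d V ew (g x) js) * prod_list (map2 (%i j. partial i (%y. g y $ j) x) is js))"
   using xU unfolding pull_def[of "U - A"] by (simp add: sum.distrib distrib_right)
  also have "\<dots> = 0" by (simp add: z)
  finally show ?thesis .
 qed
 obtain ew2 N1 where ew2: "prev_form U k ew2" "ext_d U ew2 = Om" "open N1" "A <= N1" "!!x is. x : N1 ==> ew2 x is = 0"
  by (rule vanishing_near_exact[OF U A dr fOm dOm N zOm]) (assumption | rule that)+
 have fl2: "flat_on A U (%x. ew2 x is)" for "is"
  by (rule flat_on_vanishing_near[OF form_onD(4)[OF prev_form_as_form[OF ew2(1)]] ew2(3,4)]) (rule ew2(5))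
 show ?thesis
 proof (intro exI conjI allI)
  show "prev_form U k (%x is. ew2 x is - push ew x is)" by (rule prev_form_diff(1)[OF U ew2(1) pp])
  show "flat_on A U (%x. ew2 x is - push ew x is)" for "is"
   by (rule flat_on_diff[OF U A_subset fl2 flat_push[OF ew(2)]])
  show "ext_d U (%x is. ew2 x is - push ew x is) = om"
   unfolding prev_form_diff(2)[OF U ew2(1) pp] ew2(2) by (simp add: Om_def)
 qed
qed

lemma flat_form_add: "open U ==> A <= U ==> flat_form A U k om ==> flat_form A U k ew ==> flat_form A U k (%x is. om x is + ew x is)"
 and flat_form_diff: "open U ==> A <= U ==> flat_form A U k om ==> flat_form A U k ew ==> flat_form A U k (%x is. om x is - ew x is)"
 and flat_form_zero: "flat_form A U k (%_ _. 0)"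
 by (simp_all add: flat_form_def form_on_add form_on_diff flat_on_add flat_on_diff)

text \<open>The flat forms are the kernel of the quotient map; this is the argument of the long
  exact sequence, carried out on representatives.\<close>

lemma quasi_iso_of_acyclic:
 assumes U: "open U" and A: "A <= U"
  and ac: "!!k om. flat_form A U k om ==> ext_d U om = (%_ _. 0) ==>
   EX ew. prev_form U k ew & (ALL is. flat_on A U (%x. ew x is)) & ext_d U ew = om"
 shows "J_quasi_iso A U"
 unfolding J_quasi_iso_def
proof
 fix k
 define Z where "Z = cocycles_dR U k"
 define Z' where "Z' = cocycles_W A U k"
 define R where "R = cohom_rel_dR U k"
 define R' where "R' = cohom_rel_W A U k"
 note zero = flat_form_zero[of A U]
 have R'I: "(om, om') : R'" if "om : Z'" "om' : Z'" "prev_form U k ew" "flat_form A U k (%x is. om x is - om' x is - ext_d U ew x is)" for om om' ew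
  using that unfolding R'_def cohom_rel_W_def Z'_def by auto
 have R'E: "om : Z' & om' : Z' & (EX ew. prev_form U k ew & flat_form A U k (%x is. om x is - om' x is - ext_d U ew x is))" if "(om, om') : R'" for om om'
  using that unfolding R'_def cohom_rel_W_def Z'_def by simp
 have refl': "(om, om) : R'" if "om : Z'" for om
  by (rule R'I[OF that that prev_form_zero]) (simp add: zero)
 have sym': "(om', om) : R'" if r: "(om, om') : R'" for om om'
 proof -
  obtain ew where ew: "prev_form U k ew" "flat_form A U k (%x is. om x is - om' x is - ext_d U ew x is)" using R'E[OF r] by (elim conjE exE)
  note d = prev_form_diff[OF U prev_form_zero ew(1)]
  have "flat_form A U k (%x is. 0 - (om x is - om' x is - ext_d U ew x is))" by (rule flat_form_diff[OF U A zero ew(2)])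
  then have "flat_form A U k (%x is. om' x is - om x is - ext_d U (%x is. 0 - ew x is) x is)"
   unfolding d(2) by (simp add: algebra_simps)
  then show ?thesis using R'E[OF r] by (intro R'I[OF _ _ d(1)]) simp_all
 qed
 have trans': "(om, om'') : R'" if r: "(om, om') : R'" and r': "(om', om'') : R'" for om om' om''
 proof -
  obtain ew where ew: "prev_form U k ew" "flat_form A U k (%x is. om x is - om' x is - ext_d U ew x is)" using R'E[OF r] by (elim conjE exE)
  obtain xi where xi: "prev_form U k xi" "flat_form A U k (%x is. om' x is - om'' x is - ext_d U xi x is)" using R'E[OF r'] by (elim conjE exE)
  note d = prev_form_add[OF U ew(1) xi(1)]
  have "flat_form A U k (%x is. (om x is - om' x is - ext_d U ew x is) + (om' x is - om'' x is - ext_d U xi x is))" by (rule flat_form_add[OF U A ew(2) xi(2)])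
  then have "flat_form A U k (%x is. om x is - om'' x is - ext_d U (%x is. ew x is + xi x is) x is)"
   unfolding d(2) by (simp add: algebra_simps)
  then show ?thesis using R'E[OF r] R'E[OF r'] by (intro R'I[OF _ _ d(1)]) simp_all
 qed
 have ZZ': "om : Z'" if "om : Z" for om
  using that zero by (simp add: Z_def Z'_def cocycles_dR_def cocycles_W_def)
 \<comment> \<open>For two de Rham cocycles, the flat part of a Whitney relation is itself closed
   and so has a primitive, which completes the relation to a de Rham one.\<close>
 have RR': "(om, om') : R \<longleftrightarrow> (om, om') : R'" if z: "om : Z" "om' : Z" for om om'
 proof
  assume "(om, om') : R"
  then obtain ew where ew: "prev_form U k ew" "(%x is. om x is - om' x is) = ext_d U ew" unfolding R_def cohom_rel_dR_def by auto
  have "om x is - om' x is - ext_d U ew x is = 0" for x "is" unfolding ew(2)[symmetric] by simp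
  then show "(om, om') : R'" using zero by (intro R'I[OF ZZ'[OF z(1)] ZZ'[OF z(2)] ew(1)]) simp
 next
  assume r: "(om, om') : R'"
  obtain ew where ew: "prev_form U k ew" "flat_form A U k (%x is. om x is - om' x is - ext_d U ew x is)" using R'E[OF r] by (elim conjE exE)
  have f: "form_on U k om" "form_on U k om'" "ext_d U om = (%_ _. 0)" "ext_d U om' = (%_ _. 0)"
   using z by (simp_all add: Z_def cocycles_dR_def)
  note de = prev_form_ext_d[OF U ew(1)]
  have "ext_d U (%x is. om x is - om' x is - ext_d U ew x is) = (%_ _. 0)"
   unfolding ext_d_diff[OF form_on_diff[OF U f(1,2)] de(1)] ext_d_diff[OF f(1,2)] by (simp add: f(3,4) de(2))
  from ac[OF ew(2) this] obtain xi where xi: "prev_form U k xi" "ext_d U xi = (%x is. om x is - om' x is - ext_d U ew x is)" by (elim exE conjE)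
  note d = prev_form_add[OF U ew(1) xi(1)]
  have "(%x is. om x is - om' x is) = ext_d U (%x is. ew x is + xi x is)" unfolding d(2) xi(2) by simp
  then show "(om, om') : R" using z d(1) unfolding R_def cohom_rel_dR_def Z_def by auto
 qed
 have RZ: "om : Z & om' : Z" if "(om, om') : R" for om om'
  using that unfolding R_def cohom_rel_dR_def Z_def by simp
 \<comment> \<open>A de Rham class is the trace on \<open>Z\<close> of the larger Whitney class, so
   equal images force equal classes.\<close>
 have cls: "R `` {om} = R' `` {om} Int Z" if z: "om : Z" for om
 proof (intro set_eqI iffI)
  fix x assume "x : R `` {om}"
  then have r: "(om, x) : R" by simp
  then show "x : R' `` {om} Int Z" using RR'[OF z, of x] RZ[OF r] by simp
 next
  fix x assume "x : R' `` {om} Int Z"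
  then show "x : R `` {om}" using RR'[OF z, of x] by simp
 qed
 have img: "cohom_J A U k (R `` {om}) = R' `` {om}" if z: "om : Z" for om
  unfolding cohom_J_def R'_def[symmetric]
 proof (intro set_eqI iffI)
  fix x assume "x : R' `` (R `` {om})"
  then obtain y where y: "y : R `` {om}" "(y, x) : R'" by (rule ImageE)
  have "(om, y) : R'" using y(1) unfolding cls[OF z] by simp
  from trans'[OF this y(2)] show "x : R' `` {om}" by simp
 next
  fix x assume "x : R' `` {om}"
  moreover have "om : R `` {om}" unfolding cls[OF z] using refl'[OF ZZ'[OF z]] z by simp
  ultimately show "x : R' `` (R `` {om})" by auto
 qed
 \<comment> \<open>The defect \<open>ext_d U om\<close> is flat and closed; subtracting a flat
   primitive of it leaves a genuine cocycle in the same class.\<close>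
 have surj: "EX om0:Z. R' `` {om0} = R' `` {om}" if z: "om : Z'" for om
 proof -
  have f: "form_on U k om" "flat_form A U (Suc k) (ext_d U om)" using z by (simp_all add: Z'_def cocycles_W_def)
  from ac[OF f(2) ext_d_ext_d[OF U f(1)]] obtain xi where xi: "prev_form U (Suc k) xi" "ALL is. flat_on A U (%x. xi x is)" "ext_d U xi = ext_d U om" by (elim exE conjE)
  have fxi: "form_on U k xi" using xi(1) by (simp add: prev_form_def)
  have flxi: "flat_form A U k xi" using fxi xi(2) by (simp add: flat_form_def)
  define om0 where "om0 = (%x is. om x is - xi x is)"
  have z0: "om0 : Z" unfolding Z_def cocycles_dR_def mem_Collect_eq om0_def ext_d_diff[OF f(1) fxi]
   by (simp add: form_on_diff[OF U f(1) fxi] xi(3))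
  have r: "(om, om0) : R'"
   by (rule R'I[OF z ZZ'[OF z0] prev_form_zero]) (simp add: om0_def flxi)
  have "R' `` {om0} = R' `` {om}"
  proof (intro set_eqI iffI)
   fix x assume "x : R' `` {om0}"
   then show "x : R' `` {om}" using trans'[OF r, of x] by simp
  next
   fix x assume "x : R' `` {om}"
   then show "x : R' `` {om0}" using trans'[OF sym'[OF r], of x] by simp
  qed
  then show ?thesis using z0 by (rule bexI)
 qed
 show "bij_betw (cohom_J A U k) (cohom_dR U k) (cohom_W A U k)"
  unfolding bij_betw_def cohom_dR_def cohom_W_def Z_def[symmetric] Z'_def[symmetric] R_def[symmetric] R'_def[symmetric]
 proof
  show "inj_on (cohom_J A U k) (Z // R)"
  proof (rule inj_onI)
   fix X Y assume X: "X : Z // R" and Y: "Y : Z // R" and e: "cohom_J A U k X = cohom_J A U k Y"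
   obtain om where om: "X = R `` {om}" "om : Z" using X by (rule quotientE)
   obtain om' where om': "Y = R `` {om'}" "om' : Z" using Y by (rule quotientE)
   have "R' `` {om} = R' `` {om'}" using e unfolding om(1) om'(1) img[OF om(2)] img[OF om'(2)] .
   then show "X = Y" unfolding om(1) om'(1) cls[OF om(2)] cls[OF om'(2)] by simp
  qed
  show "cohom_J A U k ` (Z // R) = Z' // R'"
  proof (intro set_eqI iffI)
   fix X assume "X : cohom_J A U k ` (Z // R)"
   then obtain Y where Y: "X = cohom_J A U k Y" "Y : Z // R" by (rule imageE)
   obtain om where om: "Y = R `` {om}" "om : Z" using Y(2) by (rule quotientE)
   show "X : Z' // R'" unfolding Y(1) om(1) img[OF om(2)] by (rule quotientI[OF ZZ'[OF om(2)]])
  next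
   fix X assume "X : Z' // R'"
   then obtain om where om: "X = R' `` {om}" "om : Z'" by (rule quotientE)
   obtain om0 where om0: "om0 : Z" "R' `` {om0} = R' `` {om}" using surj[OF om(2)] by (rule bexE)
   have "X = cohom_J A U k (R `` {om0})" unfolding img[OF om0(1)] om(1) om0(2) ..
   then show "X : cohom_J A U k ` (Z // R)" using quotientI[OF om0(1), of R] by (rule image_eqI)
  qed
 qed
qed

section \<open>Assembly: the geometric hypotheses provide a \<open>blow_down\<close>\<close>

lemma real_analytic_map_imp_smooth: "real_analytic_map_on W f ==> smooth_map_on W f"
 unfolding real_analytic_map_on_def by (intro allI real_analytic_on_imp_smooth_on) (erule spec)

theorem mainTheorem10:
  fixes U V A :: "(real^'n::finite) set" and \<pi> :: "real^'n \<Rightarrow> real^'n"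
  assumes "open U" and "open V"
    and "closedin (top_of_set U) A" and "semi_analytic_in U A"
    and "deformation_retract_of A U"
    and "real_analytic_map_on V \<pi>" and "proper_map (top_of_set V) (top_of_set U) \<pi>"
    and "\<pi> ` V = U"
    and "locally_union_of_quadrants V {v\<in>V. \<pi> v \<in> A}"
    and "deformation_retract_of {v\<in>V. \<pi> v \<in> A} V"
    and "real_analytic_iso (V - {v\<in>V. \<pi> v \<in> A}) (U - A) \<pi>"
  shows "J_quasi_iso A U"
proof -
 let ?B = "{v:V. \<pi> v : A}"
 note U = assms(1) and V = assms(2)
 obtain g where g: "real_analytic_map_on (U - A) g" "g ` (U - A) = V - ?B" "ALL x:V - ?B. g (\<pi> x) = x" "ALL y:U - A. \<pi> (g y) = y"
  using assms(11) unfolding real_analytic_iso_def by (elim conjE exE)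
 have s\<pi>: "smooth_map_on V \<pi>"
  by (rule real_analytic_map_imp_smooth[OF assms(6)])
 have sg: "smooth_map_on (U - A) g"
  by (rule real_analytic_map_imp_smooth[OF g(1)])
 obtain C where C: "closed C" "A = U Int C" using assms(3) unfolding closedin_closed by auto
 have "?B = V Int \<pi> -` C" using assms(8) C(2) by auto
 then have cB: "closedin (top_of_set V) ?B"
  using continuous_closedin_preimage[OF smooth_map_on_imp_continuous_on[OF s\<pi>] C(1)] by simp
 have oUA: "open (U - A)"
 proof -
  have "U - A = U - C" using C(2) by auto
  then show ?thesis using U C(1) by (simp add: open_Diff)
 qed
 have gV: "g y : V" if "y : U - A" for y
 proof -
  have "g y : g ` (U - A)" using that by (rule imageI)
  then show ?thesis unfolding g(2) by simp
 qed
 have chart: "EX W ph py S. p : W & quadrant_chart V ?B W ph py S & ph p = 0 & (ALL j. ana (%z. py z $ j))" if p: "p : V" for p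
 proof -
  obtain W ph S where W: "open W" "p : W" "W <= V" "open (ph ` W)" "real_analytic_iso W (ph ` W) ph" "ph p = 0"
   "ph ` (?B Int W) = ph ` W Int (UN si:S. quadrant si)"
   using bspec[OF assms(9)[unfolded locally_union_of_quadrants_def] p] by (elim exE conjE)
  obtain py where py: "real_analytic_map_on W ph" "real_analytic_map_on (ph ` W) py" "ALL x:W. py (ph x) = x"
   using W(5) unfolding real_analytic_iso_def by (elim conjE exE)
  have "quadrant_chart V ?B W ph py S"
   unfolding quadrant_chart_def 
   using W real_analytic_map_imp_smooth[OF py(1)] real_analytic_map_imp_smooth[OF py(2)] py(3) by simp
  moreover have "ana (%z. py z $ j)" for j
  proof -
   have z: "0 : ph ` W" using W(2,6) by (metis imageI)
   have "ALL j. ALL x:ph ` W. real_analytic_at (%z. py z $ j) x" using py(2) unfolding real_analytic_map_on_def real_analytic_on_def .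
   from real_analytic_imp_ana[OF bspec[OF spec[OF this, of j] z]] show ?thesis by simp
  qed
  ultimately show ?thesis using W(2,6) by (intro exI conjI allI)
 qed
 \<comment> \<open>Off \<open>B\<close> the chain rule for \<open>\<pi> (g y) = y\<close> makes the
   Jacobian matrix invertible. This inclusion of zero sets is the input of the Lojasiewicz
   inequality.\<close>
 have chain: "jac \<pi> v = 0 ==> v : ?B" if v: "v : V" for v
 proof (rule ccontr)
  assume z: "jac \<pi> v = 0" and nB: "v ~: ?B"
  define y where "y = \<pi> v"
  have yU: "y : U - A" using v nB assms(8) by (auto simp: y_def)
  have gy: "g y = v" using g(3) v nB by (simp add: y_def)
  have "(\<chi> j k. partial k (%x. \<pi> x $ j) v) ** (\<chi> k i. partial i (%x. g x $ k) y) = mat 1"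
  proof -
   have "(SUM k:UNIV. partial k (%x. \<pi> x $ j) v * partial i (%x. g x $ k) y) = (if i = j then 1 else 0)" for i j
   proof -
    have "partial i (%x. \<pi> (g x) $ j) y = (SUM k:UNIV. partial k (%x. \<pi> x $ j) (g y) * partial i (%x. g x $ k) y)"
    proof (rule partial_compose[where g = "%x. \<pi> x $ j"])
     show "(%x. \<pi> x $ j) differentiable (at (g y))" using s\<pi> by (intro smooth_on_imp_differentiable[OF _ gV[OF yU]]) simp
     show "(%x. g x $ k) differentiable (at y)" for k using sg by (intro smooth_on_imp_differentiable[OF _ yU]) simp
    qed
    moreover have "partial i (%x. \<pi> (g x) $ j) y = partial i (%x. x $ j) y"
     by (rule partial_cong[OF oUA yU]) (simp add: g(4))
    ultimately show ?thesis by (simp add: partial_nth gy)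
   qed
   then show ?thesis by (simp add: matrix_matrix_mult_def mat_def vec_eq_iff eq_commute)
  qed
  then have "jac \<pi> v * det (\<chi> k i. partial i (%x. g x $ k) y) = 1"
   unfolding jac_def det_mul[symmetric] by (simp add: det_I)
  then show False using z by simp
 qed
 interpret blow_down U V A \<pi> g
 proof
  show "closed_map (top_of_set V) (top_of_set U) \<pi>" using assms(7) by (simp add: proper_map_def)
  show "g (\<pi> v) = v" if "v : V" "\<pi> v ~: A" for v using g(3) that by simp
  show "EX N C. C > 0 & (ALL e>0. EX r>0. ALL v:ball p r. EX b:?B. dist v b < e & dist v b ^ N <= C * \<bar>jac \<pi> v\<bar>)"
   if p: "p : V" "\<pi> p : A" for p
  proof -
   obtain W ph py S where W: "p : W" "quadrant_chart V ?B W ph py S" "ph p = 0" "ALL j. ana (%z. py z $ j)"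
    using chart[OF p(1)] by (elim exE conjE)
   have aj: "ana (%v. jac \<pi> (p + v))"
   proof (rule ana_jac)
    fix j
    have "real_analytic_at (%x. \<pi> x $ j) p" using assms(6) p(1) by (simp add: real_analytic_map_on_def real_analytic_on_def)
    then show "ana (%y. \<pi> (p + y) $ j)" by (rule real_analytic_imp_ana)
   qed
   have pB: "p : ?B Int W" using p W(1) by simp
   show ?thesis
   proof (rule lojasiewicz_quadrants[OF W(2) cB pB W(3) spec[OF W(4)] aj chain])
    fix N C assume "0 < C" "!!e. 0 < e ==> EX r>0. ALL v:ball p r. EX b:?B. dist v b < e & dist v b ^ N <= C * \<bar>jac \<pi> v\<bar>"
    then show ?thesis by (intro exI[of _ N] exI[of _ C]) simp
   qed
  qed
 qed (use U V assms(3,8) s\<pi> sg gV g(4) in auto)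
 show ?thesis
 proof (rule quasi_iso_of_acyclic[OF U A_subset])
  fix k om assume om: "flat_form A U k om" "ext_d U om = (%_ _. 0)"
  show "EX ew. prev_form U k ew & (ALL is. flat_on A U (%x. ew x is)) & ext_d U ew = om"
  proof (rule flat_acyclic[OF assms(5) _ om])
   fix p assume "p : V"
   from chart[OF this] show "EX W ph py S. p : W & quadrant_chart V ?B W ph py S" by (elim exE conjE) (intro exI conjI)
  qed
 qed
qed


end
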